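(* Let $r_0>0$ and $E:=\{x\in\mathbb{R}^2:|x|>r_0\}$. Assume that $k\in C^\infty(\mathcal U;\mathbb{R}^2)$ for some open neighborhood $\mathcal U$ of $\overline E$. Let $F\in L^2(E;\mathbb{R}^2)$, and suppose that $$\operatorname{curl} k=0,\qquad \operatorname{div}\bigl((1-|k|^2)k-F\bigr)=0\quad\text{in }\mathcal D'(E),$$ and that $$\lim_{R\to\infty}\ \sup_{x\in E,\ |x|>R}|k(x)|=0 .$$ Then $$k\in L^{\gamma}(E;\mathbb{R}^2)\qquad\text{for every }\gamma>2 .$$
   Context: For a planar field $k=(k_1,k_2)$, $\operatorname{curl}k=\partial_1k_2-\partial_2k_1$. $\mathcal D'(E)$ denotes distributions on $E$, i.e. the equations hold weakly when tested against functions in $C_c^\infty(E)$. *)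

theory Defs
  imports "HOL-Analysis.Analysis"
begin

text \<open>
  \<open>Ck_on m U f\<close> is meant for open \<open>U\<close>, where it is the usual class \<open>C\<^sup>m(U)\<close>: since the values of
  \<open>f\<close> near a point of \<open>U\<close> determine its derivative there, \<open>f\<close> may be arbitrary outside \<open>U\<close>.
\<close>

fun Ck_on ::
  "nat \<Rightarrow> 'a::real_normed_vector set \<Rightarrow> ('a \<Rightarrow> 'b::real_normed_vector) \<Rightarrow> bool" where
  "Ck_on 0 U f \<longleftrightarrow> continuous_on U f"
| "Ck_on (Suc m) U f \<longleftrightarrow>
     (\<forall>x\<in>U. f differentiable (at x)) \<and>
     (\<forall>v. Ck_on m U (\<lambda>x. frechet_derivative f (at x) v))"

definition smooth_on ::
  "'a::real_normed_vector set \<Rightarrow> ('a \<Rightarrow> 'b::real_normed_vector) \<Rightarrow> bool" where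
  "smooth_on U f \<longleftrightarrow> (\<forall>m. Ck_on m U f)"

definition partial :: "'n::finite \<Rightarrow> (real^'n \<Rightarrow> real) \<Rightarrow> real^'n \<Rightarrow> real" where
  "partial i f x = frechet_derivative f (at x) (axis i 1)"

definition Lp :: "real \<Rightarrow> 'a::euclidean_space set \<Rightarrow> ('a \<Rightarrow> 'b::euclidean_space) \<Rightarrow> bool" where
  "Lp p E f \<longleftrightarrow>
     set_borel_measurable lebesgue E f \<and> set_integrable lebesgue E (\<lambda>x. norm (f x) powr p)"

text \<open>Test functions in \<open>C\<^sub>c\<^sup>\<infinity>(E)\<close> are represented by their extensions by zero to the whole space.\<close>

definition test_functions :: "'a::euclidean_space set \<Rightarrow> ('a \<Rightarrow> real) set" where
  "test_functions E =
     {\<phi>. smooth_on UNIV \<phi> \<and> compact (closure {x. \<phi> x \<noteq> 0}) \<and> closure {x. \<phi> x \<noteq> 0} \<subseteq> E}"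

text \<open>
  The following define the pairing of a distributional derivative with a test function \<open>\<phi>\<close>;
  the function being differentiated is assumed to be locally integrable on \<open>E\<close>.
\<close>

definition dist_partial ::
  "(real^'n::finite) set \<Rightarrow> 'n \<Rightarrow> (real^'n \<Rightarrow> real) \<Rightarrow> (real^'n \<Rightarrow> real) \<Rightarrow> real" where
  "dist_partial E i u \<phi> = - (LINT x:E|lebesgue. u x * partial i \<phi> x)"

definition dist_div ::
  "(real^'n::finite) set \<Rightarrow> (real^'n \<Rightarrow> real^'n) \<Rightarrow> (real^'n \<Rightarrow> real) \<Rightarrow> real" where
  "dist_div E G \<phi> = (\<Sum>i\<in>UNIV. dist_partial E i (\<lambda>x. G x $ i) \<phi>)"

definition dist_curl ::
  "(real^2) set \<Rightarrow> (real^2 \<Rightarrow> real^2) \<Rightarrow> (real^2 \<Rightarrow> real) \<Rightarrow> real" where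
  "dist_curl E k \<phi> =
     dist_partial E 1 (\<lambda>x. k x $ 2) \<phi> - dist_partial E 2 (\<lambda>x. k x $ 1) \<phi>"

definition zero_distribution ::
  "'a::euclidean_space set \<Rightarrow> (('a \<Rightarrow> real) \<Rightarrow> real) \<Rightarrow> bool" where
  "zero_distribution E T \<longleftrightarrow> (\<forall>\<phi>\<in>test_functions E. T \<phi> = 0)"

end

theory Submission
  imports Defs
begin

text \<open>
  Write \<open>k = K + m\<close>, where \<open>K = O(1/|x|)\<close> is the explicit field carrying the circulation of \<open>k\<close> and the
  flux of the equation. Then \<open>m\<close> is the gradient of a single-valued function \<open>v\<close> up to a radial
  correction, and the weak equation may be tested with gradients and with radial fields.

  Constant fields solve the equation. On each circle one therefore compares \<open>m\<close> with the constant \<open>q r\<close>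
  given by the first Fourier mode of \<open>v\<close>. The remaining modes satisfy a Wirtinger inequality
  whose constant is small enough that the energy of \<open>m - q r\<close>, unless bounded, would
  grow faster than \<open>r\<^sup>2\<close>, which \<open>m \<longlonglongrightarrow> 0\<close> excludes. Hence \<open>|m - q|\<^sup>2/|x|\<close> is integrable, and
  \<open>r |q r|\<^sup>2\<close> as well as \<open>1/r\<close> times the integral of \<open>|m|\<^sup>2\<close> over \<open>|x| < r\<close> tend to \<open>0\<close>.
  With this gain the same argument with \<open>q\<close> replaced by \<open>0\<close>, where the Wirtinger constant is worse,
  gives \<open>m \<in> L\<^sup>2\<close>. Since \<open>m\<close> is bounded and \<open>K = O(1/|x|)\<close>, the field \<open>k\<close> lies in \<open>L\<^sup>\<gamma>\<close> for all \<open>\<gamma> > 2\<close>.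
\<close>


section \<open>Smooth bump functions and mollification\<close>

text \<open>Testing on the disc of radius R bounds the energy inside by W/2 times R times the
  boundary energy, where W is the constant in Wirtinger's inequality; an unbounded energy thus grows
  at least like R^(2/W). For all modes together the sharp W is 1, and the threshold R^2 is attained
  by constant fields: there is no room for the losses from the cubic term and from F. Without the
  first mode there is. Instead of Fourier series, W is the L^1 norm of a kernel on the circle: pi/4
  without the first mode, pi/2 with it. The exponents 8/pi > 2 and 4/pi > 1 explain the two passes:
  the first needs the integral of |m|^2 over discs to be o(R^2), the second o(R), which is what the
  first provides.

  Two obstacles shape the details. As q r varies with r, the comparison is integrated over all R
  against a weight, and this leaves terms linear in m that no quadratic energy controls; they cancel
  by orthogonality on circles. Moreover |k|^2 k is compared with a cube of q, not of q + K, so an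
  error of order 1/|x| remains, whose square is not integrable in the plane: the first weight
  compensates for it, and in the second pass the error is of order 1/|x|^2.\<close>

lemma Ck_on_cong:
  assumes "open U" "\<And>x. x \<in> U \<Longrightarrow> f x = g x"
  shows "Ck_on m U f \<longleftrightarrow> Ck_on m U g"
  using assms(2)
proof (induction m arbitrary: f g)
  case 0
  then show ?case by (auto cong: continuous_on_cong)
next
  case (Suc m)
  have d: "(f has_derivative D) (at x) \<longleftrightarrow> (g has_derivative D) (at x)" if "x \<in> U" for x D
  proof
    assume "(f has_derivative D) (at x)"
    then show "(g has_derivative D) (at x)"
      by (rule has_derivative_transform_within_open[OF _ assms(1) that]) (use Suc.prems in auto)
  next
    assume "(g has_derivative D) (at x)"
    then show "(f has_derivative D) (at x)"
      by (rule has_derivative_transform_within_open[OF _ assms(1) that]) (use Suc.prems in auto)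
  qed
  then have e: "frechet_derivative f (at x) = frechet_derivative g (at x)" if "x \<in> U" for x
    using that by (simp add: frechet_derivative_def)
  have "Ck_on m U (\<lambda>x. frechet_derivative f (at x) v) \<longleftrightarrow>
        Ck_on m U (\<lambda>x. frechet_derivative g (at x) v)" for v
    by (rule Suc.IH) (simp add: e)
  moreover have "f differentiable (at x) \<longleftrightarrow> g differentiable (at x)" if "x \<in> U" for x
    using d[OF that] by (simp add: differentiable_def)
  ultimately show ?case by simp
qed

text \<open>\<open>Ck_on\<close> refers to the chosen \<open>frechet_derivative\<close>; this rule
  lets any known derivative \<open>D\<close> take its place, which is how the inductions on the
  order are run.\<close>

lemma Ck_on_SucI:
  assumes "open U" "\<And>x. x \<in> U \<Longrightarrow> (f has_derivative D x) (at x)"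
    and "\<And>v. Ck_on m U (\<lambda>x. D x v)"
  shows "Ck_on (Suc m) U f"
proof -
  have "frechet_derivative f (at x) = D x" if "x \<in> U" for x
    using frechet_derivative_at[OF assms(2)[OF that]] by simp
  then have "Ck_on m U (\<lambda>x. frechet_derivative f (at x) v) \<longleftrightarrow> Ck_on m U (\<lambda>x. D x v)" for v
    by (intro Ck_on_cong assms) simp
  then show ?thesis using assms by (auto simp: differentiable_def)
qed

lemma Ck_on_Suc_imp: "open U \<Longrightarrow> Ck_on (Suc m) U f \<Longrightarrow> Ck_on m U f"
proof (induction m arbitrary: f)
  case 0
  then show ?case
    by (auto simp: continuous_on_eq_continuous_at differentiable_imp_continuous_within)
next
  case (Suc m)
  from Suc.prems(2) have "Ck_on (Suc m) U (\<lambda>x. frechet_derivative f (at x) v)" for v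
    using Ck_on.simps(2) by blast
  then have "Ck_on m U (\<lambda>x. frechet_derivative f (at x) v)" for v
    using Suc by blast
  with Suc.prems(2) show ?case by simp
qed

lemma frechet_derivative_has: "f differentiable (at x) \<Longrightarrow> (f has_derivative frechet_derivative f (at x)) (at x)"
  using frechet_derivative_works by blast

lemma Ck_on_add:
  assumes "open U" shows "Ck_on m U f \<Longrightarrow> Ck_on m U g \<Longrightarrow> Ck_on m U (\<lambda>x. f x + g x)"
proof (induction m arbitrary: f g)
  case 0
  then show ?case by (auto intro: continuous_intros)
next
  case (Suc m)
  show ?case
    by (rule Ck_on_SucI[OF assms, where D="\<lambda>x v. frechet_derivative f (at x) v + frechet_derivative g (at x) v"])
      (use Suc in \<open>auto intro!: has_derivative_add frechet_derivative_has Suc.IH\<close>)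
qed

lemma Ck_on_mult:
  fixes f g :: "'a::real_normed_vector \<Rightarrow> real"
  assumes "open U" shows "Ck_on m U f \<Longrightarrow> Ck_on m U g \<Longrightarrow> Ck_on m U (\<lambda>x. f x * g x)"
proof (induction m arbitrary: f g)
  case 0
  then show ?case by (auto intro: continuous_intros)
next
  case (Suc m)
  show ?case
  proof (rule Ck_on_SucI[OF assms])
    show "((\<lambda>x. f x * g x) has_derivative (\<lambda>v. f x * frechet_derivative g (at x) v
      + frechet_derivative f (at x) v * g x)) (at x)" if "x \<in> U" for x
      by (rule has_derivative_mult) (use Suc.prems that in \<open>auto intro: frechet_derivative_has\<close>)
    show "Ck_on m U (\<lambda>x. f x * frechet_derivative g (at x) v + frechet_derivative f (at x) v * g x)" for v
      by (intro Ck_on_add assms Suc.IH Ck_on_Suc_imp[OF assms Suc.prems(1)] Ck_on_Suc_imp[OF assms Suc.prems(2)])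
        (use Suc.prems in auto)
  qed
qed

lemma Ck_on_const: "open U \<Longrightarrow> Ck_on m U (\<lambda>x. c)"
proof (induction m arbitrary: c)
  case (Suc m)
  show ?case by (rule Ck_on_SucI[where D="\<lambda>x v. 0"]) (use Suc in auto)
qed auto

lemma Ck_on_inner: "open U \<Longrightarrow> Ck_on m U (\<lambda>x. x \<bullet> v)"
proof (cases m)
  case (Suc n)
  assume "open U"
  then show ?thesis unfolding Suc
    by (intro Ck_on_SucI[where D="\<lambda>x w. w \<bullet> v"] Ck_on_const) (auto intro!: derivative_eq_intros)
qed (auto intro: continuous_intros)

text \<open>All negative powers at once: the derivatives of the standard flat function
  \<open>flat 0\<close> are combinations of these functions, so an induction on the order that
  generalises over \<open>n\<close> closes.\<close>

definition flat :: "nat \<Rightarrow> real \<Rightarrow> real" where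
  "flat n t = (if t > 0 then exp (- 1 / t) / t ^ n else 0)"

text \<open>Only the term of index \<open>n + 2\<close> of the exponential series at
  \<open>1/t\<close> is kept. The two spare powers of \<open>t\<close> make the difference quotient
  at 0 vanish in the limit.\<close>

lemma flat_bound: "\<bar>flat n t\<bar> \<le> fact (n + 2) * t\<^sup>2"
proof (cases "t > 0")
  case True
  have "(1/t) ^ (n+2) / fact (n+2) \<le> exp (1/t)"
  proof -
    have s: "(\<lambda>k. (1/t)^k / fact k) sums exp (1/t)"
      using exp_converges[of "1/t"] by (simp add: scaleR_conv_of_real divide_inverse mult.commute)
    have "(\<Sum>k\<in>{n+2}. (1/t)^k / fact k) \<le> (\<Sum>k. (1/t)^k / fact k)"
      by (rule sum_le_suminf) (use s True in \<open>auto simp: sums_iff\<close>)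
    then show ?thesis using s by (simp add: sums_iff)
  qed
  then have "1 \<le> exp (1/t) * (fact (n+2) * t ^ (n+2))"
    using True by (simp add: power_one_over divide_simps mult.commute mult.left_commute del: fact_Suc power_Suc add_2_eq_Suc')
  then have "1 / exp (1/t) \<le> fact (n+2) * t ^ (n+2)"
    by (subst pos_divide_le_eq) (simp_all add: mult.commute mult.left_commute del: fact_Suc power_Suc add_2_eq_Suc')
  then have "exp (-1/t) \<le> fact (n+2) * t^2 * t^n"
    by (simp only: minus_divide_left[symmetric] exp_minus inverse_eq_divide power_add mult.assoc mult.commute mult.left_commute)
  then have "exp (-1/t) / t^n \<le> fact (n+2) * t^2"
    using True by (subst pos_divide_le_eq) auto
  then show ?thesis using True by (simp add: flat_def)
qed (auto simp: flat_def)

lemma flat_deriv: "(flat n has_field_derivative (flat (n+2) t - real n * flat (n+1) t)) (at t)"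
proof -
  consider "t > 0" | "t < 0" | "t = 0" by linarith
  then show ?thesis
  proof cases
    case 1
    have "((\<lambda>t. exp (-1/t) / t^n) has_field_derivative (flat (n+2) t - real n * flat (n+1) t)) (at t)"
    proof (cases n)
      case (Suc j)
      have "j = 0 \<or> t ^ j = t * t ^ (j - Suc 0)" by (cases j) auto
      then show ?thesis unfolding Suc
        using 1 by (auto intro!: derivative_eq_intros simp: flat_def field_simps power2_eq_square)
    qed (use 1 in \<open>auto intro!: derivative_eq_intros simp: flat_def field_simps power2_eq_square\<close>)
    then show ?thesis
      by (rule has_field_derivative_transform_within_open[where S="{0<..}"]) (use 1 in \<open>auto simp: flat_def\<close>)
  next
    case 2
    have "((\<lambda>t. 0) has_field_derivative (flat (n+2) t - real n * flat (n+1) t)) (at t)"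
      using 2 by (auto simp: flat_def)
    then show ?thesis
      by (rule has_field_derivative_transform_within_open[where S="{..<0}"]) (use 2 in \<open>auto simp: flat_def\<close>)
  next
    case 3
    have "((\<lambda>h. flat n h / h) \<longlongrightarrow> 0) (at 0)"
    proof (rule Lim_null_comparison)
      have "norm (flat n h / h) \<le> fact (n+2) * \<bar>h\<bar>" if "h \<noteq> 0" for h
      proof -
        have "\<bar>flat n h\<bar> \<le> (fact (n+2) * \<bar>h\<bar>) * \<bar>h\<bar>"
          using flat_bound[of n h] by (simp add: power2_eq_square mult.assoc del: fact_Suc add_2_eq_Suc')
        then show ?thesis using that
          by (simp add: pos_divide_le_eq del: fact_Suc add_2_eq_Suc')
      qed
      then show "\<forall>\<^sub>F h in at 0. norm (flat n h / h) \<le> fact (n+2) * \<bar>h\<bar>"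
        by (auto simp: eventually_at intro!: exI[of _ 1])
      show "((\<lambda>h. fact (n+2) * \<bar>h\<bar>) \<longlongrightarrow> 0) (at (0::real))"
        by (auto intro!: tendsto_eq_intros)
    qed
    then show ?thesis using 3 by (simp add: DERIV_def flat_def)
  qed
qed

lemma Ck_on_flat:
  fixes c :: "'a::euclidean_space"
  shows "Ck_on m UNIV (\<lambda>x. flat n (e - (x - c) \<bullet> (x - c)))"
proof (induction m arbitrary: n)
  case 0
  have c: "continuous_on UNIV (flat n)"
    using flat_deriv[of n] by (intro continuous_at_imp_continuous_on) (auto intro: DERIV_isCont)
  have "continuous_on UNIV (\<lambda>x. flat n (e - (x - c) \<bullet> (x - c)))"
    by (rule continuous_on_compose2[OF c]) (auto intro!: continuous_intros)
  then show ?case by simp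
next
  case (Suc m)
  let ?s = "\<lambda>x. e - (x - c) \<bullet> (x - c)"
  let ?D = "\<lambda>x v. (flat (n+2) (?s x) + (- real n) * flat (n+1) (?s x)) * ((-2) * (x \<bullet> v) + 2 * (c \<bullet> v))"
  show ?case
  proof (rule Ck_on_SucI[where D="?D"])
    fix x
    have "(?s has_derivative (\<lambda>v. (-2) * (x \<bullet> v) + 2 * (c \<bullet> v))) (at x)"
      by (auto intro!: derivative_eq_intros simp: inner_commute algebra_simps)
    from has_derivative_compose[OF this flat_deriv[of n "?s x", THEN has_field_derivative_imp_has_derivative]]
    show "((\<lambda>x. flat n (?s x)) has_derivative ?D x) (at x)"
      by simp
  next
    show "Ck_on m UNIV (\<lambda>x. ?D x v)" for v
      by (intro Ck_on_mult Ck_on_add Ck_on_const Ck_on_inner Suc open_UNIV)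
  qed simp
qed

text \<open>Bridge from the Lebesgue integral to the gauge integral over a box, for which the
  Leibniz rules are stated.\<close>

lemma integral_lborel_box:
  fixes f :: "'a::euclidean_space \<Rightarrow> 'b::euclidean_space"
  assumes "continuous_on UNIV f" "\<And>x. x \<notin> cbox a b \<Longrightarrow> f x = 0"
  shows "integrable lborel f" "integral\<^sup>L lborel f = integral (cbox a b) f"
proof -
  have "integrable lborel (\<lambda>x. indicator (cbox a b) x *\<^sub>R f x)"
    by (intro borel_integrable_compact compact_cbox continuous_on_subset[OF assms(1)]) auto
  moreover have "(\<lambda>x. indicator (cbox a b) x *\<^sub>R f x) = f"
    using assms(2) by (auto simp: indicator_def)
  ultimately show i: "integrable lborel f" by simp
  have "(f has_integral integral\<^sup>L lborel f) UNIV" using has_integral_integral_lborel[OF i] .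
  moreover have "(\<lambda>x. if x \<in> cbox a b then f x else 0) = f" using assms(2) by auto
  ultimately have "(f has_integral integral\<^sup>L lborel f) (cbox a b)"
    using has_integral_restrict_UNIV[of "cbox a b" f] by simp
  then show "integral\<^sup>L lborel f = integral (cbox a b) f" by (simp add: integral_unique)
qed

lemma integral_lborel_translate:
  fixes f :: "'a::euclidean_space \<Rightarrow> 'b::euclidean_space"
  assumes "f \<in> borel_measurable borel"
  shows "(\<integral>y. f (y + c) \<partial>lborel) = (\<integral>y. f y \<partial>lborel)"
proof -
  have "(\<integral>y. f y \<partial>lborel) = (\<integral>y. f y \<partial>(distr lborel borel ((+) c)))"
    by (simp add: lborel_distr_plus)
  also have "\<dots> = (\<integral>y. f (c + y) \<partial>lborel)"
    by (rule integral_distr) (use assms in auto)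
  finally show ?thesis by (simp add: add.commute)
qed

section \<open>Continuously differentiable test functions and the extension of weak identities to
  them\<close>

text \<open>The class is C^1 only, so that test functions may be assembled from C^1 cutoffs and from
  tail integrals of a weight. Differentiability is demanded on the whole space, that is, for the
  extension by zero.\<close>

definition C1c :: "'a::euclidean_space set \<Rightarrow> ('a \<Rightarrow> real) \<Rightarrow> ('a \<Rightarrow> 'a) \<Rightarrow> bool" where
  "C1c E \<phi> D \<longleftrightarrow> (\<forall>x. (\<phi> has_derivative (\<lambda>h. D x \<bullet> h)) (at x)) \<and> continuous_on UNIV D \<and>
     (\<exists>K. compact K \<and> K \<subseteq> E \<and> (\<forall>x. x \<notin> K \<longrightarrow> \<phi> x = 0))"

lemma gradient_zero_outside:
  fixes \<phi> :: "'a::euclidean_space \<Rightarrow> real"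
  assumes "(\<phi> has_derivative (\<lambda>h. D \<bullet> h)) (at x)" "closed K" "\<And>x. x \<notin> K \<Longrightarrow> \<phi> x = 0" "x \<notin> K"
  shows "D = 0"
proof -
  have "((\<lambda>x. 0::real) has_derivative (\<lambda>h. D \<bullet> h)) (at x)"
    by (rule has_derivative_transform_within_open[OF assms(1), of "- K"]) (use assms in \<open>auto simp: open_Compl\<close>)
  moreover have "((\<lambda>x. 0::real) has_derivative (\<lambda>h. 0)) (at x)" by simp
  ultimately have "(\<lambda>h. D \<bullet> h) = (\<lambda>h. 0)" by (rule has_derivative_unique)
  then have "D \<bullet> D = 0" by metis
  then show ?thesis by simp
qed

lemma C1c_D_support:
  assumes "C1c E \<phi> D"
  obtains K where "compact K" "K \<subseteq> E" "\<And>x. x \<notin> K \<Longrightarrow> \<phi> x = 0" "\<And>x. x \<notin> K \<Longrightarrow> D x = 0"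
proof -
  from assms obtain K where K: "compact K" "K \<subseteq> E" "\<And>x. x \<notin> K \<Longrightarrow> \<phi> x = 0"
    and d: "\<And>x. (\<phi> has_derivative (\<lambda>h. D x \<bullet> h)) (at x)"
    by (auto simp: C1c_def)
  have "D x = 0" if "x \<notin> K" for x
    by (rule gradient_zero_outside[OF d]) (use K that in \<open>auto intro: compact_imp_closed\<close>)
  with K that show ?thesis by blast
qed

lemma C1c_continuous: "C1c E \<phi> D \<Longrightarrow> continuous_on UNIV \<phi>"
  unfolding C1c_def by (auto intro!: continuous_at_imp_continuous_on dest: has_derivative_continuous)

text \<open>The integral of \<open>\<phi> (y + s *\<^sub>R w)\<close> over \<open>y\<close> does not
  depend on \<open>s\<close>, by translation invariance; its derivative at \<open>s = 0\<close> is
  the integral in question.\<close>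

lemma C1c_integral_derivative:
  fixes \<phi> :: "'a::euclidean_space \<Rightarrow> real"
  assumes "C1c E \<phi> D"
  shows "(\<integral>x. D x \<bullet> w \<partial>lborel) = 0"
proof -
  obtain K where K: "compact K" "\<And>x. x \<notin> K \<Longrightarrow> \<phi> x = 0" "\<And>x. x \<notin> K \<Longrightarrow> D x = 0"
    using C1c_D_support[OF assms] by metis
  have d: "(\<phi> has_derivative (\<lambda>h. D x \<bullet> h)) (at x)" for x using assms by (simp add: C1c_def)
  have cD: "continuous_on UNIV D" using assms by (simp add: C1c_def)
  have c\<phi>: "continuous_on UNIV \<phi>" by (rule C1c_continuous[OF assms])
  \<comment> \<open>One box that contains the supports of all translates with \<open>s\<close>
    between -1 and 1, so that the parameter integral has a fixed domain.\<close>
  have "bounded ((\<lambda>(y, s). y - s *\<^sub>R w) ` (K \<times> {-1..1}))"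
    by (intro compact_imp_bounded compact_continuous_image compact_Times K) (auto simp: split_beta intro!: continuous_intros)
  then obtain a where a: "(\<lambda>(y, s). y - s *\<^sub>R w) ` (K \<times> {-1..1}) \<subseteq> cbox (-a) a"
    using bounded_subset_cbox_symmetric by blast
  have out: "y + s *\<^sub>R w \<notin> K" if "y \<notin> cbox (-a) a" "s \<in> {-1..1}" for y s
  proof
    assume "y + s *\<^sub>R w \<in> K"
    then have "(\<lambda>(y, s). y - s *\<^sub>R w) (y + s *\<^sub>R w, s) \<in> cbox (-a) a" using a that(2) by blast
    then show False using that by simp
  qed
  have 1: "((\<lambda>s. integral (cbox (-a) a) (\<lambda>y. \<phi> (y + s *\<^sub>R w))) has_vector_derivative
      integral (cbox (-a) a) (\<lambda>y. D (y + 0 *\<^sub>R w) \<bullet> w)) (at 0 within {-1..1})"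
  proof (rule leibniz_rule_vector_derivative[where U="{-1..1}" and fx="\<lambda>s y. D (y + s *\<^sub>R w) \<bullet> w"])
    fix s :: real and y
    have "((\<lambda>s. y + s *\<^sub>R w) has_derivative (\<lambda>h. h *\<^sub>R w)) (at s within {-1..1})"
      by (auto intro!: derivative_eq_intros)
    from has_derivative_compose[OF this d]
    show "((\<lambda>s. \<phi> (y + s *\<^sub>R w)) has_vector_derivative D (y + s *\<^sub>R w) \<bullet> w) (at s within {-1..1})"
      by (simp add: has_vector_derivative_def)
  next
    show "(\<lambda>y. \<phi> (y + s *\<^sub>R w)) integrable_on cbox (-a) a" for s
      by (intro integrable_continuous continuous_on_compose2[OF c\<phi>] continuous_intros) auto
    show "continuous_on ({-1..1} \<times> cbox (-a) a) (\<lambda>(s, y). D (y + s *\<^sub>R w) \<bullet> w)"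
      unfolding split_beta by (intro continuous_intros continuous_on_compose2[OF cD]) auto
  qed auto
  have 2: "integral (cbox (-a) a) (\<lambda>y. \<phi> (y + s *\<^sub>R w)) = (\<integral>x. \<phi> x \<partial>lborel)" if "s \<in> {-1..1}" for s
  proof -
    have "integral\<^sup>L lborel (\<lambda>y. \<phi> (y + s *\<^sub>R w)) = integral (cbox (-a) a) (\<lambda>y. \<phi> (y + s *\<^sub>R w))"
      by (rule integral_lborel_box) (use out that K in \<open>auto intro!: continuous_intros continuous_on_compose2[OF c\<phi>]\<close>)
    then show ?thesis
      using integral_lborel_translate[of \<phi> "s *\<^sub>R w"] c\<phi> by (simp add: borel_measurable_continuous_onI)
  qed
  have 3: "((\<lambda>s. (\<integral>x. \<phi> x \<partial>lborel)) has_vector_derivative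
      integral (cbox (-a) a) (\<lambda>y. D (y + 0 *\<^sub>R w) \<bullet> w)) (at 0 within {-1..1})"
    by (rule has_vector_derivative_transform[OF _ _ 1]) (use 2 in auto)
  have 4: "((\<lambda>s. (\<integral>x. \<phi> x \<partial>lborel)) has_vector_derivative 0) (at 0 within {-1..1::real})"
    by simp
  have "at 0 within {-1..1::real} \<noteq> bot"
    by (simp add: at_within_Icc_at)
  from vector_derivative_unique_within[OF this 3 4]
  have "integral (cbox (-a) a) (\<lambda>y. D y \<bullet> w) = 0" by simp
  moreover have "integral\<^sup>L lborel (\<lambda>y. D y \<bullet> w) = integral (cbox (-a) a) (\<lambda>y. D y \<bullet> w)"
    by (rule integral_lborel_box) (use out[of _ 0] K in \<open>auto intro!: continuous_intros continuous_on_compose2[OF cD]\<close>)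
  ultimately show ?thesis by simp
qed

lemma smooth_onE_gradient:
  fixes \<rho> :: "'a::euclidean_space \<Rightarrow> real"
  assumes "smooth_on UNIV \<rho>"
  obtains D where "\<And>x. (\<rho> has_derivative (\<lambda>h. D x \<bullet> h)) (at x)" "continuous_on UNIV D"
    "\<And>v. smooth_on UNIV (\<lambda>x. D x \<bullet> v)"
proof
  let ?D = "\<lambda>x. \<Sum>b\<in>Basis. frechet_derivative \<rho> (at x) b *\<^sub>R b"
  have C: "Ck_on (Suc m) UNIV \<rho>" for m using assms by (simp add: smooth_on_def)
  have d: "(\<rho> has_derivative frechet_derivative \<rho> (at x)) (at x)" for x
    using C[of 0] by (auto intro: frechet_derivative_has)
  have e: "?D x \<bullet> h = frechet_derivative \<rho> (at x) h" for x h
  proof -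
    have l: "linear (frechet_derivative \<rho> (at x))" using d[of x] has_derivative_linear by blast
    have "frechet_derivative \<rho> (at x) h = frechet_derivative \<rho> (at x) (\<Sum>b\<in>Basis. (h \<bullet> b) *\<^sub>R b)"
      by (simp add: euclidean_representation)
    also have "\<dots> = (\<Sum>b\<in>Basis. (h \<bullet> b) * frechet_derivative \<rho> (at x) b)"
      by (simp add: linear_sum[OF l] linear_cmul[OF l])
    finally show ?thesis by (simp add: inner_sum_left inner_commute[of _ h] mult.commute inner_commute[of "sum _ _" h] inner_sum_right)
  qed
  show "(\<rho> has_derivative (\<lambda>h. ?D x \<bullet> h)) (at x)" for x
    using d[of x] by (simp add: e)
  have "continuous_on UNIV (\<lambda>x. frechet_derivative \<rho> (at x) v)" for v
    using C[of 0] by simp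
  then show "continuous_on UNIV ?D" by (intro continuous_intros)
  show "smooth_on UNIV (\<lambda>x. ?D x \<bullet> v)" for v
    unfolding e smooth_on_def using C by simp
qed

lemma bump_exists:
  assumes "e > 0"
  obtains \<rho> :: "'a::euclidean_space \<Rightarrow> real" where
    "smooth_on UNIV \<rho>" "\<And>x. \<rho> x \<ge> 0" "\<And>x. norm x \<ge> e \<Longrightarrow> \<rho> x = 0" "(\<integral>x. \<rho> x \<partial>lborel) = 1"
proof -
  define f :: "'a \<Rightarrow> real" where "f x = flat 0 (e\<^sup>2 - (x - 0) \<bullet> (x - 0))" for x
  have Cf: "Ck_on m UNIV f" for m unfolding f_def by (rule Ck_on_flat)
  have cf: "continuous_on UNIV f" using Cf[of 0] by simp
  have f0: "f x \<ge> 0" for x by (simp add: f_def flat_def)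
  have fz: "f x = 0 \<longleftrightarrow> norm x \<ge> e" for x
  proof -
    have "e\<^sup>2 - x \<bullet> x > 0 \<longleftrightarrow> norm x < e"
      using assms power2_less_imp_less[of "norm x" e] power_strict_mono[of "norm x" e 2]
      by (auto simp: dot_square_norm)
    then show ?thesis by (auto simp: f_def flat_def)
  qed
  obtain a where a: "ball (0::'a) e \<subseteq> cbox (-a) a"
    using bounded_subset_cbox_symmetric[OF bounded_ball] by blast
  have out: "f x = 0" if "x \<notin> cbox (-a) a" for x
  proof -
    have "x \<notin> ball 0 e" using a that by blast
    then show ?thesis by (simp add: fz)
  qed
  have I: "integral\<^sup>L lborel f = integral (cbox (-a) a) f" by (rule integral_lborel_box(2)[OF cf out])
  define Z where "Z = (\<integral>x. f x \<partial>lborel)"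
  have "Z > 0"
  proof -
    have "integral (cbox (-a) a) f > 0"
    proof -
      have "integral (cbox (-a) a) f \<noteq> 0"
      proof
        assume "integral (cbox (-a) a) f = 0"
        then have h: "(f has_integral 0) (cbox (-a) a)"
          using integrable_continuous[OF continuous_on_subset[OF cf]] by (metis has_integral_integral subset_UNIV)
        have bx: "0 \<in> cbox (-a) a" using a assms by auto
        have pos: "measure lborel (cbox (-a) a) > 0"
        proof -
          have "0 < measure lborel (ball (0::'a) e)" using assms by (simp add: content_ball_pos)
          also have "\<dots> \<le> measure lborel (cbox (-a) a)"
            by (intro measure_mono_fmeasurable a) auto
          finally show ?thesis .
        qed
        then have "box (-a) a \<noteq> {}" by (metis content_eq_0_interior interior_cbox less_irrefl)
        then have "f 0 = 0"
          using has_integral_0_cbox_imp_0[OF continuous_on_subset[OF cf] _ h _ bx] f0 by auto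
        then show False using assms by (simp add: fz)
      qed
      moreover have "integral (cbox (-a) a) f \<ge> 0" by (intro Henstock_Kurzweil_Integration.integral_nonneg integrable_continuous continuous_on_subset[OF cf]) (use f0 in auto)
      ultimately show ?thesis by simp
    qed
    then show ?thesis by (simp add: Z_def I)
  qed
  show ?thesis
  proof (rule that[of "\<lambda>x. (1/Z) * f x"])
    show "smooth_on UNIV (\<lambda>x. (1/Z) * f x)"
      unfolding smooth_on_def by (intro allI Ck_on_mult Ck_on_const Cf open_UNIV)
    show "(\<integral>x. (1/Z) * f x \<partial>lborel) = 1" using \<open>Z > 0\<close> by (simp only: Bochner_Integration.integral_mult_right_zero Z_def[symmetric]) simp
    show "(1/Z) * f x \<ge> 0" for x using \<open>Z > 0\<close> f0[of x] by simp
    show "(1/Z) * f x = 0" if "norm x \<ge> e" for x using fz[of x] that by simp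
  qed
qed

lemma compact_support_box:
  fixes f :: "'a::euclidean_space \<Rightarrow> 'b::euclidean_space"
  assumes "compact K" "\<And>x. x \<notin> K \<Longrightarrow> f x = 0"
  obtains a where "\<And>x. x \<notin> cbox (-a) a \<Longrightarrow> f x = 0"
proof -
  obtain a where "K \<subseteq> cbox (-a) a"
    using bounded_subset_cbox_symmetric[OF compact_imp_bounded[OF assms(1)]] by blast
  then have "f x = 0" if "x \<notin> cbox (-a) a" for x using assms(2)[of x] that by auto
  then show ?thesis by (rule that)
qed

text \<open>Only \<open>\<rho>\<close> is differentiated, so continuity of \<open>\<phi>\<close> is
  all that is asked of it; the compact support of \<open>\<phi>\<close> confines the integral to a
  box, where the Leibniz rule applies.\<close>

lemma has_derivative_convolution:
  fixes \<rho> \<phi> :: "'a::euclidean_space \<Rightarrow> real"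
  assumes d: "\<And>x. (\<rho> has_derivative (\<lambda>h. D x \<bullet> h)) (at x)" and cD: "continuous_on UNIV D"
    and c\<phi>: "continuous_on UNIV \<phi>" and supp: "compact K" "\<And>x. x \<notin> K \<Longrightarrow> \<phi> x = 0"
  shows "((\<lambda>x. \<integral>y. \<rho> (x - y) * \<phi> y \<partial>lborel) has_derivative
    (\<lambda>h. \<integral>y. (D (x - y) \<bullet> h) * \<phi> y \<partial>lborel)) (at x)"
proof -
  obtain a where a: "\<And>x. x \<notin> cbox (-a) a \<Longrightarrow> \<phi> x = 0"
    by (rule compact_support_box[of K \<phi>]) (use supp in auto)
  have c\<rho>: "continuous_on UNIV \<rho>"
    using d by (auto intro!: continuous_at_imp_continuous_on dest: has_derivative_continuous)
  define fx where "fx x y = blinfun_inner_right (\<phi> y *\<^sub>R D (x - y))" for x y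
  have "((\<lambda>x. integral (cbox (-a) a) (\<lambda>y. \<rho> (x - y) * \<phi> y)) has_derivative
     integral (cbox (-a) a) (fx x)) (at x within UNIV)"
  proof (rule leibniz_rule)
    fix x y :: 'a
    have "((\<lambda>x. x - y) has_derivative (\<lambda>h. h)) (at x)" by (auto intro!: derivative_eq_intros)
    moreover have "blinfun_apply (fx x y) = (\<lambda>h. D (x - y) \<bullet> h * \<phi> y)" by (auto simp: fx_def)
    ultimately    show "((\<lambda>x. \<rho> (x - y) * \<phi> y) has_derivative fx x y) (at x within UNIV)"
      using has_derivative_mult_left[OF has_derivative_compose[OF _ d], of "\<lambda>x. x - y" "\<lambda>h. h" x UNIV "\<phi> y"] by simp
  next
    show "(\<lambda>y. \<rho> (x - y) * \<phi> y) integrable_on cbox (-a) a" for x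
      by (intro integrable_continuous continuous_intros continuous_on_compose2[OF c\<rho>]
          continuous_on_subset[OF c\<phi>]) auto
    show "continuous_on (UNIV \<times> cbox (-a) a) (\<lambda>(x, y). fx x y)"
      unfolding fx_def split_beta
      by (intro bounded_linear.continuous_on[OF bounded_linear_blinfun_inner_right] continuous_intros
          continuous_on_compose2[OF cD] continuous_on_compose2[OF c\<phi>]) auto
  qed auto
  moreover have "(\<integral>y. \<rho> (x - y) * \<phi> y \<partial>lborel) = integral (cbox (-a) a) (\<lambda>y. \<rho> (x - y) * \<phi> y)" for x
    by (intro integral_lborel_box continuous_intros continuous_on_compose2[OF c\<rho>] c\<phi>) (auto simp: a)
  moreover have "blinfun_apply (integral (cbox (-a) a) (fx x)) h = (\<integral>y. (D (x - y) \<bullet> h) * \<phi> y \<partial>lborel)" for h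
  proof -
    have i: "fx x integrable_on cbox (-a) a"
      unfolding fx_def
      by (intro integrable_continuous bounded_linear.continuous_on[OF bounded_linear_blinfun_inner_right] continuous_intros
          continuous_on_compose2[OF cD] continuous_on_subset[OF c\<phi>]) auto
    have "blinfun_apply (integral (cbox (-a) a) (fx x)) h = integral (cbox (-a) a) (\<lambda>y. blinfun_apply (fx x y) h)"
      using integral_linear[OF i, of "\<lambda>f. blinfun_apply f h"] by (simp add: o_def blinfun.bounded_linear_left)
    also have "\<dots> = integral (cbox (-a) a) (\<lambda>y. (D (x - y) \<bullet> h) * \<phi> y)"
      by (simp add: fx_def mult.commute)
    also have "\<dots> = (\<integral>y. (D (x - y) \<bullet> h) * \<phi> y \<partial>lborel)"
      by (intro integral_lborel_box(2)[symmetric] continuous_intros continuous_on_compose2[OF cD] c\<phi>) (auto simp: a)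
    finally show ?thesis .
  qed
  then have "blinfun_apply (integral (cbox (-a) a) (fx x)) = (\<lambda>h. \<integral>y. (D (x - y) \<bullet> h) * \<phi> y \<partial>lborel)"
    by (rule ext)
  ultimately show ?thesis by simp
qed

lemma smooth_on_convolution:
  fixes \<rho> \<phi> :: "'a::euclidean_space \<Rightarrow> real"
  assumes "smooth_on UNIV \<rho>"
    and c\<phi>: "continuous_on UNIV \<phi>" and supp: "compact K" "\<And>x. x \<notin> K \<Longrightarrow> \<phi> x = 0"
  shows "smooth_on UNIV (\<lambda>x. \<integral>y. \<rho> (x - y) * \<phi> y \<partial>lborel)"
  unfolding smooth_on_def
proof
  fix m show "Ck_on m UNIV (\<lambda>x. \<integral>y. \<rho> (x - y) * \<phi> y \<partial>lborel)"
    using assms(1)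
  proof (induction m arbitrary: \<rho>)
    case 0
    obtain D where D: "\<And>x. (\<rho> has_derivative (\<lambda>h. D x \<bullet> h)) (at x)" "continuous_on UNIV D"
      using smooth_onE_gradient[OF 0] by metis
    show ?case
      using has_derivative_convolution[OF D c\<phi> supp]
      by (auto intro!: continuous_at_imp_continuous_on dest!: has_derivative_continuous)
  next
    case (Suc m)
    obtain D where D: "\<And>x. (\<rho> has_derivative (\<lambda>h. D x \<bullet> h)) (at x)" "continuous_on UNIV D"
      "\<And>v. smooth_on UNIV (\<lambda>x. D x \<bullet> v)"
      using smooth_onE_gradient[OF Suc.prems] by metis
    show ?case
      by (rule Ck_on_SucI[OF open_UNIV has_derivative_convolution[OF D(1,2) c\<phi> supp] Suc.IH[OF D(3)]])
  qed
qed

lemma uniformly_continuous_compact_support: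
  fixes D :: "'a::euclidean_space \<Rightarrow> 'b::real_normed_vector"
  assumes "continuous_on UNIV D" "compact K" "\<And>x. x \<notin> K \<Longrightarrow> D x = 0" "e > 0"
  obtains d where "d > 0" "\<And>x y. norm (x - y) < d \<Longrightarrow> norm (D x - D y) < e"
proof -
  obtain R where R: "\<And>x. x \<in> K \<Longrightarrow> norm x \<le> R"
    using compact_imp_bounded[OF assms(2)] by (auto simp: bounded_iff)
  have "uniformly_continuous_on (cball 0 (R+1)) D"
    by (intro compact_uniformly_continuous compact_cball continuous_on_subset[OF assms(1)]) auto
  then obtain d where d: "d > 0" "\<And>x y. x \<in> cball 0 (R+1) \<Longrightarrow> y \<in> cball 0 (R+1) \<Longrightarrow> dist y x < d \<Longrightarrow> dist (D y) (D x) < e"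
    using assms(4) unfolding uniformly_continuous_on_def by metis
  have "norm (D x - D y) < e" if "norm (x - y) < min d 1" for x y
  proof (cases "x \<in> cball 0 (R+1) \<and> y \<in> cball 0 (R+1)")
    case True
    then show ?thesis using d(2)[of y x] that by (auto simp: dist_norm)
  next
    case False
    have "norm x \<le> norm y + norm (x - y)" "norm y \<le> norm x + norm (x - y)"
      using norm_triangle_ineq[of y "x - y"] norm_triangle_ineq[of x "y - x"] by (auto simp: norm_minus_commute)
    then have "norm x > R" "norm y > R" using False that by auto
    then have "x \<notin> K" "y \<notin> K" using R by force+
    then show ?thesis using assms by simp
  qed
  then show ?thesis using that[of "min d 1"] d(1) by auto
qed

text \<open>Mollification. The compact \<open>K\<close> is fixed before the accuracy
  \<open>e\<close>, so all approximating gradients live on one set, on which a locally integrable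
  field has finite mass.\<close>

lemma C1c_approx:
  fixes \<phi> :: "'a::euclidean_space \<Rightarrow> real"
  assumes "open E" "C1c E \<phi> D"
  obtains K where "compact K" "K \<subseteq> E" "\<And>x. x \<notin> K \<Longrightarrow> D x = 0"
    "\<And>e. e > 0 \<Longrightarrow> \<exists>\<psi>\<in>test_functions E. \<exists>D'. C1c E \<psi> D' \<and> (\<forall>x. norm (D' x - D x) \<le> e) \<and> (\<forall>x. x \<notin> K \<longrightarrow> D' x = 0)"
proof -
  obtain K where K: "compact K" "K \<subseteq> E" "\<And>x. x \<notin> K \<Longrightarrow> \<phi> x = 0" "\<And>x. x \<notin> K \<Longrightarrow> D x = 0"
    using C1c_D_support[OF assms(2)] by metis
  have d\<phi>: "(\<phi> has_derivative (\<lambda>h. D x \<bullet> h)) (at x)" for x using assms(2) by (simp add: C1c_def)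
  have cD: "continuous_on UNIV D" using assms(2) by (simp add: C1c_def)
  have c\<phi>: "continuous_on UNIV \<phi>" by (rule C1c_continuous[OF assms(2)])
  obtain s where s: "s > 0" "(\<Union>x\<in>K. ball x s) \<subseteq> E"
    using compact_subset_open_imp_ball_epsilon_subset[OF K(1) assms(1) K(2)] by blast
  define K' where "K' = {x + y |x y. x \<in> K \<and> y \<in> cball 0 (s/2)}"
  have K'c: "compact K'" unfolding K'_def by (intro compact_sums K compact_cball)
  have K'E: "K' \<subseteq> E"
  proof
    fix z assume "z \<in> K'"
    then obtain x y where "z = x + y" "x \<in> K" "norm y \<le> s/2" by (auto simp: K'_def)
    then have "z \<in> ball x s" using s(1) by (auto simp: dist_norm)
    then show "z \<in> E" using s(2) \<open>x \<in> K\<close> by blast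
  qed
  have KK': "K \<subseteq> K'" unfolding K'_def using s(1) by force
  show ?thesis
  proof (rule that[OF K'c K'E])
    show "D x = 0" if "x \<notin> K'" for x using that KK' K(4) by blast
  next
    fix e :: real assume "e > 0"
    then obtain d where d: "d > 0" "\<And>x y. norm (x - y) < d \<Longrightarrow> norm (D x - D y) < e"
      using uniformly_continuous_compact_support[OF cD K(1) K(4)] by metis
    \<comment> \<open>\<open>d\<close> controls the oscillation of \<open>D\<close>, and
      \<open>s/2\<close> keeps the mollified support inside \<open>K'\<close>.\<close>
    define t where "t = min d (s/2)"
    have "t > 0" using d s by (simp add: t_def)
    then obtain \<rho> :: "'a \<Rightarrow> real" where \<rho>: "smooth_on UNIV \<rho>" "\<And>x. \<rho> x \<ge> 0" "\<And>x. norm x \<ge> t \<Longrightarrow> \<rho> x = 0" "(\<integral>x. \<rho> x \<partial>lborel) = 1"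
      using bump_exists[of t] by metis
    obtain G where G: "\<And>x. (\<rho> has_derivative (\<lambda>h. G x \<bullet> h)) (at x)" "continuous_on UNIV G"
      using smooth_onE_gradient[OF \<rho>(1)] by metis
    have c\<rho>: "continuous_on UNIV \<rho>"
      using G(1) by (auto intro!: continuous_at_imp_continuous_on dest: has_derivative_continuous)
    obtain a where a: "\<And>x. x \<notin> cbox (-a) a \<Longrightarrow> D x = 0"
      by (rule compact_support_box[of K D]) (use K in auto)
    define \<psi> where "\<psi> x = (\<integral>y. \<rho> (x - y) * \<phi> y \<partial>lborel)" for x
    define D' where "D' x = (\<integral>y. \<rho> (x - y) *\<^sub>R D y \<partial>lborel)" for x
    have iD: "integrable lborel (\<lambda>y. \<rho> (x - y) *\<^sub>R D y)" for x
      by (intro integral_lborel_box(1)[of _ "-a" a] continuous_intros continuous_on_compose2[OF c\<rho>] cD) (auto simp: a)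
    have sm: "smooth_on UNIV \<psi>" unfolding \<psi>_def by (rule smooth_on_convolution[OF \<rho>(1) c\<phi> K(1) K(3)])
    \<comment> \<open>The gradient moves from the mollifier to \<open>\<phi>\<close>: the two
      integrands differ by the \<open>y\<close>-gradient of
      \<open>\<rho> (x - y) * \<phi> y\<close>, paired with \<open>h\<close>, and this has integral
      0.\<close>
    have eq: "(\<integral>y. (G (x - y) \<bullet> h) * \<phi> y \<partial>lborel) = D' x \<bullet> h" for x h
    proof -
      have "C1c UNIV (\<lambda>y. \<rho> (x - y) * \<phi> y) (\<lambda>y. \<rho> (x - y) *\<^sub>R D y - \<phi> y *\<^sub>R G (x - y))"
        unfolding C1c_def
      proof (intro conjI allI exI[of _ K])
        fix y
        have "((\<lambda>y. x - y) has_derivative (\<lambda>h. - h)) (at y)" by (auto intro!: derivative_eq_intros)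
        from has_derivative_mult[OF has_derivative_compose[OF this G(1)] d\<phi>]
        show "((\<lambda>y. \<rho> (x - y) * \<phi> y) has_derivative (\<lambda>h. (\<rho> (x - y) *\<^sub>R D y - \<phi> y *\<^sub>R G (x - y)) \<bullet> h)) (at y)"
          by (simp add: inner_diff_left algebra_simps)
      next
        show "continuous_on UNIV (\<lambda>y. \<rho> (x - y) *\<^sub>R D y - \<phi> y *\<^sub>R G (x - y))"
          by (intro continuous_intros cD c\<phi> continuous_on_compose2[OF c\<rho>] continuous_on_compose2[OF G(2)]) auto
      qed (use K in auto)
      then have "(\<integral>y. (\<rho> (x - y) *\<^sub>R D y - \<phi> y *\<^sub>R G (x - y)) \<bullet> h \<partial>lborel) = 0"
        by (rule C1c_integral_derivative)
      moreover have "(\<integral>y. (\<rho> (x - y) *\<^sub>R D y - \<phi> y *\<^sub>R G (x - y)) \<bullet> h \<partial>lborel) =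
        (\<integral>y. (\<rho> (x - y) *\<^sub>R D y) \<bullet> h \<partial>lborel) - (\<integral>y. (G (x - y) \<bullet> h) * \<phi> y \<partial>lborel)"
      proof -
        obtain b where b: "\<And>x. x \<notin> cbox (-b) b \<Longrightarrow> \<phi> x = 0"
          by (rule compact_support_box[of K \<phi>]) (use K in auto)
        have "integrable lborel (\<lambda>y. (G (x - y) \<bullet> h) * \<phi> y)"
          by (intro integral_lborel_box(1)[of _ "-b" b] continuous_intros continuous_on_compose2[OF G(2)] c\<phi>) (auto simp: b)
        then show ?thesis
          using integrable_inner_left[OF iD[of x], of h]
          by (subst Bochner_Integration.integral_diff[symmetric]) (simp_all add: inner_diff_left mult.commute)
      qed
      ultimately show ?thesis unfolding D'_def using integral_inner_left[OF iD[of x], of h] by simp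
    qed
    have dps: "(\<psi> has_derivative (\<lambda>h. D' x \<bullet> h)) (at x)" for x
      using has_derivative_convolution[OF G c\<phi> K(1) K(3), of x] unfolding eq \<psi>_def .
    have z: "\<psi> x = 0" if "x \<notin> K'" for x
    proof -
      have "\<rho> (x - y) * \<phi> y = 0" for y
      proof (rule ccontr)
        assume "\<not> ?thesis"
        then have "y \<in> K" "norm (x - y) < t" using K(3) \<rho>(3) by (auto simp: not_le[symmetric])
        then have "x \<in> K'" unfolding K'_def mem_Collect_eq
          by (intro exI[of _ y] exI[of _ "x - y"]) (auto simp: t_def)
        then show False using that by simp
      qed
      then have "(\<lambda>y. \<rho> (x - y) * \<phi> y) = (\<lambda>y. 0)" by (rule ext)
      then show ?thesis by (simp only: \<psi>_def) simp
    qed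
    have zD: "D' x = 0" if "x \<notin> K'" for x
      by (rule gradient_zero_outside[OF dps, of K']) (use z that K'c in \<open>auto intro: compact_imp_closed\<close>)
    have cD': "continuous_on UNIV D'"
    proof -
      obtain D2 where D2: "\<And>x. (\<psi> has_derivative (\<lambda>h. D2 x \<bullet> h)) (at x)" "continuous_on UNIV D2"
        using smooth_onE_gradient[OF sm] by metis
      have "D2 x = D' x" for x
      proof -
        have "(\<lambda>h. D2 x \<bullet> h) = (\<lambda>h. D' x \<bullet> h)" by (rule has_derivative_unique[OF D2(1) dps])
        then show ?thesis by (metis vector_eq_rdot)
      qed
      then show ?thesis using D2(2) by (simp add: ext)
    qed
    have cl: "closure {x. \<psi> x \<noteq> 0} \<subseteq> K'"
      by (rule closure_minimal) (use z K'c in \<open>auto intro: compact_imp_closed\<close>)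
    have "\<psi> \<in> test_functions E"
      unfolding test_functions_def
      using sm cl K'E compact_Int_closed[OF K'c closed_closure, of "{x. \<psi> x \<noteq> 0}"] by (auto simp: Int_absorb1)
    moreover have "C1c E \<psi> D'" unfolding C1c_def using dps cD' z K'c K'E by blast
    moreover have "norm (D' x - D x) \<le> e" for x
    proof -
      have cr: "continuous_on UNIV (\<lambda>y. \<rho> (x - y))" by (intro continuous_intros continuous_on_compose2[OF c\<rho>]) auto
      obtain b where b: "\<And>y. y \<notin> cbox (-b) b \<Longrightarrow> \<rho> (x - y) = 0"
        by (rule compact_support_box[of "cball x t" "\<lambda>y. \<rho> (x - y)"]) (use \<rho>(3) in \<open>auto simp: dist_norm\<close>)
      have ir: "integrable lborel (\<lambda>y. \<rho> (x - y))" by (rule integral_lborel_box(1)[OF cr b])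
      have one: "(\<integral>y. \<rho> (x - y) \<partial>lborel) = 1"
      proof -
        have "(\<integral>y. \<rho> (x - y) \<partial>lborel) = (\<integral>y. \<rho> (x + (-1) *\<^sub>R y) \<partial>lborel)" by simp
        also have "\<dots> = (\<integral>y. \<rho> y \<partial>lborel)"
        proof -
          have "lborel = distr lborel borel (\<lambda>y::'a. x + (-1) *\<^sub>R y)"
            by (subst lborel_affine[of "-1" x]) (auto simp: density_1)
          then have "(\<integral>y. \<rho> y \<partial>lborel) = (\<integral>y. \<rho> y \<partial>(distr lborel borel (\<lambda>y::'a. x + (-1) *\<^sub>R y)))" by simp
          also have "\<dots> = (\<integral>y. \<rho> (x + (-1) *\<^sub>R y) \<partial>lborel)"
            by (rule integral_distr) (use c\<rho> in \<open>auto intro: borel_measurable_continuous_onI\<close>)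
          finally show ?thesis ..
        qed
        finally show ?thesis using \<rho>(4) by simp
      qed
      have "D' x - D x = (\<integral>y. \<rho> (x - y) *\<^sub>R (D y - D x) \<partial>lborel)"
        using iD[of x] ir one by (simp add: D'_def scaleR_diff_right Bochner_Integration.integral_diff)
      also have "norm \<dots> \<le> (\<integral>y. e * \<rho> (x - y) \<partial>lborel)"
      proof (rule order_trans[OF integral_norm_bound integral_mono])
        show "integrable lborel (\<lambda>y. norm (\<rho> (x - y) *\<^sub>R (D y - D x)))"
          using iD[of x] ir by (intro integrable_norm) (simp add: scaleR_diff_right)
        show "integrable lborel (\<lambda>y. e * \<rho> (x - y))" using ir by simp
        show "norm (\<rho> (x - y) *\<^sub>R (D y - D x)) \<le> e * \<rho> (x - y)" for y
        proof (cases "norm (x - y) < t")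
          case True
          then have "norm (D y - D x) < e" using d(2)[of y x] by (simp add: t_def norm_minus_commute)
          then show ?thesis using \<rho>(2)[of "x - y"] mult_left_mono[of "norm (D y - D x)" e "\<rho> (x - y)"]
            by (simp add: mult.commute)
        qed (use \<rho>(3) in auto)
      qed
      finally show ?thesis using one by simp
    qed
    ultimately show "\<exists>\<psi>\<in>test_functions E. \<exists>D'. C1c E \<psi> D' \<and> (\<forall>x. norm (D' x - D x) \<le> e) \<and> (\<forall>x. x \<notin> K' \<longrightarrow> D' x = 0)"
      using zD by blast
  qed
qed

text \<open>Passage to the limit in \<open>C1c_approx\<close>: the error is at most \<open>e\<close>
  times the mass of \<open>G\<close> on the common support.\<close>

lemma weak_identity_C1c:
  fixes G :: "'a::euclidean_space \<Rightarrow> 'a"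
  assumes "open E" and int: "\<And>K. compact K \<Longrightarrow> K \<subseteq> E \<Longrightarrow> set_integrable lebesgue K G"
    and test: "\<And>\<psi> D. \<psi> \<in> test_functions E \<Longrightarrow> C1c E \<psi> D \<Longrightarrow> (LINT x:E|lebesgue. G x \<bullet> D x) = 0"
    and "C1c E \<phi> D"
  shows "(LINT x:E|lebesgue. G x \<bullet> D x) = 0"
proof -
  obtain K where K: "compact K" "K \<subseteq> E" "\<And>x. x \<notin> K \<Longrightarrow> D x = 0"
    "\<And>e. e > 0 \<Longrightarrow> \<exists>\<psi>\<in>test_functions E. \<exists>D'. C1c E \<psi> D' \<and> (\<forall>x. norm (D' x - D x) \<le> e) \<and> (\<forall>x. x \<notin> K \<longrightarrow> D' x = 0)"
    using C1c_approx[OF assms(1,4)] by metis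
  have K2: "set_integrable lebesgue K G" by (rule int[OF K(1,2)])
  have iK: "integrable lebesgue (\<lambda>x. indicator K x *\<^sub>R G x)" using K2 by (simp add: set_integrable_def)
  have red: "(LINT x:E|lebesgue. G x \<bullet> C x) = (\<integral>x. (indicator K x *\<^sub>R G x) \<bullet> C x \<partial>lebesgue)"
    and intg: "integrable lebesgue (\<lambda>x. (indicator K x *\<^sub>R G x) \<bullet> C x)"
    if "continuous_on UNIV C" "\<And>x. x \<notin> K \<Longrightarrow> C x = 0" for C
  proof -
    show "(LINT x:E|lebesgue. G x \<bullet> C x) = (\<integral>x. (indicator K x *\<^sub>R G x) \<bullet> C x \<partial>lebesgue)"
      unfolding set_lebesgue_integral_def
      by (rule Bochner_Integration.integral_cong) (use that K(2) in \<open>auto simp: indicator_def\<close>)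
    have "bounded (C ` K)" by (intro compact_imp_bounded compact_continuous_image K continuous_on_subset[OF that(1)]) auto
    then obtain B where B: "\<And>x. x \<in> K \<Longrightarrow> norm (C x) \<le> B" by (auto simp: bounded_iff)
    have B': "norm (C x) \<le> \<bar>B\<bar>" for x using B[of x] that(2)[of x] by (cases "x \<in> K") auto
    show "integrable lebesgue (\<lambda>x. (indicator K x *\<^sub>R G x) \<bullet> C x)"
    proof (rule Bochner_Integration.integrable_bound[OF integrable_mult_left[OF integrable_norm[OF iK], of "\<bar>B\<bar>"]])
      have "C \<in> borel_measurable lebesgue"
        using borel_measurable_continuous_onI[OF that(1)] by (simp add: measurable_completion)
      then show "(\<lambda>x. (indicator K x *\<^sub>R G x) \<bullet> C x) \<in> borel_measurable lebesgue"
        using iK by (intro borel_measurable_inner) auto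
      show "AE x in lebesgue. norm ((indicator K x *\<^sub>R G x) \<bullet> C x) \<le> norm (norm (indicator K x *\<^sub>R G x) * \<bar>B\<bar>)"
      proof (rule AE_I2)
        fix x
        have "norm ((indicator K x *\<^sub>R G x) \<bullet> C x) \<le> norm (indicator K x *\<^sub>R G x) * norm (C x)"
          unfolding real_norm_def by (rule Cauchy_Schwarz_ineq2)
        also have "\<dots> \<le> norm (indicator K x *\<^sub>R G x) * \<bar>B\<bar>"
          using B'[of x] by (intro mult_left_mono) auto
        finally show "norm ((indicator K x *\<^sub>R G x) \<bullet> C x) \<le> norm (norm (indicator K x *\<^sub>R G x) * \<bar>B\<bar>)"
          by simp
      qed
    qed
  qed
  have cD: "continuous_on UNIV D" using assms(4) by (simp add: C1c_def)
  define I where "I = (\<integral>x. norm (indicator K x *\<^sub>R G x) \<partial>lebesgue)"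
  have "\<bar>LINT x:E|lebesgue. G x \<bullet> D x\<bar> \<le> e * I" if "e > 0" for e
  proof -
    obtain \<psi> D' where \<psi>: "\<psi> \<in> test_functions E" "C1c E \<psi> D'" "\<And>x. norm (D' x - D x) \<le> e" "\<And>x. x \<notin> K \<Longrightarrow> D' x = 0"
      using K(4)[OF \<open>e > 0\<close>] by metis
    have cD': "continuous_on UNIV D'" using \<psi>(2) by (simp add: C1c_def)
    have "(LINT x:E|lebesgue. G x \<bullet> D x) = (LINT x:E|lebesgue. G x \<bullet> D x) - (LINT x:E|lebesgue. G x \<bullet> D' x)"
      using test[OF \<psi>(1,2)] by simp
    also have "\<dots> = (\<integral>x. (indicator K x *\<^sub>R G x) \<bullet> (D x - D' x) \<partial>lebesgue)"
    proof -
      have "(LINT x:E|lebesgue. G x \<bullet> D x) = (\<integral>x. (indicator K x *\<^sub>R G x) \<bullet> D x \<partial>lebesgue)"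
        "integrable lebesgue (\<lambda>x. (indicator K x *\<^sub>R G x) \<bullet> D x)"
        by (intro red intg cD K(3); assumption)+
      moreover have "(LINT x:E|lebesgue. G x \<bullet> D' x) = (\<integral>x. (indicator K x *\<^sub>R G x) \<bullet> D' x \<partial>lebesgue)"
        "integrable lebesgue (\<lambda>x. (indicator K x *\<^sub>R G x) \<bullet> D' x)"
        by (intro red intg cD' \<psi>(4); assumption)+
      ultimately show ?thesis by (simp only: inner_diff_right Bochner_Integration.integral_diff)
    qed
    also have "\<bar>\<dots>\<bar> \<le> (\<integral>x. e * norm (indicator K x *\<^sub>R G x) \<partial>lebesgue)"
      unfolding real_norm_def[symmetric]
    proof (rule order_trans[OF integral_norm_bound integral_mono])
      show "integrable lebesgue (\<lambda>x. norm ((indicator K x *\<^sub>R G x) \<bullet> (D x - D' x)))"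
        by (intro integrable_norm intg continuous_intros cD cD') (use K(3) \<psi>(4) in auto)
      show "integrable lebesgue (\<lambda>x. e * norm (indicator K x *\<^sub>R G x))" using iK by (intro integrable_mult_right integrable_norm)
      show "norm ((indicator K x *\<^sub>R G x) \<bullet> (D x - D' x)) \<le> e * norm (indicator K x *\<^sub>R G x)" for x
      proof -
        have "norm ((indicator K x *\<^sub>R G x) \<bullet> (D x - D' x)) \<le> norm (indicator K x *\<^sub>R G x) * norm (D x - D' x)"
          unfolding real_norm_def by (rule Cauchy_Schwarz_ineq2)
        also have "\<dots> \<le> norm (indicator K x *\<^sub>R G x) * e"
          using \<psi>(3)[of x] by (intro mult_left_mono) (auto simp: norm_minus_commute)
        finally show ?thesis by (simp add: mult.commute)
      qed
    qed
    finally show ?thesis by (simp add: I_def)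
  qed
  note bd = this
  have I0: "I \<ge> 0" unfolding I_def by simp
  show ?thesis
  proof (rule ccontr)
    let ?v = "\<bar>LINT x:E|lebesgue. G x \<bullet> D x\<bar>"
    assume "\<not> ?thesis"
    then have p: "?v > 0" by simp
    \<comment> \<open>With this accuracy the error is at most half of the value supposed to be
      nonzero.\<close>
    have "?v \<le> ?v / (2 * (I + 1)) * I" using p I0 by (intro bd) auto
    also have "\<dots> \<le> ?v / 2" using p I0 by (simp add: field_simps)
    finally show False using p by simp
  qed
qed

section \<open>Rotations of the plane\<close>

text \<open>Counterclockwise quarter turn. As \<open>perp x\<close> has the length of
  \<open>x\<close>, pairing a gradient with it gives the derivative in the angle, not in arc
  length.\<close>

definition perp :: "real^2 \<Rightarrow> real^2" where
  "perp x = (\<chi> i. if i = 1 then - x $ 2 else x $ 1)"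

lemma perp_nth [simp]: "perp x $ 1 = - x $ 2" "perp x $ 2 = x $ 1"
  by (simp_all add: perp_def)

lemma inner_2: "(x::real^2) \<bullet> y = x $ 1 * y $ 1 + x $ 2 * y $ 2"
  by (simp add: inner_vec_def sum_2)

lemma linear_perp: "linear perp"
  by (intro linearI) (simp_all add: vec_eq_iff forall_2)

lemma bounded_linear_perp: "bounded_linear perp"
  using linear_perp by (simp add: linear_conv_bounded_linear)

lemmas perp_linear_simps [simp] =
  linear_add[OF linear_perp] linear_diff[OF linear_perp] linear_cmul[OF linear_perp]
  linear_neg[OF linear_perp] linear_0[OF linear_perp]

lemmas perp_has_derivative [derivative_intros] = bounded_linear.has_derivative[OF bounded_linear_perp]

lemmas continuous_on_perp [continuous_intros] = bounded_linear.continuous_on[OF bounded_linear_perp]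

lemma perp_perp [simp]: "perp (perp x) = - x"
  by (simp add: vec_eq_iff forall_2)

lemma inner_perp_self [simp]: "x \<bullet> perp x = 0" "perp x \<bullet> x = 0"
  by (simp_all add: inner_2)

lemma inner_perp_perp [simp]: "perp x \<bullet> perp y = x \<bullet> y"
  by (simp add: inner_2)

lemma inner_perp_left: "perp x \<bullet> y = - (x \<bullet> perp y)"
  by (simp add: inner_2)

lemma norm_perp [simp]: "norm (perp x) = norm x"
  by (simp add: norm_eq_sqrt_inner)

lemma perp_decomp: "(x \<bullet> x) *\<^sub>R y = (y \<bullet> x) *\<^sub>R x + (y \<bullet> perp x) *\<^sub>R perp x"
  by (simp add: vec_eq_iff forall_2 inner_2 algebra_simps)

lemma perp_pythagoras: "(y \<bullet> y) * (x \<bullet> x) = (y \<bullet> x)\<^sup>2 + (y \<bullet> perp x)\<^sup>2"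
  by (simp add: inner_2 algebra_simps power2_eq_square)

definition rot :: "real \<Rightarrow> real^2 \<Rightarrow> real^2" where
  "rot t x = cos t *\<^sub>R x + sin t *\<^sub>R perp x"

lemma linear_rot: "linear (rot t)"
  by (intro linearI) (simp_all add: rot_def algebra_simps)

lemmas rot_linear_simps [simp] =
  linear_add[OF linear_rot] linear_diff[OF linear_rot] linear_cmul[OF linear_rot]
  linear_neg[OF linear_rot] linear_0[OF linear_rot]

lemma inner_rot_rot [simp]: "rot t x \<bullet> rot t y = x \<bullet> y"
proof -
  have "rot t x \<bullet> rot t y = cos t * cos t * (x \<bullet> y) + sin t * sin t * (x \<bullet> y)"
    by (simp add: rot_def inner_2 algebra_simps)
  also have "\<dots> = ((cos t)\<^sup>2 + (sin t)\<^sup>2) * (x \<bullet> y)"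
    by (simp only: power2_eq_square distrib_right)
  finally show ?thesis by simp
qed

lemma norm_rot [simp]: "norm (rot t x) = norm x"
  by (simp add: norm_eq_sqrt_inner)

lemma rot_perp: "rot t (perp x) = perp (rot t x)"
  by (simp add: rot_def)

lemma rot_rot: "rot s (rot t x) = rot (s + t) x"
  by (simp add: vec_eq_iff forall_2 rot_def sin_add cos_add algebra_simps)

lemma rot_0 [simp]: "rot 0 x = x"
  by (simp add: rot_def)

lemma rot_2pi [simp]: "rot (2 * pi) x = x"
  by (simp add: rot_def)

lemma continuous_on_rot [continuous_intros]:
  fixes f :: "'a::t2_space \<Rightarrow> real"
  shows "continuous_on S f \<Longrightarrow> continuous_on S g \<Longrightarrow> continuous_on S (\<lambda>x. rot (f x) (g x))"
  unfolding rot_def by (intro continuous_intros)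

lemma rot_measurable [measurable]: "rot t \<in> borel_measurable borel"
  using linear_rot by (intro borel_measurable_continuous_onI linear_continuous_on) (simp add: linear_conv_bounded_linear)

lemma has_derivative_rot: "(rot t has_derivative rot t) (at x within S)"
  using linear_rot by (simp add: linear_conv_bounded_linear bounded_linear_imp_has_derivative)

lemma rot_has_vector_derivative:
  "((\<lambda>t. rot t x) has_vector_derivative perp (rot t x)) (at t within S)"
  unfolding rot_def by (auto intro!: derivative_eq_intros simp: algebra_simps)

definition circ :: "real \<Rightarrow> real^2" where "circ r = r *\<^sub>R axis 1 1"

lemma norm_circ: "norm (circ r) = \<bar>r\<bar>"
  by (simp add: circ_def)

lemma rot_to_circ: obtains t where "t \<ge> 0" "x = rot t (circ (norm x))"
proof (cases "x = 0")
  case True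
  then have "x = rot 0 (circ (norm x))" by (simp add: circ_def)
  then show ?thesis by (rule that[rotated]) simp
next
  case False
  have "(x $ 1 / norm x)\<^sup>2 + (x $ 2 / norm x)\<^sup>2 = 1"
    using False by (simp add: power_divide norm_eq_sqrt_inner inner_2 power2_eq_square vec_eq_iff forall_2 flip: add_divide_distrib)
  then obtain t where t: "t \<ge> 0" "x $ 1 / norm x = cos t" "x $ 2 / norm x = sin t"
    using sincos_total_2pi by metis
  then have c: "norm x * cos t = x $ 1" "norm x * sin t = x $ 2" using False by (simp_all add: field_simps)
  have "rot t (circ (norm x)) $ 1 = x $ 1" "rot t (circ (norm x)) $ 2 = x $ 2"
    unfolding c[symmetric] by (simp_all add: rot_def circ_def axis_def)
  then have "x = rot t (circ (norm x))"
    by (simp only: vec_eq_iff forall_2)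
  with t(1) show ?thesis by (rule that)
qed

section \<open>Rotation invariance and integrals of radial functions\<close>

lemma lborel_rot: "distr lborel borel (rot t) = lborel"
proof (rule lborel_eqI[symmetric])
  fix l u :: "real^2" assume lu: "\<And>b. b \<in> Basis \<Longrightarrow> l \<bullet> b \<le> u \<bullet> b"
  note m = rot_measurable[of t]
  have inv: "rot t -` box l u = rot (- t) ` box l u"
  proof (intro equalityI subsetI)
    fix x assume "x \<in> rot t -` box l u"
    then show "x \<in> rot (- t) ` box l u"
      by (intro image_eqI[of _ _ "rot t x"]) (auto simp: rot_rot)
  qed (auto simp: rot_rot)
  have o: "orthogonal_transformation (rot (- t))"
    by (simp add: orthogonal_transformation_def linear_rot)
  have "emeasure (distr lborel borel (rot t)) (box l u) = emeasure lborel (rot (- t) ` box l u)"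
    by (subst emeasure_distr) (use m inv in auto)
  also have "\<dots> = emeasure lebesgue (rot (- t) ` box l u)"
  proof -
    have "rot t -` box l u \<in> sets borel" using measurable_sets[OF m, of "box l u"] by simp
    then show ?thesis by (simp add: inv)
  qed
  also have "\<dots> = ennreal (measure lebesgue (rot (- t) ` box l u))"
    using fmeasurableD2[OF measurable_orthogonal_image[OF o lmeasurable_box, of l u]]
    by (intro emeasure_eq_ennreal_measure) auto
  also have "\<dots> = ennreal (measure lebesgue (box l u))"
    by (simp add: measure_orthogonal_image[OF o lmeasurable_box])
  also have "\<dots> = emeasure lborel (box l u)"
    by (subst emeasure_eq_measure2) (use emeasure_lborel_box_finite in auto)
  also have "\<dots> = (\<Prod>b\<in>Basis. (u - l) \<bullet> b)"
    using lu by (subst emeasure_lborel_box) auto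
  finally show "emeasure (distr lborel borel (rot t)) (box l u) = (\<Prod>b\<in>Basis. (u - l) \<bullet> b)" .
qed simp

definition ann :: "real \<Rightarrow> real \<Rightarrow> (real^2) set" where
  "ann a L = {x. a \<le> norm x \<and> norm x \<le> L}"

lemma compact_ann: "compact (ann a L)"
proof -
  have "ann a L = cball 0 L - ball 0 a" by (auto simp: ann_def)
  then show ?thesis by (simp add: compact_diff)
qed

lemma rot_in_ann [simp]: "rot t x \<in> ann a L \<longleftrightarrow> x \<in> ann a L"
  by (simp add: ann_def)

lemma set_integrable_ann:
  fixes f :: "real^2 \<Rightarrow> 'b::{banach, second_countable_topology}"
  shows "continuous_on (ann a L) f \<Longrightarrow> set_integrable lborel (ann a L) f"
  unfolding set_integrable_def by (intro borel_integrable_compact compact_ann)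

text \<open>Fubini in angle and position, then rotation invariance of Lebesgue measure and of the
  annulus. Identities on single circles become identities on annuli in this way, without polar
  coordinates.\<close>

lemma rot_average:
  fixes f :: "real^2 \<Rightarrow> real"
  assumes cf: "continuous_on (ann a L) f" and cc: "continuous_on {0..2*pi} c"
  shows "(LINT x:ann a L|lborel. integral {0..2*pi} (\<lambda>t. c t * f (rot t x)))
       = integral {0..2*pi} c * (LINT x:ann a L|lborel. f x)"
proof -
  let ?A = "ann a L" and ?T = "{0..2*pi}"
  define F where "F x t = indicator ?A x * (indicator ?T t * (c t * f (rot t x)))" for x t
  have "integrable lborel (\<lambda>z. indicator (?A \<times> ?T) z *\<^sub>R (c (snd z) * f (rot (snd z) (fst z))))"
    by (intro borel_integrable_compact compact_Times compact_ann compact_Icc continuous_intros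
        continuous_on_compose2[OF cf] continuous_on_compose2[OF cc]) auto
  moreover have "(\<lambda>z. indicator (?A \<times> ?T) z *\<^sub>R (c (snd z) * f (rot (snd z) (fst z)))) = case_prod F"
    by (auto simp: F_def indicator_def)
  ultimately have "integrable (lborel \<Otimes>\<^sub>M lborel) (case_prod F)" by (simp add: lborel_prod)
  from lborel_pair.Fubini_integral[OF this]
  have 1: "(\<integral>t. (\<integral>x. F x t \<partial>lborel) \<partial>lborel) = (\<integral>x. (\<integral>t. F x t \<partial>lborel) \<partial>lborel)" .
  have 2: "(\<integral>t. F x t \<partial>lborel) = indicator ?A x * integral ?T (\<lambda>t. c t * f (rot t x))" for x
  proof (cases "x \<in> ?A")
    case True
    have "continuous_on ?T (\<lambda>t. c t * f (rot t x))"
      by (intro continuous_intros cc continuous_on_compose2[OF cf]) (use True in auto)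
    then have "set_integrable lborel ?T (\<lambda>t. c t * f (rot t x))"
      by (rule borel_integrable_atLeastAtMost')
    from set_borel_integral_eq_integral(2)[OF this] show ?thesis
      using True by (simp add: F_def set_lebesgue_integral_def)
  qed (simp add: F_def)
  define I where "I = (LINT x:?A|lborel. f x)"
  have 3: "(\<integral>x. F x t \<partial>lborel) = indicator ?T t * (c t * I)" for t
  proof -
    have m: "(\<lambda>x. indicator ?A x * f x) \<in> borel_measurable borel"
      using borel_measurable_continuous_on_indicator[OF _ cf] compact_ann[of a L] by (simp add: compact_imp_closed borel_closed)
    have "I = (\<integral>x. indicator ?A x * f x \<partial>(distr lborel borel (rot t)))"
      by (simp add: I_def lborel_rot set_lebesgue_integral_def)
    also have "\<dots> = (\<integral>x. indicator ?A (rot t x) * f (rot t x) \<partial>lborel)"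
      by (rule integral_distr) (use m in auto)
    finally have I: "I = (\<integral>x. indicator ?A x * f (rot t x) \<partial>lborel)"
      by (simp add: indicator_def)
    then show ?thesis
    proof -
      have "F x t = (indicator ?T t * c t) * (indicator ?A x * f (rot t x))" for x
        by (simp add: F_def)
      then show ?thesis using I by simp
    qed
  qed
  have "(\<integral>t. (\<integral>x. F x t \<partial>lborel) \<partial>lborel) = (LINT t:?T|lborel. c t * I)"
    by (simp only: 3 set_lebesgue_integral_def real_scaleR_def)
  also have "\<dots> = integral ?T (\<lambda>t. c t * I)"
    by (rule set_borel_integral_eq_integral(2)) (intro borel_integrable_atLeastAtMost' continuous_intros cc)
  finally show ?thesis using 1 by (simp add: 2 set_lebesgue_integral_def I_def)
qed

text \<open>Half open, since such a shell is exactly what \<open>ann a q\<close> adds to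
  \<open>ann a p\<close>.\<close>

lemma measure_shell:
  assumes "0 \<le> p" "p \<le> q"
  shows "measure lborel {x::real^2. p < norm x \<and> norm x \<le> q} = pi * (q\<^sup>2 - p\<^sup>2)"
    "{x::real^2. p < norm x \<and> norm x \<le> q} \<in> fmeasurable lborel"
proof -
  have e: "{x::real^2. p < norm x \<and> norm x \<le> q} = cball 0 q - cball 0 p" by auto
  have f: "cball 0 r \<in> fmeasurable (lborel :: (real^2) measure)" for r
    by (simp add: fmeasurable_compact)
  show "{x::real^2. p < norm x \<and> norm x \<le> q} \<in> fmeasurable lborel"
    unfolding e using f by (intro fmeasurable.Diff)
  have "measure lborel (cball 0 q - cball 0 p :: (real^2) set) = measure lborel (cball 0 q :: (real^2) set) - measure lborel (cball 0 p :: (real^2) set)"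
    by (rule measure_Diff) (use f[of q] f[of p] assms in \<open>auto simp: fmeasurable_def\<close>)
  then show "measure lborel {x::real^2. p < norm x \<and> norm x \<le> q} = pi * (q\<^sup>2 - p\<^sup>2)"
    unfolding e using assms by (simp add: content_cball unit_ball_vol_2 algebra_simps power2_eq_square)
qed

text \<open>Polar coordinates for radial integrands without a change of variables: the integral over
  \<open>ann a s\<close> is differentiated in \<open>s\<close>, the area of thin shells giving the
  derivative \<open>2 * pi * (s * f s)\<close>.\<close>

lemma integral_radial:
  fixes f :: "real \<Rightarrow> real"
  assumes "0 < a" "a \<le> L" and cf: "continuous_on {a..L} f"
  shows "(LINT x:ann a L|lborel. f (norm x)) = 2 * pi * integral {a..L} (\<lambda>r. r * f r)"
proof -
  define \<Phi> where "\<Phi> s = (LINT x:ann a s|lborel. f (norm x))" for s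
  have cn: "continuous_on (ann a s) (\<lambda>x. f (norm x))" if "s \<le> L" for s
    by (intro continuous_on_compose2[OF cf] continuous_intros) (use that in \<open>auto simp: ann_def\<close>)
  have key: "\<bar>\<Phi> q - \<Phi> p - c * (pi * (q\<^sup>2 - p\<^sup>2))\<bar> \<le> e * (pi * (q\<^sup>2 - p\<^sup>2))"
    if "a \<le> p" "p \<le> q" "q \<le> L" "\<And>r. p \<le> r \<Longrightarrow> r \<le> q \<Longrightarrow> \<bar>f r - c\<bar> \<le> e" for p q c e
  proof -
    let ?S = "{x::real^2. p < norm x \<and> norm x \<le> q}"
    have Sm: "?S \<in> sets lborel" "emeasure lborel ?S < \<infinity>"
      using measure_shell(2)[of p q] that assms by (auto simp: fmeasurable_def)
    have u: "ann a q = ann a p \<union> ?S" "ann a p \<inter> ?S = {}" using that by (auto simp: ann_def)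
    have sq: "set_integrable lborel (ann a q) (\<lambda>x. f (norm x))" by (rule set_integrable_ann[OF cn[OF that(3)]])
    have sp: "set_integrable lborel (ann a p) (\<lambda>x. f (norm x))" by (rule set_integrable_ann[OF cn]) (use that in simp)
    have sS: "set_integrable lborel ?S (\<lambda>x. f (norm x))"
      by (rule set_integrable_subset[OF sq Sm(1)]) (use u in auto)
    have "\<Phi> q - \<Phi> p = (LINT x:?S|lborel. f (norm x))"
      unfolding \<Phi>_def u(1) by (subst set_integral_Un[OF u(2) sp sS]) simp
    also have "\<dots> - c * (pi * (q\<^sup>2 - p\<^sup>2)) = (LINT x:?S|lborel. f (norm x) - c)"
      using measure_shell[of p q] that assms Sm sS
      by (subst set_integral_diff) (auto simp: set_integrable_def set_lebesgue_integral_def mult.commute)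
    also have "\<bar>\<dots>\<bar> \<le> (LINT x:?S|lborel. e)"
    proof -
      have i: "set_integrable lborel ?S (\<lambda>x. f (norm x) - c)"
        using sS Sm by (intro set_integral_diff) (auto simp: set_integrable_def)
      have "\<bar>LINT x:?S|lborel. f (norm x) - c\<bar> \<le> (LINT x:?S|lborel. \<bar>f (norm x) - c\<bar>)"
        using set_integral_norm_bound[OF i] by simp
      also have "\<dots> \<le> (LINT x:?S|lborel. e)"
        using Sm that(4) by (intro set_integral_mono set_integrable_abs i) (auto simp: set_integrable_def)
      finally show ?thesis .
    qed
    also have "\<dots> = e * (pi * (q\<^sup>2 - p\<^sup>2))"
      using measure_shell[of p q] that assms Sm by (simp add: set_lebesgue_integral_def mult.commute)
    finally show ?thesis .
  qed
  have der: "(\<Phi> has_vector_derivative 2 * pi * (s * f s)) (at s within {a..L})" if s: "s \<in> {a..L}" for s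
    unfolding has_real_derivative_iff_has_vector_derivative[symmetric] has_field_derivative_iff
  proof (rule LIM_zero_cancel, rule tendstoI)
    fix e :: real assume "e > 0"
    \<comment> \<open>\<open>e'\<close> handles the oscillation of \<open>f\<close>, through
      \<open>u + s \<le> 2 * L\<close>; \<open>d'\<close> below handles the replacement of
      \<open>u + s\<close> by \<open>2 * s\<close>.\<close>
    define e' where "e' = e / (2 * (pi * (2 * L) + 1))"
    have L0: "L > 0" using assms by simp
    then have pos: "pi * (2 * L) + 1 > 0" by (simp add: add_pos_pos)
    then have e': "e' > 0" using \<open>e > 0\<close> by (simp add: e'_def)
    have e'2: "e' * (pi * (2 * L)) \<le> e / 2"
    proof -
      have "e' * (pi * (2 * L)) \<le> e' * (pi * (2 * L) + 1)" using e' by simp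
      also have "\<dots> = e / 2" using pos unfolding e'_def by (simp add: field_simps)
      finally show ?thesis .
    qed
    have "\<exists>d>0. \<forall>r\<in>{a..L}. dist r s < d \<longrightarrow> dist (f r) (f s) < e'"
      using cf s e' unfolding continuous_on_iff by blast
    then obtain d where d: "d > 0" "\<And>r. r \<in> {a..L} \<Longrightarrow> \<bar>r - s\<bar> < d \<Longrightarrow> \<bar>f r - f s\<bar> \<le> e'"
      by (force simp: dist_real_def)
    define d' where "d' = min d (e / (4 * (pi * (\<bar>f s\<bar> + 1))))"
    have d': "d' > 0" using d \<open>e > 0\<close> by (simp add: d'_def)
    show "\<forall>\<^sub>F u in at s within {a..L}. dist ((\<Phi> u - \<Phi> s) / (u - s) - 2 * pi * (s * f s)) 0 < e"
      unfolding eventually_at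
    proof (intro exI[of _ d'] conjI d' ballI impI)
      fix u assume u: "u \<in> {a..L}" "u \<noteq> s \<and> dist u s < d'"
      have b: "\<bar>\<Phi> u - \<Phi> s - f s * (pi * (u\<^sup>2 - s\<^sup>2))\<bar> \<le> e' * (pi * \<bar>u\<^sup>2 - s\<^sup>2\<bar>)"
      proof (cases "s \<le> u")
        case True
        then have "s\<^sup>2 \<le> u\<^sup>2" using s assms by (intro power_mono) auto
        then show ?thesis using key[of s u "f s" e'] True s u d(2) by (auto simp: dist_real_def d'_def)
      next
        case False
        then have "u\<^sup>2 \<le> s\<^sup>2" using u assms by (intro power_mono) auto
        moreover have "\<bar>\<Phi> s - \<Phi> u - f s * (pi * (s\<^sup>2 - u\<^sup>2))\<bar> \<le> e' * (pi * (s\<^sup>2 - u\<^sup>2))"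
          using False s u d(2) by (intro key) (auto simp: dist_real_def d'_def)
        moreover have "\<Phi> u - \<Phi> s - f s * (pi * (u\<^sup>2 - s\<^sup>2)) = - (\<Phi> s - \<Phi> u - f s * (pi * (s\<^sup>2 - u\<^sup>2)))"
          by (simp add: algebra_simps)
        ultimately show ?thesis by simp
      qed
      have us: "u - s \<noteq> 0" using u by auto
      have f1: "u\<^sup>2 - s\<^sup>2 = (u - s) * (u + s)" by (simp add: algebra_simps power2_eq_square)
      have "\<bar>(\<Phi> u - \<Phi> s) / (u - s) - f s * (pi * (u + s))\<bar> = \<bar>\<Phi> u - \<Phi> s - f s * (pi * (u\<^sup>2 - s\<^sup>2))\<bar> / \<bar>u - s\<bar>"
        using us unfolding f1 by (simp add: field_simps flip: abs_divide)
      also have "\<dots> \<le> e' * (pi * \<bar>u\<^sup>2 - s\<^sup>2\<bar>) / \<bar>u - s\<bar>" using b by (intro divide_right_mono) auto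
      also have "\<dots> = e' * (pi * (u + s))" using us u s assms unfolding f1 by (simp add: abs_mult)
      also have "\<dots> \<le> e' * (pi * (2 * L))" using u s e' by (intro mult_left_mono) auto
      finally have 1: "\<bar>(\<Phi> u - \<Phi> s) / (u - s) - f s * (pi * (u + s))\<bar> \<le> e / 2" using e'2 by linarith
      have "\<bar>f s * (pi * (u + s)) - 2 * pi * (s * f s)\<bar> = \<bar>f s\<bar> * pi * \<bar>u - s\<bar>"
      proof -
        have "f s * (pi * (u + s)) - 2 * pi * (s * f s) = f s * pi * (u - s)" by (simp add: algebra_simps)
        then show ?thesis by (simp add: abs_mult)
      qed
      also have "\<dots> \<le> ((\<bar>f s\<bar> + 1) * pi) * d'" using u by (intro mult_mono) (auto simp: dist_real_def)
      also have "\<dots> \<le> ((\<bar>f s\<bar> + 1) * pi) * (e / (4 * (pi * (\<bar>f s\<bar> + 1))))"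
        by (intro mult_left_mono) (auto simp: d'_def)
      also have "\<dots> = e / 4" by (simp add: field_simps add_nonneg_eq_0_iff)
      finally have "\<bar>f s * (pi * (u + s)) - 2 * pi * (s * f s)\<bar> \<le> e / 4" .
      then show "dist ((\<Phi> u - \<Phi> s) / (u - s) - 2 * pi * (s * f s)) 0 < e"
        using 1 \<open>e > 0\<close> unfolding dist_real_def by linarith
    qed
  qed
  have "((\<lambda>s. 2 * pi * (s * f s)) has_integral (\<Phi> L - \<Phi> a)) {a..L}"
    by (rule fundamental_theorem_of_calculus[OF assms(2) der])
  \<comment> \<open>Annuli are closed, so \<open>ann a a\<close> is a sphere and not empty; it is a
    null set.\<close>
  moreover have "\<Phi> a = 0"
  proof -
    have "ann a a \<subseteq> sphere 0 a" by (auto simp: ann_def)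
    moreover have "negligible (sphere (0::real^2) a)" by (rule negligible_sphere)
    ultimately have "negligible (ann a a)" by (rule negligible_subset[rotated])
    then have "ann a a \<in> null_sets lborel"
      using compact_ann[of a a] by (simp add: negligible_iff_null_sets null_sets_completion_iff borel_compact)
    then show ?thesis unfolding \<Phi>_def set_lebesgue_integral_def
      by (intro integral_eq_zero_AE AE_I') (auto simp: indicator_def)
  qed
  ultimately have "\<Phi> L = integral {a..L} (\<lambda>s. 2 * pi * (s * f s))"
    by (simp add: has_integral_iff)
  then show ?thesis by (simp add: \<Phi>_def)
qed

section \<open>Integration by parts\<close>

text \<open>The gradient cut off to \<open>K\<close> is continuous because it agrees with
  \<open>D\<close> on \<open>E\<close> and vanishes off \<open>K\<close>, and these two open sets
  cover the space. Values of \<open>D\<close> outside \<open>E\<close> are thereby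
  irrelevant.\<close>

lemma C1c_extend:
  fixes \<phi> :: "'a::euclidean_space \<Rightarrow> real"
  assumes E: "open E" and d: "\<And>x. x \<in> E \<Longrightarrow> (\<phi> has_derivative (\<lambda>h. D x \<bullet> h)) (at x)"
    and cD: "continuous_on E D" and K: "compact K" "K \<subseteq> E" "\<And>x. x \<notin> K \<Longrightarrow> \<phi> x = 0"
  shows "C1c E \<phi> (\<lambda>x. if x \<in> K then D x else 0)"
proof -
  let ?D = "\<lambda>x. if x \<in> K then D x else 0"
  have z: "D x = 0" if "x \<in> E" "x \<notin> K" for x
    by (rule gradient_zero_outside[OF d[OF that(1)] compact_imp_closed[OF K(1)]]) (use K(3) that in auto)
  have eq: "?D x = D x" if "x \<in> E" for x using z that by auto
  have c1: "continuous_on E ?D" using cD eq by (simp cong: continuous_on_cong)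
  have c2: "continuous_on (-K) ?D"
    by (rule continuous_on_eq[of _ "\<lambda>x. 0"]) auto
  have oK: "open (-K)" using K(1) compact_imp_closed by auto
  have "continuous_on (E \<union> -K) ?D" by (rule continuous_on_open_Un[OF E oK c1 c2])
  moreover have "E \<union> -K = UNIV" using K(2) by blast
  ultimately have c: "continuous_on UNIV ?D" by simp
  have "(\<phi> has_derivative (\<lambda>h. ?D x \<bullet> h)) (at x)" for x
  proof (cases "x \<in> E")
    case True
    then show ?thesis using d[OF True] eq[OF True] by simp
  next
    case False
    then have "x \<in> -K" using K(2) by blast
    have "(\<phi> has_derivative (\<lambda>h. 0)) (at x)"
      by (rule has_derivative_transform_within_open[OF has_derivative_const[of 0] oK \<open>x \<in> -K\<close>]) (use K(3) in auto)
    then show ?thesis using \<open>x \<in> -K\<close> by simp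
  qed
  then show ?thesis unfolding C1c_def using c K by blast
qed

lemma linear_inner_2:
  fixes l :: "real^2 \<Rightarrow> real"
  assumes "linear l"
  shows "l h = (\<chi> j. l (axis j 1)) \<bullet> h"
proof -
  have "h = h $ 1 *\<^sub>R axis 1 1 + h $ 2 *\<^sub>R axis 2 1"
    by (simp add: vec_eq_iff forall_2 axis_def)
  then have "l h = l (h $ 1 *\<^sub>R axis 1 1 + h $ 2 *\<^sub>R axis 2 1)" by simp
  also have "\<dots> = h $ 1 * l (axis 1 1) + h $ 2 * l (axis 2 1)"
    by (simp only: linear_add[OF assms] linear_cmul[OF assms] real_scaleR_def)
  finally show ?thesis by (simp add: inner_2 mult.commute)
qed

definition ext_plane :: "real \<Rightarrow> (real^2) set" where
  "ext_plane r0 = {x. norm x > r0}"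

lemma open_ext_plane: "open (ext_plane r0)"
  unfolding ext_plane_def by (intro open_Collect_less continuous_intros)

lemma ann_subset_ext: "r0 < a \<Longrightarrow> ann a L \<subseteq> ext_plane r0"
  by (auto simp: ann_def ext_plane_def)

text \<open>As \<open>r0 < a\<close>, the compact annulus lies inside the open exterior domain; each
  component of \<open>Y\<close> is a compactly supported C^1 function, and its partial derivatives
  integrate to 0.\<close>

lemma integral_divergence_eq_0:
  fixes Y :: "real^2 \<Rightarrow> real^2"
  assumes "r0 < a" and d: "\<And>x. x \<in> ext_plane r0 \<Longrightarrow> (Y has_derivative Y' x) (at x)"
    and c: "\<And>h. continuous_on (ext_plane r0) (\<lambda>x. Y' x h)"
    and z: "\<And>x. x \<notin> ann a L \<Longrightarrow> Y x = 0"
  shows "(LINT x:ann a L|lborel. Y' x (axis 1 1) $ 1 + Y' x (axis 2 1) $ 2) = 0"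
proof -
  let ?K = "ann a L"
  have comp: "(LINT x:?K|lborel. Y' x (axis i 1) $ i) = 0" for i
  proof -
    let ?D = "\<lambda>x. (\<chi> j. Y' x (axis j 1) $ i)"
    have d': "((\<lambda>x. Y x $ i) has_derivative (\<lambda>h. ?D x \<bullet> h)) (at x)" if "x \<in> ext_plane r0" for x
    proof -
      have l: "linear (\<lambda>h. Y' x h $ i)"
        using has_derivative_linear[OF d[OF that]] by (simp add: linear_iff)
      have "((\<lambda>x. Y x $ i) has_derivative (\<lambda>h. Y' x h $ i)) (at x)"
        by (rule bounded_linear.has_derivative[OF bounded_linear_vec_nth d[OF that]])
      moreover have "(\<lambda>h. Y' x h $ i) = (\<lambda>h. ?D x \<bullet> h)"
        by (rule ext) (rule linear_inner_2[OF l])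
      ultimately show ?thesis by simp
    qed
    have "continuous_on (ext_plane r0) ?D"
      unfolding continuous_on_vec_lambda by (intro continuous_on_vec_lambda continuous_intros c)
    from C1c_integral_derivative[OF C1c_extend[OF open_ext_plane d' this compact_ann ann_subset_ext[OF assms(1)]], of L "axis i 1"]
    have "(\<integral>x. (if x \<in> ?K then ?D x else 0) \<bullet> axis i 1 \<partial>lborel) = 0" using z by simp
    moreover have "(if x \<in> ?K then ?D x else 0) \<bullet> axis i 1 = indicator ?K x *\<^sub>R (Y' x (axis i 1) $ i)" for x
      by (simp add: inner_axis)
    ultimately show ?thesis by (simp add: set_lebesgue_integral_def)
  qed
  have i: "set_integrable lborel ?K (\<lambda>x. Y' x (axis i 1) $ i)" for i
    by (intro set_integrable_ann continuous_intros continuous_on_subset[OF c ann_subset_ext[OF assms(1)]])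
  show ?thesis using comp by (simp add: set_integral_add(2)[OF i i])
qed

section \<open>Circular means and the potential of a closed field\<close>

lemma integral_periodic_shift:
  fixes g :: "real \<Rightarrow> 'a::euclidean_space"
  assumes c: "continuous_on UNIV g" and p: "\<And>t. g (t + 2 * pi) = g t" and "s \<ge> 0"
  shows "integral {0..2*pi} (\<lambda>t. g (t + s)) = integral {0..2*pi} g"
proof -
  have i: "g integrable_on {a..b}" for a b
    by (intro integrable_continuous_interval continuous_on_subset[OF c]) simp
  have sh: "integral {a..b} (\<lambda>t. g (t + d)) = integral {a+d..b+d} g" for a b d
    using integral_shift[of a d b g] continuous_on_subset[OF c] by (simp add: o_def)
  have "integral {0..2*pi} (\<lambda>t. g (t + s)) = integral {s..2*pi+s} g" by (simp add: sh)
  moreover have "integral {0..s} g + integral {s..2*pi+s} g = integral {0..2*pi+s} g"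
    by (rule Henstock_Kurzweil_Integration.integral_combine) (use assms i in auto)
  moreover have "integral {0..2*pi} g + integral {2*pi..2*pi+s} g = integral {0..2*pi+s} g"
    by (rule Henstock_Kurzweil_Integration.integral_combine) (use assms i in auto)
  moreover have "integral {2*pi..2*pi+s} g = integral {0..s} g"
    using sh[of 0 s "2*pi"] p by (simp add: add.commute)
  ultimately show ?thesis by (metis add.commute add_left_cancel)
qed

text \<open>By periodicity the angular integral does not see the starting point on the circle, so it
  is a function of the radius alone.\<close>

lemma circle_integral_rot:
  fixes F :: "real^2 \<Rightarrow> 'a::euclidean_space"
  assumes c: "continuous_on (sphere 0 (norm x)) F"
  shows "integral {0..2*pi} (\<lambda>t. F (rot t x)) = integral {0..2*pi} (\<lambda>t. F (rot t (circ (norm x))))"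
proof -
  obtain s where s: "s \<ge> 0" "x = rot s (circ (norm x))" by (rule rot_to_circ)
  define g where "g t = F (rot t (circ (norm x)))" for t
  have "continuous_on UNIV g"
    unfolding g_def by (intro continuous_on_compose2[OF c] continuous_intros) (auto simp: norm_circ)
  moreover have "g (t + 2 * pi) = g t" for t
    by (simp add: g_def rot_def)
  ultimately have "integral {0..2*pi} (\<lambda>t. g (t + s)) = integral {0..2*pi} g"
    using integral_periodic_shift s(1) by blast
  moreover have "g (t + s) = F (rot t x)" for t
    using s(2) by (metis g_def rot_rot)
  ultimately show ?thesis by (simp add: g_def[abs_def])
qed

lemma ext_planeD: "x \<in> ext_plane r0 \<Longrightarrow> r0 < norm x"
  by (simp add: ext_plane_def)

lemma rot_in_ext [simp]: "rot t x \<in> ext_plane r0 \<longleftrightarrow> x \<in> ext_plane r0"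
  by (simp add: ext_plane_def)

text \<open>Convolution with \<open>w\<close> along circles centred at 0. There is no factor
  \<open>1 / (2 * pi)\<close>; the weight carries the normalisation.\<close>

definition angular_mean :: "(real \<Rightarrow> real) \<Rightarrow> (real^2 \<Rightarrow> 'a::euclidean_space) \<Rightarrow> real^2 \<Rightarrow> 'a" where
  "angular_mean w F x = integral {0..2*pi} (\<lambda>t. w t *\<^sub>R F (rot t x))"

lemma continuous_on_angular_mean:
  fixes F :: "real^2 \<Rightarrow> 'a::euclidean_space"
  assumes "continuous_on {0..2*pi} w" "continuous_on (ext_plane r0) F"
  shows "continuous_on (ext_plane r0) (angular_mean w F)"
proof -
  have "continuous_on (ext_plane r0 \<times> cbox 0 (2*pi)) (\<lambda>(x, t). w t *\<^sub>R F (rot t x))"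
    unfolding split_beta
    by (intro continuous_intros continuous_on_compose2[OF assms(1)] continuous_on_compose2[OF assms(2)]) auto
  from integral_continuous_on_param[OF this] show ?thesis
    by (simp add: angular_mean_def[abs_def] cbox_interval)
qed

text \<open>Rotations are orthogonal: the gradient found at \<open>rot t x\<close> is carried back
  to \<open>x\<close> by the adjoint \<open>rot (- t)\<close>.\<close>

lemma has_derivative_angular_mean:
  fixes F :: "real^2 \<Rightarrow> real"
  assumes w: "continuous_on {0..2*pi} w"
    and d: "\<And>x. x \<in> ext_plane r0 \<Longrightarrow> (F has_derivative (\<lambda>h. D x \<bullet> h)) (at x)"
    and cD: "continuous_on (ext_plane r0) D" and x: "x \<in> ext_plane r0"
  shows "(angular_mean w F has_derivative
    (\<lambda>h. integral {0..2*pi} (\<lambda>t. w t *\<^sub>R rot (- t) (D (rot t x))) \<bullet> h)) (at x)"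
proof -
  obtain e where e: "e > 0" "ball x e \<subseteq> ext_plane r0"
    using open_ext_plane x by (meson open_contains_ball)
  have cF: "continuous_on (ext_plane r0) F"
    using d by (auto intro!: continuous_at_imp_continuous_on dest: has_derivative_continuous)
  define G where "G x t = w t *\<^sub>R rot (- t) (D (rot t x))" for x t
  define fx where "fx x t = blinfun_inner_right (G x t)" for x t
  have cG: "continuous_on (ball x e \<times> cbox 0 (2*pi)) (\<lambda>(x, t). G x t)"
    unfolding split_beta G_def
    by (intro continuous_intros continuous_on_compose2[OF w] continuous_on_compose2[OF cD]) (use e in auto)
  have "((\<lambda>x. integral (cbox 0 (2*pi)) (\<lambda>t. w t * F (rot t x))) has_derivative
      blinfun_apply (integral (cbox 0 (2*pi)) (fx x))) (at x within ball x e)"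
  proof (rule leibniz_rule)
    fix y t assume y: "y \<in> ball x e" and t: "t \<in> cbox 0 (2 * pi)"
    have "((\<lambda>y. w t * F (rot t y)) has_derivative (\<lambda>h. w t * (D (rot t y) \<bullet> rot t h))) (at y within ball x e)"
      by (intro has_derivative_mult_right has_derivative_compose[OF has_derivative_rot] d) (use y e in auto)
    moreover have "rot (- t) z \<bullet> h = z \<bullet> rot t h" for z h
      using inner_rot_rot[of t "rot (- t) z" h] by (simp add: rot_rot)
    then have "blinfun_apply (fx y t) = (\<lambda>h. w t * (D (rot t y) \<bullet> rot t h))"
      by (auto simp: fx_def G_def)
    ultimately show "((\<lambda>y. w t * F (rot t y)) has_derivative blinfun_apply (fx y t)) (at y within ball x e)"
      by simp
  next
    fix y assume y: "y \<in> ball x e"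
    show "(\<lambda>t. w t * F (rot t y)) integrable_on cbox 0 (2 * pi)"
      by (intro integrable_continuous continuous_intros continuous_on_compose2[OF w] continuous_on_compose2[OF cF])
        (use y e in auto)
  next
    show "continuous_on (ball x e \<times> cbox 0 (2 * pi)) (\<lambda>(x, t). fx x t)"
      using cG unfolding fx_def split_beta
      by (intro bounded_linear.continuous_on[OF bounded_linear_blinfun_inner_right])
  qed (use e in auto)
  moreover have "blinfun_apply (integral (cbox 0 (2*pi)) (fx x)) = (\<lambda>h. integral {0..2*pi} (G x) \<bullet> h)"
  proof
    fix h
    have cx: "continuous_on (cbox 0 (2*pi)) (G x)"
    proof -
      have "continuous_on (cbox 0 (2*pi)) (\<lambda>t. (x, t))" by (intro continuous_intros)
      moreover have "(\<lambda>t. (x, t)) ` cbox 0 (2*pi) \<subseteq> ball x e \<times> cbox 0 (2*pi)" using e(1) by auto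
      ultimately show ?thesis using continuous_on_compose2[OF cG] by fastforce
    qed
    have i: "fx x integrable_on cbox 0 (2*pi)"
      unfolding fx_def
      by (intro integrable_continuous bounded_linear.continuous_on[OF bounded_linear_blinfun_inner_right] cx)
    have "blinfun_apply (integral (cbox 0 (2*pi)) (fx x)) h = integral (cbox 0 (2*pi)) (\<lambda>t. blinfun_apply (fx x t) h)"
      using integral_linear[OF i, of "\<lambda>f. blinfun_apply f h"] by (simp add: o_def blinfun.bounded_linear_left)
    also have "\<dots> = integral (cbox 0 (2*pi)) (G x) \<bullet> h"
      using integral_linear[OF integrable_continuous[OF cx] bounded_linear_inner_left[of h]] by (simp add: o_def fx_def)
    finally show "blinfun_apply (integral (cbox 0 (2*pi)) (fx x)) h = integral {0..2*pi} (G x) \<bullet> h"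
      by (simp add: cbox_interval)
  qed
  ultimately show ?thesis
    using at_within_open[of x "ball x e"] e(1)
    by (simp add: G_def[abs_def] angular_mean_def[abs_def] cbox_interval)
qed

lemma rot_curve_has_vector_derivative:
  fixes F :: "real^2 \<Rightarrow> real"
  assumes "(F has_derivative (\<lambda>h. D (rot t x) \<bullet> h)) (at (rot t x))"
  shows "((\<lambda>t. F (rot t x)) has_vector_derivative D (rot t x) \<bullet> perp (rot t x)) (at t within S)"
proof -
  have "((\<lambda>t. rot t x) has_derivative (\<lambda>h. h *\<^sub>R perp (rot t x))) (at t within S)"
    using rot_has_vector_derivative by (simp add: has_vector_derivative_def)
  from has_derivative_compose[OF this assms] show ?thesis
    by (simp add: has_vector_derivative_def)
qed

text \<open>The periodic primitive on the circle is convolution with the sawtooth.\<close>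

definition saw :: "real \<Rightarrow> real" where "saw t = (t - pi) / (2 * pi)"

lemma continuous_on_saw [continuous_intros]: "continuous_on S saw"
  unfolding saw_def by (intro continuous_intros) auto

text \<open>The distributional condition on the curl enters as pointwise symmetry of
  \<open>k'\<close>. It is obtained from \<open>weak_divergence_free_imp_zero\<close> applied to
  \<open>perp (k x)\<close>.\<close>

locale closed_field =
  fixes r0 :: real and k :: "real^2 \<Rightarrow> real^2" and k' :: "real^2 \<Rightarrow> real^2 \<Rightarrow> real^2"
  assumes r0: "r0 > 0"
    and k': "\<And>x. x \<in> ext_plane r0 \<Longrightarrow> (k has_derivative k' x) (at x)"
    and ck': "\<And>h. continuous_on (ext_plane r0) (\<lambda>x. k' x h)"
    and curl: "\<And>x. x \<in> ext_plane r0 \<Longrightarrow> k' x (axis 1 1) $ 2 = k' x (axis 2 1) $ 1"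
begin

abbreviation "E \<equiv> ext_plane r0"

lemma E_nonzero: "x \<in> E \<Longrightarrow> x \<noteq> 0" "x \<in> E \<Longrightarrow> norm x > 0" "x \<in> E \<Longrightarrow> x \<bullet> x > 0"
  using r0 by (auto simp: ext_plane_def)

lemma ck: "continuous_on E k"
  using k' by (auto intro!: continuous_at_imp_continuous_on dest: has_derivative_continuous)

lemma k'_expand: "x \<in> E \<Longrightarrow> k' x h = h $ 1 *\<^sub>R k' x (axis 1 1) + h $ 2 *\<^sub>R k' x (axis 2 1)"
proof -
  assume "x \<in> E"
  have l: "linear (k' x)" using has_derivative_linear[OF k'[OF \<open>x \<in> E\<close>]] .
  have "h = h $ 1 *\<^sub>R axis 1 1 + h $ 2 *\<^sub>R axis 2 1"
    by (simp add: vec_eq_iff forall_2 axis_def)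
  then have "k' x h = k' x (h $ 1 *\<^sub>R axis 1 1 + h $ 2 *\<^sub>R axis 2 1)" by simp
  then show ?thesis by (simp only: linear_add[OF l] linear_cmul[OF l])
qed

lemma k'_sym:
  assumes "x \<in> E"
  shows "k' x h \<bullet> w = k' x w \<bullet> h"
  using curl[OF assms] by (subst (1 2) k'_expand[OF assms]) (simp add: inner_2 algebra_simps)

lemma continuous_k'_comp: "continuous_on E g \<Longrightarrow> continuous_on E (\<lambda>x. k' x (g x))"
proof -
  assume g: "continuous_on E g"
  have "continuous_on E (\<lambda>x. g x $ 1 *\<^sub>R k' x (axis 1 1) + g x $ 2 *\<^sub>R k' x (axis 2 1))"
    by (intro continuous_intros g ck')
  moreover have "k' x (g x) = g x $ 1 *\<^sub>R k' x (axis 1 1) + g x $ 2 *\<^sub>R k' x (axis 2 1)" if "x \<in> E" for x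
    by (rule k'_expand[OF that])
  ultimately show ?thesis using continuous_on_cong by force
qed

text \<open>Not divided by the radius: on a circle of radius \<open>r\<close> these are
  \<open>r\<close> times the unit components, so the angular means of \<open>tang\<close> and
  \<open>rad\<close> are circulation and flux over \<open>2 * pi\<close>.\<close>

definition "tang x = k x \<bullet> perp x"
definition "rad x = k x \<bullet> x"
definition "Dtang x = k' x (perp x) - perp (k x)"
definition "Drad x = k' x x + k x"

lemma tang_deriv: "x \<in> E \<Longrightarrow> (tang has_derivative (\<lambda>h. Dtang x \<bullet> h)) (at x)"
proof -
  assume x: "x \<in> E"
  have "k x \<bullet> perp h + k' x h \<bullet> perp x = Dtang x \<bullet> h" for h
    unfolding Dtang_def inner_diff_left inner_perp_left by (simp add: k'_sym[OF x, of h])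
  then show ?thesis
    using has_derivative_inner[OF k'[OF x] perp_has_derivative[OF has_derivative_ident]]
    by (simp add: tang_def[abs_def])
qed

lemma rad_deriv: "x \<in> E \<Longrightarrow> (rad has_derivative (\<lambda>h. Drad x \<bullet> h)) (at x)"
proof -
  assume x: "x \<in> E"
  have "k x \<bullet> h + k' x h \<bullet> x = Drad x \<bullet> h" for h
    by (simp add: Drad_def inner_add_left k'_sym[OF x, of h])
  then show ?thesis
    using has_derivative_inner[OF k'[OF x] has_derivative_ident]
    by (simp add: rad_def[abs_def])
qed

lemma continuous_Dtang: "continuous_on E Dtang" and continuous_Drad: "continuous_on E Drad"
  unfolding Dtang_def[abs_def] Drad_def[abs_def] by (intro continuous_intros continuous_k'_comp ck)+

lemma continuous_tang: "continuous_on E tang" and continuous_rad: "continuous_on E rad"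
  unfolding tang_def[abs_def] rad_def[abs_def] by (intro continuous_intros ck)+

text \<open>The curl equation in polar form: \<open>r\<close> times the radial derivative of
  \<open>tang\<close> is the angular derivative of \<open>rad\<close>. It makes a function built
  from \<open>tang\<close> alone know about \<open>rad\<close>.\<close>

lemma Dtang_radial: "x \<in> E \<Longrightarrow> Dtang x \<bullet> x = Drad x \<bullet> perp x"
  by (simp add: Dtang_def Drad_def inner_diff_left inner_add_left inner_perp_left k'_sym[of x x])

text \<open>On each circle, the primitive of mean 0 of \<open>tang\<close> minus its mean. It is
  single-valued by construction, whereas a line integral of \<open>k\<close> around the hole would
  not be when the circulation is nonzero.\<close>

definition "v = angular_mean saw tang"
definition "Dv x = integral {0..2*pi} (\<lambda>t. saw t *\<^sub>R rot (- t) (Dtang (rot t x)))"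

lemma v_deriv: "x \<in> E \<Longrightarrow> (v has_derivative (\<lambda>h. Dv x \<bullet> h)) (at x)"
  unfolding v_def Dv_def
  by (intro has_derivative_angular_mean[OF _ tang_deriv continuous_Dtang] continuous_intros)

lemma continuous_v: "continuous_on E v"
  unfolding v_def by (intro continuous_on_angular_mean continuous_tang continuous_intros)

lemma continuous_Dv: "continuous_on E Dv"
proof -
  have "continuous_on (E \<times> cbox 0 (2*pi)) (\<lambda>(x, t). saw t *\<^sub>R rot (- t) (Dtang (rot t x)))"
    unfolding split_beta
    by (intro continuous_intros continuous_on_compose2[OF continuous_on_saw[of UNIV]] continuous_on_compose2[OF continuous_Dtang]) auto
  from integral_continuous_on_param[OF this] show ?thesis
    by (simp add: Dv_def[abs_def] cbox_interval)
qed

lemma integral_rot_inner: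
  assumes "x \<in> E" "continuous_on E D" "continuous_on {0..2*pi} w"
  shows "integral {0..2*pi} (\<lambda>t. w t *\<^sub>R rot (- t) (D (rot t x))) \<bullet> h = integral {0..2*pi} (\<lambda>t. w t * (D (rot t x) \<bullet> rot t h))"
proof -
  have "(\<lambda>t. w t *\<^sub>R rot (- t) (D (rot t x))) integrable_on {0..2*pi}"
    by (intro integrable_continuous_interval continuous_intros continuous_on_compose2[OF assms(2)] assms(3)) (use assms in auto)
  from integral_linear[OF this bounded_linear_inner_left[of h]]
  have "integral {0..2*pi} (\<lambda>t. w t *\<^sub>R rot (- t) (D (rot t x))) \<bullet> h = integral {0..2*pi} (\<lambda>t. w t * (rot (- t) (D (rot t x)) \<bullet> h))"
    by (simp add: o_def)
  moreover have "rot (- t) z \<bullet> h = z \<bullet> rot t h" for z t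
    using inner_rot_rot[of t "rot (- t) z" h] by (simp add: rot_rot)
  ultimately show ?thesis by simp
qed

text \<open>\<open>saw\<close> has slope \<open>1 / (2 * pi)\<close> and runs from -1/2 to 1/2; the
  two boundary terms, both at the point \<open>x\<close>, add up to one full value of
  \<open>F\<close>.\<close>

lemma saw_by_parts:
  assumes "\<And>x. x \<in> E \<Longrightarrow> (F has_derivative (\<lambda>h. D x \<bullet> h)) (at x)" "continuous_on E D" "x \<in> E"
  shows "integral {0..2*pi} (\<lambda>t. saw t * (D (rot t x) \<bullet> perp (rot t x))) = F x - integral {0..2*pi} (\<lambda>t. F (rot t x)) / (2 * pi)"
proof -
  have cF: "continuous_on E F"
    using assms(1) by (auto intro!: continuous_at_imp_continuous_on dest: has_derivative_continuous)
  have "((\<lambda>t. saw t * (D (rot t x) \<bullet> perp (rot t x)) + F (rot t x) / (2 * pi)) has_integral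
      saw (2*pi) * F (rot (2*pi) x) - saw 0 * F (rot 0 x)) {0..2*pi}"
  proof (rule fundamental_theorem_of_calculus)
    fix t assume "t \<in> {0..2*pi}"
    have 1: "((\<lambda>t. F (rot t x)) has_vector_derivative D (rot t x) \<bullet> perp (rot t x)) (at t within {0..2*pi})"
      by (rule rot_curve_has_vector_derivative) (use assms in auto)
    have 2: "(saw has_vector_derivative 1 / (2*pi)) (at t within {0..2*pi})"
      unfolding saw_def[abs_def] has_real_derivative_iff_has_vector_derivative[symmetric]
      by (auto intro!: derivative_eq_intros)
    from has_vector_derivative_mult[OF 2 1]
    show "((\<lambda>t. saw t * F (rot t x)) has_vector_derivative
      saw t * (D (rot t x) \<bullet> perp (rot t x)) + F (rot t x) / (2 * pi)) (at t within {0..2*pi})"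
      by simp
  qed simp
  moreover have "saw (2*pi) = 1/2" "saw 0 = -1/2" by (simp_all add: saw_def field_simps)
  ultimately have "integral {0..2*pi} (\<lambda>t. saw t * (D (rot t x) \<bullet> perp (rot t x)) + F (rot t x) / (2 * pi)) = F x"
    by (simp add: integral_unique)
  moreover have "integral {0..2*pi} (\<lambda>t. saw t * (D (rot t x) \<bullet> perp (rot t x)) + F (rot t x) / (2 * pi))
    = integral {0..2*pi} (\<lambda>t. saw t * (D (rot t x) \<bullet> perp (rot t x))) + integral {0..2*pi} (\<lambda>t. F (rot t x) / (2 * pi))"
    by (intro Henstock_Kurzweil_Integration.integral_add integrable_continuous_interval continuous_intros
       continuous_on_compose2[OF cF] continuous_on_compose2[OF assms(2)]) (use assms(3) in auto)
  ultimately show ?thesis by simp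
qed

text \<open>Sampled at the radius \<open>r0 + 1\<close>; by \<open>tang_mean\<close> every other
  radius gives the same value. In contrast \<open>rbar\<close> depends on the radius, since
  \<open>k\<close> need not be free of divergence.\<close>

definition "tbar = integral {0..2*pi} (\<lambda>t. tang (rot t (circ (r0 + 1)))) / (2 * pi)"
definition "rbar r = integral {0..2*pi} (\<lambda>t. rad (rot t (circ r))) / (2 * pi)"

text \<open>The angular mean of \<open>tang\<close> has gradient 0: the angular part is the integral
  of a derivative over a closed loop, and by \<open>Dtang_radial\<close> so is the radial part. The
  exterior domain is connected.\<close>

lemma tang_mean: "x \<in> E \<Longrightarrow> integral {0..2*pi} (\<lambda>t. tang (rot t x)) / (2 * pi) = tbar"
proof -
  assume x: "x \<in> E"
  let ?m = "angular_mean (\<lambda>t. 1) tang"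
  let ?D = "\<lambda>x. integral {0..2*pi} (\<lambda>t. 1 *\<^sub>R rot (- t) (Dtang (rot t x)))"
  have closed_loop: "integral {0..2*pi} (\<lambda>t. D (rot t y) \<bullet> perp (rot t y)) = 0"
    if "\<And>x. x \<in> E \<Longrightarrow> (F has_derivative (\<lambda>h. D x \<bullet> h)) (at x)" "y \<in> E" for F D y
  proof -
    have "((\<lambda>t. D (rot t y) \<bullet> perp (rot t y)) has_integral F (rot (2*pi) y) - F (rot 0 y)) {0..2*pi}"
      by (rule fundamental_theorem_of_calculus) (use that in \<open>auto intro!: rot_curve_has_vector_derivative\<close>)
    then show ?thesis by (simp add: integral_unique)
  qed
  have zero: "?D y = 0" if y: "y \<in> E" for y
  proof -
    have "?D y \<bullet> h = integral {0..2*pi} (\<lambda>t. 1 * (Dtang (rot t y) \<bullet> rot t h))" for h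
      by (rule integral_rot_inner) (use y continuous_Dtang in auto)
    note eq = this[unfolded mult_1]
    have "?D y \<bullet> perp y = 0" unfolding eq rot_perp using tang_deriv y by (rule closed_loop)
    moreover have "?D y \<bullet> y = integral {0..2*pi} (\<lambda>t. Drad (rot t y) \<bullet> perp (rot t y))"
      unfolding eq using y by (simp add: Dtang_radial)
    then have "?D y \<bullet> y = 0" using closed_loop[OF rad_deriv y] by simp
    ultimately have "(y \<bullet> y) *\<^sub>R ?D y = 0" using perp_decomp[of y "?D y"] by simp
    then show ?thesis using E_nonzero[OF y] by simp
  qed
  have "connected E"
  proof -
    have "E = - cball 0 r0" by (auto simp: ext_plane_def)
    then show ?thesis by (simp add: connected_complement_bounded_convex)
  qed
  have "(?m has_derivative (\<lambda>h. 0)) (at y)" if "y \<in> E" for y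
    using has_derivative_angular_mean[OF continuous_on_const tang_deriv continuous_Dtang that, of 1]
    unfolding zero[OF that] inner_zero_left .
  moreover have "circ (r0 + 1) \<in> E" using r0 by (simp add: ext_plane_def norm_circ)
  ultimately have "?m x = ?m (circ (r0 + 1))"
    using has_derivative_zero_unique_connected[OF open_ext_plane \<open>connected E\<close>] x by blast
  then show ?thesis by (simp add: angular_mean_def tbar_def)
qed

lemma rad_mean: "x \<in> E \<Longrightarrow> integral {0..2*pi} (\<lambda>t. rad (rot t x)) / (2 * pi) = rbar (norm x)"
  unfolding rbar_def
  by (subst circle_integral_rot) (auto intro!: continuous_on_subset[OF continuous_rad] simp: ext_plane_def)

lemma Dv_tangential: "x \<in> E \<Longrightarrow> Dv x \<bullet> perp x = tang x - tbar"
  unfolding Dv_def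
  by (subst integral_rot_inner) (auto simp: continuous_Dtang rot_perp saw_by_parts[OF tang_deriv continuous_Dtang] tang_mean intro: continuous_intros)

lemma Dv_radial: "x \<in> E \<Longrightarrow> Dv x \<bullet> x = rad x - rbar (norm x)"
  unfolding Dv_def
  by (subst integral_rot_inner) (auto simp: continuous_Dtang Dtang_radial saw_by_parts[OF rad_deriv continuous_Drad] rad_mean intro: continuous_intros)

lemma k_decomp:
  assumes "x \<in> E"
  shows "k x = Dv x + (rbar (norm x) / (norm x)\<^sup>2) *\<^sub>R x + (tbar / (norm x)\<^sup>2) *\<^sub>R perp x"
proof -
  have n: "x \<bullet> x = (norm x)\<^sup>2" "(norm x)\<^sup>2 \<noteq> 0" using E_nonzero[OF assms] by (simp_all add: dot_square_norm)
  have "(x \<bullet> x) *\<^sub>R k x = (rad x) *\<^sub>R x + (tang x) *\<^sub>R perp x"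
    using perp_decomp[of x "k x"] by (simp add: rad_def tang_def)
  also have "\<dots> = (x \<bullet> x) *\<^sub>R Dv x + rbar (norm x) *\<^sub>R x + tbar *\<^sub>R perp x"
    using perp_decomp[of x "Dv x"] by (simp add: Dv_tangential[OF assms] Dv_radial[OF assms] algebra_simps)
  finally have e: "(norm x)\<^sup>2 *\<^sub>R k x = (norm x)\<^sup>2 *\<^sub>R Dv x + rbar (norm x) *\<^sub>R x + tbar *\<^sub>R perp x" by (simp only: n(1))
  have "k x = (1 / (norm x)\<^sup>2) *\<^sub>R ((norm x)\<^sup>2 *\<^sub>R k x)" using n(2) by simp
  also have "\<dots> = Dv x + (rbar (norm x) / (norm x)\<^sup>2) *\<^sub>R x + (tbar / (norm x)\<^sup>2) *\<^sub>R perp x"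
    unfolding e using n(2) by (simp add: scaleR_add_right)
  finally show ?thesis .
qed

lemma continuous_rbar: "continuous_on {r0<..} rbar"
proof -
  have "continuous_on ({r0<..} \<times> cbox 0 (2*pi)) (\<lambda>(r, t). rad (rot t (circ r)))"
    unfolding split_beta circ_def
    by (intro continuous_on_compose2[OF continuous_rad] continuous_intros)
      (use r0 in \<open>auto simp: ext_plane_def norm_circ[unfolded circ_def]\<close>)
  from integral_continuous_on_param[OF this] have "continuous_on {r0<..} (\<lambda>r. integral {0..2*pi} (\<lambda>t. rad (rot t (circ r))))"
    by (simp add: cbox_interval)
  then show ?thesis unfolding rbar_def[abs_def] by (intro continuous_intros) auto
qed

end

section \<open>Wirtinger's inequality for the modes above the first\<close>

lemma integral_FTC:
  fixes P p :: "real \<Rightarrow> real"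
  assumes "a \<le> b" "\<And>t. a \<le> t \<Longrightarrow> t \<le> b \<Longrightarrow> (P has_real_derivative p t) (at t)"
  shows "integral {a..b} p = P b - P a"
  using assms by (intro integral_unique fundamental_theorem_of_calculus)
    (auto simp: has_real_derivative_iff_has_vector_derivative[symmetric] intro: has_field_derivative_at_within)

lemma trig_integrals:
  "integral {0..2*pi} (\<lambda>t. cos t * cos t) = pi"
  "integral {0..2*pi} (\<lambda>t. sin t * sin t) = pi"
  "integral {0..2*pi} (\<lambda>t. sin t * cos t) = 0"
  "integral {0..2*pi} cos = 0"
  "integral {0..2*pi} sin = 0"
  "integral {0..2*pi} saw = 0"
  "integral {0..2*pi} (\<lambda>t. saw t * cos t) = 0"
  "integral {0..2*pi} (\<lambda>t. saw t * sin t) = - 1"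
proof -
  have sc: "cos t * cos t = 1 - sin t * sin t" for t :: real
    using sin_cos_squared_add[of t] by (simp add: power2_eq_square)
  show "integral {0..2*pi} (\<lambda>t. cos t * cos t) = pi"
    by (subst integral_FTC[where P="\<lambda>t. t / 2 + sin t * cos t / 2"]) (auto intro!: derivative_eq_intros simp: sc field_simps)
  show "integral {0..2*pi} (\<lambda>t. sin t * sin t) = pi"
    by (subst integral_FTC[where P="\<lambda>t. t / 2 - sin t * cos t / 2"]) (auto intro!: derivative_eq_intros simp: sc field_simps)
  show "integral {0..2*pi} (\<lambda>t. sin t * cos t) = 0"
    by (subst integral_FTC[where P="\<lambda>t. sin t * sin t / 2"]) (auto intro!: derivative_eq_intros)
  show "integral {0..2*pi} cos = 0"
    by (subst integral_FTC[where P="sin"]) (auto intro!: derivative_eq_intros)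
  show "integral {0..2*pi} sin = 0"
    by (subst integral_FTC[where P="\<lambda>t. - cos t"]) (auto intro!: derivative_eq_intros)
  show "integral {0..2*pi} saw = 0"
    by (subst integral_FTC[where P="\<lambda>t. (t - pi)^2 / (4 * pi)"]) (auto intro!: derivative_eq_intros simp: saw_def power2_eq_square field_simps)
  show "integral {0..2*pi} (\<lambda>t. saw t * cos t) = 0"
    by (subst integral_FTC[where P="\<lambda>t. (t - pi) / (2 * pi) * sin t + cos t / (2 * pi)"]) (auto intro!: derivative_eq_intros simp: saw_def field_simps)
  show "integral {0..2*pi} (\<lambda>t. saw t * sin t) = - 1"
    by (subst integral_FTC[where P="\<lambda>t. - ((t - pi) / (2 * pi) * cos t) + sin t / (2 * pi)"]) (auto intro!: derivative_eq_intros simp: saw_def field_simps)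
qed

text \<open>Jordan's inequality, from concavity of the sine on a quarter period.\<close>

lemma sin_ge_linear:
  fixes s :: real
  assumes "0 \<le> s" "s \<le> pi / 2"
  shows "2 * s / pi \<le> sin s"
proof -
  have "convex_on {0..pi/2} (\<lambda>x::real. - sin x)"
  proof (rule f''_ge0_imp_convex)
    show "((\<lambda>x. - sin x) has_real_derivative - cos x) (at x)" for x :: real by (auto intro!: derivative_eq_intros)
    show "((\<lambda>x. - cos x) has_real_derivative sin x) (at x)" for x :: real by (auto intro!: derivative_eq_intros)
    show "0 \<le> sin x" if "x \<in> {0..pi/2}" for x :: real using that by (intro sin_ge_zero) auto
  qed auto
  from convex_onD[OF this, of "2 * s / pi" 0 "pi/2"] assms
  have "- sin ((1 - 2 * s / pi) * 0 + (2 * s / pi) * (pi / 2)) \<le> (1 - 2 * s / pi) * (- sin 0) + (2 * s / pi) * (- sin (pi/2))"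
    by (simp add: field_simps)
  then show ?thesis by simp
qed

text \<open>
  Adding a multiple of \<open>sin\<close> to the sawtooth does not change the convolution with functions
  orthogonal to the first modes; the factor \<open>1/4\<close> minimises the \<open>L\<^sup>1\<close> norm.
\<close>

definition saw2 :: "real \<Rightarrow> real" where "saw2 t = saw t + sin t / 4"

lemma continuous_on_saw2 [continuous_intros]: "continuous_on S saw2"
  unfolding saw2_def by (intro continuous_intros) auto

text \<open>The added sine moves a zero to \<open>pi/2\<close>. Together with the zero at
  \<open>pi\<close> and the odd symmetry \<open>flip\<close> about \<open>pi\<close>, the sign
  changes lie at the multiples of \<open>pi/2\<close>, where the primitive \<open>P\<close> is
  evaluated.\<close>

lemma integral_abs_saw2: "integral {0..2*pi} (\<lambda>t. \<bar>saw2 t\<bar>) = pi / 4"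
proof -
  define P where "P t = (t - pi)\<^sup>2 / (4 * pi) - cos t / 4" for t :: real
  have dP: "(P has_real_derivative saw2 t) (at t)" for t
    unfolding P_def saw2_def saw_def by (auto intro!: derivative_eq_intros simp: power2_eq_square field_simps)
  have s0: "saw2 t = - ((pi - t) / (2 * pi)) + sin (pi - t) / 4" for t
    by (simp add: saw2_def saw_def divide_simps) 
  have flip: "saw2 t = - saw2 (2 * pi - t)" for t
    by (simp add: saw2_def saw_def field_simps sin_diff)
  have neg: "saw2 t \<le> 0" if "0 \<le> t" "t \<le> pi/2" for t
  proof -
    have "1/4 \<le> (pi - t) / (2 * pi)" using that by (simp add: field_simps)
    moreover have "sin (pi - t) / 4 \<le> 1/4" using sin_le_one[of "pi - t"] by linarith
    ultimately show ?thesis unfolding s0 by linarith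
  qed
  have pos: "saw2 t \<ge> 0" if "pi/2 \<le> t" "t \<le> pi" for t
  proof -
    have "2 * (pi - t) / pi \<le> sin (pi - t)" by (rule sin_ge_linear) (use that in auto)
    moreover have "2 * (pi - t) / pi = 4 * ((pi - t) / (2 * pi))" by (simp add: field_simps)
    ultimately show ?thesis unfolding s0 by linarith
  qed
  have i: "(\<lambda>t. \<bar>saw2 t\<bar>) integrable_on {a..b}" for a b
    by (intro integrable_continuous_interval continuous_intros)
  have 1: "integral {0..pi/2} (\<lambda>t. \<bar>saw2 t\<bar>) = P 0 - P (pi/2)"
  proof -
    have "integral {0..pi/2} (\<lambda>t. \<bar>saw2 t\<bar>) = integral {0..pi/2} (\<lambda>t. - saw2 t)"
      by (intro Henstock_Kurzweil_Integration.integral_cong) (use neg in auto)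
    also have "\<dots> = - P (pi/2) - (- P 0)" by (rule integral_FTC) (auto intro!: derivative_eq_intros dP)
    finally show ?thesis by simp
  qed
  have 2: "integral {pi/2..pi} (\<lambda>t. \<bar>saw2 t\<bar>) = P pi - P (pi/2)"
  proof -
    have "integral {pi/2..pi} (\<lambda>t. \<bar>saw2 t\<bar>) = integral {pi/2..pi} saw2"
      by (intro Henstock_Kurzweil_Integration.integral_cong) (use pos in auto)
    also have "\<dots> = P pi - P (pi/2)" by (rule integral_FTC) (auto intro!: derivative_eq_intros dP)
    finally show ?thesis by simp
  qed
  have 3: "integral {pi..3*pi/2} (\<lambda>t. \<bar>saw2 t\<bar>) = P pi - P (3*pi/2)"
  proof -
    have "integral {pi..3*pi/2} (\<lambda>t. \<bar>saw2 t\<bar>) = integral {pi..3*pi/2} (\<lambda>t. - saw2 t)"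
    proof (intro Henstock_Kurzweil_Integration.integral_cong)
      fix t assume "t \<in> {pi..3*pi/2}"
      then have "saw2 (2 * pi - t) \<ge> 0" by (intro pos) auto
      then show "\<bar>saw2 t\<bar> = - saw2 t" using flip[of t] by simp
    qed
    also have "\<dots> = - P (3*pi/2) - (- P pi)" by (rule integral_FTC) (auto intro!: derivative_eq_intros dP)
    finally show ?thesis by simp
  qed
  have 4: "integral {3*pi/2..2*pi} (\<lambda>t. \<bar>saw2 t\<bar>) = P (2*pi) - P (3*pi/2)"
  proof -
    have "integral {3*pi/2..2*pi} (\<lambda>t. \<bar>saw2 t\<bar>) = integral {3*pi/2..2*pi} saw2"
    proof (intro Henstock_Kurzweil_Integration.integral_cong)
      fix t assume "t \<in> {3*pi/2..2*pi}"
      then have "saw2 (2 * pi - t) \<le> 0" by (intro neg) auto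
      then show "\<bar>saw2 t\<bar> = saw2 t" using flip[of t] by simp
    qed
    also have "\<dots> = P (2*pi) - P (3*pi/2)" by (rule integral_FTC) (auto intro!: derivative_eq_intros dP)
    finally show ?thesis by simp
  qed
  have "integral {0..2*pi} (\<lambda>t. \<bar>saw2 t\<bar>) = integral {0..pi/2} (\<lambda>t. \<bar>saw2 t\<bar>) + integral {pi/2..pi} (\<lambda>t. \<bar>saw2 t\<bar>)
      + integral {pi..3*pi/2} (\<lambda>t. \<bar>saw2 t\<bar>) + integral {3*pi/2..2*pi} (\<lambda>t. \<bar>saw2 t\<bar>)"
    by (subst Henstock_Kurzweil_Integration.integral_combine, auto intro!: i)+
  moreover have "cos (3 * pi / 2) = 0" using cos_3over2_pi by (simp add: mult.commute)
  then have "P 0 = pi / 4 - 1/4" "P (pi/2) = pi / 16" "P pi = 1/4" "P (3*pi/2) = pi / 16" "P (2*pi) = pi/4 - 1/4"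
    by (simp_all add: P_def power2_eq_square field_simps)
  ultimately show ?thesis unfolding 1 2 3 4 by simp
qed

lemma integral_abs_saw: "integral {0..2*pi} (\<lambda>t. \<bar>saw t\<bar>) = pi / 2"
proof -
  have i: "(\<lambda>t. \<bar>saw t\<bar>) integrable_on {a..b}" for a b
    by (intro integrable_continuous_interval continuous_intros)
  have 1: "integral {0..pi} (\<lambda>t. \<bar>saw t\<bar>) = pi / 4"
  proof -
    have "integral {0..pi} (\<lambda>t. \<bar>saw t\<bar>) = integral {0..pi} (\<lambda>t. - saw t)"
      by (intro Henstock_Kurzweil_Integration.integral_cong) (auto simp: saw_def field_simps)
    also have "\<dots> = pi / 4" by (subst integral_FTC[where P="\<lambda>t. - ((t - pi)^2 / (4 * pi))"])
      (auto intro!: derivative_eq_intros simp: saw_def power2_eq_square field_simps)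
    finally show ?thesis .
  qed
  have 2: "integral {pi..2*pi} (\<lambda>t. \<bar>saw t\<bar>) = pi / 4"
  proof -
    have "integral {pi..2*pi} (\<lambda>t. \<bar>saw t\<bar>) = integral {pi..2*pi} saw"
      by (intro Henstock_Kurzweil_Integration.integral_cong) (auto simp: saw_def field_simps)
    also have "\<dots> = pi / 4" by (subst integral_FTC[where P="\<lambda>t. (t - pi)^2 / (4 * pi)"])
      (auto intro!: derivative_eq_intros simp: saw_def power2_eq_square field_simps)
    finally show ?thesis .
  qed
  have "integral {0..2*pi} (\<lambda>t. \<bar>saw t\<bar>) = integral {0..pi} (\<lambda>t. \<bar>saw t\<bar>) + integral {pi..2*pi} (\<lambda>t. \<bar>saw t\<bar>)"
    by (subst Henstock_Kurzweil_Integration.integral_combine) (auto intro!: i)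
  then show ?thesis using 1 2 by simp
qed

text \<open>Discriminant argument: integrating \<open>\<bar>H t\<bar>\<close> times a square gives
  \<open>key\<close> for every \<open>s\<close>, and \<open>s = A / W\<close> is the optimal choice.
  If \<open>W = 0\<close>, then \<open>key\<close> bounds a linear function of \<open>s\<close>, so
  \<open>A = 0\<close>.\<close>

lemma weighted_Cauchy_Schwarz:
  fixes H g :: "real \<Rightarrow> real"
  assumes cH: "continuous_on {a..b} H" and cg: "continuous_on {a..b} g" and "a \<le> b"
  shows "(integral {a..b} (\<lambda>t. H t * g t))\<^sup>2 \<le> integral {a..b} (\<lambda>t. \<bar>H t\<bar>) * integral {a..b} (\<lambda>t. \<bar>H t\<bar> * (g t)\<^sup>2)"
proof -
  let ?I = "integral {a..b}"
  define W where "W = ?I (\<lambda>t. \<bar>H t\<bar>)"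
  define A where "A = ?I (\<lambda>t. H t * g t)"
  define B where "B = ?I (\<lambda>t. \<bar>H t\<bar> * (g t)\<^sup>2)"
  have key: "2 * s * A \<le> W * s\<^sup>2 + B" for s
  proof -
    have "?I (\<lambda>t. 2 * s * (H t * g t)) \<le> ?I (\<lambda>t. \<bar>H t\<bar> * s\<^sup>2 + \<bar>H t\<bar> * (g t)\<^sup>2)"
    proof (intro integral_le integrable_continuous_interval continuous_intros cH cg)
      fix t
      have "2 * s * (H t * g t) \<le> \<bar>H t\<bar> * (2 * \<bar>s * g t\<bar>)"
        using abs_ge_self[of "H t * (s * g t)"] by (simp add: abs_mult algebra_simps)
      also have "\<dots> \<le> \<bar>H t\<bar> * (s\<^sup>2 + (g t)\<^sup>2)"
        using sum_squares_bound[of "\<bar>s\<bar>" "\<bar>g t\<bar>"] by (intro mult_left_mono) (simp_all add: abs_mult)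
      finally show "2 * s * (H t * g t) \<le> \<bar>H t\<bar> * s\<^sup>2 + \<bar>H t\<bar> * (g t)\<^sup>2"
        by (simp add: distrib_left)
    qed
    also have "\<dots> = W * s\<^sup>2 + B" unfolding W_def B_def
      by (subst Henstock_Kurzweil_Integration.integral_add) (auto intro!: integrable_continuous_interval continuous_intros cH cg)
    finally show ?thesis by (simp add: A_def)
  qed
  have W0: "W \<ge> 0" unfolding W_def
    by (intro Henstock_Kurzweil_Integration.integral_nonneg integrable_continuous_interval continuous_intros cH) auto
  have "A\<^sup>2 \<le> W * B"
  proof (cases "W = 0")
    case True
    have "A = 0"
    proof (rule ccontr)
      assume "A \<noteq> 0"
      then have "2 * ((B + 1) / (2 * A)) * A = B + 1" by simp
      then show False using key[of "(B + 1) / (2 * A)"] True by simp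
    qed
    then show ?thesis using True by simp
  next
    case False
    then have "W > 0" using W0 by simp
    have "W * (2 * (A / W) * A) \<le> W * (W * (A / W)\<^sup>2 + B)" using key[of "A / W"] \<open>W > 0\<close> by (intro mult_left_mono) auto
    then show ?thesis using \<open>W > 0\<close> by (simp add: power2_eq_square field_simps)
  qed
  then show ?thesis by (simp add: A_def B_def W_def)
qed

text \<open>Young's inequality for convolution on circles, L^1 with L^2: Cauchy-Schwarz with weight
  \<open>\<bar>H t\<bar>\<close>, then \<open>rot_average\<close>. It stands in for Wirtinger's
  inequality, with the kernel norms \<open>pi/2\<close> and \<open>pi/4\<close> instead of the sharp
  constants 1 and 1/2.\<close>

lemma angular_mean_L2:
  fixes g :: "real^2 \<Rightarrow> real"
  assumes cg: "continuous_on (ext_plane r0) g" and "r0 < a" and cH: "continuous_on {0..2*pi} H"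
    and c\<eta>: "continuous_on {a..L} \<eta>" and \<eta>: "\<And>r. a \<le> r \<Longrightarrow> r \<le> L \<Longrightarrow> \<eta> r \<ge> 0"
  shows "(LINT x:ann a L|lborel. \<eta> (norm x) * (angular_mean H g x)\<^sup>2)
    \<le> (integral {0..2*pi} (\<lambda>t. \<bar>H t\<bar>))\<^sup>2 * (LINT x:ann a L|lborel. \<eta> (norm x) * (g x)\<^sup>2)"
proof -
  let ?A = "ann a L" and ?W = "integral {0..2*pi} (\<lambda>t. \<bar>H t\<bar>)"
  have sub: "?A \<subseteq> ext_plane r0" by (rule ann_subset_ext[OF \<open>r0 < a\<close>])
  have cf: "continuous_on ?A (\<lambda>x. \<eta> (norm x) * (g x)\<^sup>2)"
    by (intro continuous_intros continuous_on_compose2[OF c\<eta>] continuous_on_subset[OF cg sub]) (auto simp: ann_def)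
  have cl: "continuous_on ?A (\<lambda>x. \<eta> (norm x) * (angular_mean H g x)\<^sup>2)"
    by (intro continuous_intros continuous_on_compose2[OF c\<eta>] continuous_on_subset[OF continuous_on_angular_mean[OF cH cg] sub]) (auto simp: ann_def)
  let ?h = "\<lambda>x. integral {0..2*pi} (\<lambda>t. \<bar>H t\<bar> *\<^sub>R (\<eta> (norm (rot t x)) * (g (rot t x))\<^sup>2))"
  have "continuous_on (?A \<times> cbox 0 (2*pi)) (\<lambda>(x, t). \<bar>H t\<bar> *\<^sub>R (\<eta> (norm (rot t x)) * (g (rot t x))\<^sup>2))"
    unfolding split_beta
    by (intro continuous_intros continuous_on_compose2[OF cH] continuous_on_compose2[OF c\<eta>] continuous_on_compose2[OF cg])
      (use \<open>r0 < a\<close> in \<open>auto simp: ann_def ext_plane_def\<close>)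
  from integral_continuous_on_param[OF this] have ch: "continuous_on ?A ?h" by (simp add: cbox_interval)
  have "(LINT x:?A|lborel. \<eta> (norm x) * (angular_mean H g x)\<^sup>2) \<le> (LINT x:?A|lborel. ?W * ?h x)"
  proof (intro set_integral_mono set_integrable_ann cl continuous_intros ch)
    fix x assume x: "x \<in> ?A"
    have cgx: "continuous_on {0..2*pi} (\<lambda>t. g (rot t x))"
      by (intro continuous_on_compose2[OF cg] continuous_intros) (use x sub in auto)
    have "(angular_mean H g x)\<^sup>2 \<le> ?W * integral {0..2*pi} (\<lambda>t. \<bar>H t\<bar> * (g (rot t x))\<^sup>2)"
      unfolding angular_mean_def using weighted_Cauchy_Schwarz[OF cH cgx] by simp
    then have "\<eta> (norm x) * (angular_mean H g x)\<^sup>2 \<le> \<eta> (norm x) * (?W * integral {0..2*pi} (\<lambda>t. \<bar>H t\<bar> * (g (rot t x))\<^sup>2))"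
      using \<eta> x by (intro mult_left_mono) (auto simp: ann_def)
    also have "\<dots> = ?W * (\<eta> (norm x) * integral {0..2*pi} (\<lambda>t. \<bar>H t\<bar> * (g (rot t x))\<^sup>2))" by simp
    also have "\<eta> (norm x) * integral {0..2*pi} (\<lambda>t. \<bar>H t\<bar> * (g (rot t x))\<^sup>2) = ?h x"
      by (subst Henstock_Kurzweil_Integration.integral_mult_right[symmetric])
        (simp add: mult.left_commute)
    finally show "\<eta> (norm x) * (angular_mean H g x)\<^sup>2 \<le> ?W * ?h x" .
  qed
  also have "\<dots> = ?W * (LINT x:?A|lborel. ?h x)" by simp
  also have "(LINT x:?A|lborel. ?h x) = ?W * (LINT x:?A|lborel. \<eta> (norm x) * (g x)\<^sup>2)"
    using rot_average[OF cf, of "\<lambda>t. \<bar>H t\<bar>"] cH by (simp add: continuous_intros)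
  finally show ?thesis by (simp add: power2_eq_square)
qed

section \<open>The first angular mode\<close>

lemma integral_trig_product:
  "integral {0..2*pi} (\<lambda>t. (A * cos t + B * sin t) * (C * cos t + D * sin t)) = pi * (A * C + B * D)"
proof -
  have "integral {0..2*pi} (\<lambda>t. (A * cos t + B * sin t) * (C * cos t + D * sin t))
    = integral {0..2*pi} (\<lambda>t. (A * C) * (cos t * cos t) + ((A * D + B * C) * (sin t * cos t) + (B * D) * (sin t * sin t)))"
    by (simp add: algebra_simps)
  also have "\<dots> = (A * C) * integral {0..2*pi} (\<lambda>t. cos t * cos t) + ((A * D + B * C) * integral {0..2*pi} (\<lambda>t. sin t * cos t)
     + (B * D) * integral {0..2*pi} (\<lambda>t. sin t * sin t))"
    by (subst Henstock_Kurzweil_Integration.integral_add, (intro integrable_continuous_interval continuous_intros)+,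
        subst Henstock_Kurzweil_Integration.integral_add, (intro integrable_continuous_interval continuous_intros)+) simp
  also have "\<dots> = pi * (A * C + B * D)" unfolding trig_integrals by (simp add: algebra_simps)
  finally show ?thesis .
qed

lemma inner_rot_expand: "b \<bullet> rot t x = (b \<bullet> x) * cos t + (b \<bullet> perp x) * sin t"
  by (simp add: rot_def inner_add_right)

lemma integral_rot_inner_product:
  "integral {0..2*pi} (\<lambda>t. (c \<bullet> rot t x) * (b \<bullet> rot t x)) = pi * (norm x)\<^sup>2 * (c \<bullet> b)"
proof -
  have "(x \<bullet> x) * (c \<bullet> b) = ((x \<bullet> x) *\<^sub>R c) \<bullet> b" by simp
  also have "\<dots> = (c \<bullet> x) * (b \<bullet> x) + (c \<bullet> perp x) * (b \<bullet> perp x)"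
    unfolding perp_decomp by (simp only: inner_add_left inner_scaleR_left inner_commute[of x b] inner_commute[of "perp x" b])
  finally show ?thesis
    unfolding inner_rot_expand integral_trig_product by (simp add: dot_square_norm algebra_simps)
qed

lemma integral_inner_rot: "integral {0..2*pi} (\<lambda>t. b \<bullet> rot t x) = 0"
proof -
  have "integral {0..2*pi} (\<lambda>t. b \<bullet> rot t x) = (b \<bullet> x) * integral {0..2*pi} cos + (b \<bullet> perp x) * integral {0..2*pi} sin"
    unfolding inner_rot_expand
    by (subst Henstock_Kurzweil_Integration.integral_add; 
        (intro integrable_continuous_interval continuous_intros)?) simp
  then show ?thesis by (simp add: trig_integrals)
qed

lemma ann_integral_cong:
  "(\<And>x. x \<in> ann a L \<Longrightarrow> f x = g x) \<Longrightarrow> (LINT x:ann a L|lborel. f x) = (LINT x:ann a L|lborel. g x)"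
  unfolding set_lebesgue_integral_def by (rule Bochner_Integration.integral_cong) (auto simp: indicator_def)

lemma radial_has_derivative:
  fixes b :: "real \<Rightarrow> 'a::real_normed_vector" and x :: "real^2"
  assumes "(b has_vector_derivative b') (at (norm x))" "x \<noteq> 0"
  shows "((\<lambda>x. b (norm x)) has_derivative (\<lambda>h. (x \<bullet> h / norm x) *\<^sub>R b')) (at x)"
proof -
  have "((\<lambda>x. b (norm x)) has_derivative (\<lambda>h. (sgn x \<bullet> h) *\<^sub>R b')) (at x)"
    using has_derivative_compose[OF has_derivative_norm[OF assms(2)] assms(1)[unfolded has_vector_derivative_def]]
    by (simp add: inner_commute)
  then show ?thesis by (simp add: sgn_div_norm divide_inverse mult.commute)
qed

lemma continuous_on_radial_E:
  assumes "continuous_on {r0<..} b" shows "continuous_on (ext_plane r0) (\<lambda>x. b (norm x))"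
  by (rule continuous_on_compose2[OF assms]) (auto intro: continuous_intros simp: ext_plane_def)

context closed_field
begin

text \<open>
  The linear function \<open>x \<mapsto> q r \<bullet> x\<close> is the first Fourier mode of \<open>v\<close> on the circle of radius \<open>r\<close>.
\<close>

definition "q r = (1 / (pi * r)) *\<^sub>R integral {0..2*pi} (\<lambda>t. v (rot t (circ r)) *\<^sub>R rot t (circ 1))"
definition "q' r = (1 / (pi * r)) *\<^sub>R integral {0..2*pi} (\<lambda>t. (Dv (rot t (circ r)) \<bullet> rot t (circ 1)) *\<^sub>R rot t (circ 1)) - (1 / r) *\<^sub>R q r"

lemma circ_in_E: "r0 < r \<Longrightarrow> rot t (circ r) \<in> E"
  using r0 by (simp add: ext_plane_def norm_circ)

lemma circ_scale: "rot t (circ r) = r *\<^sub>R rot t (circ 1)"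
  by (simp add: circ_def)

lemma v_circle_integral:
  assumes "x \<in> E"
  shows "integral {0..2*pi} (\<lambda>t. v (rot t x) *\<^sub>R rot t x) = (pi * (norm x)\<^sup>2) *\<^sub>R q (norm x)"
proof -
  let ?r = "norm x"
  have sub: "sphere 0 ?r \<subseteq> E" using assms by (auto simp: ext_plane_def)
  have "integral {0..2*pi} (\<lambda>t. v (rot t x) *\<^sub>R rot t x) = integral {0..2*pi} (\<lambda>t. v (rot t (circ ?r)) *\<^sub>R rot t (circ ?r))"
    by (rule circle_integral_rot[where F="\<lambda>y. v y *\<^sub>R y"]) (intro continuous_intros continuous_on_subset[OF continuous_v sub])
  also have "\<dots> = integral {0..2*pi} (\<lambda>t. ?r *\<^sub>R (v (rot t (circ ?r)) *\<^sub>R rot t (circ 1)))"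
    by (subst (2) circ_scale) (simp add: mult.commute)
  also have "\<dots> = ?r *\<^sub>R integral {0..2*pi} (\<lambda>t. v (rot t (circ ?r)) *\<^sub>R rot t (circ 1))"
    by (rule Henstock_Kurzweil_Integration.integral_cmul)
  finally show ?thesis using E_nonzero(2)[OF assms] by (simp add: q_def power2_eq_square)
qed

lemma continuous_rot_curve:
  assumes "x \<in> E" "continuous_on E F"
  shows "continuous_on S (\<lambda>t. F (rot t x))"
  by (intro continuous_on_compose2[OF assms(2)] continuous_intros) (use assms in auto)

lemma v_circle_inner:
  assumes "x \<in> E"
  shows "integral {0..2*pi} (\<lambda>t. v (rot t x) * (b \<bullet> rot t x)) = pi * (norm x)\<^sup>2 * (q (norm x) \<bullet> b)"
proof -
  have "(\<lambda>t. v (rot t x) *\<^sub>R rot t x) integrable_on {0..2*pi}"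
    by (intro integrable_continuous_interval continuous_intros continuous_rot_curve[OF assms continuous_v])
  from integral_linear[OF this bounded_linear_inner_left[of b]]
  have "integral {0..2*pi} (\<lambda>t. (v (rot t x) *\<^sub>R rot t x) \<bullet> b) = integral {0..2*pi} (\<lambda>t. v (rot t x) *\<^sub>R rot t x) \<bullet> b"
    by (simp add: o_def)
  then show ?thesis by (simp add: v_circle_integral[OF assms] inner_commute)
qed

lemma q_deriv:
  assumes "r0 < r" shows "(q has_vector_derivative q' r) (at r)"
proof -
  define u where "u s = integral {0..2*pi} (\<lambda>t. v (rot t (circ s)) *\<^sub>R rot t (circ 1))" for s
  define u' where "u' s = integral {0..2*pi} (\<lambda>t. (Dv (rot t (circ s)) \<bullet> rot t (circ 1)) *\<^sub>R rot t (circ 1))" for s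
  have "((\<lambda>s. integral (cbox 0 (2*pi)) (\<lambda>t. v (rot t (circ s)) *\<^sub>R rot t (circ 1))) has_vector_derivative
     integral (cbox 0 (2*pi)) (\<lambda>t. (Dv (rot t (circ r)) \<bullet> rot t (circ 1)) *\<^sub>R rot t (circ 1))) (at r within {r0<..})"
  proof (rule leibniz_rule_vector_derivative[where fx="\<lambda>s t. (Dv (rot t (circ s)) \<bullet> rot t (circ 1)) *\<^sub>R rot t (circ 1)"])
    fix s t assume s: "s \<in> {r0<..}"
    have "((\<lambda>s. rot t (circ s)) has_derivative (\<lambda>h. h *\<^sub>R rot t (circ 1))) (at s within {r0<..})"
      by (subst circ_scale) (auto intro!: derivative_eq_intros)
    from has_derivative_compose[OF this v_deriv[OF circ_in_E]] s
    have "((\<lambda>s. v (rot t (circ s))) has_derivative (\<lambda>h. h *\<^sub>R (Dv (rot t (circ s)) \<bullet> rot t (circ 1)))) (at s within {r0<..})"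
      by simp
    from has_derivative_scaleR_left[OF this, of "rot t (circ 1)"]
    show "((\<lambda>s. v (rot t (circ s)) *\<^sub>R rot t (circ 1)) has_vector_derivative
      (Dv (rot t (circ s)) \<bullet> rot t (circ 1)) *\<^sub>R rot t (circ 1)) (at s within {r0<..})"
      by (simp add: has_vector_derivative_def)
  next
    fix s assume "s \<in> {r0<..}"
    then show "(\<lambda>t. v (rot t (circ s)) *\<^sub>R rot t (circ 1)) integrable_on cbox 0 (2 * pi)"
      using circ_in_E[of s 0] by (intro integrable_continuous continuous_intros continuous_rot_curve[OF _ continuous_v]) auto
  next
    show "continuous_on ({r0<..} \<times> cbox 0 (2 * pi)) (\<lambda>(s, t). (Dv (rot t (circ s)) \<bullet> rot t (circ 1)) *\<^sub>R rot t (circ 1))"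
      unfolding split_beta circ_def
      by (intro continuous_intros continuous_on_compose2[OF continuous_Dv]) (use circ_in_E in \<open>auto simp: circ_def\<close>)
  qed (use assms in auto)
  then have u: "(u has_vector_derivative u' r) (at r)"
    unfolding u_def[abs_def] u'_def using at_within_open[of r "{r0<..}"] assms by (simp add: cbox_interval)
  have "((\<lambda>r. 1 / (pi * r)) has_real_derivative - (1 / (pi * r)) * (1 / r)) (at r)"
    using assms r0 by (auto intro!: derivative_eq_intros simp: field_simps)
  from has_vector_derivative_scaleR[OF this u]
  have "(q has_vector_derivative ((1 / (pi * r)) *\<^sub>R u' r + (- (1 / (pi * r)) * (1 / r)) *\<^sub>R u r)) (at r)"
    by (simp add: q_def[abs_def] u_def[abs_def])
  then show ?thesis by (simp add: q'_def q_def u_def u'_def mult.commute mult.left_commute)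
qed

lemma continuous_q: "continuous_on {r0<..} q"
  using q_deriv by (intro continuous_at_imp_continuous_on) (auto intro: has_vector_derivative_continuous)

lemma continuous_q': "continuous_on {r0<..} q'"
proof -
  have "continuous_on ({r0<..} \<times> cbox 0 (2 * pi)) (\<lambda>(s, t). (Dv (rot t (circ s)) \<bullet> rot t (circ 1)) *\<^sub>R rot t (circ 1))"
    unfolding split_beta circ_def
    by (intro continuous_intros continuous_on_compose2[OF continuous_Dv]) (use circ_in_E in \<open>auto simp: circ_def\<close>)
  from integral_continuous_on_param[OF this]
  have "continuous_on {r0<..} (\<lambda>s. integral {0..2*pi} (\<lambda>t. (Dv (rot t (circ s)) \<bullet> rot t (circ 1)) *\<^sub>R rot t (circ 1)))"
    by (simp add: cbox_interval)
  then show ?thesis unfolding q'_def[abs_def]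
    by (intro continuous_intros continuous_q) (use r0 in auto)
qed

text \<open>\<open>saw\<close> has integral 0, so the constant \<open>tbar\<close> of
  \<open>Dv_tangential\<close> drops out of the convolution.\<close>

lemma v_saw: "x \<in> E \<Longrightarrow> v x = angular_mean saw (\<lambda>y. Dv y \<bullet> perp y) x"
proof -
  assume x: "x \<in> E"
  have "angular_mean saw (\<lambda>y. Dv y \<bullet> perp y) x = integral {0..2*pi} (\<lambda>t. saw t * tang (rot t x) - tbar * saw t)"
    unfolding angular_mean_def using x by (simp add: Dv_tangential algebra_simps)
  also have "\<dots> = v x - tbar * integral {0..2*pi} saw"
    unfolding v_def angular_mean_def
    by (subst Henstock_Kurzweil_Integration.integral_diff; 
        (intro integrable_continuous_interval continuous_intros continuous_rot_curve[OF x continuous_tang])?) simp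
  finally show ?thesis by (simp add: trig_integrals)
qed

text \<open>Convolution with \<open>saw\<close> recovers \<open>v\<close> as well as the linear
  function \<open>q r \<bullet> x\<close> from their angular derivatives. These two derivatives have
  the same sine coefficient, so the additional \<open>sin t / 4\<close> in the kernel contributes
  nothing to the difference.\<close>

lemma v_mode2:
  assumes x: "x \<in> E"
  shows "v x - q (norm x) \<bullet> x = angular_mean saw2 (\<lambda>y. (Dv y - q (norm y)) \<bullet> perp y) x"
proof -
  let ?r = "norm x" and ?I = "integral {0..2*pi}"
  let ?d = "\<lambda>t. Dv (rot t x) \<bullet> perp (rot t x)"
  let ?e = "\<lambda>t. q ?r \<bullet> perp (rot t x)"
  have cd: "continuous_on S ?d" for S by (intro continuous_intros continuous_rot_curve[OF x continuous_Dv])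
  have ce: "continuous_on S ?e" for S by (intro continuous_intros)
  have i: "f integrable_on {0..2*pi}" if "continuous_on UNIV f" for f :: "real \<Rightarrow> real"
    by (intro integrable_continuous_interval continuous_on_subset[OF that]) auto
  have e: "?e t = (q ?r \<bullet> perp x) * cos t - (q ?r \<bullet> x) * sin t" for t
    by (simp add: rot_def inner_add_right inner_diff_right)
  have a: "?I (\<lambda>t. saw t * ?d t) = v x" using v_saw[OF x] by (simp add: angular_mean_def)
  have b: "?I (\<lambda>t. saw t * ?e t) = q ?r \<bullet> x"
  proof -
    have "?I (\<lambda>t. saw t * ?e t) = ?I (\<lambda>t. (q ?r \<bullet> perp x) * (saw t * cos t) - (q ?r \<bullet> x) * (saw t * sin t))"
      unfolding e by (simp add: algebra_simps)
    also have "\<dots> = (q ?r \<bullet> perp x) * ?I (\<lambda>t. saw t * cos t) - (q ?r \<bullet> x) * ?I (\<lambda>t. saw t * sin t)"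
      by (subst Henstock_Kurzweil_Integration.integral_diff; (intro i continuous_intros)?) simp
    finally show ?thesis by (simp add: trig_integrals)
  qed
  \<comment> \<open>Integration by parts leads to the cosine coefficient of \<open>v\<close>, which
    is what \<open>q\<close> records.\<close>
  have c: "?I (\<lambda>t. sin t * ?d t) = - pi * (q ?r \<bullet> x)"
  proof -
    have "((\<lambda>t. sin t * ?d t + cos t * v (rot t x)) has_integral sin (2*pi) * v (rot (2*pi) x) - sin 0 * v (rot 0 x)) {0..2*pi}"
    proof (rule fundamental_theorem_of_calculus)
      fix t
      have 1: "((\<lambda>t. v (rot t x)) has_vector_derivative ?d t) (at t within {0..2*pi})"
        by (rule rot_curve_has_vector_derivative) (use x v_deriv in auto)
      have 2: "(sin has_vector_derivative cos t) (at t within {0..2*pi})"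
        unfolding has_real_derivative_iff_has_vector_derivative[symmetric] by (auto intro!: derivative_eq_intros)
      from has_vector_derivative_mult[OF 2 1]
      show "((\<lambda>t. sin t * v (rot t x)) has_vector_derivative sin t * ?d t + cos t * v (rot t x)) (at t within {0..2*pi})"
        by simp
    qed simp
    then have "?I (\<lambda>t. sin t * ?d t + cos t * v (rot t x)) = 0" by (simp add: integral_unique)
    then have "?I (\<lambda>t. sin t * ?d t) = - ?I (\<lambda>t. cos t * v (rot t x))"
      by (subst (asm) Henstock_Kurzweil_Integration.integral_add; 
        (intro i continuous_intros cd continuous_rot_curve[OF x continuous_v])?) simp
    moreover have "(x \<bullet> x) * ?I (\<lambda>t. cos t * v (rot t x)) = pi * (norm x)\<^sup>2 * (q ?r \<bullet> x)"
    proof -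
      have "v (rot t x) * (x \<bullet> rot t x) = (x \<bullet> x) * (cos t * v (rot t x))" for t
        by (simp add: inner_rot_expand)
      then show ?thesis using v_circle_inner[OF x, of x] by (simp only: Henstock_Kurzweil_Integration.integral_mult_right)
    qed
    ultimately show ?thesis using E_nonzero[OF x] by (simp add: dot_square_norm)
  qed
  have d: "?I (\<lambda>t. sin t * ?e t) = - pi * (q ?r \<bullet> x)"
  proof -
    have "?I (\<lambda>t. sin t * ?e t) = ?I (\<lambda>t. (0 * cos t + 1 * sin t) * ((q ?r \<bullet> perp x) * cos t + (- (q ?r \<bullet> x)) * sin t))"
      unfolding e by (simp add: algebra_simps)
    also have "\<dots> = - pi * (q ?r \<bullet> x)" unfolding integral_trig_product by simp
    finally show ?thesis .
  qed
  have "angular_mean saw2 (\<lambda>y. (Dv y - q (norm y)) \<bullet> perp y) x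
    = ?I (\<lambda>t. (saw t * ?d t - saw t * ?e t) + (sin t * ?d t - sin t * ?e t) / 4)"
    unfolding angular_mean_def saw2_def by (simp add: inner_diff_left field_simps)
  also have "\<dots> = (?I (\<lambda>t. saw t * ?d t) - ?I (\<lambda>t. saw t * ?e t)) + (?I (\<lambda>t. sin t * ?d t) - ?I (\<lambda>t. sin t * ?e t)) / 4"
    by (simp add: Henstock_Kurzweil_Integration.integral_add Henstock_Kurzweil_Integration.integral_diff i cd ce continuous_intros)
  finally show ?thesis unfolding a b c d by simp
qed

lemma v_bound:
  assumes x: "x \<in> E" and b: "\<And>y. norm y = norm x \<Longrightarrow> \<bar>Dv y \<bullet> perp y\<bar> \<le> B"
  shows "\<bar>v x\<bar> \<le> pi / 2 * B"
proof -
  let ?g = "\<lambda>t. Dv (rot t x) \<bullet> perp (rot t x)"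
  have cg: "continuous_on S ?g" for S
    by (intro continuous_intros continuous_rot_curve[OF x continuous_Dv])
  have "norm (integral {0..2*pi} (\<lambda>t. saw t * ?g t)) \<le> integral {0..2*pi} (\<lambda>t. \<bar>saw t\<bar> * B)"
  proof (rule integral_norm_bound_integral)
    show "norm (saw t * ?g t) \<le> \<bar>saw t\<bar> * B" for t
      using b[of "rot t x"] by (simp add: abs_mult mult_left_mono)
  qed (intro integrable_continuous_interval continuous_intros cg)+
  then show ?thesis
    using v_saw[OF x] by (simp add: angular_mean_def integral_abs_saw)
qed

lemma q_bound:
  assumes "r0 < r" and b: "\<And>y. norm y = r \<Longrightarrow> \<bar>Dv y \<bullet> perp y\<bar> \<le> r * B"
  shows "norm (q r) \<le> pi * B"
proof -
  have r: "r > 0" using assms r0 by simp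
  have vb: "\<bar>v (rot t (circ r))\<bar> \<le> pi / 2 * (r * B)" for t
    by (rule v_bound[OF circ_in_E[OF assms(1)]]) (use b r in \<open>auto simp: norm_circ\<close>)
  have "norm (integral {0..2*pi} (\<lambda>t. v (rot t (circ r)) *\<^sub>R rot t (circ 1))) \<le> integral {0..2*pi} (\<lambda>t. pi / 2 * (r * B))"
  proof (rule integral_norm_bound_integral)
    show "norm (v (rot t (circ r)) *\<^sub>R rot t (circ 1)) \<le> pi / 2 * (r * B)" for t
      using vb by (simp add: norm_circ)
    show "(\<lambda>t. v (rot t (circ r)) *\<^sub>R rot t (circ 1)) integrable_on {0..2*pi}"
      using circ_in_E[OF assms(1), of 0] by (intro integrable_continuous_interval continuous_intros continuous_rot_curve[OF _ continuous_v]) auto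
  qed auto
  also have "\<dots> = 2 * pi * (pi / 2 * (r * B))" by simp
  finally have "norm (q r) \<le> (1 / (pi * r)) * (2 * pi * (pi / 2 * (r * B)))"
    using r unfolding q_def norm_scaleR by (simp only: abs_of_pos divide_pos_pos mult_pos_pos zero_less_one pi_gt_zero) (rule mult_left_mono, simp_all)
  also have "\<dots> = pi * B" using r by simp
  finally show ?thesis .
qed

text \<open>Averaging over rotations first: on each circle, when paired with a linear function,
  \<open>v\<close> may be replaced by its first mode. The factor 1/2 is the mean of a squared
  cosine.\<close>

lemma mode1_orthogonal:
  assumes a: "r0 < a" and ch: "continuous_on {r0<..} h"
  shows "(LINT x:ann a L|lborel. v x * (h (norm x) \<bullet> x)) = (LINT x:ann a L|lborel. (norm x)\<^sup>2 * (q (norm x) \<bullet> h (norm x))) / 2"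
    "(LINT x:ann a L|lborel. (q (norm x) \<bullet> x) * (h (norm x) \<bullet> x)) = (LINT x:ann a L|lborel. (norm x)\<^sup>2 * (q (norm x) \<bullet> h (norm x))) / 2"
    "(LINT x:ann a L|lborel. h (norm x) \<bullet> x) = 0"
proof -
  let ?A = "ann a L"
  have sub: "?A \<subseteq> E" by (rule ann_subset_ext[OF a])
  note c = continuous_on_subset[OF continuous_on_radial_E[OF ch] sub] continuous_on_subset[OF continuous_v sub]
    continuous_on_subset[OF continuous_on_radial_E[OF continuous_q] sub]
  have A: "2 * pi * (LINT x:?A|lborel. f x) = (LINT x:?A|lborel. integral {0..2*pi} (\<lambda>t. f (rot t x)))"
    if "continuous_on ?A f" for f
    using rot_average[OF that, of "\<lambda>t. 1"] by simp
  have ci: "set_lebesgue_integral lborel ?A f = set_lebesgue_integral lborel ?A g" if "\<And>x. x \<in> E \<Longrightarrow> f x = g x" for f g :: "real^2 \<Rightarrow> real"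
    by (rule set_lebesgue_integral_cong) (use that sub compact_ann[of a L] in \<open>auto intro: borel_compact\<close>)
  have "2 * pi * (LINT x:?A|lborel. v x * (h (norm x) \<bullet> x)) = (LINT x:?A|lborel. pi * ((norm x)\<^sup>2 * (q (norm x) \<bullet> h (norm x))))"
  proof -
    have "2 * pi * (LINT x:?A|lborel. v x * (h (norm x) \<bullet> x)) = (LINT x:?A|lborel. integral {0..2*pi} (\<lambda>t. v (rot t x) * (h (norm (rot t x)) \<bullet> rot t x)))"
      by (rule A) (intro continuous_intros c)
    also have "\<dots> = (LINT x:?A|lborel. pi * ((norm x)\<^sup>2 * (q (norm x) \<bullet> h (norm x))))"
      by (rule ci) (simp add: v_circle_inner)
    finally show ?thesis .
  qed
  then show "(LINT x:?A|lborel. v x * (h (norm x) \<bullet> x)) = (LINT x:?A|lborel. (norm x)\<^sup>2 * (q (norm x) \<bullet> h (norm x))) / 2"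
    by simp
  have "2 * pi * (LINT x:?A|lborel. (q (norm x) \<bullet> x) * (h (norm x) \<bullet> x)) = (LINT x:?A|lborel. pi * ((norm x)\<^sup>2 * (q (norm x) \<bullet> h (norm x))))"
  proof -
    have "2 * pi * (LINT x:?A|lborel. (q (norm x) \<bullet> x) * (h (norm x) \<bullet> x)) = (LINT x:?A|lborel. integral {0..2*pi} (\<lambda>t. (q (norm (rot t x)) \<bullet> rot t x) * (h (norm (rot t x)) \<bullet> rot t x)))"
      by (rule A) (intro continuous_intros c)
    also have "\<dots> = (LINT x:?A|lborel. pi * ((norm x)\<^sup>2 * (q (norm x) \<bullet> h (norm x))))"
      by (rule ci) (simp add: integral_rot_inner_product)
    finally show ?thesis .
  qed
  then show "(LINT x:?A|lborel. (q (norm x) \<bullet> x) * (h (norm x) \<bullet> x)) = (LINT x:?A|lborel. (norm x)\<^sup>2 * (q (norm x) \<bullet> h (norm x))) / 2"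
    by simp
  have "2 * pi * (LINT x:?A|lborel. h (norm x) \<bullet> x) = (LINT x:?A|lborel. 0)"
  proof -
    have "2 * pi * (LINT x:?A|lborel. h (norm x) \<bullet> x) = (LINT x:?A|lborel. integral {0..2*pi} (\<lambda>t. h (norm (rot t x)) \<bullet> rot t x))"
      by (rule A) (intro continuous_intros c)
    also have "\<dots> = (LINT x:?A|lborel. 0)"
      by (rule ci) (simp add: integral_inner_rot)
    finally show ?thesis .
  qed
  then show "(LINT x:?A|lborel. h (norm x) \<bullet> x) = 0" by simp
qed

text \<open>
  Subtracting the radial field of flux \<open>2 \<pi> fl\<close> and the rotational field carrying the circulation of
  \<open>k\<close> leaves a field that is the gradient of \<open>v\<close> up to a radial multiple of \<open>x\<close>.
\<close>

definition "m fl x = k x - (fl / (norm x)\<^sup>2) *\<^sub>R x - (tbar / (norm x)\<^sup>2) *\<^sub>R perp x"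

lemma m_eq: "x \<in> E \<Longrightarrow> m fl x = Dv x + ((rbar (norm x) - fl) / (norm x)\<^sup>2) *\<^sub>R x"
  unfolding m_def by (subst k_decomp) (simp_all add: diff_divide_distrib algebra_simps)

lemma m_perp: "x \<in> E \<Longrightarrow> m fl x \<bullet> perp x = Dv x \<bullet> perp x"
  by (simp add: m_eq inner_add_left)

lemma m_radial: "x \<in> E \<Longrightarrow> m fl x \<bullet> x = Dv x \<bullet> x + (rbar (norm x) - fl)"
  using E_nonzero(2)[of x] by (simp add: m_eq inner_add_left dot_square_norm)

lemma continuous_m: "continuous_on E (m fl)"
  unfolding m_def[abs_def] using E_nonzero by (intro continuous_intros ck) auto

text \<open>
  The left-hand integral has no contribution from the region where \<open>\<zeta>\<close> is constant. This makes
  all terms linear in \<open>m\<close> in the energy argument harmless.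
\<close>

lemma mode_mean_identity:
  fixes b h :: "real \<Rightarrow> real^2"
  assumes a: "r0 < a" and \<zeta>: "\<And>r. r0 < r \<Longrightarrow> (\<zeta> has_real_derivative \<zeta>' r) (at r)" "continuous_on {r0<..} \<zeta>'" "\<And>r. r < a \<Longrightarrow> \<zeta> r = 0"
    and b: "\<And>r. r0 < r \<Longrightarrow> (b has_vector_derivative - h r) (at r)" "\<And>r. r > L \<Longrightarrow> b r = 0"
    and \<kappa>: "\<And>r. r0 < r \<Longrightarrow> (\<kappa> has_real_derivative - (h r \<bullet> q r)) (at r)" "\<And>r. r > L \<Longrightarrow> \<kappa> r = 0"
    and ch: "continuous_on {r0<..} h"
  shows "(LINT x:ann a L|lborel. \<zeta> (norm x) * (m fl x \<bullet> b (norm x) - \<kappa> (norm x)))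
       = (LINT x:ann a L|lborel. \<zeta>' (norm x) * (norm x * \<kappa> (norm x) / 2 - v x * (x \<bullet> b (norm x)) / norm x))"
proof -
  let ?A = "ann a L"
  have sub: "?A \<subseteq> E" by (rule ann_subset_ext[OF a])
  have cb: "continuous_on {r0<..} b" using b(1) by (intro continuous_at_imp_continuous_on) (auto intro: has_vector_derivative_continuous)
  have c\<kappa>: "continuous_on {r0<..} \<kappa>" using \<kappa>(1) by (intro continuous_at_imp_continuous_on) (auto intro: DERIV_isCont)
  have c\<zeta>: "continuous_on {r0<..} \<zeta>" using \<zeta>(1) by (intro continuous_at_imp_continuous_on) (auto intro: DERIV_isCont)
  note cE = continuous_on_radial_E[OF cb] continuous_on_radial_E[OF c\<kappa>] continuous_on_radial_E[OF c\<zeta>] continuous_on_radial_E[OF \<zeta>(2)]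
    continuous_on_radial_E[OF ch] continuous_on_radial_E[OF continuous_q] continuous_v continuous_Dv continuous_on_radial_E[OF continuous_rbar]
  \<comment> \<open>The divergence theorem is applied to \<open>\<zeta> W\<close>. Since
    \<open>x\<close> has divergence 2, the field \<open>W\<close> has divergence
    \<open>Dv x \<bullet> b - \<kappa>\<close> plus terms from the radial derivatives of
    \<open>b\<close> and \<open>\<kappa>\<close>; the prescribed derivative of
    \<open>\<kappa>\<close> makes these extra terms cancel on average over circles.\<close>
  define W where "W x = v x *\<^sub>R b (norm x) - (\<kappa> (norm x) / 2) *\<^sub>R x" for x
  define W' where "W' x w = (v x *\<^sub>R ((x \<bullet> w / norm x) *\<^sub>R (- h (norm x))) + (Dv x \<bullet> w) *\<^sub>R b (norm x))
      - ((\<kappa> (norm x) / 2) *\<^sub>R w + ((x \<bullet> w / norm x) * (- (h (norm x) \<bullet> q (norm x))) / 2) *\<^sub>R x)" for x w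
  define Y' where "Y' x w = \<zeta> (norm x) *\<^sub>R W' x w + ((x \<bullet> w / norm x) * \<zeta>' (norm x)) *\<^sub>R W x" for x w
  have dY: "((\<lambda>x. \<zeta> (norm x) *\<^sub>R W x) has_derivative Y' x) (at x)" if x: "x \<in> E" for x
  proof -
    note nx = E_nonzero(1)[OF x] ext_planeD[OF x]
    have db: "((\<lambda>x. b (norm x)) has_derivative (\<lambda>w. (x \<bullet> w / norm x) *\<^sub>R (- h (norm x)))) (at x)"
      by (rule radial_has_derivative[OF b(1)[OF nx(2)] nx(1)])
    have d\<kappa>: "((\<lambda>x. \<kappa> (norm x)) has_derivative (\<lambda>w. (x \<bullet> w / norm x) *\<^sub>R (- (h (norm x) \<bullet> q (norm x))))) (at x)"
      by (rule radial_has_derivative[OF _ nx(1)]) (use \<kappa>(1)[OF nx(2)] in \<open>simp add: has_real_derivative_iff_has_vector_derivative\<close>)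
    have d\<zeta>: "((\<lambda>x. \<zeta> (norm x)) has_derivative (\<lambda>w. (x \<bullet> w / norm x) *\<^sub>R \<zeta>' (norm x))) (at x)"
      by (rule radial_has_derivative[OF _ nx(1)]) (use \<zeta>(1)[OF nx(2)] in \<open>simp add: has_real_derivative_iff_has_vector_derivative\<close>)
    have d\<kappa>2: "((\<lambda>x. \<kappa> (norm x) / 2) has_derivative (\<lambda>w. (x \<bullet> w / norm x) * (- (h (norm x) \<bullet> q (norm x))) / 2)) (at x)"
      using has_derivative_mult_left[OF d\<kappa>, of "1/2"] by simp
    have "(W has_derivative W' x) (at x)"
      unfolding W_def[abs_def] W'_def[abs_def]
      by (intro has_derivative_diff has_derivative_scaleR v_deriv[OF x] db d\<kappa>2 has_derivative_ident)
    from has_derivative_scaleR[OF d\<zeta> this] show ?thesis by (simp add: Y'_def[abs_def])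
  qed
  have cY: "continuous_on E (\<lambda>x. Y' x w)" for w
    unfolding Y'_def W'_def W_def using E_nonzero by (intro continuous_intros cE) auto
  have zY: "\<zeta> (norm x) *\<^sub>R W x = 0" if "x \<notin> ?A" for x
    using that \<zeta>(3) b(2) \<kappa>(2) by (auto simp: ann_def W_def not_le)
  have "(LINT x:?A|lborel. Y' x (axis 1 1) $ 1 + Y' x (axis 2 1) $ 2) = 0"
    by (rule integral_divergence_eq_0[OF a dY cY zY])
  \<comment> \<open>Three groups: the two integrands of the claim; a pair that cancels by
    \<open>mode1_orthogonal(1)\<close>; and the radial part of \<open>m\<close> paired with
    \<open>b\<close>, linear on each circle and hence of integral 0.\<close>
  moreover have tr: "Y' x (axis 1 1) $ 1 + Y' x (axis 2 1) $ 2
     = (\<zeta> (norm x) * (m fl x \<bullet> b (norm x) - \<kappa> (norm x)) - \<zeta>' (norm x) * (norm x * \<kappa> (norm x) / 2 - v x * (x \<bullet> b (norm x)) / norm x))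
       - (v x * (((\<zeta> (norm x) / norm x) *\<^sub>R h (norm x)) \<bullet> x) - (norm x)\<^sup>2 * (q (norm x) \<bullet> ((\<zeta> (norm x) / norm x) *\<^sub>R h (norm x))) / 2)
       - ((\<zeta> (norm x) * (rbar (norm x) - fl) / (norm x)\<^sup>2) *\<^sub>R b (norm x)) \<bullet> x" if x: "x \<in> E" for x
  proof -
    define r where "r = norm x"
    have r: "r > 0" "x $ 1 * x $ 1 + x $ 2 * x $ 2 = r * r"
    proof -
      show "r > 0" using E_nonzero(2)[OF x] by (simp add: r_def)
      have "x $ 1 * x $ 1 + x $ 2 * x $ 2 = x \<bullet> x" by (simp add: inner_2)
      then show "x $ 1 * x $ 1 + x $ 2 * x $ 2 = r * r" by (simp add: r_def dot_square_norm power2_eq_square)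
    qed
    have W2: "x $ 1 * W x $ 1 + x $ 2 * W x $ 2 = v x * (x \<bullet> b r) - \<kappa> r / 2 * (r * r)"
      unfolding r(2)[symmetric] by (simp add: W_def inner_2 algebra_simps flip: r_def)
    have W1: "W' x (axis 1 1) $ 1 + W' x (axis 2 1) $ 2 = - v x * (x \<bullet> h r) / r + Dv x \<bullet> b r - \<kappa> r + (h r \<bullet> q r) / r / 2 * (r * r)"
      unfolding r(2)[symmetric] by (simp add: W'_def inner_2 axis_def algebra_simps add_divide_distrib diff_divide_distrib flip: r_def)
    have "Y' x (axis 1 1) $ 1 + Y' x (axis 2 1) $ 2 = \<zeta> r * (W' x (axis 1 1) $ 1 + W' x (axis 2 1) $ 2)
       + \<zeta>' r / r * (x $ 1 * W x $ 1 + x $ 2 * W x $ 2)"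
      by (simp add: Y'_def inner_axis algebra_simps flip: r_def)
    also have "\<dots> = \<zeta> r * (- v x * (x \<bullet> h r) / r + Dv x \<bullet> b r - \<kappa> r + (h r \<bullet> q r) / r / 2 * (r * r))
       + \<zeta>' r / r * (v x * (x \<bullet> b r) - \<kappa> r / 2 * (r * r))"
      by (simp only: W1 W2)
    also have "\<dots> = (\<zeta> r * ((Dv x + ((rbar r - fl) / r\<^sup>2) *\<^sub>R x) \<bullet> b r - \<kappa> r) - \<zeta>' r * (r * \<kappa> r / 2 - v x * (x \<bullet> b r) / r))
       - (v x * (((\<zeta> r / r) *\<^sub>R h r) \<bullet> x) - r\<^sup>2 * (q r \<bullet> ((\<zeta> r / r) *\<^sub>R h r)) / 2)
       - ((\<zeta> r * (rbar r - fl) / r\<^sup>2) *\<^sub>R b r) \<bullet> x"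
      using r(1) by (simp add: inner_add_left inner_commute[of x] inner_commute[of "q r"] field_simps power2_eq_square)
    finally show ?thesis using m_eq[OF x] by (simp add: r_def)
  qed
  ultimately have "0 = (LINT x:?A|lborel.
      (\<zeta> (norm x) * (m fl x \<bullet> b (norm x) - \<kappa> (norm x)) - \<zeta>' (norm x) * (norm x * \<kappa> (norm x) / 2 - v x * (x \<bullet> b (norm x)) / norm x))
       - (v x * (((\<zeta> (norm x) / norm x) *\<^sub>R h (norm x)) \<bullet> x) - (norm x)\<^sup>2 * (q (norm x) \<bullet> ((\<zeta> (norm x) / norm x) *\<^sub>R h (norm x))) / 2)
       - ((\<zeta> (norm x) * (rbar (norm x) - fl) / (norm x)\<^sup>2) *\<^sub>R b (norm x)) \<bullet> x)"
    by (subst ann_integral_cong[OF tr[symmetric]]) (use sub in auto)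
  also have "\<dots> = ((LINT x:?A|lborel. \<zeta> (norm x) * (m fl x \<bullet> b (norm x) - \<kappa> (norm x)))
      - (LINT x:?A|lborel. \<zeta>' (norm x) * (norm x * \<kappa> (norm x) / 2 - v x * (x \<bullet> b (norm x)) / norm x)))
       - ((LINT x:?A|lborel. v x * (((\<zeta> (norm x) / norm x) *\<^sub>R h (norm x)) \<bullet> x)) - (LINT x:?A|lborel. (norm x)\<^sup>2 * (q (norm x) \<bullet> ((\<zeta> (norm x) / norm x) *\<^sub>R h (norm x))) / 2))
       - (LINT x:?A|lborel. ((\<zeta> (norm x) * (rbar (norm x) - fl) / (norm x)\<^sup>2) *\<^sub>R b (norm x)) \<bullet> x)"
  proof -
    have "set_integrable lborel ?A f" if "continuous_on E f" for f :: "real^2 \<Rightarrow> real"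
      by (rule set_integrable_ann[OF continuous_on_subset[OF that sub]])
    note I = this
    have 1: "set_integrable lborel ?A (\<lambda>x. \<zeta> (norm x) * (m fl x \<bullet> b (norm x) - \<kappa> (norm x)))"
      "set_integrable lborel ?A (\<lambda>x. \<zeta>' (norm x) * (norm x * \<kappa> (norm x) / 2 - v x * (x \<bullet> b (norm x)) / norm x))"
      "set_integrable lborel ?A (\<lambda>x. v x * (((\<zeta> (norm x) / norm x) *\<^sub>R h (norm x)) \<bullet> x))"
      "set_integrable lborel ?A (\<lambda>x. (norm x)\<^sup>2 * (q (norm x) \<bullet> ((\<zeta> (norm x) / norm x) *\<^sub>R h (norm x))) / 2)"
      "set_integrable lborel ?A (\<lambda>x. ((\<zeta> (norm x) * (rbar (norm x) - fl) / (norm x)\<^sup>2) *\<^sub>R b (norm x)) \<bullet> x)"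
      using E_nonzero by (intro I continuous_intros cE continuous_m; auto)+
    show ?thesis
      by (subst set_integral_diff(2), intro set_integral_diff(1) 1, intro 1,
          subst set_integral_diff(2), intro set_integral_diff(1) 1, intro set_integral_diff(1) 1,
          subst set_integral_diff(2), intro 1, intro 1,
          subst set_integral_diff(2), intro 1, intro 1, rule refl)
  qed
  also have "(LINT x:?A|lborel. v x * (((\<zeta> (norm x) / norm x) *\<^sub>R h (norm x)) \<bullet> x)) - (LINT x:?A|lborel. (norm x)\<^sup>2 * (q (norm x) \<bullet> ((\<zeta> (norm x) / norm x) *\<^sub>R h (norm x))) / 2) = 0"
  proof -
    have "continuous_on {r0<..} (\<lambda>r. (\<zeta> r / r) *\<^sub>R h r)"
      using r0 by (intro continuous_intros c\<zeta> ch) auto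
    from mode1_orthogonal(1)[OF a this] show ?thesis by (simp only: set_integral_divide_zero)
  qed
  also have "(LINT x:?A|lborel. ((\<zeta> (norm x) * (rbar (norm x) - fl) / (norm x)\<^sup>2) *\<^sub>R b (norm x)) \<bullet> x) = 0"
    by (rule mode1_orthogonal(3)[OF a]) (use r0 in \<open>auto intro!: continuous_intros c\<zeta> cb continuous_rbar\<close>)
  finally show ?thesis by simp
qed

text \<open>Up to normalisation \<open>r * q' r\<close> is the first Fourier coefficient of the
  radial component of \<open>m - q\<close>, because the correction by \<open>rbar - fl\<close> is
  constant on circles. Pairing with the vector \<open>q'\<close> itself and Cauchy-Schwarz give the
  bound.\<close>

lemma q'_bound:
  assumes x: "x \<in> E"
  shows "(norm x)\<^sup>2 * (norm (q' (norm x)))\<^sup>2 \<le> 2 / pi * integral {0..2*pi} (\<lambda>t. (norm (m fl (rot t x) - q (norm x)))\<^sup>2)"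
proof -
  let ?r = "norm x" and ?I = "integral {0..2*pi}"
  let ?p = "\<lambda>t. m fl (rot t x) - q ?r"
  let ?b = "q' ?r"
  have r: "?r > 0" using E_nonzero[OF x] by simp
  have cp: "continuous_on S ?p" for S by (intro continuous_intros continuous_rot_curve[OF x continuous_m])
  have sub: "sphere 0 ?r \<subseteq> E" using x by (auto simp: ext_plane_def)
  have D: "?I (\<lambda>t. (Dv (rot t x) \<bullet> rot t x) * (?b \<bullet> rot t x)) = pi * ?r^3 * (?b \<bullet> ?b) + pi * ?r\<^sup>2 * (q ?r \<bullet> ?b)"
  proof -
    let ?J = "?I (\<lambda>t. (Dv (rot t (circ ?r)) \<bullet> rot t (circ 1)) *\<^sub>R rot t (circ 1))"
    have "?I (\<lambda>t. (Dv (rot t x) \<bullet> rot t x) * (?b \<bullet> rot t x)) = ?I (\<lambda>t. (Dv (rot t (circ ?r)) \<bullet> rot t (circ ?r)) * (?b \<bullet> rot t (circ ?r)))"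
      by (rule circle_integral_rot[where F="\<lambda>y. (Dv y \<bullet> y) * (?b \<bullet> y)"]) (intro continuous_intros continuous_on_subset[OF continuous_Dv sub])
    also have "\<dots> = ?I (\<lambda>t. ?r\<^sup>2 * (((Dv (rot t (circ ?r)) \<bullet> rot t (circ 1)) *\<^sub>R rot t (circ 1)) \<bullet> ?b))"
    proof -
      have "z \<bullet> rot t (circ ?r) = ?r * (z \<bullet> rot t (circ 1))" for z t by (subst circ_scale) simp
      then have "(Dv (rot t (circ ?r)) \<bullet> rot t (circ ?r)) * (?b \<bullet> rot t (circ ?r))
         = ?r\<^sup>2 * (((Dv (rot t (circ ?r)) \<bullet> rot t (circ 1)) *\<^sub>R rot t (circ 1)) \<bullet> ?b)" for t
        by (simp add: power2_eq_square inner_commute[of "q' _"])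
      then show ?thesis by (simp only:)
    qed
    also have "\<dots> = ?r\<^sup>2 * (?J \<bullet> ?b)"
    proof -
      have "(\<lambda>t. (Dv (rot t (circ ?r)) \<bullet> rot t (circ 1)) *\<^sub>R rot t (circ 1)) integrable_on {0..2*pi}"
        using circ_in_E[OF ext_planeD[OF x], of 0]
        by (intro integrable_continuous_interval continuous_intros continuous_rot_curve[OF _ continuous_Dv]) auto
      from integral_linear[OF this bounded_linear_inner_left[of ?b]] show ?thesis by (simp add: o_def)
    qed
    also have "?J = (pi * ?r) *\<^sub>R (?b + (1 / ?r) *\<^sub>R q ?r)" using r by (simp add: q'_def)
    finally show ?thesis using r by (simp add: inner_add_left algebra_simps power2_eq_square power3_eq_cube)
  qed
  \<comment> \<open>The term with \<open>q\<close> in \<open>D\<close> cancels against the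
    comparison with \<open>q\<close>, so that only the square of \<open>q'\<close> survives.\<close>
  have P: "?I (\<lambda>t. (?p t \<bullet> rot t x) * (?b \<bullet> rot t x)) = pi * ?r^3 * (?b \<bullet> ?b)"
  proof -
    have "?I (\<lambda>t. (?p t \<bullet> rot t x) * (?b \<bullet> rot t x)) = ?I (\<lambda>t. ((Dv (rot t x) \<bullet> rot t x) * (?b \<bullet> rot t x)
       + (rbar ?r - fl) * (?b \<bullet> rot t x)) - (q ?r \<bullet> rot t x) * (?b \<bullet> rot t x))"
      using x by (simp add: m_radial inner_diff_left algebra_simps)
    also have "\<dots> = (?I (\<lambda>t. (Dv (rot t x) \<bullet> rot t x) * (?b \<bullet> rot t x)) + (rbar ?r - fl) * ?I (\<lambda>t. ?b \<bullet> rot t x))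
       - ?I (\<lambda>t. (q ?r \<bullet> rot t x) * (?b \<bullet> rot t x))"
    proof -
      have 1: "(\<lambda>t. (Dv (rot t x) \<bullet> rot t x) * (?b \<bullet> rot t x)) integrable_on {0..2*pi}"
        "(\<lambda>t. (rbar ?r - fl) * (?b \<bullet> rot t x)) integrable_on {0..2*pi}"
        "(\<lambda>t. (q ?r \<bullet> rot t x) * (?b \<bullet> rot t x)) integrable_on {0..2*pi}"
        by (intro integrable_continuous_interval continuous_intros continuous_rot_curve[OF x continuous_Dv])+
      show ?thesis
        by (subst Henstock_Kurzweil_Integration.integral_diff[OF integrable_add[OF 1(1,2)] 1(3)],
            subst Henstock_Kurzweil_Integration.integral_add[OF 1(1,2)]) simp
    qed
    also have "\<dots> = pi * ?r^3 * (?b \<bullet> ?b)"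
      unfolding D integral_inner_rot integral_rot_inner_product by simp
    finally show ?thesis .
  qed
  have "pi * ?r^3 * (?b \<bullet> ?b) \<le> ?I (\<lambda>t. norm (?p t) * (?r * (norm ?b * ?r)))"
    unfolding P[symmetric]
  proof (intro integral_le integrable_continuous_interval continuous_intros continuous_rot_curve[OF x continuous_m])
    fix t
    have "(?p t \<bullet> rot t x) * (?b \<bullet> rot t x) \<le> \<bar>?p t \<bullet> rot t x\<bar> * \<bar>?b \<bullet> rot t x\<bar>"
      by (metis abs_ge_self abs_mult)
    also have "\<dots> \<le> (norm (?p t) * ?r) * (norm ?b * ?r)"
      using Cauchy_Schwarz_ineq2[of "?p t" "rot t x"] Cauchy_Schwarz_ineq2[of ?b "rot t x"]
      by (intro mult_mono) auto
    finally show "(?p t \<bullet> rot t x) * (?b \<bullet> rot t x) \<le> norm (?p t) * (?r * (norm ?b * ?r))" by simp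
  qed
  then have "(?r * ?r * norm ?b) * (pi * (?r * norm ?b)) \<le> (?r * ?r * norm ?b) * ?I (\<lambda>t. norm (?p t))"
    by (simp add: dot_square_norm power2_eq_square power3_eq_cube algebra_simps)
  then have le: "pi * (?r * norm ?b) \<le> ?I (\<lambda>t. norm (?p t))" if "norm ?b \<noteq> 0"
    using that r by (subst (asm) mult_le_cancel_left_pos) auto
  have I0: "0 \<le> ?I (\<lambda>t. norm (?p t))"
    by (intro Henstock_Kurzweil_Integration.integral_nonneg integrable_continuous_interval continuous_intros cp) auto
  have "pi * (?r * norm ?b) \<le> ?I (\<lambda>t. norm (?p t))" using le I0 by (cases "norm ?b = 0") auto
  then have "(pi * (?r * norm ?b))\<^sup>2 \<le> (?I (\<lambda>t. norm (?p t)))\<^sup>2" using r by (intro power_mono) auto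
  also have "\<dots> \<le> 2 * pi * ?I (\<lambda>t. (norm (?p t))\<^sup>2)"
    using weighted_Cauchy_Schwarz[of 0 "2*pi" "\<lambda>t. 1" "\<lambda>t. norm (?p t)"] by (simp add: continuous_on_norm[OF cp])
  finally show ?thesis by (simp add: power_mult_distrib power2_eq_square field_simps)
qed

end

section \<open>Tail integrals and cutoffs\<close>

text \<open>Zero beyond \<open>L\<close>; when \<open>f\<close> vanishes from \<open>L\<close> on,
  the function is therefore differentiable at \<open>L\<close> as well.\<close>

definition tail_integral :: "real \<Rightarrow> (real \<Rightarrow> 'a::euclidean_space) \<Rightarrow> real \<Rightarrow> 'a" where
  "tail_integral L f r = (if r \<le> L then integral {r..L} f else 0)"

lemma tail_integral_beyond: "L < r \<Longrightarrow> tail_integral L f r = 0"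
  by (simp add: tail_integral_def)

lemma tail_integral_deriv:
  fixes f :: "real \<Rightarrow> 'a::euclidean_space"
  assumes c: "continuous_on {r0<..} f" and z: "\<And>r. r \<ge> L \<Longrightarrow> f r = 0" and r: "r0 < r"
  shows "(tail_integral L f has_vector_derivative - f r) (at r)"
proof -
  define p where "p = (r0 + r) / 2"
  have p: "r0 < p" "p < r" using r by (auto simp: p_def)
  define B where "B = max L r + 1"
  have cB: "continuous_on {p..B} f" by (rule continuous_on_subset[OF c]) (use p in auto)
  have i: "f integrable_on {s..t}" if "p \<le> s" for s t
    by (intro integrable_continuous_interval continuous_on_subset[OF c]) (use p that in auto)
  have eq: "tail_integral L f s = integral {p..B} f - integral {p..s} f" if "s \<in> {p<..<B}" for s
  proof -
    have 1: "integral {p..s} f + integral {s..B} f = integral {p..B} f"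
      by (rule Henstock_Kurzweil_Integration.integral_combine) (use that i in auto)
    have "integral {s..B} f = tail_integral L f s"
    proof (cases "s \<le> L")
      case True
      have "integral {s..L} f + integral {L..B} f = integral {s..B} f"
        by (rule Henstock_Kurzweil_Integration.integral_combine) (use True that i in \<open>auto simp: B_def\<close>)
      moreover have "integral {L..B} f = integral {L..B} (\<lambda>x. 0)"
        by (intro Henstock_Kurzweil_Integration.integral_cong) (use z in auto)
      ultimately show ?thesis using True by (simp add: tail_integral_def)
    next
      case False
      have "integral {s..B} f = integral {s..B} (\<lambda>x. 0)"
        by (intro Henstock_Kurzweil_Integration.integral_cong) (use z False in auto)
      then show ?thesis using False by (simp add: tail_integral_def)
    qed
    then show ?thesis using 1 by (simp add: algebra_simps)
  qed
  have "((\<lambda>s. integral {p..s} f) has_vector_derivative f r) (at r within {p..B})"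
    by (rule integral_has_vector_derivative[OF cB]) (use p in \<open>auto simp: B_def\<close>)
  then have "((\<lambda>s. integral {p..s} f) has_vector_derivative f r) (at r)"
    using at_within_interior[of r "{p..B}"] p by (simp add: B_def)
  then have "((\<lambda>s. integral {p..B} f - integral {p..s} f) has_vector_derivative - f r) (at r)"
    by (auto intro!: derivative_eq_intros)
  then show ?thesis
    by (rule has_vector_derivative_transform_within_open[of _ _ _ "{p<..<B}"]) (use p eq in \<open>auto simp: B_def\<close>)
qed

lemma continuous_tail_integral:
  fixes f :: "real \<Rightarrow> 'a::euclidean_space"
  assumes c: "continuous_on {r0<..} f" and z: "\<And>r. r \<ge> L \<Longrightarrow> f r = 0"
  shows "continuous_on {r0<..} (tail_integral L f)"
  using tail_integral_deriv[OF assms] by (intro continuous_at_imp_continuous_on) (auto intro: has_vector_derivative_continuous)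

lemma maxsq_deriv: "((\<lambda>s::real. (max 0 s)\<^sup>2) has_real_derivative 2 * max 0 s) (at s)"
proof -
  consider "s > 0" | "s < 0" | "s = 0" by linarith
  then show ?thesis
  proof cases
    case 1
    have "((\<lambda>s::real. s\<^sup>2) has_real_derivative 2 * max 0 s) (at s)"
      using 1 by (auto intro!: derivative_eq_intros)
    then show ?thesis
      by (rule has_field_derivative_transform_within_open[where S="{0<..}"]) (use 1 in auto)
  next
    case 2
    have "((\<lambda>s::real. 0) has_real_derivative 2 * max 0 s) (at s)"
      using 2 by auto
    then show ?thesis
      by (rule has_field_derivative_transform_within_open[where S="{..<0}"]) (use 2 in auto)
  next
    case 3
    have "((\<lambda>h::real. (max 0 h)\<^sup>2 / h) \<longlongrightarrow> 0) (at 0)"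
    proof (rule Lim_null_comparison)
      have "norm ((max 0 h)\<^sup>2 / h) \<le> \<bar>h\<bar>" if "h \<noteq> 0" for h :: real
        using that by (auto simp: max_def power2_eq_square)
      then show "\<forall>\<^sub>F h in at (0::real). norm ((max 0 h)\<^sup>2 / h) \<le> \<bar>h\<bar>"
        by (auto simp: eventually_at intro!: exI[of _ 1])
      show "((\<lambda>h::real. \<bar>h\<bar>) \<longlongrightarrow> 0) (at 0)"
        by (auto intro!: tendsto_eq_intros)
    qed
    then show ?thesis using 3 by (simp add: DERIV_def)
  qed
qed

text \<open>A C^1 transition from 0 to 1 on the unit interval, a quotient of squares of positive
  parts that have no common zero. This regularity is all that \<open>C1c\<close> asks for.\<close>

definition step :: "real \<Rightarrow> real" where
  "step s = (max 0 s)\<^sup>2 / ((max 0 s)\<^sup>2 + (max 0 (1 - s))\<^sup>2)"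

definition step' :: "real \<Rightarrow> real" where
  "step' s = (2 * max 0 s * ((max 0 s)\<^sup>2 + (max 0 (1 - s))\<^sup>2) - (max 0 s)\<^sup>2 * (2 * max 0 s - 2 * max 0 (1 - s)))
     / ((max 0 s)\<^sup>2 + (max 0 (1 - s))\<^sup>2)\<^sup>2"

lemma step_denom: "(max 0 s)\<^sup>2 + (max 0 (1 - s))\<^sup>2 > (0::real)"
  by (cases "s > 0") (auto simp: max_def add_pos_nonneg)

lemma step_deriv: "(step has_real_derivative step' s) (at s)"
proof -
  have 1: "((\<lambda>s::real. (max 0 (1 - s))\<^sup>2) has_real_derivative - 2 * max 0 (1 - s)) (at s)"
  proof -
    have d: "((\<lambda>s::real. 1 - s) has_real_derivative -1) (at s)" by (auto intro!: derivative_eq_intros)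
    show ?thesis
      using DERIV_chain2[where f="\<lambda>s::real. (max 0 s)\<^sup>2" and g="\<lambda>s. 1 - s", OF maxsq_deriv d] by simp
  qed
  have "(step has_real_derivative (2 * max 0 s * ((max 0 s)\<^sup>2 + (max 0 (1 - s))\<^sup>2) - (max 0 s)\<^sup>2 * (2 * max 0 s + - 2 * max 0 (1 - s)))
     / (((max 0 s)\<^sup>2 + (max 0 (1 - s))\<^sup>2) * ((max 0 s)\<^sup>2 + (max 0 (1 - s))\<^sup>2))) (at s)"
    unfolding step_def[abs_def]
    by (rule DERIV_divide[OF maxsq_deriv DERIV_add[OF maxsq_deriv 1]]) (rule less_imp_neq[OF step_denom, symmetric])
  then show ?thesis by (simp add: step'_def power2_eq_square)
qed

lemma step_props:
  "s \<le> 0 \<Longrightarrow> step s = 0" "s \<ge> 1 \<Longrightarrow> step s = 1" "0 \<le> step s" "step s \<le> 1"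
  "s \<le> 0 \<Longrightarrow> step' s = 0" "s \<ge> 1 \<Longrightarrow> step' s = 0"
proof -
  show "0 \<le> step s" using step_denom[of s] by (simp add: step_def)
  show "step s \<le> 1" using step_denom[of s] by (simp add: step_def)
qed (auto simp: step_def step'_def max_def power2_eq_square)

lemma continuous_step': "continuous_on S step'"
proof -
  have "((max 0 s)\<^sup>2 + (max 0 (1 - s))\<^sup>2)\<^sup>2 \<noteq> 0" for s :: real
    by (rule power_not_zero[OF less_imp_neq[OF step_denom, symmetric]])
  then show ?thesis unfolding step'_def[abs_def] by (intro continuous_intros ballI)
qed

lemma step'_bounded: obtains B where "B > 0" "\<And>s. \<bar>step' s\<bar> \<le> B"
proof -
  have "bounded (step' ` {0..1})" by (intro compact_imp_bounded compact_continuous_image continuous_step') auto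
  then obtain B where "\<forall>y\<in>step' ` {0..1}. norm y \<le> B" unfolding bounded_iff by blast
  then have B: "\<bar>step' s\<bar> \<le> B" if "s \<in> {0..1}" for s using that by auto
  have "\<bar>step' s\<bar> \<le> max B 1" for s
    using B[of s] step_props(5,6)[of s] by (cases "s \<in> {0..1}") (auto simp: not_le)
  then show ?thesis by (intro that[of "max B 1"]) auto
qed

lemma ann_integral_bound:
  fixes f :: "real^2 \<Rightarrow> real"
  assumes cf: "continuous_on (ann a L) f" and "b \<le> L"
    and B: "\<And>x. x \<in> ann a b \<Longrightarrow> \<bar>f x\<bar> \<le> B" and z: "\<And>x. x \<in> ann a L \<Longrightarrow> norm x > b \<Longrightarrow> f x = 0"
  shows "\<bar>LINT x:ann a L|lborel. f x\<bar> \<le> B * measure lborel (ann a b)"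
proof -
  have sub: "ann a b \<subseteq> ann a L" using \<open>b \<le> L\<close> by (auto simp: ann_def)
  have "(LINT x:ann a L|lborel. f x) = (LINT x:ann a b|lborel. f x)"
    unfolding set_lebesgue_integral_def
  proof (rule Bochner_Integration.integral_cong[OF refl])
    fix x
    show "indicator (ann a L) x *\<^sub>R f x = indicator (ann a b) x *\<^sub>R f x"
      using z[of x] sub by (cases "x \<in> ann a L"; cases "x \<in> ann a b") (auto simp: ann_def)
  qed
  have i: "set_integrable lborel (ann a b) f" by (rule set_integrable_ann[OF continuous_on_subset[OF cf sub]])
  have fm: "ann a b \<in> fmeasurable lborel" by (rule fmeasurable_compact[OF compact_ann])
  have "\<bar>LINT x:ann a b|lborel. f x\<bar> \<le> (LINT x:ann a b|lborel. \<bar>f x\<bar>)"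
    using set_integral_norm_bound[OF i] by simp
  also have "\<dots> \<le> (LINT x:ann a b|lborel. B)"
    by (intro set_integral_mono set_integrable_abs i set_integrable_ann continuous_on_const B)
  also have "\<dots> = B * measure lborel (ann a b)"
    using fm by (simp add: set_lebesgue_integral_def mult.commute fmeasurable_def)
  finally show ?thesis using \<open>_ = (LINT x:ann a b|lborel. f x)\<close> by simp
qed

section \<open>The weak equation with zero flux\<close>

text \<open>
  For the right flux constant \<open>fl\<close> the weak equation admits, besides gradients, every compactly
  supported radial multiple of \<open>x\<close>.
\<close>

locale weak_field = closed_field +
  fixes F :: "real^2 \<Rightarrow> real^2" and fl :: real
  assumes F_meas: "(\<lambda>x. indicator E x *\<^sub>R F x) \<in> borel_measurable lebesgue"
    and F_L2: "set_integrable lebesgue E (\<lambda>x. (norm (F x))\<^sup>2)"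
    and weak: "\<And>\<psi> D h a L. C1c E \<psi> D \<Longrightarrow> r0 < a \<Longrightarrow> continuous_on {r0<..} h \<Longrightarrow> (\<And>r. r < a \<or> L < r \<Longrightarrow> h r = 0) \<Longrightarrow>
      (LINT x:E|lebesgue. ((m fl x - (norm (k x))\<^sup>2 *\<^sub>R k x) - F x) \<bullet> (D x + h (norm x) *\<^sub>R x)) = 0"
    and decay: "\<And>e. e > 0 \<Longrightarrow> \<exists>R. \<forall>x. norm x \<ge> R \<longrightarrow> norm (k x) \<le> e"
begin

text \<open>The flux of the equation, without \<open>F\<close>, after removal of the divergence-free
  field \<open>k - m\<close>.\<close>

definition "b1 x = m fl x - (norm (k x))\<^sup>2 *\<^sub>R k x"
definition "F2 = (LINT x:E|lebesgue. (norm (F x))\<^sup>2)"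

lemma continuous_b1: "continuous_on E b1"
  unfolding b1_def[abs_def] by (intro continuous_intros continuous_m ck)

lemma F2_nonneg: "F2 \<ge> 0"
  unfolding F2_def set_lebesgue_integral_def by (intro Bochner_Integration.integral_nonneg) auto

lemma set_integrable_ann_lebesgue:
  fixes f :: "real^2 \<Rightarrow> 'b::euclidean_space"
  assumes "continuous_on (ann a L) f"
  shows "set_integrable lebesgue (ann a L) f" "(LINT x:ann a L|lebesgue. f x) = (LINT x:ann a L|lborel. f x)"
proof -
  have i: "set_integrable lborel (ann a L) f" by (rule set_integrable_ann[OF assms])
  then have m: "(\<lambda>x. indicator (ann a L) x *\<^sub>R f x) \<in> borel_measurable lborel"
    by (auto simp: set_integrable_def)
  show "set_integrable lebesgue (ann a L) f"
    using i m by (simp add: set_integrable_def integrable_completion)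
  show "(LINT x:ann a L|lebesgue. f x) = (LINT x:ann a L|lborel. f x)"
    using m by (simp add: set_lebesgue_integral_def integral_completion)
qed

lemma F_ann:
  assumes "r0 < a"
  shows "set_integrable lebesgue (ann a L) F" "set_integrable lebesgue (ann a L) (\<lambda>x. (norm (F x))\<^sup>2)"
    "(LINT x:ann a L|lebesgue. (norm (F x))\<^sup>2) \<le> F2"
proof -
  let ?A = "ann a L"
  have sub: "?A \<subseteq> E" by (rule ann_subset_ext[OF assms])
  have A: "?A \<in> sets lebesgue" using compact_ann[of a L] by (simp add: borel_compact)
  show i2: "set_integrable lebesgue ?A (\<lambda>x. (norm (F x))\<^sup>2)"
    by (rule set_integrable_subset[OF F_L2 A sub])
  have eq: "indicator ?A x *\<^sub>R F x = indicator ?A x *\<^sub>R (indicator E x *\<^sub>R F x)" for x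
    using sub by (auto simp: indicator_def)
  have meas: "(\<lambda>x. indicator ?A x *\<^sub>R F x) \<in> borel_measurable lebesgue"
    unfolding eq by (rule borel_measurable_scaleR[OF borel_measurable_indicator[OF A] F_meas])
  have one: "integrable lebesgue (\<lambda>x. indicator ?A x *\<^sub>R (1::real))"
    using set_integrable_ann_lebesgue(1)[of a L "\<lambda>x. 1::real"] by (simp add: set_integrable_def)
  show "set_integrable lebesgue ?A F"
    unfolding set_integrable_def
  proof (rule Bochner_Integration.integrable_bound[OF Bochner_Integration.integrable_add[OF one i2[unfolded set_integrable_def]] meas])
    have "y \<le> 1 + y\<^sup>2" for y :: real
      using zero_le_power2[of "y - 1/2"] by (simp add: power2_eq_square algebra_simps)
    then show "AE x in lebesgue. norm (indicator ?A x *\<^sub>R F x) \<le> norm (indicator ?A x *\<^sub>R (1::real) + indicator ?A x *\<^sub>R (norm (F x))\<^sup>2)"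
      by (intro AE_I2) (auto simp: indicator_def)
  qed
  show "(LINT x:?A|lebesgue. (norm (F x))\<^sup>2) \<le> F2"
    unfolding F2_def set_lebesgue_integral_def
    by (rule integral_mono[OF i2[unfolded set_integrable_def] F_L2[unfolded set_integrable_def]])
      (use sub in \<open>auto simp: indicator_def\<close>)
qed

text \<open>\<open>F\<close> is only square integrable. It is separated here once and for all:
  pointwise it is absorbed into a multiple of its square, with total cost \<open>C0 * F2\<close>,
  and what remains to be estimated is the integral of a continuous function.\<close>

lemma weak_inequality:
  assumes psi: "C1c E \<psi> D" and a: "r0 < a" and ch: "continuous_on {r0<..} h" and hz: "\<And>r. r < a \<or> L < r \<Longrightarrow> h r = 0"
    and Dz: "\<And>x. x \<in> E \<Longrightarrow> x \<notin> ann a L \<Longrightarrow> D x = 0"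
    and cG: "continuous_on (ann a L) G"
    and pt: "\<And>x. x \<in> ann a L \<Longrightarrow> G x - C0 * (norm (F x))\<^sup>2 \<le> (b1 x - F x) \<bullet> (D x + h (norm x) *\<^sub>R x)"
    and C0: "C0 \<ge> 0"
  shows "(LINT x:ann a L|lborel. G x) \<le> C0 * F2"
proof -
  let ?A = "ann a L" and ?\<Psi> = "\<lambda>x. D x + h (norm x) *\<^sub>R x"
  have sub: "?A \<subseteq> E" by (rule ann_subset_ext[OF a])
  have c\<Psi>: "continuous_on ?A ?\<Psi>"
    using psi by (intro continuous_intros continuous_on_subset[OF continuous_on_radial_E[OF ch] sub])
      (auto simp: C1c_def intro: continuous_on_subset)
  have z: "?\<Psi> x = 0" if "x \<in> E" "x \<notin> ?A" for x
    using Dz[OF that] hz[of "norm x"] that by (auto simp: ann_def)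
  have "(LINT x:E|lebesgue. (b1 x - F x) \<bullet> ?\<Psi> x) = 0"
    unfolding b1_def by (rule weak[OF psi a ch hz])
  moreover have "(LINT x:E|lebesgue. (b1 x - F x) \<bullet> ?\<Psi> x) = (LINT x:?A|lebesgue. (b1 x - F x) \<bullet> ?\<Psi> x)"
    unfolding set_lebesgue_integral_def
  proof (rule Bochner_Integration.integral_cong[OF refl])
    fix x
    show "indicator E x *\<^sub>R ((b1 x - F x) \<bullet> ?\<Psi> x) = indicator ?A x *\<^sub>R ((b1 x - F x) \<bullet> ?\<Psi> x)"
      using z[of x] sub by (cases "x \<in> ?A"; cases "x \<in> E") auto
  qed
  ultimately have 0: "(LINT x:?A|lebesgue. (b1 x - F x) \<bullet> ?\<Psi> x) = 0" by simp
  have i: "set_integrable lebesgue ?A (\<lambda>x. (b1 x - F x) \<bullet> ?\<Psi> x)"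
  proof -
    have 1: "set_integrable lebesgue ?A (\<lambda>x. b1 x \<bullet> ?\<Psi> x)"
      by (intro set_integrable_ann_lebesgue continuous_intros c\<Psi> continuous_on_subset[OF continuous_b1 sub])
    have "bounded (?\<Psi> ` ?A)" by (intro compact_imp_bounded compact_continuous_image c\<Psi> compact_ann)
    then obtain B where B: "\<And>x. x \<in> ?A \<Longrightarrow> norm (?\<Psi> x) \<le> B" by (auto simp: bounded_iff)
    have "set_integrable lebesgue ?A (\<lambda>x. F x \<bullet> ?\<Psi> x)"
      unfolding set_integrable_def
    proof (rule Bochner_Integration.integrable_bound)
      show "integrable lebesgue (\<lambda>x. \<bar>B\<bar> * norm (indicator ?A x *\<^sub>R F x))"
        using F_ann(1)[OF a, of L] unfolding set_integrable_def by (intro integrable_mult_right integrable_norm)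
      have m1: "(\<lambda>x. indicator ?A x *\<^sub>R F x) \<in> borel_measurable lebesgue"
        using F_ann(1)[OF a, of L] by (auto simp: set_integrable_def)
      have m2: "(\<lambda>x. indicator ?A x *\<^sub>R ?\<Psi> x) \<in> borel_measurable lebesgue"
        using set_integrable_ann_lebesgue(1)[OF c\<Psi>] by (auto simp: set_integrable_def)
      have "(\<lambda>x. indicator ?A x *\<^sub>R (F x \<bullet> ?\<Psi> x)) = (\<lambda>x. (indicator ?A x *\<^sub>R F x) \<bullet> (indicator ?A x *\<^sub>R ?\<Psi> x))"
        by (auto simp: indicator_def)
      then show "(\<lambda>x. indicator ?A x *\<^sub>R (F x \<bullet> ?\<Psi> x)) \<in> borel_measurable lebesgue"
        using borel_measurable_inner[OF m1 m2] by simp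
      show "AE x in lebesgue. norm (indicator ?A x *\<^sub>R (F x \<bullet> ?\<Psi> x)) \<le> norm (\<bar>B\<bar> * norm (indicator ?A x *\<^sub>R F x))"
      proof (rule AE_I2)
        fix x
        have "\<bar>F x \<bullet> ?\<Psi> x\<bar> \<le> \<bar>B\<bar> * norm (F x)" if "x \<in> ?A"
        proof -
          have "\<bar>F x \<bullet> ?\<Psi> x\<bar> \<le> norm (F x) * norm (?\<Psi> x)" by (rule Cauchy_Schwarz_ineq2)
          also have "\<dots> \<le> norm (F x) * \<bar>B\<bar>" using B[OF that] by (intro mult_left_mono) auto
          finally show ?thesis by (simp add: mult.commute)
        qed
        then show "norm (indicator ?A x *\<^sub>R (F x \<bullet> ?\<Psi> x)) \<le> norm (\<bar>B\<bar> * norm (indicator ?A x *\<^sub>R F x))"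
          by (cases "x \<in> ?A") auto
      qed
    qed
    then show ?thesis using set_integral_diff(1)[OF 1] by (simp add: inner_diff_left)
  qed
  have iG: "set_integrable lebesgue ?A G" by (rule set_integrable_ann_lebesgue[OF cG])
  have iF: "set_integrable lebesgue ?A (\<lambda>x. C0 * (norm (F x))\<^sup>2)" using F_ann(2)[OF a] by simp
  have "(LINT x:?A|lebesgue. G x - C0 * (norm (F x))\<^sup>2) \<le> (LINT x:?A|lebesgue. (b1 x - F x) \<bullet> ?\<Psi> x)"
    by (intro set_integral_mono set_integral_diff iG iF i pt)
  then have "(LINT x:?A|lebesgue. G x) \<le> (LINT x:?A|lebesgue. C0 * (norm (F x))\<^sup>2)"
    unfolding 0 set_integral_diff(2)[OF iG iF] by simp
  also have "\<dots> = C0 * (LINT x:?A|lebesgue. (norm (F x))\<^sup>2)" by simp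
  also have "\<dots> \<le> C0 * F2" by (intro mult_left_mono F_ann(3)[OF a] C0)
  finally show ?thesis by (simp add: set_integrable_ann_lebesgue(2)[OF cG])
qed

end

section \<open>The weighted energy inequality\<close>

definition cube :: "real^2 \<Rightarrow> real^2" where "cube y = (norm y)\<^sup>2 *\<^sub>R y"

lemma continuous_on_cube [continuous_intros]: "continuous_on S f \<Longrightarrow> continuous_on S (\<lambda>x. cube (f x))"
  unfolding cube_def by (intro continuous_intros)

lemma norm_cube: "norm (cube y) = norm y ^ 3"
  by (simp add: cube_def power2_eq_square power3_eq_cube)

lemma tail_has_integral:
  fixes f :: "real \<Rightarrow> 'a::euclidean_space"
  assumes "continuous_on {r0<..} f" "r0 < r" "r \<le> L"
  shows "(f has_integral tail_integral L f r) {r..L}"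
proof -
  have "f integrable_on {r..L}"
    by (intro integrable_continuous_interval continuous_on_subset[OF assms(1)]) (use assms in auto)
  then show ?thesis using assms(3) by (simp add: tail_integral_def integrable_integral)
qed

lemma tail_norm_bound:
  fixes f :: "real \<Rightarrow> 'a::euclidean_space" and g :: "real \<Rightarrow> real"
  assumes cf: "continuous_on {r0<..} f" and cg: "continuous_on {r0<..} g" and "r0 < a" "a \<le> r"
    and le: "\<And>R. a \<le> R \<Longrightarrow> R \<le> L \<Longrightarrow> norm (f R) \<le> g R" and int: "integral {a..L} g \<le> A" "0 \<le> A"
  shows "norm (tail_integral L f r) \<le> A"
proof (cases "r \<le> L")
  case True
  have ig: "g integrable_on {p..L}" if "a \<le> p" for p
    by (intro integrable_continuous_interval continuous_on_subset[OF cg]) (use assms that in auto)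
  have if': "f integrable_on {r..L}"
    by (intro integrable_continuous_interval continuous_on_subset[OF cf]) (use assms in auto)
  have "norm (integral {r..L} f) \<le> integral {r..L} g"
    by (rule integral_norm_bound_integral[OF if' ig[OF \<open>a \<le> r\<close>]]) (use le assms in auto)
  also have "\<dots> \<le> integral {a..L} g"
    by (intro integral_subset_le ig) (use assms in \<open>auto intro: order_trans[OF norm_ge_zero le]\<close>)
  finally show ?thesis using True int by (simp add: tail_integral_def)
qed (use int in \<open>simp add: tail_integral_def\<close>)

text \<open>
  The method is used twice: with \<open>Q = q\<close>, \<open>H = saw2\<close>, \<open>W = \<pi>/4\<close>, \<open>s = 2\<close>, and with \<open>Q = 0\<close>, \<open>H = saw\<close>,
  \<open>W = \<pi>/2\<close>, \<open>s = 1\<close>. In both cases \<open>s W / 2 = \<pi>/4\<close>, and the estimate closes because this is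
  less than \<open>1\<close>. The function \<open>\<rho>\<close> absorbs the difference of \<open>k\<close> and \<open>m\<close>.
\<close>

locale energy = weak_field +
  fixes Q Q' :: "real \<Rightarrow> real^2" and H :: "real \<Rightarrow> real" and W s a0 :: real and \<rho> :: "real \<Rightarrow> real" and V0 B0 Z :: real
  assumes Qcase: "(Q = q \<and> Q' = q') \<or> (Q = (\<lambda>_. 0) \<and> Q' = (\<lambda>_. 0))"
    and cH: "continuous_on {0..2*pi} H" and W: "W = integral {0..2*pi} (\<lambda>t. \<bar>H t\<bar>)" "0 < W" "W \<le> 8/5"
    and s: "0 \<le> s" "s \<le> 2" "s * W \<le> 8/5"
    and rep: "\<And>x. x \<in> E \<Longrightarrow> v x - Q (norm x) \<bullet> x = angular_mean H (\<lambda>y. (Dv y - Q (norm y)) \<bullet> perp y) x"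
    and a0: "r0 < a0"
    and Q_small: "\<And>r. a0 \<le> r \<Longrightarrow> norm (Q r) \<le> 1"
    and cube_diff: "\<And>x R. a0 \<le> norm x \<Longrightarrow> norm x \<le> R \<Longrightarrow>
       norm (cube (k x) - cube (Q R)) \<le> 1/100 * norm (m fl x - Q R) + \<rho> (norm x)"
    and c\<rho>: "continuous_on {r0<..} \<rho>" and \<rho>: "\<And>r. a0 \<le> r \<Longrightarrow> 0 \<le> \<rho> r"
    and V0: "\<And>x. x \<in> ann a0 (a0 + 1) \<Longrightarrow> \<bar>v x\<bar> \<le> V0"
    and B0: "\<And>x. x \<in> ann a0 (a0 + 1) \<Longrightarrow> norm (b1 x) \<le> B0"
    and Z: "\<And>t. \<bar>step' t\<bar> \<le> Z"
begin

lemma a0_pos: "a0 > 0" using a0 r0 by simp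

lemma Q_deriv: "r0 < r \<Longrightarrow> (Q has_vector_derivative Q' r) (at r)"
  using Qcase q_deriv by auto

lemma continuous_Q: "continuous_on {r0<..} Q" and continuous_Q': "continuous_on {r0<..} Q'"
  using Qcase continuous_q continuous_q' by auto

definition "\<zeta> r = step (r - a0)"
definition "\<zeta>' r = step' (r - a0)"

lemma \<zeta>_deriv: "(\<zeta> has_real_derivative \<zeta>' r) (at r)"
proof -
  have d: "((\<lambda>r. r - a0) has_real_derivative 1) (at r)" by (auto intro!: derivative_eq_intros)
  show ?thesis
    using DERIV_chain2[where f=step and g="\<lambda>r. r - a0", OF step_deriv d] by (simp add: \<zeta>_def[abs_def] \<zeta>'_def)
qed

lemma \<zeta>_props: "r \<le> a0 \<Longrightarrow> \<zeta> r = 0" "r \<ge> a0 + 1 \<Longrightarrow> \<zeta> r = 1" "0 \<le> \<zeta> r" "\<zeta> r \<le> 1"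
  "r \<ge> a0 + 1 \<Longrightarrow> \<zeta>' r = 0" "\<bar>\<zeta>' r\<bar> \<le> Z"
  using step_props[of "r - a0"] Z by (auto simp: \<zeta>_def \<zeta>'_def)

lemma continuous_\<zeta>: "continuous_on S \<zeta>" and continuous_\<zeta>': "continuous_on S \<zeta>'"
proof -
  show "continuous_on S \<zeta>" using DERIV_isCont[OF \<zeta>_deriv] by (intro continuous_at_imp_continuous_on) auto
  show "continuous_on S \<zeta>'" unfolding \<zeta>'_def[abs_def]
    by (rule continuous_on_compose2[OF continuous_step'[of UNIV]]) (intro continuous_on_diff continuous_on_id continuous_on_const subset_UNIV)+
qed

lemma V0_nonneg: "0 \<le> V0" and B0_nonneg: "0 \<le> B0" and Z_nonneg: "0 \<le> Z"
proof -
  have "circ a0 \<in> ann a0 (a0 + 1)" using a0_pos by (simp add: ann_def norm_circ)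
  from order_trans[OF abs_ge_zero V0[OF this]] order_trans[OF norm_ge_zero B0[OF this]]
  show "0 \<le> V0" "0 \<le> B0" .
  show "0 \<le> Z" using Z[of 0] by simp
qed

definition "vol = measure lborel (ann a0 (a0 + 1))"

text \<open>Coefficient of the square of \<open>F\<close>: 25 from the bulk estimate with
  \<open>\<alpha> r \<le> A\<close>, 25 from the shell estimate with
  \<open>r * \<omega> r \<le> A\<close>, the rest from the inner cutoff.\<close>

definition "C0 A = 50 * A + Z * (A * V0 + A * (a0 + 1))"

text \<open>The weight enters only through \<open>A\<close>. This uniformity is what allows the
  parameters of the weights to be sent to infinity.\<close>

definition "Cst A = C0 A * F2 + 25 * A + Z * (A * V0 + A * (a0 + 1)) * (B0 + 1) * vol
   + Z * ((a0 + 1) * (2 * A) / 2 + V0 * (2 * A)) * vol + 2 * (Z * ((a0 + 1) * A / 2 + V0 * A) * vol)"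

end

text \<open>One constant \<open>A\<close> bounds the moments of the weight and the weighted error
  \<open>\<rho>\<close>. The weight may depend on further parameters as long as \<open>A\<close>
  stays fixed.\<close>

locale weighted_energy = energy +
  fixes \<omega> \<omega>' :: "real \<Rightarrow> real" and L A :: real
  assumes \<omega>_deriv: "\<And>r. r0 < r \<Longrightarrow> (\<omega> has_real_derivative \<omega>' r) (at r)" and continuous_\<omega>': "continuous_on {r0<..} \<omega>'"
    and \<omega>_nonneg: "\<And>r. a0 \<le> r \<Longrightarrow> 0 \<le> \<omega> r" and \<omega>_zero: "\<And>r. L \<le> r \<Longrightarrow> \<omega> r = 0"
    and L: "a0 + 1 \<le> L" and A: "0 \<le> A"
    and A1: "\<And>r. a0 \<le> r \<Longrightarrow> r * \<omega> r \<le> A"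
    and A2: "integral {a0..L} \<omega> \<le> A"
    and A3: "integral {a0..L} (\<lambda>r. r * \<omega> r * norm (Q' r)) \<le> A"
    and A4: "(LINT x:ann a0 L|lborel. (tail_integral L \<omega> (norm x) + norm x * \<omega> (norm x)) * (\<rho> (norm x))\<^sup>2) \<le> A"
begin

lemma continuous_\<omega>: "continuous_on {r0<..} \<omega>"
  using \<omega>_deriv by (intro continuous_at_imp_continuous_on) (auto intro: DERIV_isCont)

text \<open>
  Constants solve the equation, so \<open>m\<close> may be compared with \<open>Q R\<close> on the disc of radius \<open>R\<close>.
  Integrating over \<open>R\<close> against the weight \<open>\<omega>\<close> gives
  \<open>P x = \<integral>\<^bsub>|x|\<^esub>\<^sup>\<infinity> \<omega> R |m x - Q R|\<^sup>2 dR\<close>, with the square expanded.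
\<close>

definition "e y = y - cube y"
definition "\<alpha> = tail_integral L \<omega>"
definition "\<beta> = tail_integral L (\<lambda>R. \<omega> R *\<^sub>R Q R)"
definition "\<kappa> = tail_integral L (\<lambda>R. \<omega> R * (Q R \<bullet> Q R))"
definition "be = tail_integral L (\<lambda>R. \<omega> R *\<^sub>R e (Q R))"
definition "\<kappa>e = tail_integral L (\<lambda>R. (\<omega> R *\<^sub>R e (Q R)) \<bullet> Q R)"
definition "b2 = tail_integral L (\<lambda>R. (R * \<omega> R) *\<^sub>R Q' R)"
definition "\<kappa>2 = tail_integral L (\<lambda>R. ((R * \<omega> R) *\<^sub>R Q' R) \<bullet> Q R)"
definition "P x = \<alpha> (norm x) * (m fl x \<bullet> m fl x) - 2 * (m fl x \<bullet> \<beta> (norm x)) + \<kappa> (norm x)"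
definition "p x = m fl x - Q (norm x)"
definition "v2 x = v x - Q (norm x) \<bullet> x"

abbreviation "AA \<equiv> ann a0 L"

lemma AA_sub: "AA \<subseteq> E" by (rule ann_subset_ext[OF a0])

lemma e_le: "a0 \<le> r \<Longrightarrow> norm (e (Q r)) \<le> 2"
proof -
  assume "a0 \<le> r"
  from Q_small[OF this] have "norm (Q r) ^ 3 \<le> 1" by (simp add: power_le_one)
  then show ?thesis using Q_small[OF \<open>a0 \<le> r\<close>] norm_triangle_ineq4[of "Q r" "cube (Q r)"]
    by (simp add: e_def norm_cube)
qed

lemmas c_intros = continuous_intros continuous_\<omega> continuous_\<omega>' continuous_Q continuous_Q' continuous_\<zeta> continuous_\<zeta>' c\<rho> continuous_rbar

lemma c_kernels:
  "continuous_on {r0<..} (\<lambda>R. \<omega> R *\<^sub>R Q R)" "continuous_on {r0<..} (\<lambda>R. \<omega> R * (Q R \<bullet> Q R))"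
  "continuous_on {r0<..} (\<lambda>R. \<omega> R *\<^sub>R e (Q R))" "continuous_on {r0<..} (\<lambda>R. (\<omega> R *\<^sub>R e (Q R)) \<bullet> Q R)"
  "continuous_on {r0<..} (\<lambda>R. (R * \<omega> R) *\<^sub>R Q' R)" "continuous_on {r0<..} (\<lambda>R. ((R * \<omega> R) *\<^sub>R Q' R) \<bullet> Q R)"
  unfolding e_def by (intro c_intros)+

lemma c_tails:
  "continuous_on {r0<..} \<alpha>" "continuous_on {r0<..} \<beta>" "continuous_on {r0<..} \<kappa>"
  "continuous_on {r0<..} be" "continuous_on {r0<..} \<kappa>e" "continuous_on {r0<..} b2" "continuous_on {r0<..} \<kappa>2"
  unfolding \<alpha>_def \<beta>_def \<kappa>_def be_def \<kappa>e_def b2_def \<kappa>2_def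
  by (rule continuous_tail_integral[OF continuous_\<omega>] continuous_tail_integral[OF c_kernels(1)] continuous_tail_integral[OF c_kernels(2)]
    continuous_tail_integral[OF c_kernels(3)] continuous_tail_integral[OF c_kernels(4)] continuous_tail_integral[OF c_kernels(5)]
    continuous_tail_integral[OF c_kernels(6)]; simp add: \<omega>_zero)+

lemmas c_E = continuous_on_radial_E[OF c_tails(1)] continuous_on_radial_E[OF c_tails(2)] continuous_on_radial_E[OF c_tails(3)]
  continuous_on_radial_E[OF c_tails(4)] continuous_on_radial_E[OF c_tails(5)] continuous_on_radial_E[OF c_tails(6)]
  continuous_on_radial_E[OF c_tails(7)] continuous_on_radial_E[OF continuous_\<omega>] continuous_on_radial_E[OF continuous_Q]
  continuous_on_radial_E[OF continuous_\<zeta>] continuous_on_radial_E[OF continuous_\<zeta>'] continuous_on_radial_E[OF c\<rho>]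
  continuous_m continuous_v continuous_b1 continuous_Dv

lemma c_P: "continuous_on E P" and c_p: "continuous_on E p" and c_v2: "continuous_on E v2"
  unfolding P_def[abs_def] p_def[abs_def] v2_def[abs_def] by (intro continuous_intros c_E)+

lemma iA: "continuous_on E f \<Longrightarrow> set_integrable lborel AA f" for f :: "real^2 \<Rightarrow> real"
  by (rule set_integrable_ann[OF continuous_on_subset[OF _ AA_sub]])

lemma AA_D: "x \<in> AA \<Longrightarrow> r0 < norm x" "x \<in> AA \<Longrightarrow> norm x \<le> L" "x \<in> AA \<Longrightarrow> a0 \<le> norm x" "x \<in> AA \<Longrightarrow> norm x > 0" "x \<in> AA \<Longrightarrow> x \<in> E"
  using a0 a0_pos AA_sub by (auto simp: ann_def)

lemma \<alpha>_bounds: "a0 \<le> r \<Longrightarrow> 0 \<le> \<alpha> r" "a0 \<le> r \<Longrightarrow> \<alpha> r \<le> A" "a0 \<le> r \<Longrightarrow> norm (\<beta> r) \<le> A"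
proof -
  assume r: "a0 \<le> r"
  show "0 \<le> \<alpha> r" unfolding \<alpha>_def tail_integral_def
    using r a0 \<omega>_nonneg by (auto intro!: Henstock_Kurzweil_Integration.integral_nonneg integrable_continuous_interval continuous_on_subset[OF continuous_\<omega>])
  have "norm (\<alpha> r) \<le> A" unfolding \<alpha>_def
    by (rule tail_norm_bound[OF continuous_\<omega> continuous_\<omega> a0 r _ A2 A]) (use \<omega>_nonneg in auto)
  then show "\<alpha> r \<le> A" by simp
  show "norm (\<beta> r) \<le> A" unfolding \<beta>_def
  proof (rule tail_norm_bound[OF c_kernels(1) continuous_\<omega> a0 r _ A2 A])
    fix R assume "a0 \<le> R"
    then show "norm (\<omega> R *\<^sub>R Q R) \<le> \<omega> R"
      using \<omega>_nonneg[of R] Q_small[of R] mult_left_mono[of "norm (Q R)" 1 "\<omega> R"] by simp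
  qed
qed

text \<open>Unites the two cases of \<open>Q\<close>. For \<open>Q = q\<close> this is
  \<open>mode_mean_identity\<close>, and only the shell where \<open>\<zeta>\<close> varies
  contributes; for \<open>Q = 0\<close> the assumption \<open>h0\<close> makes both tails
  vanish.\<close>

lemma mean_term:
  fixes h :: "real \<Rightarrow> real^2"
  assumes ch: "continuous_on {r0<..} h" and hz: "\<And>r. L \<le> r \<Longrightarrow> h r = 0"
    and h0: "Q = (\<lambda>_. 0) \<Longrightarrow> Q' = (\<lambda>_. 0) \<Longrightarrow> h = (\<lambda>_. 0)"
    and bnd: "\<And>r. a0 \<le> r \<Longrightarrow> norm (tail_integral L h r) \<le> B" "\<And>r. a0 \<le> r \<Longrightarrow> \<bar>tail_integral L (\<lambda>R. h R \<bullet> Q R) r\<bar> \<le> B"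
  shows "\<bar>LINT x:AA|lborel. \<zeta> (norm x) * (m fl x \<bullet> tail_integral L h (norm x) - tail_integral L (\<lambda>R. h R \<bullet> Q R) (norm x))\<bar>
     \<le> Z * ((a0 + 1) * B / 2 + V0 * B) * vol"
proof -
  let ?b = "tail_integral L h" and ?k = "tail_integral L (\<lambda>R. h R \<bullet> Q R)"
  have chQ: "continuous_on {r0<..} (\<lambda>R. h R \<bullet> Q R)" by (intro c_intros ch)
  have cb: "continuous_on {r0<..} ?b" by (rule continuous_tail_integral[OF ch hz])
  have ck: "continuous_on {r0<..} ?k" by (rule continuous_tail_integral[OF chQ]) (simp add: hz)
  have B: "0 \<le> B" using bnd(2)[of a0] by simp
  have eq: "(LINT x:AA|lborel. \<zeta> (norm x) * (m fl x \<bullet> ?b (norm x) - ?k (norm x)))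
     = (LINT x:AA|lborel. \<zeta>' (norm x) * (norm x * ?k (norm x) / 2 - v x * (x \<bullet> ?b (norm x)) / norm x))"
    using Qcase
  proof
    assume Q: "Q = q \<and> Q' = q'"
    show ?thesis
    proof (rule mode_mean_identity[OF a0])
      show "(\<zeta> has_real_derivative \<zeta>' r) (at r)" for r by (rule \<zeta>_deriv)
      show "(?b has_vector_derivative - h r) (at r)" if "r0 < r" for r by (rule tail_integral_deriv[OF ch hz that])
      show "(?k has_real_derivative - (h r \<bullet> q r)) (at r)" if "r0 < r" for r
        using tail_integral_deriv[OF chQ _ that, of L] Q by (simp add: hz has_real_derivative_iff_has_vector_derivative)
    qed (auto simp: \<zeta>_props tail_integral_beyond ch continuous_\<zeta>')
  next
    assume "Q = (\<lambda>_. 0) \<and> Q' = (\<lambda>_. 0)"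
    then have "h = (\<lambda>_. 0)" using h0 by simp
    then have "?b r = 0" "?k r = 0" for r by (simp_all add: tail_integral_def)
    then show ?thesis by simp
  qed
  have "\<bar>LINT x:AA|lborel. \<zeta>' (norm x) * (norm x * ?k (norm x) / 2 - v x * (x \<bullet> ?b (norm x)) / norm x)\<bar>
     \<le> Z * ((a0 + 1) * B / 2 + V0 * B) * vol"
    unfolding vol_def
  proof (rule ann_integral_bound[OF _ L])
    show "continuous_on AA (\<lambda>x. \<zeta>' (norm x) * (norm x * ?k (norm x) / 2 - v x * (x \<bullet> ?b (norm x)) / norm x))"
      using AA_D(4) by (intro continuous_on_subset[OF _ AA_sub] continuous_intros c_E continuous_on_radial_E[OF cb] continuous_on_radial_E[OF ck])
        (auto simp: E_nonzero)
    fix x assume x: "x \<in> ann a0 (a0 + 1)"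
    then have n: "a0 \<le> norm x" "norm x \<le> a0 + 1" "norm x > 0" using a0_pos by (auto simp: ann_def)
    have "\<bar>norm x * ?k (norm x) / 2\<bar> \<le> (a0 + 1) * B / 2"
      using n bnd(2)[OF n(1)] a0_pos by (simp add: abs_mult mult_mono)
    moreover have "\<bar>v x * (x \<bullet> ?b (norm x)) / norm x\<bar> \<le> V0 * B"
    proof -
      have "\<bar>x \<bullet> ?b (norm x)\<bar> / norm x \<le> norm (?b (norm x))"
        using Cauchy_Schwarz_ineq2[of x "?b (norm x)"] n by (simp add: field_simps)
      then have "\<bar>x \<bullet> ?b (norm x)\<bar> / norm x \<le> B" using bnd(1)[OF n(1)] by linarith
      then have "\<bar>v x\<bar> * (\<bar>x \<bullet> ?b (norm x)\<bar> / norm x) \<le> V0 * B"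
        using V0[OF x] V0_nonneg by (intro mult_mono) auto
      then show ?thesis by (simp add: abs_mult)
    qed
    ultimately have "\<bar>norm x * ?k (norm x) / 2 - v x * (x \<bullet> ?b (norm x)) / norm x\<bar> \<le> (a0 + 1) * B / 2 + V0 * B"
      by linarith
    then show "\<bar>\<zeta>' (norm x) * (norm x * ?k (norm x) / 2 - v x * (x \<bullet> ?b (norm x)) / norm x)\<bar> \<le> Z * ((a0 + 1) * B / 2 + V0 * B)"
      unfolding abs_mult using \<zeta>_props(6)[of "norm x"] Z_nonneg by (intro mult_mono) auto
  qed (use \<zeta>_props in auto)
  then show ?thesis unfolding eq .
qed

text \<open>For fixed \<open>R\<close> let \<open>y = m fl x - Q R\<close>. Then
  \<open>b1 x = y + e (Q R) - d\<close> with \<open>d\<close> the difference of the cubes, so the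
  product with \<open>y\<close> is the square of \<open>y\<close>, plus the linear term
  \<open>e (Q R) \<bullet> y\<close>, which is kept, minus \<open>(d + f) \<bullet> y\<close>, which
  is absorbed. The claim is the integral of this over \<open>R\<close> against
  \<open>\<omega>\<close>.\<close>

lemma energy_density:
  assumes x: "x \<in> AA"
  shows "97/100 * P x + (m fl x \<bullet> be (norm x) - \<kappa>e (norm x)) - 25 * \<alpha> (norm x) * ((\<rho> (norm x))\<^sup>2 + (norm f)\<^sup>2)
    \<le> (b1 x - f) \<bullet> (\<alpha> (norm x) *\<^sub>R m fl x - \<beta> (norm x))"
proof -
  let ?r = "norm x" and ?M = "m fl x"
  note xr = AA_D[OF x]
  define c where "c = 25 * ((\<rho> ?r)\<^sup>2 + (norm f)\<^sup>2)"
  define \<Theta> where "\<Theta> R = ((b1 x - f) \<bullet> ?M) * \<omega> R - (b1 x - f) \<bullet> (\<omega> R *\<^sub>R Q R)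
    - 97/100 * ((?M \<bullet> ?M) * \<omega> R - 2 * (?M \<bullet> (\<omega> R *\<^sub>R Q R)) + \<omega> R * (Q R \<bullet> Q R))
    - (?M \<bullet> (\<omega> R *\<^sub>R e (Q R)) - (\<omega> R *\<^sub>R e (Q R)) \<bullet> Q R) + c * \<omega> R" for R
  define T where "T = ((b1 x - f) \<bullet> ?M) * \<alpha> ?r - (b1 x - f) \<bullet> \<beta> ?r
    - 97/100 * ((?M \<bullet> ?M) * \<alpha> ?r - 2 * (?M \<bullet> \<beta> ?r) + \<kappa> ?r)
    - (?M \<bullet> be ?r - \<kappa>e ?r) + c * \<alpha> ?r"
  have inn: "((\<lambda>R. y \<bullet> g R) has_integral y \<bullet> i) S" if "(g has_integral i) S" for y i :: "real^2" and g :: "real \<Rightarrow> real^2" and S :: "real set"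
    using has_integral_linear[OF that bounded_linear_inner_right[of y]] by (simp add: o_def)
  have "(\<Theta> has_integral T) {?r..L}"
    unfolding \<Theta>_def T_def \<alpha>_def \<beta>_def \<kappa>_def be_def \<kappa>e_def
    by (intro has_integral_add has_integral_diff has_integral_mult_right inn tail_has_integral[OF _ xr(1,2)] c_kernels continuous_\<omega>)
  moreover have "0 \<le> \<Theta> R" if R: "R \<in> {?r..L}" for R
  proof -
    define y where "y = ?M - Q R"
    define d where "d = cube (k x) - cube (Q R)"
    have dn: "norm d \<le> 1/100 * norm y + \<rho> ?r"
      unfolding d_def y_def by (rule cube_diff) (use xr R in auto)
    have \<rho>0: "0 \<le> \<rho> ?r" using \<rho> xr by auto
    have eq: "\<Theta> R = \<omega> R * (c + 3/100 * (y \<bullet> y) - (d + f) \<bullet> y)"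
    proof -
      have "\<Theta> R = \<omega> R * ((b1 x - f) \<bullet> y - 97/100 * (y \<bullet> y) - e (Q R) \<bullet> y + c)"
        by (simp add: \<Theta>_def y_def inner_diff_left inner_diff_right inner_commute[of "Q R" ?M] inner_commute[of ?M "e (Q R)"] algebra_simps)
      moreover have "b1 x = y + e (Q R) - d"
        by (simp add: b1_def y_def e_def d_def cube_def)
      ultimately show ?thesis
        by (simp add: inner_diff_left inner_add_left algebra_simps)
    qed
    have "(d + f) \<bullet> y \<le> norm (d + f) * norm y" by (rule norm_cauchy_schwarz)
    also have "\<dots> \<le> (1/100 * norm y + \<rho> ?r + norm f) * norm y"
      using norm_triangle_ineq[of d f] dn by (intro mult_right_mono) auto
    \<comment> \<open>Of the 3/100 given up, 1/100 pays for \<open>cube_diff\<close> and 1/100 each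
      for \<open>\<rho>\<close> and \<open>f\<close>; the price is the factor 25, since
      \<open>2 * sqrt (1/100 * 25) = 1\<close>.\<close>
    also have "\<dots> \<le> c + 3/100 * (norm y)\<^sup>2"
    proof -
      have "0 \<le> (norm y / 10 - 5 * \<rho> ?r)\<^sup>2 + (norm y / 10 - 5 * norm f)\<^sup>2" by simp
      then show ?thesis by (simp add: c_def power2_eq_square algebra_simps)
    qed
    finally have "0 \<le> c + 3/100 * (y \<bullet> y) - (d + f) \<bullet> y" by (simp add: dot_square_norm)
    then show ?thesis unfolding eq using \<omega>_nonneg[of R] xr R by (intro mult_nonneg_nonneg) auto
  qed
  ultimately have "0 \<le> T" by (rule has_integral_nonneg)
  then show ?thesis
    by (simp add: T_def P_def c_def inner_diff_right inner_scaleR_right algebra_simps)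
qed

text \<open>The balance \<open>1 / (2 * W)\<close> against \<open>W / 2\<close> in the main product
  is chosen so that \<open>g4_bound\<close>, which costs \<open>W\<^sup>2\<close>, leaves the same
  factor \<open>W / 2\<close> on the tangential and on the radial part of \<open>p\<close>. The
  small terms use up \<open>1/40 = 1/200 + 1/100 + 1/100\<close> of the square of
  \<open>v2\<close>.\<close>

lemma shell_density:
  assumes x: "x \<in> AA"
  shows "- ((1 / (2 * W) + 1/40) * ((v2 x)\<^sup>2 / norm x) + W / 2 * ((p x \<bullet> x)\<^sup>2 / norm x) + 1/200 * (norm x * (norm (p x))\<^sup>2)
     + 25 * norm x * ((\<rho> (norm x))\<^sup>2 + (norm f)\<^sup>2)) - v2 x * (e (Q (norm x)) \<bullet> x) / norm x
     \<le> - (v2 x * ((b1 x - f) \<bullet> x) / norm x)"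
proof -
  define r where "r = norm x"
  have r: "r > 0" "a0 \<le> r" using AA_D[OF x] by (auto simp: r_def)
  define d where "d = cube (k x) - cube (Q r)"
  define V where "V = v2 x"
  have dn: "norm d \<le> 1/100 * norm (p x) + \<rho> r"
    unfolding d_def p_def r_def by (rule cube_diff) (use r in \<open>auto simp: r_def\<close>)
  have b: "b1 x = p x + e (Q r) - d"
    by (simp add: b1_def p_def e_def d_def cube_def r_def)
  have am: "2 * (\<bar>V\<bar> * y) \<le> t * V\<^sup>2 / r + r * y\<^sup>2 / t" if "t > 0" for y t
  proof -
    have "0 \<le> (t * \<bar>V\<bar> - r * y)\<^sup>2" by simp
    then have "2 * (\<bar>V\<bar> * y) * (t * r) \<le> t\<^sup>2 * V\<^sup>2 + r\<^sup>2 * y\<^sup>2"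
      by (simp add: power2_eq_square algebra_simps flip: abs_mult)
    then have "2 * (\<bar>V\<bar> * y) \<le> (t\<^sup>2 * V\<^sup>2 + r\<^sup>2 * y\<^sup>2) / (t * r)"
      using that r by (simp add: pos_le_divide_eq)
    also have "\<dots> = t * V\<^sup>2 / r + r * y\<^sup>2 / t"
      using that r by (simp add: power2_eq_square field_simps)
    finally show ?thesis .
  qed
  have n1: "\<bar>y \<bullet> x\<bar> / r \<le> norm y" for y
    using Cauchy_Schwarz_ineq2[of y x] r by (simp add: r_def field_simps)
  have 1: "V * (p x \<bullet> x) / r \<le> 1 / (2 * W) * (V\<^sup>2 / r) + W / 2 * ((p x \<bullet> x)\<^sup>2 / r)"
  proof -
    have "V * (p x \<bullet> x) / r \<le> \<bar>V\<bar> * (\<bar>p x \<bullet> x\<bar> / r)"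
      using abs_ge_self[of "V * (p x \<bullet> x) / r"] r by (simp add: abs_mult)
    also have "2 * \<dots> \<le> (1 / W) * V\<^sup>2 / r + r * (\<bar>p x \<bullet> x\<bar> / r)\<^sup>2 / (1 / W)"
      by (rule am) (use W in auto)
    also have "\<dots> = 2 * (1 / (2 * W) * (V\<^sup>2 / r) + W / 2 * ((p x \<bullet> x)\<^sup>2 / r))"
      using r by (simp add: power_divide power2_eq_square field_simps)
    finally show ?thesis by simp
  qed
  have 2: "\<bar>V * (d \<bullet> x) / r\<bar> \<le> 1/200 * (V\<^sup>2 / r) + 1/200 * (r * (norm (p x))\<^sup>2) + (1/100 * (V\<^sup>2 / r) + 25 * r * (\<rho> r)\<^sup>2)"
  proof -
    have "\<bar>V * (d \<bullet> x) / r\<bar> = \<bar>V\<bar> * (\<bar>d \<bullet> x\<bar> / r)" using r by (simp add: abs_mult)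
    also have "\<dots> \<le> \<bar>V\<bar> * (1/100 * norm (p x) + \<rho> r)"
      using n1[of d] dn by (intro mult_left_mono) auto
    also have "\<dots> = 1/200 * (2 * (\<bar>V\<bar> * norm (p x))) + 1/2 * (2 * (\<bar>V\<bar> * \<rho> r))" by (simp add: algebra_simps)
    also have "\<dots> \<le> 1/200 * (1 * V\<^sup>2 / r + r * (norm (p x))\<^sup>2 / 1) + 1/2 * ((1/50) * V\<^sup>2 / r + r * (\<rho> r)\<^sup>2 / (1/50))"
      by (intro add_mono mult_left_mono am) auto
    also have "\<dots> = 1/200 * (V\<^sup>2 / r) + 1/200 * (r * (norm (p x))\<^sup>2) + (1/100 * (V\<^sup>2 / r) + 25 * r * (\<rho> r)\<^sup>2)"
      by (simp add: algebra_simps)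
    finally show ?thesis .
  qed
  have 3: "\<bar>V * (f \<bullet> x) / r\<bar> \<le> 1/100 * (V\<^sup>2 / r) + 25 * r * (norm f)\<^sup>2"
  proof -
    have "\<bar>V * (f \<bullet> x) / r\<bar> = \<bar>V\<bar> * (\<bar>f \<bullet> x\<bar> / r)" using r by (simp add: abs_mult)
    also have "\<dots> \<le> \<bar>V\<bar> * norm f" using n1[of f] by (intro mult_left_mono) auto
    also have "\<dots> = 1/2 * (2 * (\<bar>V\<bar> * norm f))" by simp
    also have "\<dots> \<le> 1/2 * ((1/50) * V\<^sup>2 / r + r * (norm f)\<^sup>2 / (1/50))"
      by (intro mult_left_mono am) auto
    also have "\<dots> = 1/100 * (V\<^sup>2 / r) + 25 * r * (norm f)\<^sup>2" by simp
    finally show ?thesis .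
  qed
  have eq: "V * ((b1 x - f) \<bullet> x) / r = V * (p x \<bullet> x) / r + V * (e (Q r) \<bullet> x) / r - V * (d \<bullet> x) / r - V * (f \<bullet> x) / r"
    unfolding b using r by (simp add: inner_diff_left inner_add_left field_simps)
  have "V * ((b1 x - f) \<bullet> x) / r \<le> ((1 / (2 * W) + 1/40) * (V\<^sup>2 / r) + W / 2 * ((p x \<bullet> x)\<^sup>2 / r) + 1/200 * (r * (norm (p x))\<^sup>2)
     + 25 * r * ((\<rho> r)\<^sup>2 + (norm f)\<^sup>2)) + V * (e (Q r) \<bullet> x) / r"
    using 1 abs_le_D2[OF 2] abs_le_D2[OF 3] unfolding eq distrib_left distrib_right by linarith
  then show ?thesis by (simp add: r_def V_def)
qed

end

context weighted_energy
begin

text \<open>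
  The superposition over \<open>R > |x|\<close>, with weight \<open>\<omega> R\<close>, of the competitors \<open>v x - Q R \<bullet> x\<close>, cut off
  near the inner boundary.
\<close>

definition "\<psi> x = \<zeta> (norm x) * (\<alpha> (norm x) * v x - \<beta> (norm x) \<bullet> x)"
text \<open>Differentiating the tails \<open>\<alpha>\<close> and \<open>\<beta>\<close> produces
  \<open>- \<omega> r\<close> and \<open>- (\<omega> r *\<^sub>R Q r)\<close>, which combine to the
  term with \<open>v2\<close>: the boundary contribution of the disc of radius
  \<open>norm x\<close>.\<close>

definition "D\<psi> x = \<zeta> (norm x) *\<^sub>R (\<alpha> (norm x) *\<^sub>R Dv x - \<beta> (norm x) - (\<omega> (norm x) / norm x * v2 x) *\<^sub>R x)
   + (\<zeta>' (norm x) / norm x * (\<alpha> (norm x) * v x - \<beta> (norm x) \<bullet> x)) *\<^sub>R x"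

lemma \<psi>_deriv:
  assumes x: "x \<in> E"
  shows "(\<psi> has_derivative (\<lambda>h. D\<psi> x \<bullet> h)) (at x)"
proof -
  note nx = E_nonzero(1)[OF x] ext_planeD[OF x]
  have d\<alpha>: "((\<lambda>x. \<alpha> (norm x)) has_derivative (\<lambda>h. (x \<bullet> h / norm x) *\<^sub>R (- \<omega> (norm x)))) (at x)"
    unfolding \<alpha>_def by (rule radial_has_derivative[OF tail_integral_deriv[OF continuous_\<omega> \<omega>_zero nx(2)] nx(1)])
  have d\<beta>: "((\<lambda>x. \<beta> (norm x)) has_derivative (\<lambda>h. (x \<bullet> h / norm x) *\<^sub>R (- (\<omega> (norm x) *\<^sub>R Q (norm x))))) (at x)"
    unfolding \<beta>_def by (rule radial_has_derivative[OF tail_integral_deriv[OF c_kernels(1) _ nx(2)] nx(1)]) (simp add: \<omega>_zero)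
  have d\<zeta>: "((\<lambda>x. \<zeta> (norm x)) has_derivative (\<lambda>h. (x \<bullet> h / norm x) *\<^sub>R \<zeta>' (norm x))) (at x)"
    by (rule radial_has_derivative[OF _ nx(1)]) (use \<zeta>_deriv in \<open>simp add: has_real_derivative_iff_has_vector_derivative\<close>)
  have "(\<psi> has_derivative (\<lambda>h. \<zeta> (norm x) * ((\<alpha> (norm x) * (Dv x \<bullet> h) + ((x \<bullet> h / norm x) *\<^sub>R (- \<omega> (norm x))) * v x)
      - (\<beta> (norm x) \<bullet> h + ((x \<bullet> h / norm x) *\<^sub>R (- (\<omega> (norm x) *\<^sub>R Q (norm x)))) \<bullet> x))
      + ((x \<bullet> h / norm x) *\<^sub>R \<zeta>' (norm x)) * (\<alpha> (norm x) * v x - \<beta> (norm x) \<bullet> x))) (at x)"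
    unfolding \<psi>_def[abs_def]
    by (intro has_derivative_mult has_derivative_diff has_derivative_inner d\<zeta> d\<alpha> d\<beta> v_deriv[OF x] has_derivative_ident)
  moreover have "\<zeta> (norm x) * ((\<alpha> (norm x) * (Dv x \<bullet> h) + ((x \<bullet> h / norm x) *\<^sub>R (- \<omega> (norm x))) * v x)
      - (\<beta> (norm x) \<bullet> h + ((x \<bullet> h / norm x) *\<^sub>R (- (\<omega> (norm x) *\<^sub>R Q (norm x)))) \<bullet> x))
      + ((x \<bullet> h / norm x) *\<^sub>R \<zeta>' (norm x)) * (\<alpha> (norm x) * v x - \<beta> (norm x) \<bullet> x) = D\<psi> x \<bullet> h" for h
    using nx(1) by (simp add: D\<psi>_def v2_def inner_add_left inner_diff_left field_simps)
  ultimately show ?thesis by simp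
qed

lemma c_D\<psi>: "continuous_on E D\<psi>"
  unfolding D\<psi>_def[abs_def] using E_nonzero by (intro continuous_intros c_E c_v2) auto

lemma \<psi>_C1c: "C1c E \<psi> (\<lambda>x. if x \<in> AA then D\<psi> x else 0)"
proof (rule C1c_extend[OF open_ext_plane \<psi>_deriv c_D\<psi> compact_ann AA_sub])
  fix x assume "x \<notin> AA"
  then show "\<psi> x = 0"
    using \<zeta>_props(1)[of "norm x"] by (auto simp: \<psi>_def ann_def not_le \<alpha>_def \<beta>_def tail_integral_beyond)
qed

section \<open>The tested equation, term by term\<close>

text \<open>\<open>g1\<close> is the bulk energy, \<open>g2\<close> the term linear in
  \<open>m\<close>, \<open>g3\<close> the error from \<open>\<rho>\<close>. On the shell,
  \<open>g6\<close> splits into the radial part \<open>g5\<close> and the tangential part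
  \<open>g5'\<close>; \<open>g4\<close> is the part to which the kernel bound applies, and
  \<open>g7\<close> is linear in \<open>v2\<close>. The inner cutoff gives
  \<open>g8\<close>.\<close>

definition "g1 x = \<zeta> (norm x) * P x"
definition "g2 x = \<zeta> (norm x) * (m fl x \<bullet> be (norm x) - \<kappa>e (norm x))"
definition "g3 x = \<zeta> (norm x) * ((\<alpha> (norm x) + norm x * \<omega> (norm x)) * (\<rho> (norm x))\<^sup>2)"
definition "g4 x = \<zeta> (norm x) * (\<omega> (norm x) * ((v2 x)\<^sup>2 / norm x))"
definition "g5 x = \<zeta> (norm x) * (\<omega> (norm x) * ((p x \<bullet> x)\<^sup>2 / norm x))"
definition "g5' x = \<zeta> (norm x) * (\<omega> (norm x) * ((p x \<bullet> perp x)\<^sup>2 / norm x))"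
definition "g6 x = \<zeta> (norm x) * (\<omega> (norm x) * (norm x * (norm (p x))\<^sup>2))"
definition "g7 x = \<zeta> (norm x) * (\<omega> (norm x) * (v2 x * (e (Q (norm x)) \<bullet> x) / norm x))"
definition "g8 x = \<bar>\<zeta>' (norm x)\<bar> * (\<alpha> (norm x) * \<bar>v x\<bar> + norm (\<beta> (norm x)) * norm x) * (norm (b1 x) + 1)"

lemma c_g: "continuous_on E g1" "continuous_on E g2" "continuous_on E g3" "continuous_on E g4" "continuous_on E g5"
  "continuous_on E g5'" "continuous_on E g6" "continuous_on E g7" "continuous_on E g8"
  unfolding g1_def[abs_def] g2_def[abs_def] g3_def[abs_def] g4_def[abs_def] g5_def[abs_def] g5'_def[abs_def] g6_def[abs_def]
    g7_def[abs_def] g8_def[abs_def] e_def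
  using E_nonzero by (intro continuous_intros c_E c_P c_p c_v2; auto)+

lemmas i_g = c_g[THEN iA]

text \<open>Bulk energy \<open>IP\<close> and shell energy \<open>JJ\<close>, both superposed over
  radii with the weight. The argument plays \<open>bulk_bound\<close> and
  \<open>shell_vs_bulk\<close> against each other.\<close>

definition "IP = (LINT x:AA|lborel. g1 x)"
definition "JJ = (LINT x:AA|lborel. g6 x)"

text \<open>The gradient of \<open>\<psi>\<close> contains \<open>\<alpha>\<close> times
  \<open>Dv\<close>; the radial test field supplies exactly the part that turns this into
  \<open>\<alpha>\<close> times \<open>m\<close>, see \<open>m_eq\<close>. The two density estimates
  then apply, and everything with \<open>\<zeta>'\<close> is bounded on its fixed shell.\<close>

lemma g_weak: "(LINT x:AA|lborel. 97/100 * g1 x + g2 x - 25 * g3 x - (1 / (2 * W) + 1/40) * g4 x - W / 2 * g5 x - 1/200 * g6 x - g7 x - g8 x)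
   \<le> C0 A * F2"
proof (rule weak_inequality[OF \<psi>_C1c a0, where h="\<lambda>r. \<zeta> r * \<alpha> r * ((rbar r - fl) / r\<^sup>2)"])
  show "continuous_on {r0<..} (\<lambda>r. \<zeta> r * \<alpha> r * ((rbar r - fl) / r\<^sup>2))"
    using r0 by (intro c_intros c_tails) auto
  show "\<zeta> r * \<alpha> r * ((rbar r - fl) / r\<^sup>2) = 0" if "r < a0 \<or> L < r" for r
    using that \<zeta>_props(1)[of r] by (auto simp: \<alpha>_def tail_integral_beyond)
  show "continuous_on AA (\<lambda>x. 97/100 * g1 x + g2 x - 25 * g3 x - (1 / (2 * W) + 1/40) * g4 x - W / 2 * g5 x - 1/200 * g6 x - g7 x - g8 x)"
    by (intro continuous_intros continuous_on_subset[OF _ AA_sub] c_g)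
  show "0 \<le> C0 A"
    unfolding C0_def using A Z_nonneg V0_nonneg a0_pos by (intro add_nonneg_nonneg mult_nonneg_nonneg) auto
  fix x assume x: "x \<in> AA"
  note xr = AA_D[OF x]
  define r where "r = norm x"
  have r: "r > 0" "a0 \<le> r" "r \<le> L" using xr by (auto simp: r_def)
  let ?f = "F x"
  define Y where "Y = \<alpha> r * v x - \<beta> r \<bullet> x"
  have \<Psi>: "(if x \<in> AA then D\<psi> x else 0) + (\<zeta> r * \<alpha> r * ((rbar r - fl) / r\<^sup>2)) *\<^sub>R x
     = \<zeta> r *\<^sub>R (\<alpha> r *\<^sub>R m fl x - \<beta> r) - (\<zeta> r * \<omega> r * v2 x / r) *\<^sub>R x + (\<zeta>' r * Y / r) *\<^sub>R x"
    using x m_eq[OF xr(5)] by (simp add: D\<psi>_def Y_def scaleR_add_right scaleR_diff_right mult.assoc flip: r_def)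
  have 1: "\<zeta> r * (97/100 * P x + (m fl x \<bullet> be r - \<kappa>e r) - 25 * \<alpha> r * ((\<rho> r)\<^sup>2 + (norm ?f)\<^sup>2))
     \<le> \<zeta> r * ((b1 x - ?f) \<bullet> (\<alpha> r *\<^sub>R m fl x - \<beta> r))"
    using energy_density[OF x, of ?f] \<zeta>_props(3)[of r] by (intro mult_left_mono) (auto simp: r_def)
  have 2: "(\<zeta> r * \<omega> r) * (- ((1 / (2 * W) + 1/40) * ((v2 x)\<^sup>2 / r) + W / 2 * ((p x \<bullet> x)\<^sup>2 / r) + 1/200 * (r * (norm (p x))\<^sup>2)
     + 25 * r * ((\<rho> r)\<^sup>2 + (norm ?f)\<^sup>2)) - v2 x * (e (Q r) \<bullet> x) / r)
     \<le> (\<zeta> r * \<omega> r) * (- (v2 x * ((b1 x - ?f) \<bullet> x) / r))"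
    using shell_density[OF x, of ?f] \<zeta>_props(3)[of r] \<omega>_nonneg[OF r(2)] by (intro mult_left_mono) (auto simp: r_def)
  have Y: "\<bar>Y\<bar> \<le> \<alpha> r * \<bar>v x\<bar> + norm (\<beta> r) * r"
  proof -
    have "\<bar>Y\<bar> \<le> \<bar>\<alpha> r * v x\<bar> + \<bar>\<beta> r \<bullet> x\<bar>" unfolding Y_def by linarith
    also have "\<dots> \<le> \<alpha> r * \<bar>v x\<bar> + norm (\<beta> r) * r"
      using Cauchy_Schwarz_ineq2[of "\<beta> r" x] \<alpha>_bounds(1)[OF r(2)] by (intro add_mono) (auto simp: abs_mult r_def)
    finally show ?thesis .
  qed
  define S where "S = \<bar>\<zeta>' r\<bar> * (\<alpha> r * \<bar>v x\<bar> + norm (\<beta> r) * r)"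
  have S0: "0 \<le> S" unfolding S_def using \<alpha>_bounds(1)[OF r(2)] r by (intro mult_nonneg_nonneg add_nonneg_nonneg) auto
  have S1: "S \<le> Z * (A * V0 + A * (a0 + 1))"
  proof (cases "r \<le> a0 + 1")
    case True
    then have "x \<in> ann a0 (a0 + 1)" using r by (simp add: ann_def r_def)
    from V0[OF this] have "\<alpha> r * \<bar>v x\<bar> \<le> A * V0" using \<alpha>_bounds(1,2)[OF r(2)] by (intro mult_mono) auto
    moreover have "norm (\<beta> r) * r \<le> A * (a0 + 1)" using \<alpha>_bounds(3)[OF r(2)] True r A by (intro mult_mono) auto
    moreover have "0 \<le> \<alpha> r * \<bar>v x\<bar> + norm (\<beta> r) * r" using \<alpha>_bounds(1)[OF r(2)] r by auto
    ultimately show ?thesis unfolding S_def using \<zeta>_props(6)[of r] Z_nonneg by (intro mult_mono) auto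
  next
    case False
    then have "S = 0" using \<zeta>_props(5)[of r] by (simp add: S_def)
    then show ?thesis using A Z_nonneg V0_nonneg a0_pos by (auto intro!: mult_nonneg_nonneg add_nonneg_nonneg)
  qed
  have 3: "- (S * (norm (b1 x) + 1 + (norm ?f)\<^sup>2)) \<le> \<zeta>' r * Y / r * ((b1 x - ?f) \<bullet> x)"
  proof -
    have "\<bar>(b1 x - ?f) \<bullet> x\<bar> \<le> (norm (b1 x) + norm ?f) * r"
      using Cauchy_Schwarz_ineq2[of "b1 x - ?f" x] mult_right_mono[OF norm_triangle_ineq4[of "b1 x" ?f], of r] r
      unfolding r_def by linarith
    then have "\<bar>(b1 x - ?f) \<bullet> x\<bar> / r \<le> norm (b1 x) + norm ?f" using r by (simp add: field_simps)
    also have "\<dots> \<le> norm (b1 x) + 1 + (norm ?f)\<^sup>2"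
      using zero_le_power2[of "norm ?f - 1/2"] by (simp add: power2_eq_square algebra_simps)
    finally have "\<bar>(b1 x - ?f) \<bullet> x\<bar> / r \<le> norm (b1 x) + 1 + (norm ?f)\<^sup>2" .
    moreover have "\<bar>\<zeta>' r * Y\<bar> \<le> S" unfolding S_def abs_mult by (intro mult_left_mono Y) auto
    ultimately have "\<bar>\<zeta>' r * Y\<bar> * (\<bar>(b1 x - ?f) \<bullet> x\<bar> / r) \<le> S * (norm (b1 x) + 1 + (norm ?f)\<^sup>2)"
      using S0 r by (intro mult_mono) auto
    moreover have "\<bar>\<zeta>' r * Y / r * ((b1 x - ?f) \<bullet> x)\<bar> = \<bar>\<zeta>' r * Y\<bar> * (\<bar>(b1 x - ?f) \<bullet> x\<bar> / r)"
      using r by (simp add: abs_mult)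
    ultimately show ?thesis by linarith
  qed
  have 4: "(25 * (\<zeta> r * \<alpha> r) + 25 * (\<zeta> r * (r * \<omega> r)) + S) * (norm ?f)\<^sup>2 \<le> C0 A * (norm ?f)\<^sup>2"
  proof (intro mult_right_mono)
    have "\<zeta> r * \<alpha> r \<le> 1 * A" using \<zeta>_props(3,4)[of r] \<alpha>_bounds(1,2)[OF r(2)] by (intro mult_mono) auto
    moreover have "\<zeta> r * (r * \<omega> r) \<le> 1 * A" using \<zeta>_props(3,4)[of r] A1[OF r(2)] \<omega>_nonneg[OF r(2)] r by (intro mult_mono) auto
    ultimately show "25 * (\<zeta> r * \<alpha> r) + 25 * (\<zeta> r * (r * \<omega> r)) + S \<le> C0 A" using S1 by (simp add: C0_def)
  qed simp
  have "97/100 * g1 x + g2 x - 25 * g3 x - (1 / (2 * W) + 1/40) * g4 x - W / 2 * g5 x - 1/200 * g6 x - g7 x - g8 x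
      - (25 * (\<zeta> r * \<alpha> r) + 25 * (\<zeta> r * (r * \<omega> r)) + S) * (norm ?f)\<^sup>2
    = \<zeta> r * (97/100 * P x + (m fl x \<bullet> be r - \<kappa>e r) - 25 * \<alpha> r * ((\<rho> r)\<^sup>2 + (norm ?f)\<^sup>2))
     + (\<zeta> r * \<omega> r) * (- ((1 / (2 * W) + 1/40) * ((v2 x)\<^sup>2 / r) + W / 2 * ((p x \<bullet> x)\<^sup>2 / r) + 1/200 * (r * (norm (p x))\<^sup>2)
     + 25 * r * ((\<rho> r)\<^sup>2 + (norm ?f)\<^sup>2)) - v2 x * (e (Q r) \<bullet> x) / r)
     - S * (norm (b1 x) + 1 + (norm ?f)\<^sup>2)"
    unfolding g1_def g2_def g3_def g4_def g5_def g6_def g7_def g8_def r_def[symmetric] S_def by algebra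
  also have "\<dots> \<le> \<zeta> r * ((b1 x - ?f) \<bullet> (\<alpha> r *\<^sub>R m fl x - \<beta> r)) + (\<zeta> r * \<omega> r) * (- (v2 x * ((b1 x - ?f) \<bullet> x) / r))
     + \<zeta>' r * Y / r * ((b1 x - ?f) \<bullet> x)"
    using 1 2 3 by linarith
  also have "\<dots> = (b1 x - ?f) \<bullet> ((if x \<in> AA then D\<psi> x else 0) + (\<zeta> r * \<alpha> r * ((rbar r - fl) / r\<^sup>2)) *\<^sub>R x)"
    unfolding \<Psi> inner_add_right inner_diff_right[of _ "_ *\<^sub>R _" "_ *\<^sub>R x"] inner_scaleR_right by simp
  finally show "97/100 * g1 x + g2 x - 25 * g3 x - (1 / (2 * W) + 1/40) * g4 x - W / 2 * g5 x - 1/200 * g6 x - g7 x - g8 x - C0 A * (norm ?f)\<^sup>2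
    \<le> (b1 x - ?f) \<bullet> ((if x \<in> AA then D\<psi> x else 0) + (\<zeta> (norm x) * \<alpha> (norm x) * ((rbar (norm x) - fl) / (norm x)\<^sup>2)) *\<^sub>R x)"
    using 4 unfolding r_def by linarith
qed auto

lemma g2_bound: "\<bar>LINT x:AA|lborel. g2 x\<bar> \<le> Z * ((a0 + 1) * (2 * A) / 2 + V0 * (2 * A)) * vol"
  unfolding g2_def be_def \<kappa>e_def
proof (rule mean_term[OF c_kernels(3)])
  show "\<omega> r *\<^sub>R e (Q r) = 0" if "L \<le> r" for r using \<omega>_zero[OF that] by simp
  show "(\<lambda>R. \<omega> R *\<^sub>R e (Q R)) = (\<lambda>_. 0)" if "Q = (\<lambda>_. 0)" using that by (simp add: e_def cube_def)
  have le: "norm (\<omega> R *\<^sub>R e (Q R)) \<le> 2 * \<omega> R" if "a0 \<le> R" for R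
    using \<omega>_nonneg[OF that] e_le[OF that] mult_left_mono[of "norm (e (Q R))" 2 "\<omega> R"] by simp
  have int: "integral {a0..L} (\<lambda>R. 2 * \<omega> R) \<le> 2 * A" using A2 by simp
  fix r assume r: "a0 \<le> r"
  show "norm (tail_integral L (\<lambda>R. \<omega> R *\<^sub>R e (Q R)) r) \<le> 2 * A"
    by (rule tail_norm_bound[OF c_kernels(3) _ a0 r le int]) (use A in \<open>auto intro: continuous_intros continuous_\<omega>\<close>)
  have "norm (tail_integral L (\<lambda>R. (\<omega> R *\<^sub>R e (Q R)) \<bullet> Q R) r) \<le> 2 * A"
  proof (rule tail_norm_bound[OF c_kernels(4) _ a0 r _ int])
    fix R assume R: "a0 \<le> R"
    have "norm ((\<omega> R *\<^sub>R e (Q R)) \<bullet> Q R) \<le> norm (\<omega> R *\<^sub>R e (Q R)) * norm (Q R)"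
      unfolding real_norm_def by (rule Cauchy_Schwarz_ineq2)
    also have "\<dots> \<le> 2 * \<omega> R * 1" using le[OF R] Q_small[OF R] \<omega>_nonneg[OF R] by (intro mult_mono) auto
    finally show "norm ((\<omega> R *\<^sub>R e (Q R)) \<bullet> Q R) \<le> 2 * \<omega> R" by simp
  qed (use A in \<open>auto intro: continuous_intros continuous_\<omega>\<close>)
  then show "\<bar>tail_integral L (\<lambda>R. (\<omega> R *\<^sub>R e (Q R)) \<bullet> Q R) r\<bar> \<le> 2 * A" by simp
qed

lemma g3_bound: "(LINT x:AA|lborel. g3 x) \<le> A"
proof -
  have "(LINT x:AA|lborel. g3 x) \<le> (LINT x:AA|lborel. (\<alpha> (norm x) + norm x * \<omega> (norm x)) * (\<rho> (norm x))\<^sup>2)"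
  proof (intro set_integral_mono i_g iA)
    show "continuous_on E (\<lambda>x. (\<alpha> (norm x) + norm x * \<omega> (norm x)) * (\<rho> (norm x))\<^sup>2)" by (intro continuous_intros c_E)
    fix x assume x: "x \<in> AA"
    have "0 \<le> (\<alpha> (norm x) + norm x * \<omega> (norm x)) * (\<rho> (norm x))\<^sup>2"
      using \<alpha>_bounds(1) \<omega>_nonneg AA_D(3)[OF x] by auto
    then show "g3 x \<le> (\<alpha> (norm x) + norm x * \<omega> (norm x)) * (\<rho> (norm x))\<^sup>2"
      unfolding g3_def using \<zeta>_props(3,4)[of "norm x"] by (metis mult_left_le_one_le)
  qed
  then show ?thesis using A4 by (simp add: \<alpha>_def)
qed

text \<open>The place where the kernel norm enters: \<open>angular_mean_L2\<close> with the radial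
  weight \<open>\<zeta> r * \<omega> r / r\<close>.\<close>

lemma g4_bound: "(LINT x:AA|lborel. g4 x) \<le> W\<^sup>2 * (LINT x:AA|lborel. g5' x)"
proof -
  let ?g = "\<lambda>y. (Dv y - Q (norm y)) \<bullet> perp y"
  let ?\<eta> = "\<lambda>r. \<zeta> r * \<omega> r / r"
  have "(LINT x:AA|lborel. ?\<eta> (norm x) * (angular_mean H ?g x)\<^sup>2) \<le> (integral {0..2*pi} (\<lambda>t. \<bar>H t\<bar>))\<^sup>2 * (LINT x:AA|lborel. ?\<eta> (norm x) * (?g x)\<^sup>2)"
  proof (rule angular_mean_L2[OF _ a0 cH])
    show "continuous_on E ?g" by (intro continuous_intros c_E)
    show "continuous_on {a0..L} ?\<eta>"
      using a0 r0 by (intro continuous_intros continuous_\<zeta> continuous_on_subset[OF continuous_\<omega>]) auto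
    show "0 \<le> ?\<eta> r" if "a0 \<le> r" for r
      using that \<zeta>_props(3)[of r] \<omega>_nonneg[OF that] a0_pos by auto
  qed
  moreover have "(LINT x:AA|lborel. ?\<eta> (norm x) * (angular_mean H ?g x)\<^sup>2) = (LINT x:AA|lborel. g4 x)"
    by (rule ann_integral_cong) (simp add: g4_def v2_def rep[OF AA_D(5)])
  moreover have "(LINT x:AA|lborel. ?\<eta> (norm x) * (?g x)\<^sup>2) = (LINT x:AA|lborel. g5' x)"
    by (rule ann_integral_cong) (simp add: g5'_def p_def inner_diff_left m_perp[OF AA_D(5)])
  ultimately show ?thesis by (simp add: W)
qed

lemma g6_split: "JJ = (LINT x:AA|lborel. g5 x) + (LINT x:AA|lborel. g5' x)"
proof -
  have "g6 x = g5 x + g5' x" if x: "x \<in> AA" for x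
  proof -
    have "(norm (p x))\<^sup>2 * (norm x)\<^sup>2 = (p x \<bullet> x)\<^sup>2 + (p x \<bullet> perp x)\<^sup>2"
      using perp_pythagoras[of "p x" x] by (simp add: dot_square_norm)
    then have "norm x * (norm (p x))\<^sup>2 = (p x \<bullet> x)\<^sup>2 / norm x + (p x \<bullet> perp x)\<^sup>2 / norm x"
      using AA_D(4)[OF x] by (simp add: power2_eq_square field_simps)
    then show ?thesis by (simp add: g6_def g5_def g5'_def algebra_simps)
  qed
  then have "JJ = (LINT x:AA|lborel. g5 x + g5' x)" unfolding JJ_def by (rule ann_integral_cong)
  then show ?thesis using i_g by (simp add: set_integral_add)
qed

text \<open>For \<open>Q = q\<close> the function \<open>v2\<close> has no first mode and is
  orthogonal on circles to the linear function \<open>e (Q r) \<bullet> x\<close>; for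
  \<open>Q = 0\<close> the factor \<open>e 0\<close> vanishes.\<close>

lemma g7_zero: "(LINT x:AA|lborel. g7 x) = 0"
  using Qcase
proof
  assume Q: "Q = q \<and> Q' = q'"
  let ?h = "\<lambda>r. (\<zeta> r * \<omega> r / r) *\<^sub>R e (Q r)"
  have ch: "continuous_on {r0<..} ?h" unfolding e_def using r0 by (intro c_intros) auto
  have cE: "continuous_on E (\<lambda>x. ?h (norm x))" by (rule continuous_on_radial_E[OF ch])
  have Qq: "Q = q" using Q by simp
  have "(LINT x:AA|lborel. g7 x) = (LINT x:AA|lborel. v x * (?h (norm x) \<bullet> x) - (Q (norm x) \<bullet> x) * (?h (norm x) \<bullet> x))"
    by (rule ann_integral_cong) (simp add: g7_def v2_def algebra_simps diff_divide_distrib)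
  also have "\<dots> = (LINT x:AA|lborel. v x * (?h (norm x) \<bullet> x)) - (LINT x:AA|lborel. (Q (norm x) \<bullet> x) * (?h (norm x) \<bullet> x))"
    by (intro set_integral_diff iA continuous_intros c_E cE)
  also have "\<dots> = 0" using mode1_orthogonal(1,2)[OF a0 ch, of L, folded Qq] by simp
  finally show ?thesis .
next
  assume "Q = (\<lambda>_. 0) \<and> Q' = (\<lambda>_. 0)"
  then have "Q (norm x) = 0" for x :: "real^2" by simp
  then have "g7 x = 0" for x unfolding g7_def e_def cube_def by simp
  then show ?thesis by simp
qed

lemma g8_bound: "(LINT x:AA|lborel. g8 x) \<le> Z * (A * V0 + A * (a0 + 1)) * (B0 + 1) * vol"
proof -
  have "\<bar>LINT x:AA|lborel. g8 x\<bar> \<le> Z * (A * V0 + A * (a0 + 1)) * (B0 + 1) * vol"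
    unfolding vol_def
  proof (rule ann_integral_bound[OF continuous_on_subset[OF c_g(9) AA_sub] L])
    fix x assume x: "x \<in> ann a0 (a0 + 1)"
    then have n: "a0 \<le> norm x" "norm x \<le> a0 + 1" by (auto simp: ann_def)
    have "\<alpha> (norm x) * \<bar>v x\<bar> \<le> A * V0" using V0[OF x] \<alpha>_bounds(1,2)[OF n(1)] by (intro mult_mono) auto
    moreover have "norm (\<beta> (norm x)) * norm x \<le> A * (a0 + 1)" using \<alpha>_bounds(3)[OF n(1)] n A by (intro mult_mono) auto
    ultimately have s: "\<alpha> (norm x) * \<bar>v x\<bar> + norm (\<beta> (norm x)) * norm x \<le> A * V0 + A * (a0 + 1)" by linarith
    have s0: "0 \<le> \<alpha> (norm x) * \<bar>v x\<bar> + norm (\<beta> (norm x)) * norm x" using \<alpha>_bounds(1)[OF n(1)] by auto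
    have "\<bar>\<zeta>' (norm x)\<bar> * (\<alpha> (norm x) * \<bar>v x\<bar> + norm (\<beta> (norm x)) * norm x) \<le> Z * (A * V0 + A * (a0 + 1))"
      using \<zeta>_props(6) Z_nonneg s s0 by (intro mult_mono) auto
    then have "g8 x \<le> Z * (A * V0 + A * (a0 + 1)) * (B0 + 1)"
      unfolding g8_def
      by (rule mult_mono) (use B0[OF x] A V0_nonneg a0_pos Z_nonneg in \<open>auto intro!: mult_nonneg_nonneg add_nonneg_nonneg\<close>)
    moreover have "0 \<le> g8 x" unfolding g8_def using s0 by (intro mult_nonneg_nonneg) auto
    ultimately show "\<bar>g8 x\<bar> \<le> Z * (A * V0 + A * (a0 + 1)) * (B0 + 1)" by simp
  qed (use \<zeta>_props in \<open>auto simp: g8_def\<close>)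
  then show ?thesis by linarith
qed

text \<open>\<open>g4_bound\<close> turns \<open>1 / (2 * W)\<close> into \<open>W / 2\<close> on
  \<open>g5'\<close>, so together with \<open>g5\<close> the main shell terms are
  \<open>W / 2 * JJ\<close>. The loss \<open>8/100\<close> covers
  \<open>W\<^sup>2 / 40 \<le> 64/1000\<close>, from \<open>W \<le> 8/5\<close>, and
  \<open>1/200\<close>.\<close>

lemma bulk_bound: "97/100 * IP \<le> (W / 2 + 8/100) * JJ + (C0 A * F2 + 25 * A + Z * (A * V0 + A * (a0 + 1)) * (B0 + 1) * vol
   + Z * ((a0 + 1) * (2 * A) / 2 + V0 * (2 * A)) * vol)"
proof -
  let ?I = "\<lambda>g. LINT x:AA|lborel. g x"
  have "(LINT x:AA|lborel. 97/100 * g1 x + g2 x - 25 * g3 x - (1 / (2 * W) + 1/40) * g4 x - W / 2 * g5 x - 1/200 * g6 x - g7 x - g8 x)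
     = 97/100 * ?I g1 + ?I g2 - 25 * ?I g3 - (1 / (2 * W) + 1/40) * ?I g4 - W / 2 * ?I g5 - 1/200 * ?I g6 - ?I g7 - ?I g8"
    using i_g by (simp add: set_integral_add set_integral_diff del: divide_const_simps)
  then have 1: "97/100 * IP + ?I g2 - 25 * ?I g3 - (1 / (2 * W) + 1/40) * ?I g4 - W / 2 * ?I g5 - 1/200 * JJ - ?I g8 \<le> C0 A * F2"
    using g_weak g7_zero by (simp add: IP_def JJ_def)
  have nn: "0 \<le> ?I g5" "0 \<le> ?I g5'"
    unfolding set_lebesgue_integral_def
    by (intro Bochner_Integration.integral_nonneg; use AA_D \<zeta>_props(3) \<omega>_nonneg in \<open>auto simp: g5_def g5'_def indicator_def\<close>)+
  have "(1 / (2 * W) + 1/40) * ?I g4 \<le> (1 / (2 * W) + 1/40) * (W\<^sup>2 * ?I g5')"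
    using g4_bound W by (intro mult_left_mono) auto
  also have "\<dots> = W / 2 * ?I g5' + W\<^sup>2 / 40 * ?I g5'"
    using W by (simp add: field_simps power2_eq_square)
  also have "\<dots> \<le> W / 2 * ?I g5' + 64/1000 * ?I g5'"
  proof -
    have "W\<^sup>2 \<le> (8/5)\<^sup>2" using W by (intro power_mono) auto
    then show ?thesis using nn by (intro add_left_mono mult_right_mono) (auto simp: power2_eq_square)
  qed
  finally have 2: "(1 / (2 * W) + 1/40) * ?I g4 \<le> W / 2 * ?I g5' + 64/1000 * ?I g5'" .
  have 3: "?I g5' \<le> JJ" using nn g6_split by linarith
  have 4: "W / 2 * JJ = W / 2 * ?I g5 + W / 2 * ?I g5'" unfolding g6_split by (simp add: distrib_left)
  have 5: "0 \<le> JJ" using nn g6_split by linarith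
  show ?thesis using 1 2 3 4 5 abs_le_D2[OF g2_bound] g3_bound g8_bound unfolding distrib_right by linarith
qed

text \<open>
  Differentiating \<open>r \<omega>\<close> bounds the shell term \<open>JJ\<close> by \<open>s\<close> times the bulk term \<open>IP\<close>; the part \<open>\<tau>\<close> of
  the derivative comes from the outer cutoff of the weight.
\<close>

lemma shell_vs_bulk:
  assumes c\<tau>: "continuous_on {r0<..} \<tau>" and \<tau>: "\<And>r. a0 \<le> r \<Longrightarrow> 0 \<le> \<tau> r"
    and g': "\<And>r. a0 \<le> r \<Longrightarrow> r \<le> L \<Longrightarrow> - (\<omega> r + r * \<omega>' r) \<le> s * \<omega> r + \<tau> r"
    and D: "\<And>r. a0 \<le> r \<Longrightarrow> r \<le> L \<Longrightarrow> \<tau> r * (norm (Q r))\<^sup>2 \<le> \<tau> r * D\<^sup>2"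
    and \<theta>: "integral {a0..L} \<tau> \<le> \<theta>"
  shows "JJ \<le> s * IP + 2 * \<theta> * (LINT x:AA|lborel. (norm (m fl x))\<^sup>2 + D\<^sup>2) + 2 * (Z * ((a0 + 1) * A / 2 + V0 * A) * vol)"
proof -
  have i\<tau>: "\<tau> integrable_on {r..L}" if "a0 \<le> r" for r
    by (intro integrable_continuous_interval continuous_on_subset[OF c\<tau>]) (use that a0 in auto)
  have \<theta>0: "0 \<le> \<theta>"
    using \<theta> Henstock_Kurzweil_Integration.integral_nonneg[OF i\<tau>[OF order_refl]] \<tau> by force
  \<comment> \<open>The \<open>R\<close>-derivative of \<open>R * \<omega> R\<close> times the
    square of \<open>m fl x - Q R\<close> is integrated from \<open>norm x\<close> to
    \<open>L\<close>, where the weight vanishes. Differentiating \<open>Q\<close> leaves a term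
    linear in \<open>m\<close>, again of the kind treated by \<open>mean_term\<close>.\<close>
  have pt: "norm x * \<omega> (norm x) * (norm (p x))\<^sup>2 \<le> s * P x + 2 * \<theta> * ((norm (m fl x))\<^sup>2 + D\<^sup>2)
     + 2 * (m fl x \<bullet> b2 (norm x) - \<kappa>2 (norm x))" if x: "x \<in> AA" for x
  proof -
    let ?r = "norm x" and ?M = "m fl x"
    note xr = AA_D[OF x]
    define y where "y R = ?M - Q R" for R
    have dy: "((\<lambda>R. R * \<omega> R * (y R \<bullet> y R)) has_vector_derivative (\<omega> R + R * \<omega>' R) * (y R \<bullet> y R) - 2 * ((R * \<omega> R) * (Q' R \<bullet> y R))) (at R within {?r..L})"
      if "R \<in> {?r..L}" for R
    proof -
      have R: "r0 < R" using that xr by auto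
      have d1: "((\<lambda>R. R * \<omega> R) has_derivative (\<lambda>h. h * (\<omega> R + R * \<omega>' R))) (at R)"
      proof -
        have "(\<lambda>h. h * (\<omega> R + R * \<omega>' R)) = (*) (\<omega> R + R * \<omega>' R)" by (simp add: fun_eq_iff mult.commute)
        then show ?thesis
          using DERIV_mult[OF DERIV_ident \<omega>_deriv[OF R]] by (simp add: has_field_derivative_def mult.commute add.commute)
      qed
      have d2: "(y has_derivative (\<lambda>h. - (h *\<^sub>R Q' R))) (at R)"
        unfolding y_def[abs_def] using has_derivative_diff[OF has_derivative_const Q_deriv[OF R, unfolded has_vector_derivative_def]] by simp
      have "((\<lambda>R. R * \<omega> R * (y R \<bullet> y R)) has_derivative (\<lambda>h. R * \<omega> R * (y R \<bullet> - (h *\<^sub>R Q' R) + - (h *\<^sub>R Q' R) \<bullet> y R) + h * (\<omega> R + R * \<omega>' R) * (y R \<bullet> y R))) (at R)"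
        by (rule has_derivative_mult[OF d1 has_derivative_inner[OF d2 d2]])
      then have "((\<lambda>R. R * \<omega> R * (y R \<bullet> y R)) has_vector_derivative (\<omega> R + R * \<omega>' R) * (y R \<bullet> y R) - 2 * ((R * \<omega> R) * (Q' R \<bullet> y R))) (at R)"
        by (simp add: has_vector_derivative_def inner_commute[of "y R" "Q' R"] algebra_simps)
      then show ?thesis by (rule has_vector_derivative_at_within)
    qed
    have h1: "((\<lambda>R. (\<omega> R + R * \<omega>' R) * (y R \<bullet> y R) - 2 * ((R * \<omega> R) * (Q' R \<bullet> y R))) has_integral
      (L * \<omega> L * (y L \<bullet> y L) - ?r * \<omega> ?r * (y ?r \<bullet> y ?r))) {?r..L}"
      by (rule fundamental_theorem_of_calculus[OF xr(2) dy])
    have inn: "((\<lambda>R. z \<bullet> g R) has_integral z \<bullet> i) S" if "(g has_integral i) S" for z i :: "real^2" and g :: "real \<Rightarrow> real^2" and S :: "real set"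
      using has_integral_linear[OF that bounded_linear_inner_right[of z]] by (simp add: o_def)
    define T where "T = s * ((?M \<bullet> ?M) * \<alpha> ?r - 2 * (?M \<bullet> \<beta> ?r) + \<kappa> ?r)
       + 2 * ((norm ?M)\<^sup>2 + D\<^sup>2) * tail_integral L \<tau> ?r + 2 * (?M \<bullet> b2 ?r - \<kappa>2 ?r)"
    have h2: "((\<lambda>R. s * ((?M \<bullet> ?M) * \<omega> R - 2 * (?M \<bullet> (\<omega> R *\<^sub>R Q R)) + \<omega> R * (Q R \<bullet> Q R))
       + 2 * ((norm ?M)\<^sup>2 + D\<^sup>2) * \<tau> R + 2 * (?M \<bullet> ((R * \<omega> R) *\<^sub>R Q' R) - ((R * \<omega> R) *\<^sub>R Q' R) \<bullet> Q R)) has_integral T) {?r..L}"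
      unfolding T_def \<alpha>_def \<beta>_def \<kappa>_def b2_def \<kappa>2_def
      by (intro has_integral_add has_integral_diff has_integral_mult_right inn tail_has_integral[OF _ xr(1,2)] c_kernels continuous_\<omega> c\<tau>)
    have "- (L * \<omega> L * (y L \<bullet> y L) - ?r * \<omega> ?r * (y ?r \<bullet> y ?r)) \<le> T"
    proof (rule has_integral_le[OF has_integral_neg[OF h1] h2])
      fix R assume R: "R \<in> {?r..L}"
      then have R': "a0 \<le> R" "R \<le> L" using xr by auto
      have "- (\<omega> R + R * \<omega>' R) * (y R \<bullet> y R) \<le> (s * \<omega> R + \<tau> R) * (y R \<bullet> y R)"
        using g'[OF R'] by (intro mult_right_mono) auto
      moreover have "\<tau> R * (y R \<bullet> y R) \<le> 2 * ((norm ?M)\<^sup>2 + D\<^sup>2) * \<tau> R"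
      proof -
        have "y R \<bullet> y R \<le> 2 * (norm ?M)\<^sup>2 + 2 * (norm (Q R))\<^sup>2"
        proof -
          have "norm (y R) \<le> norm ?M + norm (Q R)" unfolding y_def by (rule norm_triangle_ineq4)
          then have "(norm (y R))\<^sup>2 \<le> (norm ?M + norm (Q R))\<^sup>2" by (intro power_mono) auto
          also have "\<dots> \<le> 2 * (norm ?M)\<^sup>2 + 2 * (norm (Q R))\<^sup>2"
            using zero_le_power2[of "norm ?M - norm (Q R)"] by (simp add: power2_eq_square algebra_simps)
          finally show ?thesis by (simp add: dot_square_norm)
        qed
        then have "\<tau> R * (y R \<bullet> y R) \<le> \<tau> R * (2 * (norm ?M)\<^sup>2 + 2 * (norm (Q R))\<^sup>2)"
          using \<tau>[OF R'(1)] by (rule mult_left_mono)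
        also have "\<dots> = 2 * (\<tau> R * (norm ?M)\<^sup>2) + 2 * (\<tau> R * (norm (Q R))\<^sup>2)" by (simp add: algebra_simps)
        also have "\<dots> \<le> 2 * (\<tau> R * (norm ?M)\<^sup>2) + 2 * (\<tau> R * D\<^sup>2)" using D[OF R'] by linarith
        finally show ?thesis by (simp add: algebra_simps)
      qed
      ultimately have A1: "- (\<omega> R + R * \<omega>' R) * (y R \<bullet> y R) \<le> s * (\<omega> R * (y R \<bullet> y R)) + 2 * ((norm ?M)\<^sup>2 + D\<^sup>2) * \<tau> R"
        by (simp add: algebra_simps)
      have E1: "\<omega> R * (y R \<bullet> y R) = (?M \<bullet> ?M) * \<omega> R - 2 * (?M \<bullet> (\<omega> R *\<^sub>R Q R)) + \<omega> R * (Q R \<bullet> Q R)"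
        by (simp add: y_def inner_diff_left inner_diff_right inner_commute[of "Q R" ?M] algebra_simps)
      have E2: "(R * \<omega> R) * (Q' R \<bullet> y R) = ?M \<bullet> ((R * \<omega> R) *\<^sub>R Q' R) - ((R * \<omega> R) *\<^sub>R Q' R) \<bullet> Q R"
        by (simp add: y_def inner_diff_right inner_commute[of "Q' R" ?M] algebra_simps)
      show "- ((\<omega> R + R * \<omega>' R) * (y R \<bullet> y R) - 2 * ((R * \<omega> R) * (Q' R \<bullet> y R)))
         \<le> s * ((?M \<bullet> ?M) * \<omega> R - 2 * (?M \<bullet> (\<omega> R *\<^sub>R Q R)) + \<omega> R * (Q R \<bullet> Q R))
       + 2 * ((norm ?M)\<^sup>2 + D\<^sup>2) * \<tau> R + 2 * (?M \<bullet> ((R * \<omega> R) *\<^sub>R Q' R) - ((R * \<omega> R) *\<^sub>R Q' R) \<bullet> Q R)"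
        unfolding E1[symmetric] E2[symmetric] using A1 by (simp add: algebra_simps)
    qed
    moreover have "T \<le> s * P x + 2 * \<theta> * ((norm ?M)\<^sup>2 + D\<^sup>2) + 2 * (?M \<bullet> b2 ?r - \<kappa>2 ?r)"
    proof -
      have "tail_integral L \<tau> ?r \<le> \<theta>"
        using tail_norm_bound[OF c\<tau> c\<tau> a0 xr(3) _ \<theta> \<theta>0] \<tau> by (auto simp: abs_le_iff)
      then have "2 * ((norm ?M)\<^sup>2 + D\<^sup>2) * tail_integral L \<tau> ?r \<le> 2 * ((norm ?M)\<^sup>2 + D\<^sup>2) * \<theta>"
        by (intro mult_left_mono) auto
      then show ?thesis by (simp add: T_def P_def algebra_simps)
    qed
    moreover have "\<omega> L = 0" by (simp add: \<omega>_zero)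
    ultimately show ?thesis by (simp add: y_def p_def dot_square_norm)
  qed
  define g9 where "g9 x = \<zeta> (norm x) * (m fl x \<bullet> b2 (norm x) - \<kappa>2 (norm x))" for x
  define g10 where "g10 x = (norm (m fl x))\<^sup>2 + D\<^sup>2" for x
  have c9: "continuous_on E g9" unfolding g9_def[abs_def] by (intro continuous_intros c_E)
  have c10: "continuous_on E g10" unfolding g10_def[abs_def] by (intro continuous_intros c_E)
  have "JJ \<le> (LINT x:AA|lborel. s * g1 x + 2 * \<theta> * g10 x + 2 * g9 x)"
    unfolding JJ_def
  proof (intro set_integral_mono i_g iA continuous_intros c_g c9 c10)
    fix x assume x: "x \<in> AA"
    have "g6 x = \<zeta> (norm x) * (norm x * \<omega> (norm x) * (norm (p x))\<^sup>2)" by (simp add: g6_def)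
    also have "\<dots> \<le> \<zeta> (norm x) * (s * P x + 2 * \<theta> * ((norm (m fl x))\<^sup>2 + D\<^sup>2)
     + 2 * (m fl x \<bullet> b2 (norm x) - \<kappa>2 (norm x)))"
      using pt[OF x] \<zeta>_props(3) by (intro mult_left_mono) auto
    also have "\<dots> = s * g1 x + \<zeta> (norm x) * (2 * \<theta> * g10 x) + 2 * g9 x"
      by (simp add: g1_def g9_def g10_def algebra_simps)
    also have "\<dots> \<le> s * g1 x + 2 * \<theta> * g10 x + 2 * g9 x"
      using mult_right_mono[OF \<zeta>_props(4)[of "norm x"], of "2 * \<theta> * g10 x"] \<theta>0 by (simp add: g10_def)
    finally show "g6 x \<le> s * g1 x + 2 * \<theta> * g10 x + 2 * g9 x" .
  qed
  also have "\<dots> = s * IP + 2 * \<theta> * (LINT x:AA|lborel. g10 x) + 2 * (LINT x:AA|lborel. g9 x)"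
    using i_g iA[OF c9] iA[OF c10] by (simp add: set_integral_add IP_def)
  also have "(LINT x:AA|lborel. g9 x) \<le> Z * ((a0 + 1) * A / 2 + V0 * A) * vol"
  proof -
    have nb: "a0 \<le> R \<Longrightarrow> norm ((R * \<omega> R) *\<^sub>R Q' R) \<le> R * \<omega> R * norm (Q' R)" for R
      using \<omega>_nonneg[of R] a0_pos by (simp add: abs_mult)
    have cg: "continuous_on {r0<..} (\<lambda>r. r * \<omega> r * norm (Q' r))" by (intro c_intros)
    have "\<bar>LINT x:AA|lborel. g9 x\<bar> \<le> Z * ((a0 + 1) * A / 2 + V0 * A) * vol"
      unfolding g9_def b2_def \<kappa>2_def
    proof (rule mean_term[OF c_kernels(5)])
      show "(r * \<omega> r) *\<^sub>R Q' r = 0" if "L \<le> r" for r using \<omega>_zero[OF that] by simp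
      show "(\<lambda>R. (R * \<omega> R) *\<^sub>R Q' R) = (\<lambda>_. 0)" if "Q' = (\<lambda>_. 0)" using that by simp
      fix r assume r: "a0 \<le> r"
      show "norm (tail_integral L (\<lambda>R. (R * \<omega> R) *\<^sub>R Q' R) r) \<le> A"
        by (rule tail_norm_bound[OF c_kernels(5) cg a0 r nb A3 A])
      have "norm (tail_integral L (\<lambda>R. ((R * \<omega> R) *\<^sub>R Q' R) \<bullet> Q R) r) \<le> A"
      proof (rule tail_norm_bound[OF c_kernels(6) cg a0 r _ A3 A])
        fix R assume R: "a0 \<le> R"
        have "norm (((R * \<omega> R) *\<^sub>R Q' R) \<bullet> Q R) \<le> norm ((R * \<omega> R) *\<^sub>R Q' R) * norm (Q R)"
          unfolding real_norm_def by (rule Cauchy_Schwarz_ineq2)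
        also have "\<dots> \<le> (R * \<omega> R * norm (Q' R)) * 1" using nb[OF R] Q_small[OF R] \<omega>_nonneg[OF R] R a0_pos by (intro mult_mono) auto
        finally show "norm (((R * \<omega> R) *\<^sub>R Q' R) \<bullet> Q R) \<le> R * \<omega> R * norm (Q' R)" by simp
      qed
      then show "\<bar>tail_integral L (\<lambda>R. ((R * \<omega> R) *\<^sub>R Q' R) \<bullet> Q R) r\<bar> \<le> A" by simp
    qed
    then show ?thesis by linarith
  qed
  finally show ?thesis by (simp add: g10_def)
qed

text \<open>Inserting \<open>shell_vs_bulk\<close> into \<open>bulk_bound\<close> gives
  \<open>IP\<close> the coefficient \<open>s * W / 2 + 8/100 * s\<close>, at most
  \<open>96/100\<close> by \<open>s * W \<le> 8/5\<close> and \<open>s \<le> 2\<close>, against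
  \<open>97/100\<close> on the left. The margin 1/100 is the origin of the factor 100, and
  \<open>201 = 2 * 100 + 1\<close>.\<close>

lemma energy_estimate:
  assumes c\<tau>: "continuous_on {r0<..} \<tau>" and \<tau>: "\<And>r. a0 \<le> r \<Longrightarrow> 0 \<le> \<tau> r"
    and g': "\<And>r. a0 \<le> r \<Longrightarrow> r \<le> L \<Longrightarrow> - (\<omega> r + r * \<omega>' r) \<le> s * \<omega> r + \<tau> r"
    and D: "\<And>r. a0 \<le> r \<Longrightarrow> r \<le> L \<Longrightarrow> \<tau> r * (norm (Q r))\<^sup>2 \<le> \<tau> r * D\<^sup>2"
    and \<theta>: "integral {a0..L} \<tau> \<le> \<theta>"
  shows "IP \<le> 100 * (2 * \<theta> * (LINT x:AA|lborel. (norm (m fl x))\<^sup>2 + D\<^sup>2) + Cst A)"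
    and "JJ \<le> 201 * (2 * \<theta> * (LINT x:AA|lborel. (norm (m fl x))\<^sup>2 + D\<^sup>2) + Cst A)"
proof -
  define T where "T = 2 * \<theta> * (LINT x:AA|lborel. (norm (m fl x))\<^sup>2 + D\<^sup>2)"
  define U where "U = 2 * (Z * ((a0 + 1) * A / 2 + V0 * A) * vol)"
  define C where "C = C0 A * F2 + 25 * A + Z * (A * V0 + A * (a0 + 1)) * (B0 + 1) * vol
   + Z * ((a0 + 1) * (2 * A) / 2 + V0 * (2 * A)) * vol"
  have 1: "97/100 * IP \<le> (W / 2 + 8/100) * JJ + C" using bulk_bound by (simp add: C_def)
  have 2: "JJ \<le> s * IP + T + U" using shell_vs_bulk[OF assms] by (simp add: T_def U_def)
  have Cst: "Cst A = C + U" by (simp add: Cst_def C_def U_def)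
  have IP0: "0 \<le> IP"
  proof -
    have "0 \<le> P x" if x: "x \<in> AA" for x
    proof -
      let ?r = "norm x" and ?M = "m fl x"
      note xr = AA_D[OF x]
      have inn: "((\<lambda>R. z \<bullet> g R) has_integral z \<bullet> i) S" if "(g has_integral i) S" for z i :: "real^2" and g :: "real \<Rightarrow> real^2" and S :: "real set"
        using has_integral_linear[OF that bounded_linear_inner_right[of z]] by (simp add: o_def)
      have h: "((\<lambda>R. (?M \<bullet> ?M) * \<omega> R - 2 * (?M \<bullet> (\<omega> R *\<^sub>R Q R)) + \<omega> R * (Q R \<bullet> Q R)) has_integral
         ((?M \<bullet> ?M) * \<alpha> ?r - 2 * (?M \<bullet> \<beta> ?r) + \<kappa> ?r)) {?r..L}"
        unfolding \<alpha>_def \<beta>_def \<kappa>_def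
        by (intro has_integral_add has_integral_diff has_integral_mult_right inn tail_has_integral[OF _ xr(1,2)] c_kernels continuous_\<omega>)
      have "0 \<le> (?M \<bullet> ?M) * \<omega> R - 2 * (?M \<bullet> (\<omega> R *\<^sub>R Q R)) + \<omega> R * (Q R \<bullet> Q R)" if "R \<in> {?r..L}" for R
      proof -
        have "0 \<le> \<omega> R * ((?M - Q R) \<bullet> (?M - Q R))" using \<omega>_nonneg[of R] that xr by (intro mult_nonneg_nonneg) auto
        then show ?thesis by (simp add: inner_diff_left inner_diff_right inner_commute[of "Q R" ?M] algebra_simps)
      qed
      from has_integral_nonneg[OF h this] show ?thesis by (simp add: P_def mult.commute)
    qed
    then show ?thesis unfolding IP_def set_lebesgue_integral_def
      by (intro Bochner_Integration.integral_nonneg) (use \<zeta>_props(3) in \<open>auto simp: g1_def indicator_def\<close>)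
  qed
  have C0: "0 \<le> C" unfolding C_def C0_def vol_def
    using A Z_nonneg V0_nonneg B0_nonneg a0_pos F2_nonneg by (intro add_nonneg_nonneg mult_nonneg_nonneg) auto
  have U0: "0 \<le> U" unfolding U_def vol_def
    using A Z_nonneg V0_nonneg a0_pos by (intro add_nonneg_nonneg mult_nonneg_nonneg) auto
  have \<theta>0: "0 \<le> \<theta>"
  proof -
    have "\<tau> integrable_on {a0..L}"
      by (intro integrable_continuous_interval continuous_on_subset[OF c\<tau>]) (use a0 in auto)
    then have "0 \<le> integral {a0..L} \<tau>" by (rule Henstock_Kurzweil_Integration.integral_nonneg) (use \<tau> in auto)
    then show ?thesis using \<theta> by linarith
  qed
  have T0: "0 \<le> T" unfolding T_def set_lebesgue_integral_def
    using \<theta>0 by (intro mult_nonneg_nonneg Bochner_Integration.integral_nonneg) auto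
  have W1: "0 \<le> W / 2 + 8/100" "W / 2 + 8/100 \<le> 1" using W by auto
  have "(W / 2 + 8/100) * JJ \<le> (W / 2 + 8/100) * (s * IP + T + U)" by (rule mult_left_mono[OF 2 W1(1)])
  also have "\<dots> = (s * W / 2 + 8/100 * s) * IP + (W / 2 + 8/100) * (T + U)" by (simp add: algebra_simps add_divide_distrib)
  also have "\<dots> \<le> 96/100 * IP + 1 * (T + U)"
    using s IP0 W1 T0 U0 by (intro add_mono mult_right_mono) auto
  finally have I: "IP \<le> 100 * (T + Cst A)" using 1 Cst by simp
  then show "IP \<le> 100 * (2 * \<theta> * (LINT x:AA|lborel. (norm (m fl x))\<^sup>2 + D\<^sup>2) + Cst A)" by (simp add: T_def)
  have "s * IP \<le> 2 * IP" using s IP0 by (intro mult_right_mono) auto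
  then have "JJ \<le> 201 * (T + Cst A)" using 2 I C0 U0 T0 Cst by simp
  then show "JJ \<le> 201 * (2 * \<theta> * (LINT x:AA|lborel. (norm (m fl x))\<^sup>2 + D\<^sup>2) + Cst A)" by (simp add: T_def)
qed

end

section \<open>Square integrability of the corrected field\<close>

lemma measure_ann_le: "0 \<le> L \<Longrightarrow> measure lborel (ann a L) \<le> pi * L\<^sup>2"
proof -
  assume "0 \<le> L"
  have "measure lborel (ann a L) \<le> measure lborel (cball (0::real^2) L)"
    by (rule measure_mono_fmeasurable) (use compact_ann[of a L] in \<open>auto simp: ann_def fmeasurable_compact borel_compact\<close>)
  then show ?thesis using \<open>0 \<le> L\<close> by (simp add: content_cball unit_ball_vol_2)
qed

lemma ann_integral_mono_set:
  fixes f :: "real^2 \<Rightarrow> real"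
  assumes "continuous_on (ann a L) f" "\<And>x. x \<in> ann a L \<Longrightarrow> 0 \<le> f x" "a \<le> a'" "L' \<le> L"
  shows "(LINT x:ann a' L'|lborel. f x) \<le> (LINT x:ann a L|lborel. f x)"
proof -
  have sub: "ann a' L' \<subseteq> ann a L" using assms by (auto simp: ann_def)
  show ?thesis
    unfolding set_lebesgue_integral_def
    by (rule integral_mono)
      (use set_integrable_ann[OF assms(1)] set_integrable_ann[OF continuous_on_subset[OF assms(1) sub]] assms(2) sub
        in \<open>auto simp: set_integrable_def indicator_def\<close>)
qed

lemma ann_integral_split_le:
  fixes f :: "real^2 \<Rightarrow> real"
  assumes cf: "continuous_on (ann a L) f" and f: "\<And>x. x \<in> ann a L \<Longrightarrow> 0 \<le> f x" and "a \<le> R" "R \<le> L"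
  shows "(LINT x:ann a L|lborel. f x) \<le> (LINT x:ann a R|lborel. f x) + (LINT x:ann R L|lborel. f x)"
proof -
  have s: "ann a R \<subseteq> ann a L" "ann R L \<subseteq> ann a L" using assms by (auto simp: ann_def)
  note i = set_integrable_ann[OF cf] set_integrable_ann[OF continuous_on_subset[OF cf s(1)]] set_integrable_ann[OF continuous_on_subset[OF cf s(2)]]
  have "(LINT x:ann a L|lborel. f x) \<le> (\<integral>x. indicator (ann a R) x *\<^sub>R f x + indicator (ann R L) x *\<^sub>R f x \<partial>lborel)"
    unfolding set_lebesgue_integral_def
    by (rule integral_mono) (use i f s in \<open>auto simp: set_integrable_def indicator_def ann_def\<close>)
  then show ?thesis using i by (simp add: set_lebesgue_integral_def set_integrable_def)
qed

text \<open>The integrals over growing annuli are bounded, so some annulus comes within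
  \<open>e\<close> of their supremum, and at most \<open>e\<close> is left outside it.\<close>

lemma ann_integral_tail:
  fixes f :: "real^2 \<Rightarrow> real"
  assumes cf: "\<And>L. continuous_on (ann b L) f" and f: "\<And>x. norm x \<ge> b \<Longrightarrow> 0 \<le> f x"
    and C: "\<And>L. (LINT x:ann b L|lborel. f x) \<le> C" and "e > 0"
  obtains R where "R \<ge> b" "\<And>L. (LINT x:ann R L|lborel. f x) \<le> e"
proof -
  let ?I = "\<lambda>L. LINT x:ann b L|lborel. f x"
  have bdd: "bdd_above (range ?I)" by (rule bdd_aboveI2) (rule C)
  define S where "S = (SUP L. ?I L)"
  have "\<exists>L. S - e < ?I L"
    using less_cSUP_iff[of UNIV ?I "S - e"] bdd \<open>e > 0\<close> by (auto simp: S_def)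
  then obtain L0 where L0: "S - e < ?I L0" by blast
  \<comment> \<open>\<open>L0 + 1\<close> rather than \<open>L0\<close>: the annuli are closed, and
    these two must be disjoint.\<close>
  define R where "R = max b (L0 + 1)"
  have "(LINT x:ann R L|lborel. f x) \<le> e" for L
  proof -
    define L' where "L' = max L0 L"
    have s: "ann b L0 \<subseteq> ann b L'" "ann R L \<subseteq> ann b L'" "ann b L0 \<inter> ann R L = {}"
      by (auto simp: ann_def R_def L'_def)
    note i = set_integrable_ann[OF cf[of L']] set_integrable_ann[OF continuous_on_subset[OF cf s(1)]] set_integrable_ann[OF continuous_on_subset[OF cf s(2)]]
    have "(\<integral>x. indicator (ann b L0) x *\<^sub>R f x + indicator (ann R L) x *\<^sub>R f x \<partial>lborel) \<le> ?I L'"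
      unfolding set_lebesgue_integral_def
    proof (rule integral_mono)
      fix x
      show "indicator (ann b L0) x *\<^sub>R f x + indicator (ann R L) x *\<^sub>R f x \<le> indicator (ann b L') x *\<^sub>R f x"
        using s f[of x] by (cases "x \<in> ann b L0"; cases "x \<in> ann R L"; cases "x \<in> ann b L'") (auto simp: ann_def)
    qed (use i in \<open>auto simp: set_integrable_def\<close>)
    then have "?I L0 + (LINT x:ann R L|lborel. f x) \<le> ?I L'"
      using i by (simp add: set_lebesgue_integral_def set_integrable_def)
    moreover have "?I L' \<le> S" unfolding S_def by (rule cSUP_upper[OF _ bdd]) simp
    ultimately show ?thesis using L0 by linarith
  qed
  then show ?thesis by (intro that[of R]) (auto simp: R_def)
qed

lemma integral_inverse_square:
  fixes r L :: real
  shows "0 < r \<Longrightarrow> r \<le> L \<Longrightarrow> integral {r..L} (\<lambda>t. 1 / t\<^sup>2) = 1 / r - 1 / L"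
proof -
  assume r: "0 < r" "r \<le> L"
  have "integral {r..L} (\<lambda>t. 1 / t\<^sup>2) = - 1 / L - (- 1 / r)"
    by (rule integral_FTC[OF r(2)]) (use r in \<open>auto intro!: derivative_eq_intros simp: power2_eq_square\<close>)
  then show ?thesis by simp
qed

lemma inverse_square_deriv:
  assumes "c + r \<noteq> 0"
  shows "((\<lambda>r. 1 / (c + r)\<^sup>2) has_real_derivative - 2 / (c + r)^3) (at r)"
proof -
  have 1: "((\<lambda>u::real. 1 / u\<^sup>2) has_real_derivative - 2 / u^3) (at u)" if "u \<noteq> 0" for u
    using that by (auto intro!: derivative_eq_intros simp: power2_eq_square power3_eq_cube)
  have 2: "((\<lambda>r. c + r) has_real_derivative 1) (at r)" by (auto intro!: derivative_eq_intros)
  from DERIV_chain2[where f="\<lambda>u. 1 / u\<^sup>2" and g="\<lambda>r. c + r", OF 1[OF assms] 2] show ?thesis by simp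
qed

text \<open>With \<open>u = N + r\<close> these yield
  \<open>- (w r + r * w' r) \<le> 2 * w r\<close> for the first weight, the growth condition with
  \<open>s = 2\<close>.\<close>

lemma weight_identities:
  fixes r u :: real
  assumes "0 < r" "r \<le> u"
  shows "1 / r\<^sup>2 - 1 / u\<^sup>2 = (u - r) * (u + r) / (r\<^sup>2 * u\<^sup>2)"
    "- (1 / r\<^sup>2 - 1 / u\<^sup>2) - r * (- 2 / r^3 + 2 / u^3) = (1 / r\<^sup>2 - 1 / u\<^sup>2) + 2 * (u - r) / u^3"
    "2 * (u - r) / u^3 \<le> 1 / r\<^sup>2 - 1 / u\<^sup>2"
proof -
  have u: "u > 0" using assms by simp
  show "1 / r\<^sup>2 - 1 / u\<^sup>2 = (u - r) * (u + r) / (r\<^sup>2 * u\<^sup>2)"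
    using assms u by (simp add: field_simps power2_eq_square)
  show "- (1 / r\<^sup>2 - 1 / u\<^sup>2) - r * (- 2 / r^3 + 2 / u^3) = (1 / r\<^sup>2 - 1 / u\<^sup>2) + 2 * (u - r) / u^3"
    using assms u by (simp add: field_simps power2_eq_square power3_eq_cube)
  have "0 \<le> (u - r) * ((u - r) * (u + 2 * r)) / (r\<^sup>2 * u^3)" using assms u by (intro divide_nonneg_pos mult_nonneg_nonneg) auto
  also have "\<dots> = (1 / r\<^sup>2 - 1 / u\<^sup>2) - 2 * (u - r) / u^3"
    using assms u by (simp add: field_simps power2_eq_square power3_eq_cube)
  finally show "2 * (u - r) / u^3 \<le> 1 / r\<^sup>2 - 1 / u\<^sup>2" by simp
qed

definition cutoff :: "real \<Rightarrow> real \<Rightarrow> real" where "cutoff M r = 1 - step (r / M - 1)"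
definition cutoff' :: "real \<Rightarrow> real \<Rightarrow> real" where "cutoff' M r = - step' (r / M - 1) / M"

lemma cutoff_deriv: "M > 0 \<Longrightarrow> (cutoff M has_real_derivative cutoff' M r) (at r)"
proof -
  assume "M > 0"
  have d: "((\<lambda>r. r / M - 1) has_real_derivative 1 / M) (at r)"
    using \<open>M > 0\<close> by (auto intro!: derivative_eq_intros)
  have "((\<lambda>r. step (r / M - 1)) has_real_derivative step' (r / M - 1) * (1 / M)) (at r)"
    using DERIV_chain2[where f=step and g="\<lambda>r. r / M - 1", OF step_deriv d] .
  then show ?thesis unfolding cutoff_def[abs_def] cutoff'_def
    by (auto intro!: derivative_eq_intros)
qed

lemma continuous_cutoff': "M > 0 \<Longrightarrow> continuous_on S (cutoff' M)"
  unfolding cutoff'_def[abs_def]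
  by (intro continuous_on_divide continuous_on_minus continuous_on_compose2[OF continuous_step'[of UNIV]] continuous_intros) auto

lemma cutoff_props:
  assumes "M > 0"
  shows "0 \<le> cutoff M r" "cutoff M r \<le> 1" "r \<le> M \<Longrightarrow> cutoff M r = 1" "2 * M \<le> r \<Longrightarrow> cutoff M r = 0"
    "r \<le> M \<Longrightarrow> cutoff' M r = 0" "(\<And>t. \<bar>step' t\<bar> \<le> Z) \<Longrightarrow> \<bar>cutoff' M r\<bar> \<le> Z / M"
  using step_props[of "r / M - 1"] assms
  by (auto simp: cutoff_def cutoff'_def field_simps abs_divide divide_right_mono)

context energy
begin

text \<open>Beyond some radius \<open>m\<close> is below \<open>d\<close>, chosen so that the outer
  part contributes at most \<open>e / 2 * M\<^sup>2\<close>; the disc inside contributes a constant,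
  negligible against \<open>M\<^sup>2\<close>.\<close>

lemma square_mean_decay:
  assumes md: "\<And>e. e > 0 \<Longrightarrow> \<exists>R. \<forall>x. norm x \<ge> R \<longrightarrow> norm (m fl x) \<le> e"
    and m1: "\<And>x. a0 \<le> norm x \<Longrightarrow> norm (m fl x) \<le> 1" and "e > 0"
  shows "\<exists>M0. \<forall>M\<ge>M0. (LINT x:ann a0 (2 * M)|lborel. (norm (m fl x))\<^sup>2) \<le> e * M\<^sup>2"
proof -
  define d where "d = sqrt (e / (8 * pi))"
  have d: "d > 0" "d\<^sup>2 = e / (8 * pi)" using \<open>e > 0\<close> by (simp_all add: d_def)
  from md[OF d(1)] obtain R0 where R0: "\<And>x. norm x \<ge> R0 \<Longrightarrow> norm (m fl x) \<le> d" by blast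
  define R where "R = max R0 a0"
  define M0 where "M0 = R + sqrt (2 * pi * R\<^sup>2 / e)"
  have R: "R > 0" "a0 \<le> R" using a0_pos by (auto simp: R_def)
  have "(LINT x:ann a0 (2 * M)|lborel. (norm (m fl x))\<^sup>2) \<le> e * M\<^sup>2" if M: "M \<ge> M0" for M
  proof -
    have sq: "0 \<le> sqrt (2 * pi * R\<^sup>2 / e)" using \<open>e > 0\<close> by simp
    have MR: "R \<le> M" "M > 0" "sqrt (2 * pi * R\<^sup>2 / e) \<le> M" using M sq R unfolding M0_def by linarith+
    have "2 * pi * R\<^sup>2 / e = (sqrt (2 * pi * R\<^sup>2 / e))\<^sup>2" using \<open>e > 0\<close> by simp
    also have "\<dots> \<le> M\<^sup>2" using MR sq by (intro power_mono) auto
    finally have b: "pi * R\<^sup>2 \<le> e / 2 * M\<^sup>2" using \<open>e > 0\<close> by (simp add: field_simps)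
    have c: "continuous_on (ann a0 L) (\<lambda>x. (norm (m fl x))\<^sup>2)" for L
      by (intro continuous_intros continuous_on_subset[OF continuous_m ann_subset_ext[OF a0]])
    have "(LINT x:ann a0 (2 * M)|lborel. (norm (m fl x))\<^sup>2)
      \<le> (LINT x:ann a0 R|lborel. (norm (m fl x))\<^sup>2) + (LINT x:ann R (2 * M)|lborel. (norm (m fl x))\<^sup>2)"
      by (rule ann_integral_split_le[OF c]) (use R MR in auto)
    moreover have "\<bar>LINT x:ann a0 R|lborel. (norm (m fl x))\<^sup>2\<bar> \<le> 1 * measure lborel (ann a0 R)"
      by (rule ann_integral_bound[OF c]) (use m1 in \<open>auto simp: ann_def power_le_one\<close>)
    moreover have "\<bar>LINT x:ann R (2 * M)|lborel. (norm (m fl x))\<^sup>2\<bar> \<le> d\<^sup>2 * measure lborel (ann R (2 * M))"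
    proof (rule ann_integral_bound)
      show "continuous_on (ann R (2 * M)) (\<lambda>x. (norm (m fl x))\<^sup>2)"
        by (rule continuous_on_subset[OF c[of "2 * M"]]) (use R in \<open>auto simp: ann_def\<close>)
      show "\<bar>(norm (m fl x))\<^sup>2\<bar> \<le> d\<^sup>2" if "x \<in> ann R (2 * M)" for x
        using R0[of x] that by (auto simp: ann_def R_def intro!: power_mono)
    qed (auto simp: ann_def)
    moreover have "measure lborel (ann a0 R) \<le> pi * R\<^sup>2" using R by (intro measure_ann_le) auto
    moreover have "d\<^sup>2 * measure lborel (ann R (2 * M)) \<le> d\<^sup>2 * (pi * (2 * M)\<^sup>2)"
      using MR by (intro mult_left_mono measure_ann_le) auto
    moreover have "d\<^sup>2 * (pi * (2 * M)\<^sup>2) = e / 2 * M\<^sup>2" by (simp add: d(2) field_simps)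
    ultimately show ?thesis using b by linarith
  qed
  then show ?thesis by blast
qed

text \<open>At infinity the weight is of order \<open>N / r^3\<close>, the power for which the
  growth condition holds with \<open>s = 2\<close>. Hence the outer cutoff costs
  \<open>\<theta>\<close> of order \<open>N / M\<^sup>2\<close>, which
  \<open>square_mean_decay\<close> beats for fixed \<open>N\<close>. A plain
  \<open>1 / r\<^sup>2\<close> would cost \<open>1 / M\<close>, too much here; up to the radius
  \<open>N\<close> the weight is still comparable to it.\<close>

lemma first_mode_energy_bounded:
  assumes Qq: "Q = q" "Q' = q'" and s2: "s = 2" and \<rho>c: "\<rho> = (\<lambda>r. c / r)" and a1: "1 \<le> a0"
    and m1: "\<And>x. a0 \<le> norm x \<Longrightarrow> norm (m fl x) \<le> 1/20" and q1: "\<And>r. a0 \<le> r \<Longrightarrow> norm (q r) \<le> 1/20"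
    and md: "\<And>e. e > 0 \<Longrightarrow> \<exists>R. \<forall>x. norm x \<ge> R \<longrightarrow> norm (m fl x) \<le> e"
    and qd: "\<And>e. e > 0 \<Longrightarrow> \<exists>R. \<forall>r\<ge>R. norm (q r) \<le> e"
  shows "\<exists>C. \<forall>L. (LINT x:ann (a0 + 1) L|lborel. (norm (m fl x - q (norm x)))\<^sup>2 / norm x) \<le> C"
proof -
  txt \<open>The weight is \<open>1/r\<^sup>2 - 1/(N + r)\<^sup>2\<close>, cut off at radius \<open>M\<close>; first \<open>M\<close>, then \<open>N\<close> tends to infinity.\<close>
  define A where "A = 1 + 4 * pi * c\<^sup>2"
  have A: "A \<ge> 1" by (simp add: A_def)
  \<comment> \<open>Smallness of \<open>m\<close> and \<open>q\<close> on the circle, converted by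
    \<open>q'_bound\<close>; it makes \<open>r * \<omega> r * norm (Q' r)\<close> integrable
    uniformly in the parameters.\<close>
  have q'1: "norm (q' r) \<le> 1 / r" if r: "a0 \<le> r" for r
  proof -
    have r': "r0 < r" "r > 0" using r a0 a0_pos by auto
    have x: "circ r \<in> E" "norm (circ r) = r" using r' by (auto simp: ext_plane_def norm_circ)
    have "integral {0..2*pi} (\<lambda>t. (norm (m fl (rot t (circ r)) - q r))\<^sup>2) \<le> integral {0..2*pi} (\<lambda>t. 1/100)"
    proof (intro integral_le integrable_continuous_interval continuous_intros continuous_rot_curve[OF x(1) continuous_m])
      fix t
      have "norm (m fl (rot t (circ r)) - q r) \<le> 1/10"
        using norm_triangle_ineq4[of "m fl (rot t (circ r))" "q r"] m1[of "rot t (circ r)"] q1[OF r] r x by simp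
      then have "(norm (m fl (rot t (circ r)) - q r))\<^sup>2 \<le> (1/10)\<^sup>2" by (intro power_mono) auto
      then show "(norm (m fl (rot t (circ r)) - q r))\<^sup>2 \<le> 1/100" by (simp add: power2_eq_square)
    qed
    also have "\<dots> = pi / 50" by simp
    finally have i: "integral {0..2*pi} (\<lambda>t. (norm (m fl (rot t (circ r)) - q r))\<^sup>2) \<le> pi / 50" .
    have "(r * norm (q' r))\<^sup>2 \<le> 2 / pi * integral {0..2*pi} (\<lambda>t. (norm (m fl (rot t (circ r)) - q r))\<^sup>2)"
      using q'_bound[OF x(1), of fl] x(2) by (simp add: power_mult_distrib)
    also have "\<dots> \<le> 2 / pi * (pi / 50)" by (intro mult_left_mono i) auto
    also have "\<dots> \<le> 1\<^sup>2" by simp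
    finally have "r * norm (q' r) \<le> 1" by (rule power2_le_imp_le) simp
    then show ?thesis using r' by (simp add: field_simps)
  qed
  have est: "(LINT x:ann (a0 + 1) Lx|lborel. (norm (m fl x - q (norm x)))\<^sup>2 / norm x) \<le> 2 * (201 * (1 + Cst A))"
    if Lx: "a0 + 1 \<le> Lx" for Lx
  proof -
    define N where "N = Lx"
    have N: "N > 0" using Lx a0_pos by (simp add: N_def)
    \<comment> \<open>Chosen so that the cutoff error
      \<open>2 * \<theta> * (e0 * (1 + 4 * pi) * M\<^sup>2)\<close> stays below 1;
      \<open>Z + 1\<close> keeps the denominator positive.\<close>
    define e0 where "e0 = 1 / (32 * N * (Z + 1) * (1 + 4 * pi))"
    have Z1: "Z + 1 > 0" "Z \<le> Z + 1" using Z_nonneg by auto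
    have pp: "1 + 4 * pi > 0" by (simp add: add_pos_pos)
    have e0: "e0 > 0" using N Z1 pp by (simp add: e0_def)
    obtain M1 where M1: "\<And>M. M \<ge> M1 \<Longrightarrow> (LINT x:ann a0 (2 * M)|lborel. (norm (m fl x))\<^sup>2) \<le> e0 * M\<^sup>2"
      using square_mean_decay[OF md _ e0] m1 by force
    obtain M2 where M2: "\<And>r. r \<ge> M2 \<Longrightarrow> norm (q r) \<le> sqrt e0"
      using qd[of "sqrt e0"] e0 by auto
    define M where "M = max (max M1 M2) (max Lx (a0 + 1))"
    have M: "M \<ge> M1" "M \<ge> M2" "M \<ge> Lx" "M \<ge> a0 + 1" "M > 0" using a0_pos by (auto simp: M_def)
    define w where "w r = 1 / r\<^sup>2 - 1 / (N + r)\<^sup>2" for r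
    define w' where "w' r = - 2 / r^3 + 2 / (N + r)^3" for r
    define \<omega> where "\<omega> r = w r * cutoff M r" for r
    define \<omega>' where "\<omega>' r = w r * cutoff' M r + w' r * cutoff M r" for r
    have dw: "(w has_real_derivative w' r) (at r)" if "r > 0" for r
      unfolding w_def[abs_def] w'_def
      using DERIV_diff[OF inverse_square_deriv[of 0 r] inverse_square_deriv[of N r]] that N by simp
    have w0: "0 \<le> w r" "w r \<le> 1 / r\<^sup>2" "r * w r \<le> 1 / r" if "r > 0" for r
    proof -
      have "r\<^sup>2 \<le> (N + r)\<^sup>2" using that N by (intro power_mono) auto
      then show "0 \<le> w r" using that N by (simp add: w_def frac_le)
      show "w r \<le> 1 / r\<^sup>2" by (simp add: w_def)
      then have "r * w r \<le> r * (1 / r\<^sup>2)" using that by (intro mult_left_mono) auto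
      then show "r * w r \<le> 1 / r" using that by (simp add: power2_eq_square)
    qed
    have \<omega>w: "0 \<le> \<omega> r" "\<omega> r \<le> w r" "\<omega> r \<le> 1 / r\<^sup>2" if "r > 0" for r
    proof -
      show "0 \<le> \<omega> r" using w0(1)[OF that] cutoff_props(1)[OF M(5)] by (simp add: \<omega>_def)
      show "\<omega> r \<le> w r" using mult_left_mono[OF cutoff_props(2)[OF M(5)] w0(1)[OF that]] by (simp add: \<omega>_def)
      then show "\<omega> r \<le> 1 / r\<^sup>2" using w0(2)[OF that] by linarith
    qed
    have r0r: "r > 0" if "r0 < r" for r using that r0 by simp
    have d\<omega>: "(\<omega> has_real_derivative \<omega>' r) (at r)" if "r0 < r" for r
      unfolding \<omega>_def[abs_def] \<omega>'_def using DERIV_mult[OF dw[OF r0r[OF that]] cutoff_deriv[OF M(5)]]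
      by (simp add: algebra_simps)
    have cw: "continuous_on {r0<..} w" using DERIV_isCont[OF dw] r0 by (intro continuous_at_imp_continuous_on) auto
    have cc: "continuous_on S (cutoff M)" for S
      using DERIV_isCont[OF cutoff_deriv[OF M(5)]] by (intro continuous_at_imp_continuous_on) auto
    have c\<omega>: "continuous_on {r0<..} \<omega>" unfolding \<omega>_def[abs_def] by (intro continuous_intros cw cc)
    have c\<omega>': "continuous_on {r0<..} \<omega>'"
    proof -
      have "continuous_on {r0<..} w'" unfolding w'_def[abs_def] using r0 N by (intro continuous_intros) auto
      then show ?thesis unfolding \<omega>'_def[abs_def] by (intro continuous_intros cw cc continuous_cutoff'[OF M(5)])
    qed
    have i2: "(\<lambda>t. 1 / t\<^sup>2) integrable_on {r..L}" if "r > 0" for r L :: real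
      by (intro integrable_continuous_interval continuous_intros) (use that in auto)
    have i\<omega>: "\<omega> integrable_on {r..L}" if "r > r0" for r L
      by (intro integrable_continuous_interval continuous_on_subset[OF c\<omega>]) (use that in auto)
    have int\<omega>: "integral {r..2 * M} \<omega> \<le> 1 / r" if "a0 \<le> r" "r \<le> 2 * M" for r
    proof -
      have "integral {r..2 * M} \<omega> \<le> integral {r..2 * M} (\<lambda>t. 1 / t\<^sup>2)"
        by (intro integral_le i\<omega> i2) (use that a0 a0_pos \<omega>w in auto)
      also have "\<dots> = 1 / r - 1 / (2 * M)" by (rule integral_inverse_square) (use that a0_pos in auto)
      finally have "integral {r..2 * M} \<omega> \<le> 1 / r - 1 / (2 * M)" .
      moreover have "0 \<le> 1 / (2 * M)" using M by simp
      ultimately show ?thesis by linarith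
    qed
    interpret W: weighted_energy r0 k k' F fl Q Q' H W s a0 \<rho> V0 B0 Z \<omega> \<omega>' "2 * M" A
    proof unfold_locales
      show "(\<omega> has_real_derivative \<omega>' r) (at r)" if "r0 < r" for r by (rule d\<omega>[OF that])
      show "continuous_on {r0<..} \<omega>'" by (rule c\<omega>')
      show "0 \<le> \<omega> r" if "a0 \<le> r" for r using \<omega>w that a0_pos by auto
      show "\<omega> r = 0" if "2 * M \<le> r" for r using cutoff_props(4)[OF M(5) that] by (simp add: \<omega>_def)
      show "a0 + 1 \<le> 2 * M" using M a0_pos by linarith
      show "0 \<le> A" using A by simp
      show "r * \<omega> r \<le> A" if "a0 \<le> r" for r
      proof -
        have "r * \<omega> r \<le> r * w r" using \<omega>w(2)[of r] that a0_pos by (intro mult_left_mono) auto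
        also have "\<dots> \<le> 1 / r" using w0(3)[of r] that a0_pos by auto
        also have "\<dots> \<le> 1" using that a1 by simp
        finally show ?thesis using A by linarith
      qed
      have "1 / a0 \<le> 1" using a1 by simp
      then show "integral {a0..2 * M} \<omega> \<le> A" using int\<omega>[of a0] A M a0_pos by linarith
      have "integral {a0..2 * M} (\<lambda>r. r * \<omega> r * norm (Q' r)) \<le> integral {a0..2 * M} (\<lambda>t. 1 / t\<^sup>2)"
      proof (intro integral_le i2 a0_pos)
        show "(\<lambda>r. r * \<omega> r * norm (Q' r)) integrable_on {a0..2 * M}"
          by (intro integrable_continuous_interval continuous_intros continuous_on_subset[OF c\<omega>] continuous_on_subset[OF continuous_Q']) (use a0 in auto)
        fix r assume "r \<in> {a0..2 * M}"
        then have r: "a0 \<le> r" "r > 0" using a0_pos by auto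
        have "r * \<omega> r * norm (Q' r) \<le> 1 / r * (1 / r)"
        proof (intro mult_mono)
          show "r * \<omega> r \<le> 1 / r" using \<omega>w(2)[OF r(2)] w0(3)[OF r(2)] mult_left_mono[of "\<omega> r" "w r" r] r by linarith
          show "norm (Q' r) \<le> 1 / r" using q'1[OF r(1)] by (simp add: Qq)
        qed (use r in auto)
        then show "r * \<omega> r * norm (Q' r) \<le> 1 / r\<^sup>2" by (simp add: power2_eq_square)
      qed
      also have "\<dots> = 1 / a0 - 1 / (2 * M)" by (rule integral_inverse_square) (use M a0_pos in auto)
      also have "\<dots> \<le> 1" using \<open>1 / a0 \<le> 1\<close> M by (auto intro: order_trans[of _ "1 / a0"])
      finally show "integral {a0..2 * M} (\<lambda>r. r * \<omega> r * norm (Q' r)) \<le> A" using A by linarith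
      show "(LINT x:ann a0 (2 * M)|lborel. (tail_integral (2 * M) \<omega> (norm x) + norm x * \<omega> (norm x)) * (\<rho> (norm x))\<^sup>2) \<le> A"
      proof -
        have "(LINT x:ann a0 (2 * M)|lborel. (tail_integral (2 * M) \<omega> (norm x) + norm x * \<omega> (norm x)) * (\<rho> (norm x))\<^sup>2)
          \<le> (LINT x:ann a0 (2 * M)|lborel. 2 * c\<^sup>2 / (norm x)^3)"
        proof (intro set_integral_mono set_integrable_ann)
          have cE: "continuous_on (ext_plane r0) (\<lambda>x. (tail_integral (2 * M) \<omega> (norm x) + norm x * \<omega> (norm x)) * (\<rho> (norm x))\<^sup>2)"
            by (intro continuous_intros continuous_on_radial_E[OF continuous_tail_integral[OF c\<omega>]] continuous_on_radial_E[OF c\<omega>] continuous_on_radial_E[OF c\<rho>])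
              (use cutoff_props(4)[OF M(5)] in \<open>simp add: \<omega>_def\<close>)
          show "continuous_on (ann a0 (2 * M)) (\<lambda>x. (tail_integral (2 * M) \<omega> (norm x) + norm x * \<omega> (norm x)) * (\<rho> (norm x))\<^sup>2)"
            by (rule continuous_on_subset[OF cE ann_subset_ext[OF a0]])
          show "continuous_on (ann a0 (2 * M)) (\<lambda>x. 2 * c\<^sup>2 / (norm x)^3)"
            using a0_pos by (intro continuous_intros) (auto simp: ann_def)
          fix x assume x: "x \<in> ann a0 (2 * M)"
          define r where "r = norm x"
          have r: "a0 \<le> r" "r \<le> 2 * M" "r > 0" using x a0_pos by (auto simp: ann_def r_def)
          \<comment> \<open>The square of \<open>\<rho>\<close> is of order
            \<open>1 / r\<^sup>2\<close>, which is not integrable at infinity in the plane; both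
            parts of the weight supply another \<open>1 / r\<close>.\<close>
          have "tail_integral (2 * M) \<omega> r \<le> 1 / r" using int\<omega> r by (simp add: tail_integral_def)
          moreover have "r * \<omega> r \<le> 1 / r" using \<omega>w(2)[OF r(3)] w0(3)[OF r(3)] mult_left_mono[of "\<omega> r" "w r" r] r by linarith
          ultimately have "(tail_integral (2 * M) \<omega> r + r * \<omega> r) * (\<rho> r)\<^sup>2 \<le> (2 / r) * (\<rho> r)\<^sup>2"
            by (intro mult_right_mono) auto
          also have "\<dots> = 2 * c\<^sup>2 / r^3" using r by (simp add: \<rho>c power2_eq_square power3_eq_cube field_simps)
          finally show "(tail_integral (2 * M) \<omega> (norm x) + norm x * \<omega> (norm x)) * (\<rho> (norm x))\<^sup>2 \<le> 2 * c\<^sup>2 / (norm x)^3"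
            by (simp add: r_def)
        qed
        also have "\<dots> = 2 * pi * integral {a0..2 * M} (\<lambda>r. r * (2 * c\<^sup>2 / r^3))"
          by (rule integral_radial[where f="\<lambda>r. 2 * c\<^sup>2 / r^3"]) (use a0_pos M in \<open>auto intro!: continuous_intros\<close>)
        also have "integral {a0..2 * M} (\<lambda>r. r * (2 * c\<^sup>2 / r^3)) = integral {a0..2 * M} (\<lambda>r. 2 * c\<^sup>2 * (1 / r\<^sup>2))"
          by (rule Henstock_Kurzweil_Integration.integral_cong) (use a0_pos in \<open>auto simp: power2_eq_square power3_eq_cube\<close>)
        also have "\<dots> = 2 * c\<^sup>2 * (1 / a0 - 1 / (2 * M))"
          by (subst Henstock_Kurzweil_Integration.integral_mult_right, subst integral_inverse_square) (use a0_pos M in auto)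
        also have "2 * pi * \<dots> \<le> 2 * pi * (2 * c\<^sup>2 * 1)"
          using \<open>1 / a0 - 1 / (2 * M) \<le> 1\<close> by (intro mult_left_mono) auto
        finally show ?thesis by (simp add: A_def)
      qed
    qed
    define \<tau> where "\<tau> r = r * w r * \<bar>cutoff' M r\<bar>" for r
    define \<theta> where "\<theta> = 4 * N * Z / M\<^sup>2"
    have c\<tau>: "continuous_on {r0<..} \<tau>" unfolding \<tau>_def[abs_def] by (intro continuous_intros cw continuous_cutoff'[OF M(5)])
    have \<tau>0: "0 \<le> \<tau> r" if "a0 \<le> r" for r using w0(1)[of r] that a0_pos by (simp add: \<tau>_def)
    have \<tau>z: "\<tau> r = 0" if "r \<le> M" for r using cutoff_props(5)[OF M(5) that] by (simp add: \<tau>_def)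
    have \<tau>b: "\<tau> r \<le> 2 * N * Z / M^3" if r: "a0 \<le> r" for r
    proof (cases "r \<le> M")
      case True
      then show ?thesis using \<tau>z[OF True] N Z_nonneg M by simp
    next
      case False
      then have rM: "M \<le> r" "r > 0" using M by auto
      have "w r = N * (2 * r + N) / (r\<^sup>2 * (N + r)\<^sup>2)"
        unfolding w_def using rM N weight_identities(1)[of r "N + r"] by (simp add: add.commute add.left_commute)
      also have "\<dots> \<le> N * (2 * (N + r)) / (r\<^sup>2 * (N + r)\<^sup>2)"
        using rM N by (intro divide_right_mono mult_left_mono) auto
      also have "\<dots> = 2 * N / (r\<^sup>2 * (N + r))"
      proof -
        have "N * (2 * u) / (r\<^sup>2 * u\<^sup>2) = 2 * N / (r\<^sup>2 * u)" if "u > 0" for u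
          using that rM by (simp add: power2_eq_square mult.commute mult.left_commute)
        from this[of "N + r"] show ?thesis using rM N by linarith
      qed
      also have "\<dots> \<le> 2 * N / (r\<^sup>2 * r)" using rM N by (intro divide_left_mono mult_left_mono mult_pos_pos) auto
      finally have "r * w r \<le> r * (2 * N / (r\<^sup>2 * r))" using rM by (intro mult_left_mono) auto
      also have "\<dots> = 2 * N / r\<^sup>2" using rM by simp
      also have "\<dots> \<le> 2 * N / M\<^sup>2" using rM M N by (intro divide_left_mono power_mono mult_pos_pos) auto
      finally have "r * w r \<le> 2 * N / M\<^sup>2" .
      then have "\<tau> r \<le> 2 * N / M\<^sup>2 * (Z / M)"
        unfolding \<tau>_def using cutoff_props(6)[OF M(5) Z] w0(1)[OF rM(2)] rM N by (intro mult_mono) auto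
      then show ?thesis by (simp add: power2_eq_square power3_eq_cube mult.assoc)
    qed
    have \<theta>: "integral {a0..2 * M} \<tau> \<le> \<theta>"
    proof -
      have "integral {a0..2 * M} \<tau> \<le> integral {a0..2 * M} (\<lambda>_. 2 * N * Z / M^3)"
        by (intro integral_le integrable_continuous_interval continuous_on_subset[OF c\<tau>] continuous_intros) (use a0 \<tau>b in auto)
      also have "\<dots> = (2 * M - a0) * (2 * N * Z / M^3)" using M a0_pos by simp
      also have "\<dots> \<le> 2 * M * (2 * N * Z / M^3)" using a0_pos N Z_nonneg M by (intro mult_right_mono) auto
      also have "\<dots> = \<theta>" using M by (simp add: \<theta>_def power2_eq_square power3_eq_cube)
      finally show ?thesis .
    qed
    have g': "- (\<omega> r + r * \<omega>' r) \<le> s * \<omega> r + \<tau> r" if r: "a0 \<le> r" for r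
    proof -
      have rp: "r > 0" using r a0_pos by simp
      have "- w r - r * w' r = w r + 2 * N / (N + r)^3"
        using weight_identities(2)[of r "N + r"] rp N by (simp add: w_def w'_def)
      moreover have "2 * N / (N + r)^3 \<le> w r"
        using weight_identities(3)[of r "N + r"] rp N by (simp add: w_def)
      ultimately have "(- w r - r * w' r) * cutoff M r \<le> (2 * w r) * cutoff M r"
        using cutoff_props(1)[OF M(5)] by (intro mult_right_mono) auto
      moreover have "- (r * w r * cutoff' M r) \<le> \<tau> r"
        unfolding \<tau>_def using w0(1)[OF rp] rp mult_left_mono[of "- cutoff' M r" "\<bar>cutoff' M r\<bar>" "r * w r"] by simp
      ultimately show ?thesis by (simp add: \<omega>_def \<omega>'_def s2 algebra_simps)
    qed
    have Dq: "\<tau> r * (norm (Q r))\<^sup>2 \<le> \<tau> r * (sqrt e0)\<^sup>2" if r: "a0 \<le> r" for r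
    proof (cases "r \<le> M")
      case False
      then have "norm (Q r) \<le> sqrt e0" using M2[of r] M Qq by simp
      then show ?thesis using \<tau>0[OF r] by (intro mult_left_mono power_mono) auto
    qed (simp add: \<tau>z)
    have "W.JJ \<le> 201 * (2 * \<theta> * (LINT x:ann a0 (2 * M)|lborel. (norm (m fl x))\<^sup>2 + (sqrt e0)\<^sup>2) + Cst A)"
      by (rule W.energy_estimate(2)[OF c\<tau> \<tau>0 g' Dq \<theta>])
    also have "2 * \<theta> * (LINT x:ann a0 (2 * M)|lborel. (norm (m fl x))\<^sup>2 + (sqrt e0)\<^sup>2) \<le> 1"
    proof -
      have c: "continuous_on (ann a0 L) (\<lambda>x. (norm (m fl x))\<^sup>2)" for L
        by (intro continuous_intros continuous_on_subset[OF continuous_m ann_subset_ext[OF a0]])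
      have "(LINT x:ann a0 (2 * M)|lborel. (norm (m fl x))\<^sup>2 + (sqrt e0)\<^sup>2)
        = (LINT x:ann a0 (2 * M)|lborel. (norm (m fl x))\<^sup>2) + (LINT x:ann a0 (2 * M)|lborel. e0)"
        using e0 by (subst set_integral_add(2)[OF set_integrable_ann[OF c] set_integrable_ann[OF continuous_on_const]]) simp
      also have "(LINT x:ann a0 (2 * M)|lborel. e0) = e0 * measure lborel (ann a0 (2 * M))"
        using fmeasurable_compact[OF compact_ann[of a0 "2 * M"]] by (simp add: set_lebesgue_integral_def fmeasurable_def mult.commute)
      also have "\<dots> \<le> e0 * (pi * (2 * M)\<^sup>2)" using e0 M by (intro mult_left_mono measure_ann_le) auto
      also have "(LINT x:ann a0 (2 * M)|lborel. (norm (m fl x))\<^sup>2) \<le> e0 * M\<^sup>2" by (rule M1[OF M(1)])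
      finally have "(LINT x:ann a0 (2 * M)|lborel. (norm (m fl x))\<^sup>2 + (sqrt e0)\<^sup>2) \<le> e0 * (1 + 4 * pi) * M\<^sup>2"
        by (simp add: algebra_simps power2_eq_square)
      then have "2 * \<theta> * (LINT x:ann a0 (2 * M)|lborel. (norm (m fl x))\<^sup>2 + (sqrt e0)\<^sup>2) \<le> 2 * \<theta> * (e0 * (1 + 4 * pi) * M\<^sup>2)"
        using N Z_nonneg M by (intro mult_left_mono) (auto simp: \<theta>_def)
      also have "\<dots> = 8 * N * Z * (e0 * (1 + 4 * pi))" using M by (simp add: \<theta>_def)
      also have "\<dots> \<le> 8 * N * (Z + 1) * (e0 * (1 + 4 * pi))"
        using N Z1 e0 pp by (intro mult_right_mono mult_left_mono) auto
      also have "\<dots> = 1 / 4"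
      proof -
        have "8 * n * z * (1 / (32 * n * z * y) * y) = 1 / 4" if "n > 0" "z > 0" "y > 0" for n z y :: real
          using that by simp
        from this[OF N Z1(1) pp] show ?thesis by (simp only: e0_def)
      qed
      finally show ?thesis by simp
    qed
    finally have JJ: "W.JJ \<le> 201 * (1 + Cst A)" by simp
    have "(LINT x:ann (a0 + 1) Lx|lborel. (norm (m fl x - q (norm x)))\<^sup>2 / norm x) \<le> (LINT x:ann (a0 + 1) Lx|lborel. 2 * W.g6 x)"
    proof (intro set_integral_mono set_integrable_ann)
      have s1: "ann (a0 + 1) Lx \<subseteq> E" using a0 by (auto simp: ann_def ext_plane_def)
      show "continuous_on (ann (a0 + 1) Lx) (\<lambda>x. (norm (m fl x - q (norm x)))\<^sup>2 / norm x)"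
        using E_nonzero s1 by (intro continuous_intros continuous_on_subset[OF continuous_m s1]
          continuous_on_subset[OF continuous_on_radial_E[OF continuous_q] s1]) auto
      show "continuous_on (ann (a0 + 1) Lx) (\<lambda>x. 2 * W.g6 x)"
        by (intro continuous_intros continuous_on_subset[OF W.c_g(7) s1])
      fix x assume x: "x \<in> ann (a0 + 1) Lx"
      define r where "r = norm x"
      have r: "a0 + 1 \<le> r" "r \<le> N" "r \<le> M" "r > 0" using x M a0_pos by (auto simp: ann_def r_def N_def)
      have "1 / (2 * r\<^sup>2) \<le> w r"
      proof -
        have "1 / (N + r)\<^sup>2 \<le> 1 / (2 * r)\<^sup>2" using r by (intro divide_left_mono power_mono mult_pos_pos) auto
        also have "1 / (2 * r)\<^sup>2 = (1 / r\<^sup>2) / 4" by (simp add: power2_eq_square)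
        finally have Y: "1 / (N + r)\<^sup>2 \<le> (1 / r\<^sup>2) / 4" .
        have "X / 2 \<le> X - Y" if "Y \<le> X / 4" "0 \<le> X" for X Y :: real using that by simp
        from this[OF Y] show ?thesis by (simp add: w_def)
      qed
      then have "1 / (2 * r\<^sup>2) \<le> \<omega> r" using cutoff_props(3)[OF M(5) r(3)] by (simp add: \<omega>_def)
      then have "1 / (2 * r\<^sup>2) * (r * (norm (W.p x))\<^sup>2) \<le> \<omega> r * (r * (norm (W.p x))\<^sup>2)"
        using r by (intro mult_right_mono) auto
      then show "(norm (m fl x - q (norm x)))\<^sup>2 / norm x \<le> 2 * W.g6 x"
      proof -
        have "1 / (2 * r\<^sup>2) * (r * y) = (y / r) / 2" for y using r by (simp add: power2_eq_square)
        with \<open>1 / (2 * r\<^sup>2) * (r * (norm (W.p x))\<^sup>2) \<le> \<omega> r * (r * (norm (W.p x))\<^sup>2)\<close>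
        have "(norm (W.p x))\<^sup>2 / r \<le> 2 * (\<omega> r * (r * (norm (W.p x))\<^sup>2))" by simp
        then show ?thesis
          using \<zeta>_props(2)[OF r(1)] unfolding W.g6_def W.p_def r_def[symmetric] by (simp add: Qq)
      qed
    qed
    also have "\<dots> = 2 * (LINT x:ann (a0 + 1) Lx|lborel. W.g6 x)" by simp
    also have "(LINT x:ann (a0 + 1) Lx|lborel. W.g6 x) \<le> W.JJ"
      unfolding W.JJ_def
    proof (rule ann_integral_mono_set)
      show "continuous_on (ann a0 (2 * M)) W.g6" by (rule continuous_on_subset[OF W.c_g(7) W.AA_sub])
      show "0 \<le> W.g6 x" if "x \<in> ann a0 (2 * M)" for x
        using \<zeta>_props(3) W.\<omega>_nonneg W.AA_D(3)[OF that] by (auto simp: W.g6_def)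
    qed (use M a0_pos in auto)
    finally show ?thesis using JJ by linarith
  qed
  show ?thesis
  proof (intro exI allI)
    fix Lx
    show "(LINT x:ann (a0 + 1) Lx|lborel. (norm (m fl x - q (norm x)))\<^sup>2 / norm x) \<le> max 0 (2 * (201 * (1 + Cst A)))"
    proof (cases "a0 + 1 \<le> Lx")
      case False
      then have "ann (a0 + 1) Lx = {}" by (auto simp: ann_def)
      then show ?thesis by (simp add: set_lebesgue_integral_def)
    qed (use est[of Lx] in auto)
  qed
qed

text \<open>At infinity the weight is of order \<open>N / r\<^sup>2\<close>, the case
  \<open>s = 1\<close>. The outer cutoff costs \<open>\<theta>\<close> of order
  \<open>N / M\<close>, against an energy that is \<open>o(M)\<close> by \<open>mean\<close>. As
  \<open>Q = 0\<close>, the density \<open>P\<close> is \<open>\<alpha>\<close> times the square of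
  \<open>m\<close>, so the bound on the bulk energy is already the claim.\<close>

lemma square_integral_bounded:
  assumes Q0: "Q = (\<lambda>_. 0)" "Q' = (\<lambda>_. 0)" and s1: "s = 1" and \<rho>c: "\<rho> = (\<lambda>r. c / r\<^sup>2)" and a1: "1 \<le> a0"
    and mean: "\<And>e. e > 0 \<Longrightarrow> \<exists>M0. \<forall>M\<ge>M0. (LINT x:ann a0 (2 * M)|lborel. (norm (m fl x))\<^sup>2) \<le> e * M"
  shows "\<exists>C. \<forall>L. (LINT x:ann (a0 + 1) L|lborel. (norm (m fl x))\<^sup>2) \<le> C"
proof -
  txt \<open>The weight \<open>N/(N + r)\<^sup>2\<close> is comparable to \<open>1/N\<close> for \<open>r \<le> N\<close>, so that its tail integral \<open>\<alpha>\<close> is bounded below there.\<close>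
  define A where "A = 1 + 4 * pi * c\<^sup>2"
  have A: "A \<ge> 1" by (simp add: A_def)
  have est: "(LINT x:ann (a0 + 1) Lx|lborel. (norm (m fl x))\<^sup>2) \<le> 4 * (100 * (1 + Cst A))"
    if Lx: "a0 + 1 \<le> Lx" for Lx
  proof -
    define N where "N = Lx"
    have N: "N > 0" using Lx a0_pos by (simp add: N_def)
    have Z1: "Z + 1 > 0" "Z \<le> Z + 1" using Z_nonneg by auto
    define e0 where "e0 = 1 / (4 * N * (Z + 1))"
    have e0: "e0 > 0" using N Z1 by (simp add: e0_def)
    obtain M1 where M1: "\<And>M. M \<ge> M1 \<Longrightarrow> (LINT x:ann a0 (2 * M)|lborel. (norm (m fl x))\<^sup>2) \<le> e0 * M"
      using mean[OF e0] by blast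
    \<comment> \<open>The weight has mass at least 1/2 beyond any \<open>r \<le> N\<close>, and
      \<open>8 * N\<close> leaves at most \<open>N / (N + M) \<le> 1/9\<close> of it beyond
      \<open>M\<close>; hence 1/4 lies before the cutoff acts.\<close>
    define M where "M = max M1 (max (8 * N) (a0 + 1))"
    have M: "M \<ge> M1" "M \<ge> 8 * N" "M \<ge> a0 + 1" "M > 0" using a0_pos by (auto simp: M_def)
    define w where "w r = N / (N + r)\<^sup>2" for r
    define w' where "w' r = - 2 * N / (N + r)^3" for r
    define \<omega> where "\<omega> r = w r * cutoff M r" for r
    define \<omega>' where "\<omega>' r = w r * cutoff' M r + w' r * cutoff M r" for r
    have dw: "(w has_real_derivative w' r) (at r)" if "r > 0" for r
      unfolding w_def[abs_def] w'_def
      using DERIV_cmult[OF inverse_square_deriv[of N r], of N] that N by (simp add: mult.commute)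
    have w0: "0 \<le> w r" "r * w r \<le> 1" "r * w r \<le> N / r" if "r > 0" for r
    proof -
      show "0 \<le> w r" using that N by (simp add: w_def)
      have "r * N \<le> (N + r)\<^sup>2" using that N by (simp add: power2_eq_square algebra_simps)
      then show "r * w r \<le> 1" using that N by (simp add: w_def pos_divide_le_eq)
      have "r * w r \<le> r * (N / r\<^sup>2)" unfolding w_def using that N
        by (intro mult_left_mono divide_left_mono power_mono mult_pos_pos) auto
      then show "r * w r \<le> N / r" using that by (simp add: power2_eq_square)
    qed
    have \<omega>w: "0 \<le> \<omega> r" "\<omega> r \<le> w r" if "r > 0" for r
    proof -
      show "0 \<le> \<omega> r" using w0(1)[OF that] cutoff_props(1)[OF M(4)] by (simp add: \<omega>_def)
      show "\<omega> r \<le> w r" using mult_left_mono[OF cutoff_props(2)[OF M(4)] w0(1)[OF that]] by (simp add: \<omega>_def)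
    qed
    have r0r: "r > 0" if "r0 < r" for r using that r0 by simp
    have d\<omega>: "(\<omega> has_real_derivative \<omega>' r) (at r)" if "r0 < r" for r
      unfolding \<omega>_def[abs_def] \<omega>'_def using DERIV_mult[OF dw[OF r0r[OF that]] cutoff_deriv[OF M(4)]]
      by (simp add: algebra_simps)
    have cw: "continuous_on {r0<..} w" using DERIV_isCont[OF dw] r0 by (intro continuous_at_imp_continuous_on) auto
    have cc: "continuous_on S (cutoff M)" for S
      using DERIV_isCont[OF cutoff_deriv[OF M(4)]] by (intro continuous_at_imp_continuous_on) auto
    have c\<omega>: "continuous_on {r0<..} \<omega>" unfolding \<omega>_def[abs_def] by (intro continuous_intros cw cc)
    have c\<omega>': "continuous_on {r0<..} \<omega>'"
    proof -
      have "continuous_on {r0<..} w'" unfolding w'_def[abs_def] using r0 N by (intro continuous_intros) auto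
      then show ?thesis unfolding \<omega>'_def[abs_def] by (intro continuous_intros cw cc continuous_cutoff'[OF M(4)])
    qed
    have i\<omega>: "\<omega> integrable_on {r..L}" if "r > r0" for r L
      by (intro integrable_continuous_interval continuous_on_subset[OF c\<omega>]) (use that in auto)
    have iw: "w integrable_on {r..L}" if "r > r0" for r L
      by (intro integrable_continuous_interval continuous_on_subset[OF cw]) (use that in auto)
    have intw: "integral {r..L} w = N / (N + r) - N / (N + L)" if "r0 < r" "r \<le> L" for r L
    proof -
      have "integral {r..L} w = - N / (N + L) - (- N / (N + r))"
        by (rule integral_FTC[OF that(2)]) (use that r0 N in \<open>auto intro!: derivative_eq_intros simp: w_def power2_eq_square\<close>)
      then show ?thesis by simp
    qed
    have int\<omega>: "integral {r..2 * M} \<omega> \<le> 1" if "a0 \<le> r" "r \<le> 2 * M" for r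
    proof -
      have "integral {r..2 * M} \<omega> \<le> integral {r..2 * M} w"
        by (intro integral_le i\<omega> iw) (use that a0 a0_pos \<omega>w in auto)
      also have "\<dots> = N / (N + r) - N / (N + 2 * M)" by (rule intw) (use that a0 in auto)
      also have "\<dots> \<le> N / (N + r)" using N M by simp
      also have "\<dots> \<le> 1" using N that a0_pos by simp
      finally show ?thesis .
    qed
    interpret W: weighted_energy r0 k k' F fl Q Q' H W s a0 \<rho> V0 B0 Z \<omega> \<omega>' "2 * M" A
    proof unfold_locales
      show "(\<omega> has_real_derivative \<omega>' r) (at r)" if "r0 < r" for r by (rule d\<omega>[OF that])
      show "continuous_on {r0<..} \<omega>'" by (rule c\<omega>')
      show "0 \<le> \<omega> r" if "a0 \<le> r" for r using \<omega>w that a0_pos by auto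
      show "\<omega> r = 0" if "2 * M \<le> r" for r using cutoff_props(4)[OF M(4) that] by (simp add: \<omega>_def)
      show "a0 + 1 \<le> 2 * M" using M a0_pos by linarith
      show "0 \<le> A" using A by simp
      have r\<omega>: "r * \<omega> r \<le> 1" if "a0 \<le> r" for r
        using \<omega>w(2)[of r] w0(2)[of r] mult_left_mono[of "\<omega> r" "w r" r] that a0_pos by linarith
      then show "r * \<omega> r \<le> A" if "a0 \<le> r" for r using that A by (meson order_trans)
      show "integral {a0..2 * M} \<omega> \<le> A" using int\<omega>[of a0] A M a0_pos by linarith
      show "integral {a0..2 * M} (\<lambda>r. r * \<omega> r * norm (Q' r)) \<le> A" using A by (simp add: Q0)
      show "(LINT x:ann a0 (2 * M)|lborel. (tail_integral (2 * M) \<omega> (norm x) + norm x * \<omega> (norm x)) * (\<rho> (norm x))\<^sup>2) \<le> A"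
      proof -
        have "(LINT x:ann a0 (2 * M)|lborel. (tail_integral (2 * M) \<omega> (norm x) + norm x * \<omega> (norm x)) * (\<rho> (norm x))\<^sup>2)
          \<le> (LINT x:ann a0 (2 * M)|lborel. 2 * c\<^sup>2 / (norm x)^3)"
        proof (intro set_integral_mono set_integrable_ann)
          have cE: "continuous_on (ext_plane r0) (\<lambda>x. (tail_integral (2 * M) \<omega> (norm x) + norm x * \<omega> (norm x)) * (\<rho> (norm x))\<^sup>2)"
            by (intro continuous_intros continuous_on_radial_E[OF continuous_tail_integral[OF c\<omega>]] continuous_on_radial_E[OF c\<omega>] continuous_on_radial_E[OF c\<rho>])
              (use cutoff_props(4)[OF M(4)] in \<open>simp add: \<omega>_def\<close>)
          show "continuous_on (ann a0 (2 * M)) (\<lambda>x. (tail_integral (2 * M) \<omega> (norm x) + norm x * \<omega> (norm x)) * (\<rho> (norm x))\<^sup>2)"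
            by (rule continuous_on_subset[OF cE ann_subset_ext[OF a0]])
          show "continuous_on (ann a0 (2 * M)) (\<lambda>x. 2 * c\<^sup>2 / (norm x)^3)"
            using a0_pos by (intro continuous_intros) (auto simp: ann_def)
          fix x assume x: "x \<in> ann a0 (2 * M)"
          define r where "r = norm x"
          have r: "a0 \<le> r" "r \<le> 2 * M" "r > 0" "1 \<le> r" using x a0_pos a1 by (auto simp: ann_def r_def)
          have "tail_integral (2 * M) \<omega> r \<le> 1" using int\<omega> r by (simp add: tail_integral_def)
          then have "(tail_integral (2 * M) \<omega> r + r * \<omega> r) * (\<rho> r)\<^sup>2 \<le> 2 * (\<rho> r)\<^sup>2"
            using r\<omega>[OF r(1)] by (intro mult_right_mono) auto
          also have "\<dots> = 2 * c\<^sup>2 / r^4" using r by (simp add: \<rho>c power_divide flip: power_mult)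
          also have "\<dots> \<le> 2 * c\<^sup>2 / r^3"
            using r power_increasing[of 3 4 r] by (intro divide_left_mono mult_pos_pos) auto
          finally show "(tail_integral (2 * M) \<omega> (norm x) + norm x * \<omega> (norm x)) * (\<rho> (norm x))\<^sup>2 \<le> 2 * c\<^sup>2 / (norm x)^3"
            by (simp add: r_def)
        qed
        also have "\<dots> = 2 * pi * integral {a0..2 * M} (\<lambda>r. r * (2 * c\<^sup>2 / r^3))"
          by (rule integral_radial[where f="\<lambda>r. 2 * c\<^sup>2 / r^3"]) (use a0_pos M in \<open>auto intro!: continuous_intros\<close>)
        also have "integral {a0..2 * M} (\<lambda>r. r * (2 * c\<^sup>2 / r^3)) = integral {a0..2 * M} (\<lambda>r. 2 * c\<^sup>2 * (1 / r\<^sup>2))"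
          by (rule Henstock_Kurzweil_Integration.integral_cong) (use a0_pos in \<open>auto simp: power2_eq_square power3_eq_cube\<close>)
        also have "\<dots> = 2 * c\<^sup>2 * (1 / a0 - 1 / (2 * M))"
          by (subst Henstock_Kurzweil_Integration.integral_mult_right, subst integral_inverse_square) (use a0_pos M in auto)
        also have "2 * pi * \<dots> \<le> 2 * pi * (2 * c\<^sup>2 * 1)"
        proof (intro mult_left_mono)
          have "1 / a0 \<le> 1" "0 \<le> 1 / (2 * M)" using a1 M by auto
          then show "1 / a0 - 1 / (2 * M) \<le> 1" by linarith
        qed auto
        finally show ?thesis by (simp add: A_def)
      qed
    qed
    define \<tau> where "\<tau> r = r * w r * \<bar>cutoff' M r\<bar>" for r
    define \<theta> where "\<theta> = 2 * N * Z / M"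
    have c\<tau>: "continuous_on {r0<..} \<tau>" unfolding \<tau>_def[abs_def] by (intro continuous_intros cw continuous_cutoff'[OF M(4)])
    have \<tau>0: "0 \<le> \<tau> r" if "a0 \<le> r" for r using w0(1)[of r] that a0_pos by (simp add: \<tau>_def)
    have \<tau>b: "\<tau> r \<le> N * Z / M\<^sup>2" if r: "a0 \<le> r" for r
    proof (cases "r \<le> M")
      case True
      then show ?thesis using cutoff_props(5)[OF M(4) True] N Z_nonneg M by (simp add: \<tau>_def)
    next
      case False
      then have rM: "M \<le> r" "r > 0" using M by auto
      have "r * w r \<le> N / r" by (rule w0(3)[OF rM(2)])
      also have "\<dots> \<le> N / M" using rM M N by (intro divide_left_mono) auto
      finally have "\<tau> r \<le> N / M * (Z / M)"
        unfolding \<tau>_def using cutoff_props(6)[OF M(4) Z] w0(1)[OF rM(2)] rM N M by (intro mult_mono) auto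
      then show ?thesis by (simp add: power2_eq_square)
    qed
    have \<theta>: "integral {a0..2 * M} \<tau> \<le> \<theta>"
    proof -
      have "integral {a0..2 * M} \<tau> \<le> integral {a0..2 * M} (\<lambda>_. N * Z / M\<^sup>2)"
        by (intro integral_le integrable_continuous_interval continuous_on_subset[OF c\<tau>] continuous_intros) (use a0 \<tau>b in auto)
      also have "\<dots> = (2 * M - a0) * (N * Z / M\<^sup>2)" using M a0_pos by simp
      also have "\<dots> \<le> 2 * M * (N * Z / M\<^sup>2)" using a0_pos N Z_nonneg M by (intro mult_right_mono) auto
      also have "\<dots> = \<theta>" using M by (simp add: \<theta>_def power2_eq_square)
      finally show ?thesis .
    qed
    have g': "- (\<omega> r + r * \<omega>' r) \<le> s * \<omega> r + \<tau> r" if r: "a0 \<le> r" for r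
    proof -
      have rp: "r > 0" using r a0_pos by simp
      have "- w r - r * w' r = w r * ((r - N) / (N + r))"
      proof -
        define u where "u = N + r"
        have u: "u > 0" "r - N = 2 * r - u" using rp N by (auto simp: u_def)
        have "- (N / u\<^sup>2) - r * (- 2 * N / u^3) = N / u\<^sup>2 * ((r - N) / u)"
          unfolding u(2) using u(1) by (simp add: field_simps power2_eq_square power3_eq_cube)
        then show ?thesis by (simp add: w_def w'_def u_def)
      qed
      also have "\<dots> \<le> w r * 1" using w0(1)[OF rp] rp N by (intro mult_left_mono) auto
      finally have "(- w r - r * w' r) * cutoff M r \<le> w r * cutoff M r"
        using cutoff_props(1)[OF M(4)] by (intro mult_right_mono) auto
      moreover have "- (r * w r * cutoff' M r) \<le> \<tau> r"
        unfolding \<tau>_def using w0(1)[OF rp] rp mult_left_mono[of "- cutoff' M r" "\<bar>cutoff' M r\<bar>" "r * w r"] by simp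
      ultimately show ?thesis by (simp add: \<omega>_def \<omega>'_def s1 algebra_simps)
    qed
    have Dq: "\<tau> r * (norm (Q r))\<^sup>2 \<le> \<tau> r * 0\<^sup>2" for r by (simp add: Q0)
    have "W.IP \<le> 100 * (2 * \<theta> * (LINT x:ann a0 (2 * M)|lborel. (norm (m fl x))\<^sup>2 + 0\<^sup>2) + Cst A)"
      by (rule W.energy_estimate(1)[OF c\<tau> \<tau>0 g' Dq \<theta>])
    also have "2 * \<theta> * (LINT x:ann a0 (2 * M)|lborel. (norm (m fl x))\<^sup>2 + 0\<^sup>2) \<le> 1"
    proof -
      have "2 * \<theta> * (LINT x:ann a0 (2 * M)|lborel. (norm (m fl x))\<^sup>2 + 0\<^sup>2) \<le> 2 * \<theta> * (e0 * M)"
        using M1[OF M(1)] N Z_nonneg M by (intro mult_left_mono) (auto simp: \<theta>_def)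
      also have "\<dots> = 4 * N * Z * e0" using M by (simp add: \<theta>_def)
      also have "\<dots> \<le> 4 * N * (Z + 1) * e0" using N Z1 e0 by (intro mult_right_mono mult_left_mono) auto
      also have "\<dots> = 1" using N Z1 unfolding e0_def by simp
      finally show ?thesis .
    qed
    finally have IP: "W.IP \<le> 100 * (1 + Cst A)" by simp
    have P: "W.P x = tail_integral (2 * M) \<omega> (norm x) * (norm (m fl x))\<^sup>2" for x
      unfolding W.P_def W.\<alpha>_def W.\<beta>_def W.\<kappa>_def tail_integral_def dot_square_norm by (simp add: Q0)
    have "(LINT x:ann (a0 + 1) Lx|lborel. (norm (m fl x))\<^sup>2) \<le> (LINT x:ann (a0 + 1) Lx|lborel. 4 * W.g1 x)"
    proof (intro set_integral_mono set_integrable_ann)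
      have s1: "ann (a0 + 1) Lx \<subseteq> E" using a0 by (auto simp: ann_def ext_plane_def)
      show "continuous_on (ann (a0 + 1) Lx) (\<lambda>x. (norm (m fl x))\<^sup>2)"
        by (intro continuous_intros continuous_on_subset[OF continuous_m s1])
      show "continuous_on (ann (a0 + 1) Lx) (\<lambda>x. 4 * W.g1 x)"
        by (intro continuous_intros continuous_on_subset[OF W.c_g(1) s1])
      fix x assume x: "x \<in> ann (a0 + 1) Lx"
      define r where "r = norm x"
      have r: "a0 + 1 \<le> r" "r \<le> N" "r \<le> M" "r > 0" "r0 < r" using x M a0_pos N a0 by (auto simp: ann_def r_def N_def)
      have "1 / 4 \<le> tail_integral (2 * M) \<omega> r"
      proof -
        have "1/2 \<le> N / (N + r)" using r N by (simp add: pos_le_divide_eq)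
        moreover have "N / (N + M) \<le> 1 / 9" using M N by (simp add: pos_divide_le_eq)
        ultimately have "1/4 \<le> integral {r..M} w" using intw[OF r(5,3)] by linarith
        also have "integral {r..M} w = integral {r..M} \<omega>"
          by (rule Henstock_Kurzweil_Integration.integral_cong) (simp add: \<omega>_def cutoff_props(3)[OF M(4)])
        also have "\<dots> \<le> integral {r..2 * M} \<omega>"
          by (intro integral_subset_le i\<omega>) (use r M \<omega>w in auto)
        finally show ?thesis using r M by (simp add: tail_integral_def)
      qed
      then have "1/4 * (norm (m fl x))\<^sup>2 \<le> W.P x" unfolding P r_def[symmetric] by (intro mult_right_mono) auto
      then show "(norm (m fl x))\<^sup>2 \<le> 4 * W.g1 x"
        using \<zeta>_props(2)[OF r(1)] by (simp add: W.g1_def flip: r_def)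
    qed
    also have "\<dots> = 4 * (LINT x:ann (a0 + 1) Lx|lborel. W.g1 x)" by simp
    also have "(LINT x:ann (a0 + 1) Lx|lborel. W.g1 x) \<le> W.IP"
      unfolding W.IP_def
    proof (rule ann_integral_mono_set)
      show "continuous_on (ann a0 (2 * M)) W.g1" by (rule continuous_on_subset[OF W.c_g(1) W.AA_sub])
      show "0 \<le> W.g1 x" if "x \<in> ann a0 (2 * M)" for x
        using \<zeta>_props(3) W.\<alpha>_bounds(1)[OF W.AA_D(3)[OF that]] by (simp add: W.g1_def P W.\<alpha>_def)
    qed (use M N a0_pos in \<open>auto simp: N_def\<close>)
    finally show ?thesis using IP by linarith
  qed
  show ?thesis
  proof (intro exI allI)
    fix Lx
    show "(LINT x:ann (a0 + 1) Lx|lborel. (norm (m fl x))\<^sup>2) \<le> max 0 (4 * (100 * (1 + Cst A)))"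
    proof (cases "a0 + 1 \<le> Lx")
      case False
      then have "ann (a0 + 1) Lx = {}" by (auto simp: ann_def)
      then show ?thesis by (simp add: set_lebesgue_integral_def)
    qed (use est[of Lx] in auto)
  qed
qed

end

section \<open>The two passes of the energy method\<close>

lemma cube_lipschitz:
  assumes "norm y \<le> B" "norm z \<le> B"
  shows "norm (cube y - cube z) \<le> 3 * B\<^sup>2 * norm (y - z)"
proof -
  have B: "0 \<le> B" using assms(1) norm_ge_zero order_trans by blast
  have eq: "cube y - cube z = (norm y)\<^sup>2 *\<^sub>R (y - z) + ((norm y)\<^sup>2 - (norm z)\<^sup>2) *\<^sub>R z"
    by (simp add: cube_def algebra_simps)
  have "norm (cube y - cube z) \<le> norm ((norm y)\<^sup>2 *\<^sub>R (y - z)) + norm (((norm y)\<^sup>2 - (norm z)\<^sup>2) *\<^sub>R z)"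
    unfolding eq by (rule norm_triangle_ineq)
  also have "norm ((norm y)\<^sup>2 *\<^sub>R (y - z)) \<le> B\<^sup>2 * norm (y - z)"
    using assms(1) by (simp add: mult_right_mono power_mono)
  also have "norm (((norm y)\<^sup>2 - (norm z)\<^sup>2) *\<^sub>R z) \<le> 2 * B\<^sup>2 * norm (y - z)"
  proof -
    have "\<bar>(norm y)\<^sup>2 - (norm z)\<^sup>2\<bar> = (norm y + norm z) * \<bar>norm y - norm z\<bar>"
      by (simp add: power2_eq_square square_diff_square_factored abs_mult)
    also have "\<dots> \<le> (2 * B) * norm (y - z)"
      using assms B norm_triangle_ineq3[of y z] by (intro mult_mono) auto
    finally have "\<bar>(norm y)\<^sup>2 - (norm z)\<^sup>2\<bar> * norm z \<le> ((2 * B) * norm (y - z)) * B"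
      using assms B by (intro mult_mono) auto
    moreover have "((2 * B) * norm (y - z)) * B = 2 * B\<^sup>2 * norm (y - z)" by (simp add: power2_eq_square)
    ultimately show ?thesis by (simp only: norm_scaleR)
  qed
  finally show ?thesis by (simp add: algebra_simps)
qed

context weak_field
begin

definition "cK = \<bar>fl\<bar> + \<bar>tbar\<bar>"

lemma k_m_bound: "x \<in> E \<Longrightarrow> norm (k x - m fl x) \<le> cK / norm x"
proof -
  assume x: "x \<in> E"
  have "k x - m fl x = (fl / (norm x)\<^sup>2) *\<^sub>R x + (tbar / (norm x)\<^sup>2) *\<^sub>R perp x"
    by (simp add: m_def)
  then have "norm (k x - m fl x) \<le> norm ((fl / (norm x)\<^sup>2) *\<^sub>R x) + norm ((tbar / (norm x)\<^sup>2) *\<^sub>R perp x)"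
    by (metis norm_triangle_ineq)
  also have "\<dots> = cK / norm x"
    using E_nonzero(2)[OF x] by (simp add: cK_def power2_eq_square add_divide_distrib)
  finally show ?thesis .
qed

lemma cK_nonneg: "0 \<le> cK" by (simp add: cK_def)

lemma m_decay: "e > 0 \<Longrightarrow> \<exists>R. \<forall>x. norm x \<ge> R \<longrightarrow> norm (m fl x) \<le> e"
proof -
  assume e: "e > 0"
  obtain R where R: "\<And>x. norm x \<ge> R \<Longrightarrow> norm (k x) \<le> e / 2" using decay[of "e/2"] e by auto
  show ?thesis
  proof (intro exI allI impI)
    fix x :: "real^2" assume x: "norm x \<ge> max R (max (r0 + 1) (2 * cK / e))"
    then have xE: "x \<in> E" by (auto simp: ext_plane_def)
    have "cK / norm x \<le> e / 2" using x e E_nonzero(2)[OF xE] by (simp add: field_simps)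
    then show "norm (m fl x) \<le> e"
    proof -
      have "norm (k x - (k x - m fl x)) \<le> norm (k x) + norm (k x - m fl x)" by (rule norm_triangle_ineq4)
      then have "norm (m fl x) \<le> norm (k x) + norm (k x - m fl x)" by simp
      moreover have "norm (k x) \<le> e / 2" using R[of x] x by simp
      ultimately show ?thesis using k_m_bound[OF xE] \<open>cK / norm x \<le> e / 2\<close> by linarith
    qed
  qed
qed

lemma q_le: "r0 < r \<Longrightarrow> (\<And>y. norm y = r \<Longrightarrow> norm (m fl y) \<le> e) \<Longrightarrow> norm (q r) \<le> pi * e"
proof (rule q_bound)
  fix y :: "real^2" assume a: "r0 < r" "\<And>y. norm y = r \<Longrightarrow> norm (m fl y) \<le> e" and y: "norm y = r"
  then have "y \<in> E" by (simp add: ext_plane_def)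
  then have "\<bar>Dv y \<bullet> perp y\<bar> = \<bar>m fl y \<bullet> perp y\<bar>" by (simp add: m_perp)
  also have "\<dots> \<le> norm (m fl y) * r" using Cauchy_Schwarz_ineq2[of "m fl y" "perp y"] y by simp
  also have "\<dots> \<le> e * r" using a(2)[OF y] y norm_ge_zero[of y] by (intro mult_right_mono) auto
  finally show "\<bar>Dv y \<bullet> perp y\<bar> \<le> r * e" by (simp add: mult.commute)
qed

lemma q_decay: "e > 0 \<Longrightarrow> \<exists>R. \<forall>r\<ge>R. norm (q r) \<le> e"
proof -
  assume e: "e > 0"
  obtain R where R: "\<And>x. norm x \<ge> R \<Longrightarrow> norm (m fl x) \<le> e / pi" using m_decay[of "e / pi"] e by auto
  have "norm (q r) \<le> e" if "r \<ge> max R (r0 + 1)" for r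
    using q_le[of r "e / pi"] R that by simp
  then show ?thesis by blast
qed

text \<open>\<open>q'_bound\<close>, integrated over radii, bounds the integral of
  \<open>t\<^sup>2 * (norm (q' t))\<^sup>2\<close> by the tail of the first energy. Cauchy-Schwarz
  with the weight \<open>1 / t\<^sup>2\<close> then bounds the variation of \<open>q\<close> beyond
  \<open>r\<close> by \<open>sqrt (e / r)\<close>, and \<open>q\<close> tends to 0.\<close>

lemma q_tail:
  assumes b: "r0 < b" and C: "\<And>L. (LINT x:ann b L|lborel. (norm (m fl x - q (norm x)))\<^sup>2 / norm x) \<le> C" and e: "e > 0"
  obtains R where "R \<ge> b" "\<And>L. (LINT x:ann R L|lborel. (norm (m fl x - q (norm x)))\<^sup>2 / norm x) \<le> e"
    "\<And>r. r \<ge> R \<Longrightarrow> (norm (q r))\<^sup>2 \<le> e / r"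
proof -
  let ?f = "\<lambda>x. (norm (m fl x - q (norm x)))\<^sup>2 / norm x"
  have cf: "continuous_on E ?f"
    using E_nonzero by (intro continuous_intros continuous_m continuous_on_radial_E[OF continuous_q]) auto
  have cfa: "continuous_on (ann b L) ?f" for L by (rule continuous_on_subset[OF cf ann_subset_ext[OF b]])
  obtain R where R: "R \<ge> b" "\<And>L. (LINT x:ann R L|lborel. ?f x) \<le> e"
    by (rule ann_integral_tail[OF cfa _ C e]) auto
  have b0: "b > 0" using b r0 by simp
  have step: "(norm (q L - q r))\<^sup>2 \<le> e / r" if r: "R \<le> r" "r \<le> L" for r L
  proof -
    have rp: "r > 0" "r0 < r" using r R b b0 by auto
    have cq: "continuous_on {r..L} q'" by (rule continuous_on_subset[OF continuous_q']) (use rp in auto)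
    have ct: "continuous_on {r..L} (\<lambda>t. t\<^sup>2 * (norm (q' t))\<^sup>2)" by (intro continuous_intros cq)
    have sub: "ann r L \<subseteq> E" by (rule ann_subset_ext[OF rp(2)])
    have cfr: "continuous_on (ann r L) ?f" by (rule continuous_on_subset[OF cf sub])
    have "2 * pi * integral {r..L} (\<lambda>t. t * (t * (norm (q' t))\<^sup>2)) = (LINT x:ann r L|lborel. norm x * (norm (q' (norm x)))\<^sup>2)"
      by (rule integral_radial[symmetric, OF rp(1) r(2)]) (intro continuous_intros cq)
    also have "\<dots> \<le> (LINT x:ann r L|lborel. 2 / pi * integral {0..2*pi} (\<lambda>t. 1 * ?f (rot t x)))"
    proof (intro set_integral_mono set_integrable_ann)
      show "continuous_on (ann r L) (\<lambda>x. norm x * (norm (q' (norm x)))\<^sup>2)"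
        by (intro continuous_intros continuous_on_subset[OF continuous_on_radial_E[OF continuous_q'] sub])
      have "continuous_on (ann r L) (angular_mean (\<lambda>t. 1) ?f)"
        by (rule continuous_on_subset[OF continuous_on_angular_mean[OF continuous_on_const cf] sub])
      then show "continuous_on (ann r L) (\<lambda>x. 2 / pi * integral {0..2*pi} (\<lambda>t. 1 * ?f (rot t x)))"
        by (intro continuous_intros) (simp add: angular_mean_def[abs_def])
      fix x assume "x \<in> ann r L"
      then have x: "x \<in> E" "norm x > 0" using sub E_nonzero by auto
      have i: "integral {0..2*pi} (\<lambda>t. (norm (m fl (rot t x) - q (norm x)))\<^sup>2) = norm x * integral {0..2*pi} (\<lambda>t. 1 * ?f (rot t x))"
      proof -
        have "(norm (m fl (rot t x) - q (norm x)))\<^sup>2 = norm x * (1 * ?f (rot t x))" for t using x by simp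
        then show ?thesis by (simp only: Henstock_Kurzweil_Integration.integral_mult_right)
      qed
      have "norm x * (norm x * (norm (q' (norm x)))\<^sup>2) \<le> norm x * (2 / pi * integral {0..2*pi} (\<lambda>t. 1 * ?f (rot t x)))"
      proof -
        have "y * (y * z) \<le> y * (c * j)" if "y\<^sup>2 * z \<le> c * (y * j)" for y z c j :: real
          using that by (simp add: power2_eq_square mult.left_commute mult.assoc)
        from this[OF q'_bound[OF x(1), of fl, unfolded i]] show ?thesis .
      qed
      then show "norm x * (norm (q' (norm x)))\<^sup>2 \<le> 2 / pi * integral {0..2*pi} (\<lambda>t. 1 * ?f (rot t x))"
        using x(2) by (rule mult_left_le_imp_le)
    qed
    also have "\<dots> = 2 / pi * (LINT x:ann r L|lborel. integral {0..2*pi} (\<lambda>t. 1 * ?f (rot t x)))" by (rule set_integral_mult_right)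
    also have "(LINT x:ann r L|lborel. integral {0..2*pi} (\<lambda>t. 1 * ?f (rot t x))) = 2 * pi * (LINT x:ann r L|lborel. ?f x)"
      by (subst rot_average[OF cfr continuous_on_const]) simp
    also have "(LINT x:ann r L|lborel. ?f x) \<le> (LINT x:ann R L|lborel. ?f x)"
    proof (rule ann_integral_mono_set)
      show "continuous_on (ann R L) ?f" by (rule continuous_on_subset[OF cfa[of L]]) (use R in \<open>auto simp: ann_def\<close>)
    qed (use r in auto)
    also have "\<dots> \<le> e" by (rule R(2))
    \<comment> \<open>The \<open>2 / pi\<close> of \<open>q'_bound\<close> times the
      \<open>2 * pi\<close> of the rotation average gives 4; dividing by \<open>2 * pi\<close>
      leaves a factor below 1.\<close>
    finally have "2 * pi * integral {r..L} (\<lambda>t. t\<^sup>2 * (norm (q' t))\<^sup>2) \<le> 4 * e"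
      by (simp add: power2_eq_square mult.assoc)
    then have "integral {r..L} (\<lambda>t. t\<^sup>2 * (norm (q' t))\<^sup>2) \<le> 4 * e / (2 * pi)" by (simp add: field_simps)
    also have "\<dots> \<le> e" using e pi_gt3 by (simp add: field_simps)
    finally have i2: "integral {r..L} (\<lambda>t. t\<^sup>2 * (norm (q' t))\<^sup>2) \<le> e" .
    have "(q' has_integral q L - q r) {r..L}"
      by (rule fundamental_theorem_of_calculus[OF r(2)]) (use q_deriv rp in \<open>auto intro: has_vector_derivative_at_within\<close>)
    then have "norm (q L - q r) = norm (integral {r..L} q')" by (simp add: integral_unique)
    also have "\<dots> \<le> integral {r..L} (\<lambda>t. norm (q' t))"
      by (rule integral_norm_bound_integral) (intro integrable_continuous_interval continuous_intros cq order_refl)+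
    also have "\<dots> = integral {r..L} (\<lambda>t. 1 / t\<^sup>2 * (t\<^sup>2 * norm (q' t)))"
      by (rule Henstock_Kurzweil_Integration.integral_cong) (use rp in auto)
    finally have "(norm (q L - q r))\<^sup>2 \<le> (integral {r..L} (\<lambda>t. 1 / t\<^sup>2 * (t\<^sup>2 * norm (q' t))))\<^sup>2" by (intro power_mono) auto
    also have "\<dots> \<le> integral {r..L} (\<lambda>t. \<bar>1 / t\<^sup>2\<bar>) * integral {r..L} (\<lambda>t. \<bar>1 / t\<^sup>2\<bar> * (t\<^sup>2 * norm (q' t))\<^sup>2)"
      by (rule weighted_Cauchy_Schwarz[OF _ _ r(2)]) (use rp in \<open>auto intro!: continuous_intros cq\<close>)
    also have "integral {r..L} (\<lambda>t. \<bar>1 / t\<^sup>2\<bar> * (t\<^sup>2 * norm (q' t))\<^sup>2) = integral {r..L} (\<lambda>t. t\<^sup>2 * (norm (q' t))\<^sup>2)"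
      by (rule Henstock_Kurzweil_Integration.integral_cong) (use rp in \<open>auto simp: power2_eq_square\<close>)
    also have "integral {r..L} (\<lambda>t. \<bar>1 / t\<^sup>2\<bar>) = 1 / r - 1 / L"
      using integral_inverse_square[OF rp(1) r(2)] by simp
    also have "(1 / r - 1 / L) * integral {r..L} (\<lambda>t. t\<^sup>2 * (norm (q' t))\<^sup>2) \<le> 1 / r * e"
    proof (intro mult_mono i2)
      show "1 / r - 1 / L \<le> 1 / r" using rp r by simp
      show "0 \<le> integral {r..L} (\<lambda>t. t\<^sup>2 * (norm (q' t))\<^sup>2)"
        by (intro Henstock_Kurzweil_Integration.integral_nonneg integrable_continuous_interval ct) auto
    qed (use rp in auto)
    finally show ?thesis by simp
  qed
  have "(norm (q r))\<^sup>2 \<le> e / r" if r: "R \<le> r" for r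
  proof -
    have er: "0 \<le> e / r" using e r R b0 by simp
    have "norm (q r) \<le> sqrt (e / r) + \<eta>" if \<eta>: "\<eta> > 0" for \<eta>
    proof -
      obtain R1 where R1: "\<And>r. r \<ge> R1 \<Longrightarrow> norm (q r) \<le> \<eta>" using q_decay[OF \<eta>] by blast
      define L where "L = max R1 r"
      have "norm (q L - q r) \<le> sqrt (e / r)" using step[OF r, of L] real_le_rsqrt by (simp add: L_def)
      moreover have "norm (q L) \<le> \<eta>" by (rule R1) (simp add: L_def)
      ultimately show ?thesis using norm_triangle_ineq4[of "q L" "q L - q r"] by simp
    qed
    then have "norm (q r) \<le> sqrt (e / r)" by (rule field_le_epsilon)
    then have "(norm (q r))\<^sup>2 \<le> (sqrt (e / r))\<^sup>2" by (intro power_mono) auto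
    then show ?thesis using er by simp
  qed
  with R show ?thesis by (rule that)
qed

text \<open>The gain over \<open>square_mean_decay\<close>, from \<open>M\<^sup>2\<close> to
  \<open>M\<close>: up to radius \<open>2 * M\<close> the square of \<open>m - q\<close> is at most
  \<open>2 * M\<close> times the density of the first energy, whose tail is small, and the square of
  \<open>q\<close> is at most \<open>e1 / r\<close>.\<close>

lemma mean_square_decay:
  assumes a0: "r0 < a0" and m1: "\<And>x. a0 \<le> norm x \<Longrightarrow> norm (m fl x) \<le> 1"
    and C: "\<And>L. (LINT x:ann (a0 + 1) L|lborel. (norm (m fl x - q (norm x)))\<^sup>2 / norm x) \<le> C" and e: "e > 0"
  shows "\<exists>M0. \<forall>M\<ge>M0. (LINT x:ann a0 (2 * M)|lborel. (norm (m fl x))\<^sup>2) \<le> e * M"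
proof -
  let ?f = "\<lambda>x. (norm (m fl x - q (norm x)))\<^sup>2 / norm x"
  \<comment> \<open>4 stands for the part \<open>m - q\<close> and \<open>8 * pi\<close> for
    \<open>q\<close>; half of \<open>e * M\<close> is reserved for the fixed inner disc.\<close>
  define e1 where "e1 = e / (2 * (4 + 8 * pi))"
  have pp: "4 + 8 * pi > 0" by (simp add: add_pos_pos)
  have e1: "e1 > 0" "(4 + 8 * pi) * e1 = e / 2" 
  proof -
    show "e1 > 0" using e pp by (simp add: e1_def)
    have "y * (e / (2 * y)) = e / 2" if "y > 0" for y using that by simp
    from this[OF pp] show "(4 + 8 * pi) * e1 = e / 2" by (simp only: e1_def)
  qed
  obtain R where R: "R \<ge> a0 + 1" "\<And>L. (LINT x:ann R L|lborel. ?f x) \<le> e1" "\<And>r. r \<ge> R \<Longrightarrow> (norm (q r))\<^sup>2 \<le> e1 / r"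
    by (rule q_tail[OF _ C e1(1)]) (use a0 in auto)
  have Rp: "R > 0" "r0 < R" using R a0 r0 by auto
  have "(LINT x:ann a0 (2 * M)|lborel. (norm (m fl x))\<^sup>2) \<le> e * M" if M: "M \<ge> max R (2 * pi * R\<^sup>2 / e)" for M
  proof -
    have MR: "R \<le> M" "2 * pi * R\<^sup>2 / e \<le> M" using M by auto
    then have b: "pi * R\<^sup>2 \<le> e / 2 * M" using e by (simp add: field_simps)
    have c: "continuous_on (ann a0 L) (\<lambda>x. (norm (m fl x))\<^sup>2)" for L
      by (intro continuous_intros continuous_on_subset[OF continuous_m ann_subset_ext[OF a0]])
    have sub: "ann R (2 * M) \<subseteq> E" by (rule ann_subset_ext[OF Rp(2)])
    have cf: "continuous_on (ann R (2 * M)) ?f"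
      using E_nonzero sub by (intro continuous_intros continuous_on_subset[OF continuous_m sub]
        continuous_on_subset[OF continuous_on_radial_E[OF continuous_q] sub]) auto
    have ci: "continuous_on (ann R (2 * M)) (\<lambda>x. 1 / norm x)"
      using Rp by (intro continuous_intros) (auto simp: ann_def)
    have 1: "(LINT x:ann a0 (2 * M)|lborel. (norm (m fl x))\<^sup>2)
      \<le> (LINT x:ann a0 R|lborel. (norm (m fl x))\<^sup>2) + (LINT x:ann R (2 * M)|lborel. (norm (m fl x))\<^sup>2)"
      by (rule ann_integral_split_le[OF c]) (use R MR Rp in auto)
    have "\<bar>LINT x:ann a0 R|lborel. (norm (m fl x))\<^sup>2\<bar> \<le> 1 * measure lborel (ann a0 R)"
      by (rule ann_integral_bound[OF c]) (use m1 in \<open>auto simp: ann_def power_le_one\<close>)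
    moreover have "measure lborel (ann a0 R) \<le> pi * R\<^sup>2" using Rp by (intro measure_ann_le) auto
    ultimately have 2: "(LINT x:ann a0 R|lborel. (norm (m fl x))\<^sup>2) \<le> pi * R\<^sup>2" by linarith
    have "(LINT x:ann R (2 * M)|lborel. (norm (m fl x))\<^sup>2) \<le> (LINT x:ann R (2 * M)|lborel. 4 * M * ?f x + 2 * e1 * (1 / norm x))"
    proof (intro set_integral_mono set_integrable_ann)
      show "continuous_on (ann R (2 * M)) (\<lambda>x. (norm (m fl x))\<^sup>2)"
        by (intro continuous_intros continuous_on_subset[OF continuous_m sub])
      show "continuous_on (ann R (2 * M)) (\<lambda>x. 4 * M * ?f x + 2 * e1 * (1 / norm x))"
        by (intro continuous_on_add continuous_on_mult cf ci continuous_on_const)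
      fix x assume x: "x \<in> ann R (2 * M)"
      then have n: "R \<le> norm x" "norm x \<le> 2 * M" "norm x > 0" using Rp by (auto simp: ann_def)
      let ?p = "m fl x - q (norm x)"
      have "norm (m fl x) \<le> norm ?p + norm (q (norm x))"
        using norm_triangle_ineq[of ?p "q (norm x)"] by simp
      then have "(norm (m fl x))\<^sup>2 \<le> (norm ?p + norm (q (norm x)))\<^sup>2" by (intro power_mono) auto
      also have "\<dots> \<le> 2 * (norm ?p)\<^sup>2 + 2 * (norm (q (norm x)))\<^sup>2"
        using zero_le_power2[of "norm ?p - norm (q (norm x))"] by (simp add: power2_eq_square algebra_simps)
      also have "(norm ?p)\<^sup>2 \<le> 2 * M * ?f x"
        using n mult_right_mono[OF n(2), of "(norm ?p)\<^sup>2"] by (simp add: pos_le_divide_eq mult.commute)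
      also have "(norm (q (norm x)))\<^sup>2 \<le> e1 * (1 / norm x)" using R(3)[OF n(1)] by simp
      finally show "(norm (m fl x))\<^sup>2 \<le> 4 * M * ?f x + 2 * e1 * (1 / norm x)" by simp
    qed
    also have "\<dots> = (LINT x:ann R (2 * M)|lborel. 4 * M * ?f x) + (LINT x:ann R (2 * M)|lborel. 2 * e1 * (1 / norm x))"
      by (intro set_integral_add set_integrable_ann continuous_on_mult cf ci continuous_on_const)
    also have "\<dots> = 4 * M * (LINT x:ann R (2 * M)|lborel. ?f x) + 2 * e1 * (LINT x:ann R (2 * M)|lborel. 1 / norm x)"
      by (simp only: set_integral_mult_right)
    also have "(LINT x:ann R (2 * M)|lborel. 1 / norm x) = 2 * pi * integral {R..2 * M} (\<lambda>r. r * (1 / r))"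
      by (rule integral_radial[where f="\<lambda>r. 1 / r"]) (use Rp MR in \<open>auto intro!: continuous_intros\<close>)
    also have "integral {R..2 * M} (\<lambda>r. r * (1 / r)) = integral {R..2 * M} (\<lambda>r. 1)"
      by (rule Henstock_Kurzweil_Integration.integral_cong) (use Rp in auto)
    also have "\<dots> = 2 * M - R" using MR Rp by simp
    also have "4 * M * (LINT x:ann R (2 * M)|lborel. ?f x) + 2 * e1 * (2 * pi * (2 * M - R)) \<le> 4 * M * e1 + 2 * e1 * (2 * pi * (2 * M))"
      using R(2)[of "2 * M"] MR Rp e1(1) by (intro add_mono mult_left_mono) auto
    also have "\<dots> = ((4 + 8 * pi) * e1) * M" by (simp add: algebra_simps)
    also have "\<dots> = e / 2 * M" unfolding e1(2) ..
    finally show ?thesis using 1 2 b by linarith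
  qed
  then show ?thesis by blast
qed

text \<open>Both passes use the same inner radius \<open>a0\<close>. The first yields the
  \<open>o(M)\<close> bound through \<open>mean_square_decay\<close>, and exactly this is the
  hypothesis \<open>mean\<close> of the second.\<close>

lemma square_integrable_at_infinity:
  "\<exists>b C. r0 < b \<and> (\<forall>x. b \<le> norm x \<longrightarrow> norm (m fl x) \<le> 1) \<and> (\<forall>L. (LINT x:ann b L|lborel. (norm (m fl x))\<^sup>2) \<le> C)"
proof -
  \<comment> \<open>At size 1/20 the Lipschitz constant \<open>3 * (1/20)\<^sup>2\<close> of the
    cube is below the \<open>1/100\<close> demanded by \<open>cube_diff\<close>.\<close>
  obtain R1 where R1: "\<And>x. norm x \<ge> R1 \<Longrightarrow> norm (k x) \<le> 1/20" using decay[of "1/20"] by auto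
  obtain R2 where R2: "\<And>x. norm x \<ge> R2 \<Longrightarrow> norm (m fl x) \<le> 1/20" using m_decay[of "1/20"] by auto
  obtain R3 where R3: "\<And>r. r \<ge> R3 \<Longrightarrow> norm (q r) \<le> 1/20" using q_decay[of "1/20"] by auto
  define a0 where "a0 = max (max R1 R2) (max R3 (max (r0 + 1) (20 * cK)))"
  have a0: "a0 \<ge> R1" "a0 \<ge> R2" "a0 \<ge> R3" "a0 \<ge> r0 + 1" "a0 \<ge> 20 * cK" "r0 < a0" "1 \<le> a0" "a0 > 0"
    using r0 by (auto simp: a0_def)
  have sub: "ann a0 (a0 + 1) \<subseteq> E" by (rule ann_subset_ext[OF a0(6)])
  have bound: "\<exists>B. \<forall>x\<in>ann a0 (a0 + 1). norm (f x) \<le> B" if "continuous_on E f" for f :: "real^2 \<Rightarrow> 'b::real_normed_vector"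
    using compact_imp_bounded[OF compact_continuous_image[OF continuous_on_subset[OF that sub] compact_ann]]
    by (auto simp: bounded_iff)
  obtain V0 where V0: "\<And>x. x \<in> ann a0 (a0 + 1) \<Longrightarrow> \<bar>v x\<bar> \<le> V0" using bound[OF continuous_v] by auto
  obtain B0 where B0: "\<And>x. x \<in> ann a0 (a0 + 1) \<Longrightarrow> norm (b1 x) \<le> B0" using bound[OF continuous_b1] by auto
  obtain Z where Z: "\<And>s. \<bar>step' s\<bar> \<le> Z" using step'_bounded by metis
  have xE: "x \<in> E" if "a0 \<le> norm x" for x using that a0 by (auto simp: ext_plane_def)
  have Kx: "norm (k x - m fl x) \<le> cK / norm x" "cK / norm x \<le> 1/20" if "a0 \<le> norm x" for x
  proof -
    show "norm (k x - m fl x) \<le> cK / norm x" by (rule k_m_bound[OF xE[OF that]])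
    have "norm x > 0" "20 * cK \<le> norm x" using that a0 by linarith+
    then show "cK / norm x \<le> 1/20" by (simp add: pos_divide_le_eq)
  qed
  interpret S1: energy r0 k k' F fl q q' saw2 "pi / 4" 2 a0 "\<lambda>r. cK / r" V0 B0 Z
  proof unfold_locales
    show "norm (q r) \<le> 1" if "a0 \<le> r" for r using R3[of r] that a0 by auto
    show "norm (cube (k x) - cube (q R)) \<le> 1/100 * norm (m fl x - q R) + cK / norm x" if x: "a0 \<le> norm x" "norm x \<le> R" for x R
    proof -
      have "norm (cube (k x) - cube (q R)) \<le> 3 * (1/20)\<^sup>2 * norm (k x - q R)"
        by (rule cube_lipschitz) (use R1[of x] R3[of R] x a0 in auto)
      also have "\<dots> \<le> 1/100 * norm (k x - q R)" by (intro mult_right_mono) (auto simp: power2_eq_square)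
      also have "norm (k x - q R) \<le> norm (m fl x - q R) + cK / norm x"
        using norm_triangle_ineq[of "m fl x - q R" "k x - m fl x"] Kx(1)[OF x(1)] by simp
      also have "1/100 * (norm (m fl x - q R) + cK / norm x) \<le> 1/100 * norm (m fl x - q R) + cK / norm x"
      proof -
        have "0 \<le> cK / norm x" using cK_nonneg by simp
        then show ?thesis unfolding distrib_left by linarith
      qed
      finally show ?thesis by simp
    qed
    show "pi / 4 \<le> 8/5" "2 * (pi / 4) \<le> 8/5" using pi_less_4 pi_approx by auto
    show "continuous_on {r0<..} (\<lambda>r. cK / r)" using r0 by (intro continuous_intros) auto
  qed (use v_mode2 integral_abs_saw2 a0 V0 B0 Z cK_nonneg in \<open>auto intro: continuous_intros\<close>)
  obtain C where C: "\<And>L. (LINT x:ann (a0 + 1) L|lborel. (norm (m fl x - q (norm x)))\<^sup>2 / norm x) \<le> C"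
  proof -
    have "\<exists>C. \<forall>L. (LINT x:ann (a0 + 1) L|lborel. (norm (m fl x - q (norm x)))\<^sup>2 / norm x) \<le> C"
    proof (rule S1.first_mode_energy_bounded[OF refl refl refl refl a0(7) _ _ m_decay q_decay])
      show "norm (m fl x) \<le> 1/20" if "a0 \<le> norm x" for x by (rule R2) (use that a0 in linarith)
      show "norm (q r) \<le> 1/20" if "a0 \<le> r" for r by (rule R3) (use that a0 in linarith)
    qed
    then show ?thesis using that by blast
  qed
  have mean: "\<exists>M0. \<forall>M\<ge>M0. (LINT x:ann a0 (2 * M)|lborel. (norm (m fl x))\<^sup>2) \<le> e * M" if "e > 0" for e
  proof (rule mean_square_decay[OF a0(6) _ C that])
    fix x :: "real^2" assume "a0 \<le> norm x"
    then have "norm (m fl x) \<le> 1/20" by (intro R2) (use a0 in linarith)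
    then show "norm (m fl x) \<le> 1" by linarith
  qed
  \<comment> \<open>Compared with 0, the cube of \<open>k\<close> is at most a small multiple of
    \<open>m\<close> plus the square of \<open>cK / r\<close>. This faster decay is needed because
    the second weight no longer provides the additional \<open>1 / r\<close>.\<close>
  interpret S2: energy r0 k k' F fl "\<lambda>_. 0" "\<lambda>_. 0" saw "pi / 2" 1 a0 "\<lambda>r. cK\<^sup>2 / r\<^sup>2" V0 B0 Z
  proof unfold_locales
    show "norm (cube (k x) - cube 0) \<le> 1/100 * norm (m fl x - 0) + cK\<^sup>2 / (norm x)\<^sup>2" if x: "a0 \<le> norm x" for x
    proof -
      define u where "u = cK / norm x"
      have u: "0 \<le> u" "u \<le> 1/20" using Kx(2)[OF x] cK_nonneg by (auto simp: u_def)
      have kx: "norm (k x) \<le> 1/20" using R1[of x] x a0 by auto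
      have km: "norm (k x) \<le> norm (m fl x) + u"
        using norm_triangle_ineq[of "m fl x" "k x - m fl x"] Kx(1)[OF x] by (simp add: u_def)
      have "norm (cube (k x)) = norm (k x) * (norm (k x) * norm (k x))" by (simp add: norm_cube power3_eq_cube)
      also have "\<dots> \<le> norm (k x) * (1/20 * (norm (m fl x) + u))"
        by (rule mult_left_mono[OF mult_mono[OF kx km]]) auto
      also have "\<dots> = 1/20 * norm (k x) * norm (m fl x) + 1/20 * u * norm (k x)" by (simp add: algebra_simps)
      also have "\<dots> \<le> 1/20 * (1/20) * norm (m fl x) + 1/20 * u * (norm (m fl x) + u)"
        using kx km u by (intro add_mono mult_right_mono mult_left_mono) auto
      also have "1/20 * u * (norm (m fl x) + u) \<le> 1/20 * (1/20) * norm (m fl x) + u\<^sup>2"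
        using mult_right_mono[OF u(2) norm_ge_zero[of "m fl x"]] mult_nonneg_nonneg[OF u(1) u(1)]
        unfolding power2_eq_square distrib_left by linarith
      finally have "norm (cube (k x)) \<le> 1/100 * norm (m fl x) + u\<^sup>2" using norm_ge_zero[of "m fl x"] by linarith
      then show ?thesis by (simp add: cube_def u_def power_divide)
    qed
    show "pi / 2 \<le> 8/5" "1 * (pi / 2) \<le> 8/5" using pi_approx by auto
    show "continuous_on {r0<..} (\<lambda>r. cK\<^sup>2 / r\<^sup>2)" using r0 by (intro continuous_intros) auto
    show "v x - 0 \<bullet> x = angular_mean saw (\<lambda>y. (Dv y - 0) \<bullet> perp y) x" if "x \<in> E" for x
      using v_saw[OF that] by simp
  qed (use integral_abs_saw a0 V0 B0 Z in \<open>auto intro: continuous_intros\<close>)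
  obtain C2 where C2: "\<And>L. (LINT x:ann (a0 + 1) L|lborel. (norm (m fl x))\<^sup>2) \<le> C2"
    using S2.square_integral_bounded[OF refl refl refl _ a0(7) mean, of "cK\<^sup>2"] by auto
  have "norm (m fl x) \<le> 1" if "a0 + 1 \<le> norm x" for x using R2[of x] that a0 by force
  then have "r0 < a0 + 1 \<and> (\<forall>x. a0 + 1 \<le> norm x \<longrightarrow> norm (m fl x) \<le> 1) \<and> (\<forall>L. (LINT x:ann (a0 + 1) L|lborel. (norm (m fl x))\<^sup>2) \<le> C2)"
    using C2 a0 by simp
  then show ?thesis by blast
qed

section \<open>Integrability of the powers of the field\<close>

text \<open>The field is at most twice the maximum of \<open>norm (m fl x)\<close> and
  \<open>cK / norm x\<close>. Where \<open>m\<close> is at most 1 its power is below its square, and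
  \<open>r * r powr (- \<gamma>)\<close> is integrable at infinity exactly for
  \<open>\<gamma> > 2\<close>. Near the inner circle the bound \<open>B\<close> is used.\<close>

lemma powr_integrable:
  assumes \<gamma>: "\<gamma> > 2" and kb: "\<And>x. x \<in> E \<Longrightarrow> norm (k x) \<le> B"
  shows "set_integrable lborel E (\<lambda>x. norm (k x) powr \<gamma>)"
proof -
  obtain b C where b: "r0 < b" and m1: "\<And>x. b \<le> norm x \<Longrightarrow> norm (m fl x) \<le> 1"
    and C: "\<And>L. (LINT x:ann b L|lborel. (norm (m fl x))\<^sup>2) \<le> C"
    using square_integrable_at_infinity by blast
  have bp: "b > 0" using b r0 by simp
  have subb: "ann b L \<subseteq> E" for L by (rule ann_subset_ext[OF b])
  have ckp: "continuous_on E (\<lambda>x. norm (k x) powr \<gamma>)"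
    using \<gamma> by (intro continuous_on_powr' continuous_intros ck) auto
  define f where "f = (\<lambda>x. norm (k x) powr \<gamma>)"
  have cf: "continuous_on E f" using ckp by (simp add: f_def)
  have est: "(LINT x:ann b L|lborel. f x) \<le> 2 powr \<gamma> * (C + cK powr \<gamma> * (2 * pi * (b powr (2 - \<gamma>) / (\<gamma> - 2))))" if L: "b \<le> L" for L
  proof -
    have cm: "continuous_on (ann b L) (\<lambda>x. (norm (m fl x))\<^sup>2)"
      by (intro continuous_intros continuous_on_subset[OF continuous_m subb])
    have cp: "continuous_on (ann b L) (\<lambda>x. norm x powr (- \<gamma>))"
      using bp by (intro continuous_intros) (auto simp: ann_def)
    have "(LINT x:ann b L|lborel. f x) \<le> (LINT x:ann b L|lborel. 2 powr \<gamma> * ((norm (m fl x))\<^sup>2 + cK powr \<gamma> * norm x powr (- \<gamma>)))"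
    proof (intro set_integral_mono set_integrable_ann)
      show "continuous_on (ann b L) f" by (rule continuous_on_subset[OF cf subb])
      show "continuous_on (ann b L) (\<lambda>x. 2 powr \<gamma> * ((norm (m fl x))\<^sup>2 + cK powr \<gamma> * norm x powr (- \<gamma>)))"
        by (intro continuous_on_mult continuous_on_add continuous_on_const cm cp)
      fix x assume x: "x \<in> ann b L"
      then have xE: "x \<in> E" and nx: "b \<le> norm x" "norm x > 0" using subb[of L] bp by (auto simp: ann_def)
      define a where "a = norm (m fl x)"
      define u where "u = cK / norm x"
      have a: "0 \<le> a" "a \<le> 1" and u: "0 \<le> u" using m1[OF nx(1)] cK_nonneg nx by (auto simp: a_def u_def)
      have "norm (k x) \<le> a + u"
        using norm_triangle_ineq[of "m fl x" "k x - m fl x"] k_m_bound[OF xE] by (simp add: a_def u_def)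
      also have "\<dots> \<le> 2 * max a u" by simp
      finally have "f x \<le> (2 * max a u) powr \<gamma>" unfolding f_def using \<gamma> by (intro powr_mono2) auto
      also have "\<dots> = 2 powr \<gamma> * (max a u powr \<gamma>)" using a by (simp add: powr_mult)
      also have "max a u powr \<gamma> \<le> a powr \<gamma> + u powr \<gamma>" by (simp add: max_def)
      also have "a powr \<gamma> \<le> a\<^sup>2"
      proof (cases "a = 0")
        case False
        then have "a powr \<gamma> \<le> a powr 2" using a \<gamma> by (intro powr_mono') auto
        then show ?thesis using a False by (simp add: powr_numeral)
      qed simp
      also have "u powr \<gamma> = cK powr \<gamma> * norm x powr (- \<gamma>)"
        unfolding u_def using nx cK_nonneg by (subst powr_divide) (auto simp: powr_minus_divide)
      finally show "f x \<le> 2 powr \<gamma> * ((norm (m fl x))\<^sup>2 + cK powr \<gamma> * norm x powr (- \<gamma>))"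
        by (simp add: a_def)
    qed
    also have "\<dots> = 2 powr \<gamma> * ((LINT x:ann b L|lborel. (norm (m fl x))\<^sup>2) + cK powr \<gamma> * (LINT x:ann b L|lborel. norm x powr (- \<gamma>)))"
      using set_integrable_ann[OF cm] set_integrable_ann[OF cp] by (simp add: set_integral_add(2))
    also have "(LINT x:ann b L|lborel. norm x powr (- \<gamma>)) = 2 * pi * integral {b..L} (\<lambda>r. r * r powr (- \<gamma>))"
      by (rule integral_radial[where f="\<lambda>r. r powr (- \<gamma>)", OF bp L]) (use bp in \<open>auto intro!: continuous_intros\<close>)
    also have "integral {b..L} (\<lambda>r. r * r powr (- \<gamma>)) = L powr (2 - \<gamma>) / (2 - \<gamma>) - b powr (2 - \<gamma>) / (2 - \<gamma>)"
    proof (rule integral_FTC[OF L])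
      fix t assume t: "b \<le> t"
      have "((\<lambda>t. t powr (2 - \<gamma>) / (2 - \<gamma>)) has_real_derivative ((2 - \<gamma>) * t powr (2 - \<gamma> - 1)) / (2 - \<gamma>)) (at t)"
        using t bp by (intro DERIV_cdivide has_real_derivative_powr) auto
      moreover have "t * t powr (- \<gamma>) = t powr (2 - \<gamma> - 1)"
        using t bp powr_add[of t 1 "- \<gamma>"] by simp
      ultimately show "((\<lambda>t. t powr (2 - \<gamma>) / (2 - \<gamma>)) has_real_derivative t * t powr (- \<gamma>)) (at t)"
        using \<gamma> by simp
    qed
    also have "\<dots> \<le> b powr (2 - \<gamma>) / (\<gamma> - 2)"
    proof -
      have "L powr (2 - \<gamma>) / (2 - \<gamma>) \<le> 0" using \<gamma> by (simp add: divide_nonneg_neg)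
      moreover have "b powr (2 - \<gamma>) / (2 - \<gamma>) = - (b powr (2 - \<gamma>) / (\<gamma> - 2))"
        by (metis minus_diff_eq minus_divide_right)
      ultimately show ?thesis by linarith
    qed
    finally have "(LINT x:ann b L|lborel. f x) \<le> 2 powr \<gamma> * ((LINT x:ann b L|lborel. (norm (m fl x))\<^sup>2)
      + cK powr \<gamma> * (2 * pi * (b powr (2 - \<gamma>) / (\<gamma> - 2))))" by (simp add: mult_left_mono)
    also have "\<dots> \<le> 2 powr \<gamma> * (C + cK powr \<gamma> * (2 * pi * (b powr (2 - \<gamma>) / (\<gamma> - 2))))"
      by (intro mult_left_mono add_right_mono C) auto
    finally show ?thesis .
  qed
  define G where "G n x = indicator (ann b (b + real n)) x * f x" for n x
  define S where "S = {x::real^2. b \<le> norm x}"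
  have SE: "S \<subseteq> E" using b by (auto simp: S_def ext_plane_def)
  have cS: "closed S" unfolding S_def by (intro closed_Collect_le continuous_intros)
  have iG: "integrable lborel (G n)" for n
    using set_integrable_ann[OF continuous_on_subset[OF cf subb]] by (simp add: set_integrable_def G_def[abs_def])
  have f0: "0 \<le> f x" for x by (simp add: f_def)
  have mono: "G n x \<le> G n' x" if "n \<le> n'" for n n' x
    using that f0[of x] by (auto simp: G_def indicator_def ann_def)
  have inc: "incseq (\<lambda>n. integral\<^sup>L lborel (G n))"
    by (intro incseq_SucI integral_mono iG mono) auto
  have bdd: "\<exists>B. \<forall>n. integral\<^sup>L lborel (G n) \<le> B"
    using est[of "b + real _"] by (auto simp: G_def[abs_def] set_lebesgue_integral_def)
  obtain l where l: "(\<lambda>n. integral\<^sup>L lborel (G n)) \<longlonglongrightarrow> l"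
    using incseq_convergent[OF inc] bdd by metis
  have mS: "(\<lambda>x. indicator S x * f x) \<in> borel_measurable borel"
    using borel_measurable_continuous_on_indicator[OF _ continuous_on_subset[OF cf SE]] cS by (simp add: borel_closed)
  have "integrable lborel (\<lambda>x. indicator S x * f x)"
  proof (rule integrable_monotone_convergence[OF iG _ _ l])
    show "AE x in lborel. mono (\<lambda>n. G n x)" using mono by (auto simp: mono_def)
    show "AE x in lborel. (\<lambda>n. G n x) \<longlonglongrightarrow> indicator S x * f x"
    proof (rule AE_I2)
      fix x :: "real^2"
      have "\<forall>\<^sub>F n in sequentially. G n x = indicator S x * f x"
      proof (rule eventually_sequentiallyI)
        fix n assume "nat \<lceil>norm x\<rceil> \<le> n"
        then have "norm x \<le> b + real n" using bp by linarith
        then show "G n x = indicator S x * f x" by (auto simp: G_def S_def indicator_def ann_def)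
      qed
      then show "(\<lambda>n. G n x) \<longlonglongrightarrow> indicator S x * f x" by (rule tendsto_eventually)
    qed
  qed (use mS in simp)
  then have i1: "set_integrable lborel S f" by (simp add: set_integrable_def)
  let ?T = "E \<inter> ball 0 b"
  have oT: "open ?T" using open_ext_plane by auto
  have i2: "set_integrable lborel ?T f"
    unfolding set_integrable_def
  proof (rule Bochner_Integration.integrable_bound[where f="\<lambda>x. indicator ?T x * (\<bar>B\<bar> powr \<gamma>)"])
    have "emeasure lborel ?T < \<infinity>" by (rule emeasure_bounded_finite) auto
    then show "integrable lborel (\<lambda>x. indicator ?T x * (\<bar>B\<bar> powr \<gamma>))" using oT by (auto simp: borel_open)
    show "(\<lambda>x. indicator ?T x *\<^sub>R f x) \<in> borel_measurable lborel"
      using borel_measurable_continuous_on_indicator[OF _ continuous_on_subset[OF cf, of ?T]] oT by (simp add: borel_open)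
    show "AE x in lborel. norm (indicator ?T x *\<^sub>R f x) \<le> norm (indicator ?T x * (\<bar>B\<bar> powr \<gamma>))"
    proof (rule AE_I2)
      fix x
      have "f x \<le> \<bar>B\<bar> powr \<gamma>" if "x \<in> E" unfolding f_def
        by (rule powr_mono2) (use kb[OF that] \<gamma> in auto)
      then show "norm (indicator ?T x *\<^sub>R f x) \<le> norm (indicator ?T x * (\<bar>B\<bar> powr \<gamma>))"
        using f0[of x] by (auto simp: indicator_def)
    qed
  qed
  have "E = S \<union> ?T" using SE by (auto simp: S_def)
  moreover have "set_integrable lborel (S \<union> ?T) f"
    by (rule set_integrable_Un[OF i1 i2]) (use cS oT in \<open>auto simp: borel_closed borel_open\<close>)
  ultimately show ?thesis by (simp add: f_def)
qed

end

section \<open>From the distributional hypotheses to the energy method\<close>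

lemma set_integrable_inner_C1c:
  fixes G C :: "'a::euclidean_space \<Rightarrow> 'a"
  assumes int: "set_integrable lebesgue K G" and K: "compact K" "K \<subseteq> E"
    and cC: "continuous_on K C" and z: "\<And>x. x \<in> E \<Longrightarrow> x \<notin> K \<Longrightarrow> C x = 0"
  shows "set_integrable lebesgue E (\<lambda>x. G x \<bullet> C x)" "set_integrable lebesgue E (\<lambda>x. (G x \<bullet> u) * (C x \<bullet> w))"
proof -
  have iK: "integrable lebesgue (\<lambda>x. indicator K x *\<^sub>R G x)" using int by (simp add: set_integrable_def)
  have "bounded (C ` K)" by (intro compact_imp_bounded compact_continuous_image cC K)
  then obtain B where B: "\<And>x. x \<in> K \<Longrightarrow> norm (C x) \<le> B" by (auto simp: bounded_iff)
  have mC: "(\<lambda>x. indicator K x *\<^sub>R C x) \<in> borel_measurable lebesgue"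
    using borel_measurable_continuous_on_indicator[OF _ cC] K by (intro measurable_completion) (simp add: borel_compact)
  have mG: "(\<lambda>x. indicator K x *\<^sub>R G x) \<in> borel_measurable lebesgue" using iK by auto
  have bd: "integrable lebesgue (\<lambda>x. (\<bar>B\<bar> * a) * norm (indicator K x *\<^sub>R G x))" for a
    using iK by (intro integrable_mult_right integrable_norm)
  have gen: "integrable lebesgue (\<lambda>x. indicator E x *\<^sub>R f x)"
    if m: "(\<lambda>x. indicator K x *\<^sub>R f x) \<in> borel_measurable lebesgue" and le: "\<And>x. x \<in> K \<Longrightarrow> \<bar>f x\<bar> \<le> \<bar>B\<bar> * a * norm (G x)"
      and fz: "\<And>x. C x = 0 \<Longrightarrow> f x = 0" and a: "0 \<le> a" for f :: "'a \<Rightarrow> real" and a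
  proof -
    have "(\<lambda>x. indicator E x *\<^sub>R f x) = (\<lambda>x. indicator K x *\<^sub>R f x)"
      using z K(2) fz by (force simp: indicator_def)
    moreover have "integrable lebesgue (\<lambda>x. indicator K x *\<^sub>R f x)"
      by (rule Bochner_Integration.integrable_bound[OF bd[of a] m]) (use le a in \<open>auto intro!: AE_I2 simp: indicator_def abs_mult\<close>)
    ultimately show ?thesis by simp
  qed
  show "set_integrable lebesgue E (\<lambda>x. G x \<bullet> C x)"
    unfolding set_integrable_def
  proof (rule gen[of _ 1])
    have "(\<lambda>x. indicator K x *\<^sub>R (G x \<bullet> C x)) = (\<lambda>x. (indicator K x *\<^sub>R G x) \<bullet> (indicator K x *\<^sub>R C x))"
      by (auto simp: indicator_def)
    then show "(\<lambda>x. indicator K x *\<^sub>R (G x \<bullet> C x)) \<in> borel_measurable lebesgue"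
      using borel_measurable_inner[OF mG mC] by simp
    fix x assume x: "x \<in> K"
    have "\<bar>G x \<bullet> C x\<bar> \<le> norm (G x) * norm (C x)" by (rule Cauchy_Schwarz_ineq2)
    also have "\<dots> \<le> norm (G x) * \<bar>B\<bar>" using B[OF x] by (intro mult_left_mono) auto
    finally show "\<bar>G x \<bullet> C x\<bar> \<le> \<bar>B\<bar> * 1 * norm (G x)" by (simp add: mult.commute)
  qed auto
  show "set_integrable lebesgue E (\<lambda>x. (G x \<bullet> u) * (C x \<bullet> w))"
    unfolding set_integrable_def
  proof (rule gen[of _ "norm u * norm w"])
    have "(\<lambda>x. indicator K x *\<^sub>R ((G x \<bullet> u) * (C x \<bullet> w))) = (\<lambda>x. ((indicator K x *\<^sub>R G x) \<bullet> u) * ((indicator K x *\<^sub>R C x) \<bullet> w))"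
      by (auto simp: indicator_def)
    then show "(\<lambda>x. indicator K x *\<^sub>R ((G x \<bullet> u) * (C x \<bullet> w))) \<in> borel_measurable lebesgue"
      using borel_measurable_times[OF borel_measurable_inner[OF mG borel_measurable_const[of u]] borel_measurable_inner[OF mC borel_measurable_const[of w]]]
      by simp
    fix x assume x: "x \<in> K"
    have "\<bar>(G x \<bullet> u) * (C x \<bullet> w)\<bar> \<le> (norm (G x) * norm u) * (norm (C x) * norm w)"
      unfolding abs_mult by (intro mult_mono Cauchy_Schwarz_ineq2) auto
    also have "\<dots> \<le> (norm (G x) * norm u) * (\<bar>B\<bar> * norm w)"
      using B[OF x] by (intro mult_left_mono mult_right_mono) auto
    finally show "\<bar>(G x \<bullet> u) * (C x \<bullet> w)\<bar> \<le> \<bar>B\<bar> * (norm u * norm w) * norm (G x)" by (simp add: algebra_simps)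
  qed auto
qed

lemma partial_eq:
  fixes \<psi> :: "real^2 \<Rightarrow> real"
  assumes "C1c E \<psi> D" shows "partial i \<psi> x = D x $ i"
proof -
  have "(\<psi> has_derivative (\<lambda>h. D x \<bullet> h)) (at x)" using assms by (simp add: C1c_def)
  then have "frechet_derivative \<psi> (at x) = (\<lambda>h. D x \<bullet> h)" by (rule frechet_derivative_at[symmetric])
  then show ?thesis by (simp add: partial_def inner_axis)
qed

lemma compact_in_ext_plane:
  assumes "compact K" "K \<subseteq> ext_plane r0"
  obtains a L where "r0 < a" "K \<subseteq> ann a L"
proof (cases "K = {}")
  case True
  then show ?thesis using that[of "r0 + 1" 0] by simp
next
  case False
  obtain y where y: "y \<in> K" "\<And>x. x \<in> K \<Longrightarrow> norm y \<le> norm x"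
    using continuous_attains_inf[OF assms(1) False, of norm] by (auto intro: continuous_intros)
  obtain z where z: "z \<in> K" "\<And>x. x \<in> K \<Longrightarrow> norm x \<le> norm z"
    using continuous_attains_sup[OF assms(1) False, of norm] by (auto intro: continuous_intros)
  show ?thesis
    by (rule that[of "norm y" "norm z"]) (use y z assms(2) in \<open>auto simp: ann_def ext_plane_def\<close>)
qed

lemma lebesgue_ann_integral:
  fixes f :: "real^2 \<Rightarrow> real"
  assumes "continuous_on (ann a L) f"
  shows "(LINT x:ann a L|lebesgue. f x) = (LINT x:ann a L|lborel. f x)"
proof -
  have "(\<lambda>x. indicator (ann a L) x *\<^sub>R f x) \<in> borel_measurable lborel"
    using set_integrable_ann[OF assms] by (auto simp: set_integrable_def)
  then show ?thesis by (simp add: set_lebesgue_integral_def integral_completion)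
qed

lemma ext_integral_ann:
  assumes "ann a L \<subseteq> ext_plane r0" "\<And>x. x \<in> ext_plane r0 \<Longrightarrow> x \<notin> ann a L \<Longrightarrow> f x = 0"
  shows "(LINT x:ext_plane r0|M. f x) = (LINT x:ann a L|M. (f x :: real))"
  unfolding set_lebesgue_integral_def
proof (rule Bochner_Integration.integral_cong[OF refl])
  fix x show "indicator (ext_plane r0) x *\<^sub>R f x = indicator (ann a L) x *\<^sub>R f x"
    using assms by (cases "x \<in> ext_plane r0"; cases "x \<in> ann a L") auto
qed

text \<open>The fundamental lemma for a C^1 field: a bump near a point of nonzero divergence would
  give a nonzero weak integral. It serves for \<open>perp (k x)\<close>, whose divergence is minus
  the curl of \<open>k\<close>.\<close>

lemma weak_divergence_free_imp_zero:
  fixes Y :: "real^2 \<Rightarrow> real^2"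
  assumes r0: "r0 > 0" and d: "\<And>x. x \<in> ext_plane r0 \<Longrightarrow> (Y has_derivative Y' x) (at x)"
    and c: "\<And>h. continuous_on (ext_plane r0) (\<lambda>x. Y' x h)"
    and weak: "\<And>\<phi> D. C1c (ext_plane r0) \<phi> D \<Longrightarrow> (LINT x:ext_plane r0|lebesgue. Y x \<bullet> D x) = 0"
    and x0: "x0 \<in> ext_plane r0"
  shows "Y' x0 (axis 1 1) $ 1 + Y' x0 (axis 2 1) $ 2 = 0"
proof (rule ccontr)
  let ?E = "ext_plane r0"
  define g where "g x = Y' x (axis 1 1) $ 1 + Y' x (axis 2 1) $ 2" for x
  assume "\<not> ?thesis"
  then have g0: "g x0 \<noteq> 0" by (simp add: g_def)
  have cg: "continuous_on ?E g" unfolding g_def[abs_def] by (intro continuous_intros c)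
  have cY: "continuous_on ?E Y" using d by (auto intro!: continuous_at_imp_continuous_on dest: has_derivative_continuous)
  obtain d1 where d1: "d1 > 0" "cball x0 d1 \<subseteq> ?E" using open_contains_cball[of ?E] open_ext_plane x0 by auto
  have "\<exists>d>0. \<forall>x\<in>?E. dist x x0 < d \<longrightarrow> dist (g x) (g x0) < \<bar>g x0\<bar> / 2"
    using cg x0 g0 unfolding continuous_on_iff by (metis half_gt_zero zero_less_abs_iff)
  then obtain d2 where d2: "d2 > 0" "\<And>x. x \<in> ?E \<Longrightarrow> dist x x0 < d2 \<Longrightarrow> dist (g x) (g x0) < \<bar>g x0\<bar> / 2" by blast
  define e where "e = min d1 (d2 / 2)"
  have e: "e > 0" "e \<le> d1" "e < d2" using d1 d2 by (auto simp: e_def)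
  have ballE: "cball x0 e \<subseteq> ?E" using d1 e by auto
  define s where "s = sgn (g x0)"
  have gs: "\<bar>g x0\<bar> / 2 \<le> s * g x" if "x \<in> cball x0 e" for x
  proof -
    have "dist (g x) (g x0) < \<bar>g x0\<bar> / 2" using d2(2)[of x] that ballE e by (auto simp: dist_commute)
    then have "\<bar>g x - g x0\<bar> < \<bar>g x0\<bar> / 2" by (simp add: dist_real_def)
    then have "g x - g x0 < \<bar>g x0\<bar> / 2" "g x0 - g x < \<bar>g x0\<bar> / 2" by linarith+
    then show ?thesis using g0 unfolding s_def by (cases "g x0 > 0") (simp_all add: sgn_pos sgn_neg)
  qed
  define t where "t x = e\<^sup>2 - (x - x0) \<bullet> (x - x0)" for x
  define \<phi> where "\<phi> x = (max 0 (t x))\<^sup>2" for x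
  define D where "D x = (2 * max 0 (t x)) *\<^sub>R ((-2) *\<^sub>R (x - x0))" for x
  have ct: "continuous_on S t" for S unfolding t_def by (intro continuous_intros)
  have tpos: "t x \<le> 0" if "x \<notin> cball x0 e" for x
  proof -
    have "e\<^sup>2 \<le> (norm (x - x0))\<^sup>2" using that e by (intro power_mono) (auto simp: dist_norm norm_minus_commute)
    then show ?thesis by (simp add: t_def dot_square_norm)
  qed
  have d\<phi>: "(\<phi> has_derivative (\<lambda>h. D x \<bullet> h)) (at x)" for x
  proof -
    have "(t has_derivative (\<lambda>h. ((-2) *\<^sub>R (x - x0)) \<bullet> h)) (at x)"
      unfolding t_def[abs_def] by (auto intro!: derivative_eq_intros simp: inner_commute algebra_simps)
    from has_derivative_compose[OF this maxsq_deriv[of "t x", THEN has_field_derivative_imp_has_derivative]]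
    show ?thesis by (simp add: \<phi>_def[abs_def] D_def mult.assoc)
  qed
  have cD: "continuous_on S D" for S unfolding D_def[abs_def] by (intro continuous_intros ct)
  have \<phi>z: "\<phi> x = 0" "D x = 0" if "x \<notin> cball x0 e" for x
    using tpos[OF that] by (simp_all add: \<phi>_def D_def max_def)
  have C: "C1c ?E \<phi> D"
    unfolding C1c_def
    by (intro conjI exI[of _ "cball x0 e"] allI impI d\<phi> cD \<phi>z(1) ballE compact_cball) auto
  obtain a L where aL: "r0 < a" "cball x0 e \<subseteq> ann a L" by (rule compact_in_ext_plane[OF compact_cball ballE])
  have sub: "ann a L \<subseteq> ?E" by (rule ann_subset_ext[OF aL(1)])
  have out: "x \<notin> ann a L \<Longrightarrow> x \<notin> cball x0 e" for x using aL by blast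
  have w: "(LINT x:ann a L|lborel. Y x \<bullet> D x) = 0"
  proof -
    have "(LINT x:ann a L|lborel. Y x \<bullet> D x) = (LINT x:ann a L|lebesgue. Y x \<bullet> D x)"
      by (rule lebesgue_ann_integral[symmetric]) (intro continuous_intros continuous_on_subset[OF cY sub] cD)
    also have "\<dots> = (LINT x:?E|lebesgue. Y x \<bullet> D x)"
      by (rule ext_integral_ann[symmetric, OF sub]) (use \<phi>z(2)[OF out] in auto)
    finally show ?thesis using weak[OF C] by simp
  qed
  define X' where "X' x h = \<phi> x *\<^sub>R Y' x h + (D x \<bullet> h) *\<^sub>R Y x" for x h
  have c\<phi>: "continuous_on S \<phi>" for S unfolding \<phi>_def[abs_def] by (intro continuous_intros ct)
  have "(LINT x:ann a L|lborel. X' x (axis 1 1) $ 1 + X' x (axis 2 1) $ 2) = 0"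
  proof (rule integral_divergence_eq_0[OF aL(1), where Y="\<lambda>x. \<phi> x *\<^sub>R Y x"])
    show "((\<lambda>x. \<phi> x *\<^sub>R Y x) has_derivative X' x) (at x)" if "x \<in> ?E" for x
      using has_derivative_scaleR[OF d\<phi> d[OF that]] by (simp add: X'_def[abs_def])
    show "continuous_on ?E (\<lambda>x. X' x h)" for h unfolding X'_def by (intro continuous_intros c c\<phi> cD cY)
    show "\<phi> x *\<^sub>R Y x = 0" if "x \<notin> ann a L" for x using \<phi>z(1)[OF out[OF that]] by simp
  qed
  moreover have "X' x (axis 1 1) $ 1 + X' x (axis 2 1) $ 2 = \<phi> x * g x + Y x \<bullet> D x" for x
    by (simp add: X'_def g_def inner_axis inner_2 axis_def algebra_simps)
  ultimately have "(LINT x:ann a L|lborel. \<phi> x * g x + Y x \<bullet> D x) = 0" by simp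
  moreover have "(LINT x:ann a L|lborel. \<phi> x * g x + Y x \<bullet> D x) = (LINT x:ann a L|lborel. \<phi> x * g x) + (LINT x:ann a L|lborel. Y x \<bullet> D x)"
    by (intro set_integral_add set_integrable_ann continuous_intros c\<phi> cD continuous_on_subset[OF cY sub] continuous_on_subset[OF cg sub])
  ultimately have z: "(LINT x:ann a L|lborel. \<phi> x * g x) = 0" using w by simp
  \<comment> \<open>On the ball of half the radius \<open>t\<close> is at least
    \<open>3 * e\<^sup>2 / 4\<close>, and \<open>s * g\<close> is at least half the absolute value
    of \<open>g x0\<close>.\<close>
  define \<eta> where "\<eta> = (3 * e\<^sup>2 / 4)\<^sup>2 * (\<bar>g x0\<bar> / 2)"
  have \<eta>: "\<eta> > 0" using e g0 by (simp add: \<eta>_def)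
  let ?B = "ball x0 (e / 2)"
  have "\<eta> * measure lborel ?B = (\<integral>x. indicator ?B x * \<eta> \<partial>lborel)" by simp
  also have "\<dots> \<le> (\<integral>x. indicator (ann a L) x *\<^sub>R (s * (\<phi> x * g x)) \<partial>lborel)"
  proof (rule integral_mono)
    have "emeasure lborel ?B < \<infinity>" by (rule emeasure_bounded_finite) auto
    then show "integrable lborel (\<lambda>x. indicator ?B x * \<eta>)" by auto
    show "integrable lborel (\<lambda>x. indicator (ann a L) x *\<^sub>R (s * (\<phi> x * g x)))"
      using set_integrable_ann[of a L "\<lambda>x. s * (\<phi> x * g x)"]
      by (simp add: set_integrable_def continuous_intros c\<phi> continuous_on_subset[OF cg sub])
    fix x
    show "indicator ?B x * \<eta> \<le> indicator (ann a L) x *\<^sub>R (s * (\<phi> x * g x))"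
    proof (cases "x \<in> cball x0 e")
      case False
      then have "x \<notin> ?B" using e by auto
      then show ?thesis using \<phi>z(1)[OF False] by simp
    next
      case True
      have p: "0 \<le> \<phi> x * (s * g x)" using gs[OF True] by (intro mult_nonneg_nonneg[of _ "s * g x"]) (auto simp: \<phi>_def intro: order_trans[rotated])
      show ?thesis
      proof (cases "x \<in> ?B")
        case xB: True
        have "(norm (x - x0))\<^sup>2 \<le> (e / 2)\<^sup>2" using xB by (intro power_mono) (auto simp: dist_norm norm_minus_commute)
        then have "3 * e\<^sup>2 / 4 \<le> t x" by (simp add: t_def dot_square_norm power_divide)
        moreover have "0 \<le> 3 * e\<^sup>2 / 4" by simp
        ultimately have "(3 * e\<^sup>2 / 4)\<^sup>2 \<le> \<phi> x" unfolding \<phi>_def by (intro power_mono) auto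
        then have "\<eta> \<le> \<phi> x * (s * g x)" unfolding \<eta>_def using gs[OF True] by (intro mult_mono) (auto simp: \<phi>_def)
        moreover have "x \<in> ann a L" using True aL by auto
        ultimately show ?thesis using xB by (simp add: mult.left_commute)
      next
        case False
        then show ?thesis using p by (auto simp: indicator_def mult.left_commute)
      qed
    qed
  qed
  also have "\<dots> = s * (LINT x:ann a L|lborel. \<phi> x * g x)"
    by (simp add: set_lebesgue_integral_def mult.left_commute)
  finally have "\<eta> * measure lborel ?B \<le> 0" using z by simp
  moreover have "measure lborel ?B > 0" using e by (simp add: content_ball_pos)
  ultimately show False using \<eta> by (simp add: mult_le_0_iff)
qed

context closed_field
begin

text \<open>Source and vortex at the origin are both free of divergence away from 0. Multiplied by
  \<open>\<psi>\<close>, their combination has divergence equal to the integrand.\<close>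

lemma point_source_integral_zero:
  assumes "C1c E \<psi> D"
  shows "(LINT x:E|lebesgue. ((fl / (norm x)\<^sup>2) *\<^sub>R x + (tbar / (norm x)\<^sup>2) *\<^sub>R perp x) \<bullet> D x) = 0"
proof -
  let ?K = "\<lambda>x. (fl / (norm x)\<^sup>2) *\<^sub>R x + (tbar / (norm x)\<^sup>2) *\<^sub>R perp x"
  define J where "J x = fl *\<^sub>R x + tbar *\<^sub>R perp x" for x
  have Keq: "?K x = (1 / (norm x)\<^sup>2) *\<^sub>R J x" for x by (simp add: J_def scaleR_add_right)
  obtain Kc where Kc: "compact Kc" "Kc \<subseteq> E" "\<And>x. x \<notin> Kc \<Longrightarrow> \<psi> x = 0" "\<And>x. x \<notin> Kc \<Longrightarrow> D x = 0"
    using C1c_D_support[OF assms] by metis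
  obtain a L where aL: "r0 < a" "Kc \<subseteq> ann a L" by (rule compact_in_ext_plane[OF Kc(1,2)])
  have sub: "ann a L \<subseteq> E" by (rule ann_subset_ext[OF aL(1)])
  have out: "x \<notin> ann a L \<Longrightarrow> x \<notin> Kc" for x using aL by blast
  have d\<psi>: "(\<psi> has_derivative (\<lambda>h. D x \<bullet> h)) (at x)" for x using assms by (simp add: C1c_def)
  have cD: "continuous_on S D" for S using assms by (auto simp: C1c_def intro: continuous_on_subset)
  have c\<psi>: "continuous_on S \<psi>" for S using C1c_continuous[OF assms] by (rule continuous_on_subset) auto
  define w where "w r = 1 / r\<^sup>2" for r :: real
  define w' where "w' r = - 2 / r^3" for r :: real
  have dw: "(w has_vector_derivative w' r) (at r)" if "r \<noteq> 0" for r
    using inverse_square_deriv[of 0 r] that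
    by (simp add: w_def[abs_def] w'_def has_real_derivative_iff_has_vector_derivative)
  have cJ: "continuous_on S J" for S unfolding J_def[abs_def] by (intro continuous_intros)
  have cK: "continuous_on E ?K" using E_nonzero by (intro continuous_intros) auto
  have cw: "continuous_on E (\<lambda>x. w (norm x))" "continuous_on E (\<lambda>x. w' (norm x))"
    unfolding w_def w'_def using E_nonzero by (intro continuous_intros; auto)+
  define Y where "Y x = (\<psi> x * w (norm x)) *\<^sub>R J x" for x
  define Y' where "Y' x h = (\<psi> x * w (norm x)) *\<^sub>R (fl *\<^sub>R h + tbar *\<^sub>R perp h)
     + (\<psi> x * ((x \<bullet> h / norm x) *\<^sub>R w' (norm x)) + (D x \<bullet> h) * w (norm x)) *\<^sub>R J x" for x h
  have "(LINT x:ann a L|lborel. Y' x (axis 1 1) $ 1 + Y' x (axis 2 1) $ 2) = 0"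
  proof (rule integral_divergence_eq_0[OF aL(1)])
    show "(Y has_derivative Y' x) (at x)" if x: "x \<in> E" for x
    proof -
      have dJ: "(J has_derivative (\<lambda>h. fl *\<^sub>R h + tbar *\<^sub>R perp h)) (at x)"
        unfolding J_def[abs_def] by (auto intro!: derivative_eq_intros)
      have dr: "((\<lambda>x. w (norm x)) has_derivative (\<lambda>h. (x \<bullet> h / norm x) *\<^sub>R w' (norm x))) (at x)"
        by (rule radial_has_derivative[OF dw]) (use E_nonzero[OF x] in auto)
      show ?thesis unfolding Y_def[abs_def] Y'_def[abs_def]
        by (intro has_derivative_scaleR has_derivative_mult d\<psi> dr dJ)
    qed
    show "continuous_on E (\<lambda>x. Y' x h)" for h
      unfolding Y'_def using E_nonzero by (intro continuous_intros c\<psi> cw cD cJ) auto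
    show "Y x = 0" if "x \<notin> ann a L" for x using Kc(3)[OF out[OF that]] by (simp add: Y_def)
  qed
  moreover have "Y' x (axis 1 1) $ 1 + Y' x (axis 2 1) $ 2 = ?K x \<bullet> D x" if x: "x \<in> E" for x
  proof -
    define r where "r = norm x"
    have r: "r > 0" "x $ 1 * x $ 1 + x $ 2 * x $ 2 = r * r"
    proof -
      show "r > 0" using E_nonzero(2)[OF x] by (simp add: r_def)
      have "x $ 1 * x $ 1 + x $ 2 * x $ 2 = x \<bullet> x" by (simp add: inner_2)
      then show "x $ 1 * x $ 1 + x $ 2 * x $ 2 = r * r" by (simp add: r_def dot_square_norm power2_eq_square)
    qed
    have "Y' x (axis 1 1) $ 1 + Y' x (axis 2 1) $ 2
      = \<psi> x * w r * (2 * fl) + \<psi> x * w' r / r * (fl * (x $ 1 * x $ 1 + x $ 2 * x $ 2)) + w r * (D x \<bullet> J x)"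
      by (simp add: Y'_def J_def inner_axis inner_2 axis_def algebra_simps add_divide_distrib flip: r_def)
    also have "\<dots> = w r * (D x \<bullet> J x)"
      unfolding r(2) using r(1) by (simp add: w_def w'_def power2_eq_square power3_eq_cube)
    finally show ?thesis unfolding Keq by (simp add: w_def r_def inner_commute)
  qed
  ultimately have "(LINT x:ann a L|lborel. ?K x \<bullet> D x) = 0"
    using ann_integral_cong[of a L "\<lambda>x. Y' x (axis 1 1) $ 1 + Y' x (axis 2 1) $ 2" "\<lambda>x. ?K x \<bullet> D x"] sub by auto
  moreover have "(LINT x:E|lebesgue. ?K x \<bullet> D x) = (LINT x:ann a L|lebesgue. ?K x \<bullet> D x)"
    by (rule ext_integral_ann[OF sub]) (use Kc(4)[OF out] in auto)
  moreover have "(LINT x:ann a L|lebesgue. ?K x \<bullet> D x) = (LINT x:ann a L|lborel. ?K x \<bullet> D x)"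
    by (rule lebesgue_ann_integral) (intro continuous_on_inner continuous_on_subset[OF cK sub] cD)
  ultimately show ?thesis by simp
qed

text \<open>A radial multiple \<open>h\<close> of \<open>x\<close> with zero moment, the integral of
  \<open>r * h r\<close>, is the gradient of a compactly supported radial function and is
  annihilated by the weak equation. Hence the pairing with radial fields is a constant times the
  moment; the constant is the flux, and the source of strength \<open>fl\<close> reproduces the
  pairing exactly.\<close>

lemma weak_field_exists:
  assumes F_meas: "(\<lambda>x. indicator E x *\<^sub>R F x) \<in> borel_measurable lebesgue"
    and F_L2: "set_integrable lebesgue E (\<lambda>x. (norm (F x))\<^sup>2)"
    and G_int: "\<And>K. compact K \<Longrightarrow> K \<subseteq> E \<Longrightarrow> set_integrable lebesgue K (\<lambda>x. (1 - (norm (k x))\<^sup>2) *\<^sub>R k x - F x)"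
    and G_weak: "\<And>\<psi> D. C1c E \<psi> D \<Longrightarrow> (LINT x:E|lebesgue. ((1 - (norm (k x))\<^sup>2) *\<^sub>R k x - F x) \<bullet> D x) = 0"
    and decay: "\<And>e. e > 0 \<Longrightarrow> \<exists>R. \<forall>x. norm x \<ge> R \<longrightarrow> norm (k x) \<le> e"
  shows "\<exists>fl. weak_field r0 k k' F fl"
proof -
  define G where "G x = (1 - (norm (k x))\<^sup>2) *\<^sub>R k x - F x" for x
  define adm where "adm h \<longleftrightarrow> continuous_on {r0<..} h \<and> (\<exists>a L. r0 < a \<and> (\<forall>r. r < a \<or> L < r \<longrightarrow> h r = 0))" for h :: "real \<Rightarrow> real"
  define \<l> where "\<l> h = (LINT x:E|lebesgue. G x \<bullet> (h (norm x) *\<^sub>R x))" for h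
  have ih: "set_integrable lebesgue E (\<lambda>x. G x \<bullet> (h (norm x) *\<^sub>R x))" if h: "adm h" for h
  proof -
    obtain a L where aL: "r0 < a" "\<And>r. r < a \<or> L < r \<Longrightarrow> h r = 0" using h by (auto simp: adm_def)
    have ch: "continuous_on {r0<..} h" using h by (simp add: adm_def)
    have sub: "ann a L \<subseteq> E" by (rule ann_subset_ext[OF aL(1)])
    show ?thesis
    proof (rule set_integrable_inner_C1c(1)[OF _ compact_ann sub])
      show "set_integrable lebesgue (ann a L) G" unfolding G_def by (rule G_int[OF compact_ann sub])
      show "continuous_on (ann a L) (\<lambda>x. h (norm x) *\<^sub>R x)"
        by (intro continuous_intros continuous_on_subset[OF continuous_on_radial_E[OF ch] sub])
      show "h (norm x) *\<^sub>R x = 0" if "x \<notin> ann a L" for x using aL(2)[of "norm x"] that by (auto simp: ann_def)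
    qed
  qed
  have zero_mass: "\<l> h = 0" if ch: "continuous_on {r0<..} h" and aL: "r0 < a" "a \<le> L" "\<And>r. r < a \<or> L < r \<Longrightarrow> h r = 0"
    and I: "integral {a..L} (\<lambda>r. r * h r) = 0" for h a L
  proof -
    \<comment> \<open>\<open>h\<close> is known to vanish only strictly beyond \<open>L\<close>,
      while \<open>tail_integral_deriv\<close> wants zero from the endpoint on.\<close>
    define L1 where "L1 = L + 1"
    define T where "T = tail_integral L1 (\<lambda>r. r * h r)"
    have crh: "continuous_on {r0<..} (\<lambda>r. r * h r)" by (intro continuous_intros ch)
    have z: "r * h r = 0" if "r \<ge> L1" for r using aL(3)[of r] that by (simp add: L1_def)
    have dT: "(T has_vector_derivative - (r * h r)) (at r)" if "r0 < r" for r
      unfolding T_def by (rule tail_integral_deriv[OF crh z that])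
    have irh: "(\<lambda>r. r * h r) integrable_on {p..q}" if "r0 < p" for p q
      by (intro integrable_continuous_interval continuous_on_subset[OF crh]) (use that in auto)
    have aux: "integral {p..q} (\<lambda>r. r * h r) = 0" if "\<And>r. p < r \<Longrightarrow> r < q \<Longrightarrow> h r = 0" for p q
    proof -
      have "negligible {p, q}" by simp
      then have "integral {p..q} (\<lambda>r. r * h r) = integral {p..q} (\<lambda>r. 0)"
        by (rule integral_spike) (use that in force)
      then show ?thesis by simp
    qed
    have T0: "T r = 0" if r: "r0 < r" "r < a \<or> L < r" for r
    proof (cases "r \<le> L1")
      case True
      show ?thesis
      proof (cases "r < a")
        case ra: True
        have "integral {r..a} (\<lambda>r. r * h r) + integral {a..L1} (\<lambda>r. r * h r) = integral {r..L1} (\<lambda>r. r * h r)"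
          by (rule Henstock_Kurzweil_Integration.integral_combine) (use ra aL irh r in \<open>auto simp: L1_def\<close>)
        moreover have "integral {a..L} (\<lambda>r. r * h r) + integral {L..L1} (\<lambda>r. r * h r) = integral {a..L1} (\<lambda>r. r * h r)"
          by (rule Henstock_Kurzweil_Integration.integral_combine) (use aL irh in \<open>auto simp: L1_def\<close>)
        moreover have "integral {r..a} (\<lambda>r. r * h r) = 0" "integral {L..L1} (\<lambda>r. r * h r) = 0"
          by (rule aux, use aL in auto)+
        ultimately show ?thesis using I True by (simp add: T_def tail_integral_def)
      next
        case False
        have "integral {r..L1} (\<lambda>r. r * h r) = 0" by (rule aux) (use aL False r in auto)
        then show ?thesis by (simp add: T_def tail_integral_def)
      qed
    qed (simp add: T_def tail_integral_def)
    have sub: "ann a L \<subseteq> E" by (rule ann_subset_ext[OF aL(1)])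
    have "C1c E (\<lambda>x. if x \<in> E then T (norm x) else 0) (\<lambda>x. if x \<in> ann a L then (- h (norm x)) *\<^sub>R x else 0)"
    proof (rule C1c_extend[OF open_ext_plane _ _ compact_ann sub])
      show "((\<lambda>x. if x \<in> E then T (norm x) else 0) has_derivative (\<lambda>y. (- h (norm x)) *\<^sub>R x \<bullet> y)) (at x)" if x: "x \<in> E" for x
      proof (rule has_derivative_transform_within_open[OF _ open_ext_plane x])
        have "((\<lambda>x. T (norm x)) has_derivative (\<lambda>y. (x \<bullet> y / norm x) *\<^sub>R (- (norm x * h (norm x))))) (at x)"
          by (rule radial_has_derivative[OF dT[OF ext_planeD[OF x]] E_nonzero(1)[OF x]])
        moreover have "(x \<bullet> y / norm x) *\<^sub>R (- (norm x * h (norm x))) = (- h (norm x)) *\<^sub>R x \<bullet> y" for y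
          using E_nonzero(2)[OF x] by simp
        ultimately show "((\<lambda>x. T (norm x)) has_derivative (\<lambda>y. (- h (norm x)) *\<^sub>R x \<bullet> y)) (at x)" by simp
      qed auto
      show "continuous_on E (\<lambda>x. (- h (norm x)) *\<^sub>R x)"
        by (intro continuous_intros continuous_on_radial_E[OF ch])
      show "(if x \<in> E then T (norm x) else 0) = 0" if "x \<notin> ann a L" for x
        using T0[of "norm x"] that by (auto simp: ann_def ext_plane_def not_le)
    qed
    from G_weak[OF this] have "(LINT x:E|lebesgue. G x \<bullet> (if x \<in> ann a L then (- h (norm x)) *\<^sub>R x else 0)) = 0"
      by (simp add: G_def)
    moreover have "G x \<bullet> (if x \<in> ann a L then (- h (norm x)) *\<^sub>R x else 0) = - (G x \<bullet> (h (norm x) *\<^sub>R x))" for x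
      using aL(3)[of "norm x"] by (auto simp: ann_def not_le)
    ultimately show ?thesis by (simp add: \<l>_def set_lebesgue_integral_def)
  qed
  \<comment> \<open>A reference profile of positive moment \<open>i0\<close>, by which the flux
    constant is normalised.\<close>
  define h0 where "h0 r = max 0 (r - (r0 + 1)) * max 0 ((r0 + 2) - r)" for r
  have ch0: "continuous_on S h0" for S unfolding h0_def[abs_def] by (intro continuous_intros)
  have h0z: "h0 r = 0" if "r < r0 + 1 \<or> r0 + 2 < r" for r using that by (auto simp: h0_def)
  have adm0: "adm h0" unfolding adm_def using ch0 h0z r0 by (intro conjI exI[of _ "r0 + 1"] exI[of _ "r0 + 2"]) auto
  define i0 where "i0 = integral {r0 + 1..r0 + 2} (\<lambda>r. r * h0 r)"
  have i0: "i0 > 0"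
  proof -
    have c: "continuous_on {r0 + 1..r0 + 2} (\<lambda>r. r * h0 r)" by (intro continuous_intros ch0)
    have nn: "0 \<le> r * h0 r" if "r \<in> {r0 + 1..r0 + 2}" for r using that r0 by (auto simp: h0_def)
    have "0 \<le> i0" unfolding i0_def by (intro Henstock_Kurzweil_Integration.integral_nonneg integrable_continuous_interval c nn)
    moreover have "i0 \<noteq> 0"
    proof
      assume "i0 = 0"
      then have "((\<lambda>r. r * h0 r) has_integral 0) (cbox (r0 + 1) (r0 + 2))"
        using integrable_integral[OF integrable_continuous_interval[OF c]] by (simp add: i0_def cbox_interval)
      moreover have "r0 + 3/2 \<in> cbox (r0 + 1) (r0 + 2)" by (simp add: cbox_interval)
      ultimately have "(r0 + 3/2) * h0 (r0 + 3/2) = 0"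
        by (intro has_integral_0_cbox_imp_0[of "r0 + 1" "r0 + 2" "\<lambda>r. r * h0 r"]) (use c nn in \<open>auto simp: cbox_interval\<close>)
      then show False using r0 by (simp add: h0_def)
    qed
    ultimately show ?thesis by simp
  qed
  define fl where "fl = \<l> h0 / (2 * pi * i0)"
  have mass: "\<l> h = fl * (2 * pi * integral {a..L} (\<lambda>r. r * h r))"
    if ch: "continuous_on {r0<..} h" and aL: "r0 < a" "a \<le> L" "\<And>r. r < a \<or> L < r \<Longrightarrow> h r = 0" for h a L
  proof -
    define I where "I = integral {a..L} (\<lambda>r. r * h r)"
    \<comment> \<open>The multiple of the reference profile whose removal makes the moment vanish,
      so that \<open>zero_mass\<close> applies to \<open>g\<close>.\<close>
    define c where "c = I / i0"
    define g where "g r = h r - c * h0 r" for r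
    define a' where "a' = min a (r0 + 1)"
    define L' where "L' = max L (r0 + 2)"
    have cg: "continuous_on {r0<..} g" unfolding g_def[abs_def] by (intro continuous_intros ch ch0)
    have zero_ext: "integral {a'..L'} (\<lambda>r. r * u r) = integral {p..s} (\<lambda>r. r * u r)"
      if cu: "continuous_on {r0<..} u" and uz: "\<And>r. r < p \<or> s < r \<Longrightarrow> u r = 0" and ps: "a' \<le> p" "s \<le> L'" for u :: "real \<Rightarrow> real" and p s
    proof -
      have "integral {p..s} (\<lambda>r. r * u r) = integral {a'..L'} (\<lambda>r. if r \<in> {p..s} then r * u r else 0)"
        unfolding integral_restrict_Int using ps by (simp add: Int_absorb2 Int_absorb1)
      also have "\<dots> = integral {a'..L'} (\<lambda>r. r * u r)"
        by (rule Henstock_Kurzweil_Integration.integral_cong) (use uz in auto)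
      finally show ?thesis by simp
    qed
    have a': "r0 < a'" "a' \<le> L'" using aL by (auto simp: a'_def L'_def)
    have ii: "(\<lambda>r. r * u r) integrable_on {a'..L'}" if "continuous_on {r0<..} u" for u
      by (intro integrable_continuous_interval continuous_intros continuous_on_subset[OF that]) (use a' in auto)
    have "integral {a'..L'} (\<lambda>r. r * g r) = integral {a'..L'} (\<lambda>r. r * h r) - c * integral {a'..L'} (\<lambda>r. r * h0 r)"
    proof -
      have "integral {a'..L'} (\<lambda>r. r * g r) = integral {a'..L'} (\<lambda>r. r * h r - c * (r * h0 r))"
        by (simp add: g_def algebra_simps)
      also have "\<dots> = integral {a'..L'} (\<lambda>r. r * h r) - integral {a'..L'} (\<lambda>r. c * (r * h0 r))"
        by (intro Henstock_Kurzweil_Integration.integral_diff ii ch integrable_on_mult_right ch0)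
      finally show ?thesis by simp
    qed
    also have "\<dots> = I - c * i0"
      unfolding I_def i0_def
      by (subst zero_ext[OF ch aL(3)], (auto simp: a'_def L'_def)[3], subst zero_ext[OF ch0 h0z]) (auto simp: a'_def L'_def)
    also have "\<dots> = 0" using i0 by (simp add: c_def)
    finally have g0: "\<l> g = 0"
      by (intro zero_mass[OF cg a']) (use aL(3) h0z in \<open>auto simp: g_def a'_def L'_def\<close>)
    have admh: "adm h" unfolding adm_def using ch aL by blast
    have "\<l> g = \<l> h - c * \<l> h0"
    proof -
      have "G x \<bullet> (g (norm x) *\<^sub>R x) = G x \<bullet> (h (norm x) *\<^sub>R x) - c * (G x \<bullet> (h0 (norm x) *\<^sub>R x))" for x
        by (simp add: g_def algebra_simps)
      then have "\<l> g = (LINT x:E|lebesgue. G x \<bullet> (h (norm x) *\<^sub>R x) - c * (G x \<bullet> (h0 (norm x) *\<^sub>R x)))"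
        by (simp add: \<l>_def)
      also have "\<dots> = \<l> h - (LINT x:E|lebesgue. c * (G x \<bullet> (h0 (norm x) *\<^sub>R x)))"
        unfolding \<l>_def using ih[OF admh] ih[OF adm0] by (intro set_integral_diff) auto
      finally show ?thesis by (simp add: \<l>_def)
    qed
    then have "\<l> h = c * \<l> h0" using g0 by simp
    then show ?thesis using i0 by (simp add: fl_def c_def I_def)
  qed
  have "weak_field r0 k k' F fl"
  proof unfold_locales
    fix \<psi> D and h :: "real \<Rightarrow> real" and a L
    assume \<psi>: "C1c E \<psi> D" and a: "r0 < a" and ch: "continuous_on {r0<..} h" and hz: "\<And>r. r < a \<or> L < r \<Longrightarrow> h r = 0"
    define L' where "L' = max L a"
    have hz': "h r = 0" if "r < a \<or> L' < r" for r using hz[of r] that by (auto simp: L'_def)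
    have aL': "a \<le> L'" by (simp add: L'_def)
    have admh: "adm h" unfolding adm_def using ch a hz by blast
    let ?K = "\<lambda>x. (fl / (norm x)\<^sup>2) *\<^sub>R x + (tbar / (norm x)\<^sup>2) *\<^sub>R perp x"
    have cK: "continuous_on E ?K" using E_nonzero by (intro continuous_intros) auto
    obtain Kc where Kc: "compact Kc" "Kc \<subseteq> E" "\<And>x. x \<notin> Kc \<Longrightarrow> D x = 0"
      using C1c_D_support[OF \<psi>] by metis
    have cD: "continuous_on S D" for S using \<psi> by (auto simp: C1c_def intro: continuous_on_subset)
    have sub: "ann a L' \<subseteq> E" by (rule ann_subset_ext[OF a])
    have iGD: "set_integrable lebesgue E (\<lambda>x. G x \<bullet> D x)"
      unfolding G_def by (rule set_integrable_inner_C1c(1)[OF G_int[OF Kc(1,2)] Kc(1,2) cD Kc(3)])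
    have cont_int: "set_integrable lebesgue S f" if "compact S" "continuous_on S f" for S and f :: "real^2 \<Rightarrow> real^2"
      using borel_integrable_compact[OF that] by (simp add: set_integrable_def integrable_completion)
    have iKD: "set_integrable lebesgue E (\<lambda>x. ?K x \<bullet> D x)"
      by (rule set_integrable_inner_C1c(1)[OF cont_int[OF Kc(1) continuous_on_subset[OF cK Kc(2)]] Kc(1,2) cD Kc(3)])
    have chx: "continuous_on (ann a L') (\<lambda>x. h (norm x) *\<^sub>R x)"
      by (intro continuous_intros continuous_on_subset[OF continuous_on_radial_E[OF ch] sub])
    have hxz: "h (norm x) *\<^sub>R x = 0" if "x \<notin> ann a L'" for x using hz'[of "norm x"] that by (auto simp: ann_def)
    have iKh: "set_integrable lebesgue E (\<lambda>x. ?K x \<bullet> (h (norm x) *\<^sub>R x))"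
      by (rule set_integrable_inner_C1c(1)[OF cont_int[OF compact_ann continuous_on_subset[OF cK sub]] compact_ann sub chx hxz])
    \<comment> \<open>The source pairs with \<open>h\<close> to \<open>fl\<close> times the moment;
      the vortex is orthogonal to \<open>x\<close>.\<close>
    have Kh: "(LINT x:E|lebesgue. ?K x \<bullet> (h (norm x) *\<^sub>R x)) = \<l> h"
    proof -
      have "(LINT x:E|lebesgue. ?K x \<bullet> (h (norm x) *\<^sub>R x)) = (LINT x:ann a L'|lebesgue. ?K x \<bullet> (h (norm x) *\<^sub>R x))"
        by (rule ext_integral_ann[OF sub]) (subst hxz, assumption, rule inner_zero_right)
      also have "\<dots> = (LINT x:ann a L'|lborel. ?K x \<bullet> (h (norm x) *\<^sub>R x))"
        by (rule lebesgue_ann_integral) (intro continuous_on_inner chx continuous_on_subset[OF cK sub])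
      also have "\<dots> = (LINT x:ann a L'|lborel. fl * h (norm x))"
      proof (rule ann_integral_cong)
        fix x assume "x \<in> ann a L'"
        then have "norm x > 0" using sub E_nonzero by blast
        then show "?K x \<bullet> (h (norm x) *\<^sub>R x) = fl * h (norm x)"
          by (simp add: inner_add_left dot_square_norm)
      qed
      also have "\<dots> = fl * (LINT x:ann a L'|lborel. h (norm x))" by simp
      also have "(LINT x:ann a L'|lborel. h (norm x)) = 2 * pi * integral {a..L'} (\<lambda>r. r * h r)"
        by (rule integral_radial) (use a r0 aL' in \<open>auto intro: continuous_on_subset[OF ch]\<close>)
      finally show ?thesis using mass[OF ch a aL' hz'] by simp
    qed
    have "(m fl x - (norm (k x))\<^sup>2 *\<^sub>R k x - F x) \<bullet> (D x + h (norm x) *\<^sub>R x)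
      = (G x \<bullet> D x - ?K x \<bullet> D x) + (G x \<bullet> (h (norm x) *\<^sub>R x) - ?K x \<bullet> (h (norm x) *\<^sub>R x))" for x
      by (simp add: m_def G_def inner_diff_left inner_add_left inner_add_right algebra_simps)
    then have "(LINT x:E|lebesgue. (m fl x - (norm (k x))\<^sup>2 *\<^sub>R k x - F x) \<bullet> (D x + h (norm x) *\<^sub>R x))
      = (LINT x:E|lebesgue. (G x \<bullet> D x - ?K x \<bullet> D x) + (G x \<bullet> (h (norm x) *\<^sub>R x) - ?K x \<bullet> (h (norm x) *\<^sub>R x)))" by simp
    also have "\<dots> = ((LINT x:E|lebesgue. G x \<bullet> D x) - (LINT x:E|lebesgue. ?K x \<bullet> D x))
       + ((LINT x:E|lebesgue. G x \<bullet> (h (norm x) *\<^sub>R x)) - (LINT x:E|lebesgue. ?K x \<bullet> (h (norm x) *\<^sub>R x)))"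
      using set_integral_add(2)[OF set_integral_diff(1)[OF iGD iKD] set_integral_diff(1)[OF ih[OF admh] iKh]]
        set_integral_diff(2)[OF iGD iKD] set_integral_diff(2)[OF ih[OF admh] iKh] by simp
    also have "\<dots> = 0"
      using G_weak[OF \<psi>] point_source_integral_zero[OF \<psi>, of fl] Kh by (simp add: G_def \<l>_def)
    finally show "(LINT x:E|lebesgue. (m fl x - (norm (k x))\<^sup>2 *\<^sub>R k x - F x) \<bullet> (D x + h (norm x) *\<^sub>R x)) = 0" .
  qed (use F_meas F_L2 decay in auto)
  then show ?thesis by blast
qed

end

theorem theorem1p2:
  fixes r0 :: real and E U :: "(real^2) set" and k F :: "real^2 \<Rightarrow> real^2"
  assumes "r0 > 0"
    and "E = {x. norm x > r0}"
    and "open U" and "closure E \<subseteq> U"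
    and "smooth_on U k"
    and "Lp 2 E F"
    and "zero_distribution E (dist_curl E k)"
    and "zero_distribution E (dist_div E (\<lambda>x. (1 - (norm (k x))\<^sup>2) *\<^sub>R k x - F x))"
    and "((\<lambda>R. SUP x\<in>{x\<in>E. norm x > R}. ereal (norm (k x))) \<longlongrightarrow> 0) at_top"
  shows "\<forall>\<gamma>>2. Lp \<gamma> E k"
proof -
  have E: "E = ext_plane r0" using assms(2) by (simp add: ext_plane_def)
  have oE: "open E" unfolding E by (rule open_ext_plane)
  have EU: "E \<subseteq> U" using assms(4) closure_subset by blast
  define k' where "k' x = frechet_derivative k (at x)" for x
  have C1: "Ck_on (Suc 0) U k" using assms(5) by (simp add: smooth_on_def)
  have dk: "(k has_derivative k' x) (at x)" if "x \<in> U" for x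
    unfolding k'_def using C1 that by (auto intro: frechet_derivative_has)
  have ck': "continuous_on U (\<lambda>x. k' x h)" for h
    unfolding k'_def using C1 by simp
  have ckU: "continuous_on U k"
    using dk by (auto intro!: continuous_at_imp_continuous_on dest: has_derivative_continuous)
  have ckE: "continuous_on E k" by (rule continuous_on_subset[OF ckU EU])
  have cont_int: "set_integrable lebesgue S f" if "compact S" "continuous_on S f" for S and f :: "real^2 \<Rightarrow> real^2"
    using borel_integrable_compact[OF that] by (simp add: set_integrable_def integrable_completion)
  have F_meas: "(\<lambda>x. indicator E x *\<^sub>R F x) \<in> borel_measurable lebesgue"
    using assms(6) by (simp add: Lp_def set_borel_measurable_def)
  have F_L2: "set_integrable lebesgue E (\<lambda>x. (norm (F x))\<^sup>2)"
  proof -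
    have "norm (F x) powr 2 = (norm (F x))\<^sup>2" for x
      by (cases "F x = 0") (simp_all add: powr_numeral)
    then show ?thesis using assms(6) by (simp add: Lp_def)
  qed
  have F_int: "set_integrable lebesgue K F" if K: "compact K" "K \<subseteq> E" for K
    unfolding set_integrable_def
  proof (rule Bochner_Integration.integrable_bound)
    have Ks: "K \<in> sets lebesgue" using K(1) by (simp add: borel_compact)
    have 1: "integrable lebesgue (\<lambda>x. indicator K x *\<^sub>R (1::real))"
      using borel_integrable_compact[OF K(1), of "\<lambda>x. 1::real"] by (simp add: integrable_completion)
    have 2: "integrable lebesgue (\<lambda>x. indicator K x *\<^sub>R (norm (F x))\<^sup>2)"
      using set_integrable_subset[OF F_L2 Ks K(2)] by (simp add: set_integrable_def)
    show "integrable lebesgue (\<lambda>x. indicator K x *\<^sub>R (1::real) + indicator K x *\<^sub>R (norm (F x))\<^sup>2)"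
      by (rule Bochner_Integration.integrable_add[OF 1 2])
    have "indicator K x *\<^sub>R F x = indicator K x *\<^sub>R (indicator E x *\<^sub>R F x)" for x
      using K(2) by (auto simp: indicator_def)
    then show "(\<lambda>x. indicator K x *\<^sub>R F x) \<in> borel_measurable lebesgue"
      by (simp only:) (rule borel_measurable_scaleR[OF borel_measurable_indicator[OF Ks] F_meas])
    have "y \<le> 1 + y\<^sup>2" for y :: real
      using zero_le_power2[of "y - 1/2"] by (simp add: power2_eq_square algebra_simps)
    then show "AE x in lebesgue. norm (indicator K x *\<^sub>R F x) \<le> norm (indicator K x *\<^sub>R (1::real) + indicator K x *\<^sub>R (norm (F x))\<^sup>2)"
      by (intro AE_I2) (auto simp: indicator_def)
  qed
  have comp: "x $ i = x \<bullet> axis i 1" for x :: "real^2" and i by (simp add: inner_axis)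
  have pair: "(LINT x:E|lebesgue. G x $ i * partial j \<psi> x) = (LINT x:E|lebesgue. (G x \<bullet> axis i 1) * (D x \<bullet> axis j 1))"
    "set_integrable lebesgue E (\<lambda>x. (G x \<bullet> axis i 1) * (D x \<bullet> axis j 1))"
    if G: "\<And>K. compact K \<Longrightarrow> K \<subseteq> E \<Longrightarrow> set_integrable lebesgue K G" and \<psi>: "C1c E \<psi> D" for G \<psi> D and i j :: 2
  proof -
    show "(LINT x:E|lebesgue. G x $ i * partial j \<psi> x) = (LINT x:E|lebesgue. (G x \<bullet> axis i 1) * (D x \<bullet> axis j 1))"
      unfolding partial_eq[OF \<psi>] comp ..
    obtain K where K: "compact K" "K \<subseteq> E" "\<And>x. x \<notin> K \<Longrightarrow> D x = 0" using C1c_D_support[OF \<psi>] by metis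
    have "continuous_on K D" using \<psi> by (auto simp: C1c_def intro: continuous_on_subset)
    then show "set_integrable lebesgue E (\<lambda>x. (G x \<bullet> axis i 1) * (D x \<bullet> axis j 1))"
      by (intro set_integrable_inner_C1c(2)[OF G[OF K(1,2)] K(1,2)] K(3))
  qed
  have k_int: "set_integrable lebesgue K k" if "compact K" "K \<subseteq> E" for K
    by (rule cont_int[OF that(1) continuous_on_subset[OF ckE that(2)]])
  define G where "G x = (1 - (norm (k x))\<^sup>2) *\<^sub>R k x - F x" for x
  have G_int: "set_integrable lebesgue K G" if K: "compact K" "K \<subseteq> E" for K
    unfolding G_def
    by (intro set_integral_diff F_int K cont_int continuous_intros continuous_on_subset[OF ckE])
  have G_weak: "(LINT x:E|lebesgue. G x \<bullet> D x) = 0" if "C1c E \<psi> D" for \<psi> D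
  proof (rule weak_identity_C1c[OF oE G_int _ that])
    fix \<phi> D assume \<phi>: "\<phi> \<in> test_functions E" "C1c E \<phi> D"
    have "dist_div E G \<phi> = 0" using assms(8) \<phi>(1) by (simp add: zero_distribution_def G_def[abs_def])
    then have "(LINT x:E|lebesgue. (G x \<bullet> axis 1 1) * (D x \<bullet> axis 1 1)) + (LINT x:E|lebesgue. (G x \<bullet> axis 2 1) * (D x \<bullet> axis 2 1)) = 0"
      by (simp add: dist_div_def dist_partial_def sum_2 pair(1)[OF G_int \<phi>(2)])
    then have "(LINT x:E|lebesgue. (G x \<bullet> axis 1 1) * (D x \<bullet> axis 1 1) + (G x \<bullet> axis 2 1) * (D x \<bullet> axis 2 1)) = 0"
      using set_integral_add(2)[OF pair(2)[OF G_int \<phi>(2), of 1 1] pair(2)[OF G_int \<phi>(2), of 2 2]] by simp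
    then show "(LINT x:E|lebesgue. G x \<bullet> D x) = 0" unfolding comp[symmetric] by (simp add: inner_2)
  qed
  have pk_int: "set_integrable lebesgue K (\<lambda>x. perp (k x))" if "compact K" "K \<subseteq> E" for K
    by (intro cont_int that continuous_intros continuous_on_subset[OF ckE])
  \<comment> \<open>The curl is minus the divergence of the rotated field, so one extension lemma
    handles both equations.\<close>
  have curl_weak: "(LINT x:E|lebesgue. perp (k x) \<bullet> D x) = 0" if "C1c E \<psi> D" for \<psi> D
  proof (rule weak_identity_C1c[OF oE pk_int _ that])
    fix \<phi> D assume \<phi>: "\<phi> \<in> test_functions E" "C1c E \<phi> D"
    have "dist_curl E k \<phi> = 0" using assms(7) \<phi>(1) by (simp add: zero_distribution_def)
    then have "(LINT x:E|lebesgue. (k x \<bullet> axis 1 1) * (D x \<bullet> axis 2 1)) - (LINT x:E|lebesgue. (k x \<bullet> axis 2 1) * (D x \<bullet> axis 1 1)) = 0"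
      by (simp add: dist_curl_def dist_partial_def pair(1)[OF k_int \<phi>(2)])
    then have "(LINT x:E|lebesgue. (k x \<bullet> axis 1 1) * (D x \<bullet> axis 2 1) - (k x \<bullet> axis 2 1) * (D x \<bullet> axis 1 1)) = 0"
      using set_integral_diff(2)[OF pair(2)[OF k_int \<phi>(2), of 1 2] pair(2)[OF k_int \<phi>(2), of 2 1]] by simp
    then show "(LINT x:E|lebesgue. perp (k x) \<bullet> D x) = 0" unfolding comp[symmetric] by (simp add: inner_2)
  qed
  interpret closed_field r0 k k'
  proof unfold_locales
    show "0 < r0" by (rule assms(1))
    show "(k has_derivative k' x) (at x)" if "x \<in> ext_plane r0" for x using dk that EU E by blast
    show "continuous_on (ext_plane r0) (\<lambda>x. k' x h)" for h using continuous_on_subset[OF ck' EU] E by simp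
    fix x assume x: "x \<in> ext_plane r0"
    have "perp (k' x (axis 1 1)) $ 1 + perp (k' x (axis 2 1)) $ 2 = 0"
    proof (rule weak_divergence_free_imp_zero[OF assms(1) _ _ _ x])
      show "((\<lambda>x. perp (k x)) has_derivative (\<lambda>h. perp (k' x h))) (at x)" if "x \<in> ext_plane r0" for x
        by (rule perp_has_derivative) (use dk that EU E in blast)
      show "continuous_on (ext_plane r0) (\<lambda>x. perp (k' x h))" for h
        using continuous_on_subset[OF ck' EU] E by (intro continuous_intros) simp
      show "(LINT x:ext_plane r0|lebesgue. perp (k x) \<bullet> D x) = 0" if "C1c (ext_plane r0) \<phi> D" for \<phi> D
        using curl_weak that unfolding E by blast
    qed
    then show "k' x (axis 1 1) $ 2 = k' x (axis 2 1) $ 1" by simp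
  qed
  have decay: "\<exists>R. \<forall>x. norm x \<ge> R \<longrightarrow> norm (k x) \<le> e" if e: "e > 0" for e
  proof -
    \<comment> \<open>In \<open>ereal\<close> the supremum always exists; below
      \<open>ereal e\<close> for a single \<open>R\<close>, it bounds \<open>k\<close> pointwise
      beyond that radius.\<close>
    have "\<forall>\<^sub>F R in at_top. (SUP x\<in>{x\<in>E. norm x > R}. ereal (norm (k x))) < ereal e"
      using order_tendstoD(2)[OF assms(9), of "ereal e"] e by simp
    then obtain R where R: "(SUP x\<in>{x\<in>E. norm x > R}. ereal (norm (k x))) < ereal e"
      by (auto simp: eventually_at_top_linorder)
    have "norm (k x) \<le> e" if "norm x \<ge> max R r0 + 1" for x
    proof -
      have "x \<in> {x\<in>E. norm x > R}" using that assms(2) by auto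
      then have "ereal (norm (k x)) \<le> (SUP x\<in>{x\<in>E. norm x > R}. ereal (norm (k x)))" by (rule SUP_upper)
      then have "ereal (norm (k x)) < ereal e" using R by (rule le_less_trans)
      then show ?thesis by simp
    qed
    then show ?thesis by blast
  qed
  have "\<exists>fl. weak_field r0 k k' F fl"
    by (rule weak_field_exists) (use F_meas F_L2 G_int[unfolded G_def] G_weak decay in \<open>auto simp: E G_def\<close>)
  then obtain fl where "weak_field r0 k k' F fl" by blast
  then interpret weak_field r0 k k' F fl .
  obtain R where R: "\<And>x. norm x \<ge> R \<Longrightarrow> norm (k x) \<le> 1" using decay[of 1] by auto
  \<comment> \<open>Continuity of \<open>k\<close> on a neighbourhood of the closure bounds it up to
    the inner circle, in the region that decay does not reach.\<close>
  have "compact (closure E \<inter> cball 0 R)" by (simp add: closed_Int_compact)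
  then have "bounded (k ` (closure E \<inter> cball 0 R))"
    by (intro compact_imp_bounded compact_continuous_image continuous_on_subset[OF ckU]) (use assms(4) in auto)
  then obtain B where B: "\<And>x. x \<in> closure E \<inter> cball 0 R \<Longrightarrow> norm (k x) \<le> B" unfolding bounded_iff by blast
  have kb: "norm (k x) \<le> max 1 B" if "x \<in> ext_plane r0" for x
  proof (cases "norm x \<ge> R")
    case True
    then show ?thesis using R[of x] by simp
  next
    case False
    have "x \<in> closure E" using that E closure_subset by blast
    then show ?thesis using B[of x] False by simp
  qed
  show ?thesis
  proof (intro allI impI)
    fix \<gamma> :: real assume \<gamma>: "\<gamma> > 2"
    have "set_borel_measurable lebesgue E k"
      unfolding set_borel_measurable_def
      using borel_measurable_continuous_on_indicator[OF _ ckE] oE by (intro measurable_completion) (simp add: borel_open)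
    moreover have "set_integrable lebesgue E (\<lambda>x. norm (k x) powr \<gamma>)"
      using powr_integrable[OF \<gamma> kb] unfolding E
      by (auto simp: set_integrable_def integrable_completion)
    ultimately show "Lp \<gamma> E k" by (simp add: Lp_def)
  qed
qed

end
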